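(* Let $c>1$ and let $X=\{X(t)\}_{t\ge0}$ be a $(c^E,c)$-operator semistable Lévy process on $\mathbb{R}^d$ with diagonal principal exponent $E_1$. (i) If $X$ is of type $A$ and $0<\alpha_1<\min\{2,d_1\}$, then $\phi(a)=a^{\alpha_1}\log\log\frac1a$ is an exact Hausdorff measure function for almost all sample paths of $X$ over the interval $[0,1]$; that is, almost surely $0<\phi\text{-}m(X([0,1]))<\infty$. (ii) Suppose $X$ is of type $B$, $0<\alpha_1<1$, and there exist constants $K_8,\lambda_0>0$ such that for all $\lambda\ge\lambda_0$ and all $a>0$ $$\mathbb{P}\left(T(a,1)>\lambda a^{\alpha_1}\right)\le\exp\left(-K_8\lambda^{\frac1{1-\alpha_1}}\right).$$ Then $\phi(a)=a^{\alpha_1}\left(\log\log\frac1a\right)^{1-\alpha_1}$ is an exact Hausdorff measure function for almost all sample paths of $X$ over the interval $[0,1]$; that is, almost surely $0<\phi\text{-}m(X([0,1]))<\infty$.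
   Context: A Lévy process $X=\{X(t)\}_{t\ge0}$ on $\mathbb{R}^d$ is a stochastically continuous process with càdlàg paths and stationary independent increments, with $X(0)=0$ almost surely. For $c>1$ and a linear operator $E$ on $\mathbb{R}^d$, it is called $(c^E,c)$-operator semistable (with exponent $E$) if the distribution of $X(1)$ is full, i.e. not supported on any lower dimensional hyperplane, and $\{X(ct)\}_{t\ge0}$ and $\{c^EX(t)\}_{t\ge0}$ have the same finite-dimensional distributions, where $c^E=\sum_{n\ge0}\frac{(\log c)^n}{n!}E^n$. Spectral decomposition: factor the minimal polynomial of $E$ as $q_1\cdots q_p$, where all roots of $q_j$ have real part $a_j$ and $a_1<\dots<a_p$. Put $V_j=\operatorname{Ker}(q_j(E))$, $d_j=\dim V_j$; then $\mathbb{R}^d=V_1\oplus\dots\oplus V_p$ with $E$-invariant $V_j$, and $E=E_1\oplus\dots\oplus E_p$ with $E_j=E|_{V_j}$. An inner product $\langle\cdot,\cdot\rangle$ on $\mathbb{R}^d$ is fixed making the $V_j$ mutually orthogonal, and $\|x\|=\sqrt{\langle x,x\rangle}$. Put $\alpha_j=1/a_j$. Standing assumption: $X$ has no Gaussian component, in which case $0<\alpha_p<\dots<\alpha_1<2$. "Diagonal principal exponent $E_1$" means $E_1=\alpha_1^{-1}I$ with $I$ the identity on $V_1$; there is no restriction on $E_2,\dots,E_p$. $X(1)$ has a continuous Lebesgue density $p(1,\cdot)$; $X$ is of type $A$ if $p(1,0)>0$ and of type $B$ if $p(1,0)=0$. $B(x,a)$ is the closed ball of radius $a$ centered at $x$,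 and $T(a,s)=\int_0^s1_{B(0,a)}(X(t))\,dt$ is the sojourn time. Hausdorff measure: $\phi$ is right-continuous and increasing on some interval $(0,\delta)$, $\phi(0+)=0$, and satisfies $\phi(2s)/\phi(s)\le K_1$ for all $0<s<\delta/2$ for some constant $K_1>0$ (the functions $\phi$ in the claim, defined for small $a>0$, have these properties). With $|F|=\sup\{\|x-y\|:x,y\in F\}$ and the convention $\phi(0)=0$, for Borel $F\subseteq\mathbb{R}^d$, $$\phi\text{-}m(F)=\lim_{\epsilon\downarrow0}\,\inf\Big\{\sum_{i=1}^\infty\phi(|F_i|):F\subseteq\bigcup_{i=1}^\infty F_i,\ |F_i|<\epsilon\Big\}.$$ $\phi$ is an exact Hausdorff measure function for $F$ if $0<\phi\text{-}m(F)<\infty$. *)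

theory Defs
  imports
    "HOL-Probability.Probability"
    "HOL-Computational_Algebra.Polynomial"
begin

section \<open>Operators and the spectral decomposition\<close>

definition op_powr :: "real \<Rightarrow> ('a::euclidean_space \<Rightarrow> 'a) \<Rightarrow> 'a \<Rightarrow> 'a" where
  "op_powr c E x = (\<Sum>n. (ln c ^ n / fact n) *\<^sub>R (E ^^ n) x)"

definition poly_op :: "real poly \<Rightarrow> ('a::euclidean_space \<Rightarrow> 'a) \<Rightarrow> 'a \<Rightarrow> 'a" where
  "poly_op q E x = (\<Sum>i\<le>degree q. coeff q i *\<^sub>R (E ^^ i) x)"

definition minimal_poly :: "('a::euclidean_space \<Rightarrow> 'a) \<Rightarrow> real poly \<Rightarrow> bool" where
  "minimal_poly E q \<longleftrightarrow>
     lead_coeff q = 1 \<and> (\<forall>x. poly_op q E x = 0) \<and>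
     (\<forall>r. r \<noteq> 0 \<and> (\<forall>x. poly_op r E x = 0) \<longrightarrow> degree q \<le> degree r)"

text \<open>
  The factors are indexed by \<open>1, \<dots>, p\<close>; the roots in question are the complex ones. Constant
  factors are excluded: they have no roots, so the real part \<open>a j\<close> would be arbitrary.
\<close>

definition spectral_factorization ::
    "('a::euclidean_space \<Rightarrow> 'a) \<Rightarrow> nat \<Rightarrow> (nat \<Rightarrow> real poly) \<Rightarrow> (nat \<Rightarrow> real) \<Rightarrow> bool" where
  "spectral_factorization E p q a \<longleftrightarrow>
     minimal_poly E (\<Prod>j\<in>{1..p}. q j) \<and>
     (\<forall>j\<in>{1..p}. 0 < degree (q j) \<and>
        (\<forall>z::complex. poly (map_poly complex_of_real (q j)) z = 0 \<longrightarrow> Re z = a j)) \<and>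
     strict_mono_on {1..p} a"

definition spectral_space :: "('a::euclidean_space \<Rightarrow> 'a) \<Rightarrow> (nat \<Rightarrow> real poly) \<Rightarrow> nat \<Rightarrow> 'a set" where
  "spectral_space E q j = {x. poly_op (q j) E x = 0}"

definition inner_product :: "('a::euclidean_space \<Rightarrow> 'a \<Rightarrow> real) \<Rightarrow> bool" where
  "inner_product ip \<longleftrightarrow>
     bilinear ip \<and> (\<forall>x y. ip x y = ip y x) \<and> (\<forall>x. x \<noteq> 0 \<longrightarrow> 0 < ip x x)"

definition ip_norm :: "('a::euclidean_space \<Rightarrow> 'a \<Rightarrow> real) \<Rightarrow> 'a \<Rightarrow> real" where
  "ip_norm ip x = sqrt (ip x x)"

definition ip_cball :: "('a::euclidean_space \<Rightarrow> 'a \<Rightarrow> real) \<Rightarrow> 'a \<Rightarrow> real \<Rightarrow> 'a set" where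
  "ip_cball ip x r = {y. ip_norm ip (y - x) \<le> r}"


section \<open>Levy processes\<close>

text \<open>
  The time set is \<open>{0..}\<close>; the values \<open>X t\<close> for \<open>t < 0\<close> play no role.
\<close>

definition levy_process :: "'w measure \<Rightarrow> (real \<Rightarrow> 'w \<Rightarrow> 'a::euclidean_space) \<Rightarrow> bool" where
  "levy_process M X \<longleftrightarrow>
     prob_space M \<and>
     (\<forall>t\<ge>0. X t \<in> borel_measurable M) \<and>
     (AE \<omega> in M. X 0 \<omega> = 0) \<and>
     (\<forall>t\<ge>0. \<forall>\<epsilon>>0.
        ((\<lambda>s. measure M {\<omega> \<in> space M. dist (X s \<omega>) (X t \<omega>) > \<epsilon>}) \<longlongrightarrow> 0) (at t within {0..})) \<and>
     (\<forall>\<omega>\<in>space M.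
        (\<forall>t\<ge>0. ((\<lambda>s. X s \<omega>) \<longlongrightarrow> X t \<omega>) (at_right t)) \<and>
        (\<forall>t>0. \<exists>l. ((\<lambda>s. X s \<omega>) \<longlongrightarrow> l) (at_left t))) \<and>
     (\<forall>s\<ge>0. \<forall>t\<ge>0.
        distr M borel (\<lambda>\<omega>. X (s + t) \<omega> - X s \<omega>) = distr M borel (\<lambda>\<omega>. X t \<omega> - X 0 \<omega>)) \<and>
     (\<forall>(n::nat) (t::nat \<Rightarrow> real). 0 \<le> t 0 \<and> mono_on {..n} t \<longrightarrow>
        prob_space.indep_vars M (\<lambda>_. borel) (\<lambda>i \<omega>. X (t (Suc i)) \<omega> - X (t i) \<omega>) {..<n})"

definition full_distribution :: "'w measure \<Rightarrow> ('w \<Rightarrow> 'a::euclidean_space) \<Rightarrow> bool" where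
  "full_distribution M Y \<longleftrightarrow> \<not> (\<exists>H. affine H \<and> aff_dim H < int DIM('a) \<and> (AE \<omega> in M. Y \<omega> \<in> H))"

definition same_fdd ::
    "'w measure \<Rightarrow> (real \<Rightarrow> 'w \<Rightarrow> 'a::euclidean_space) \<Rightarrow> (real \<Rightarrow> 'w \<Rightarrow> 'a) \<Rightarrow> bool" where
  "same_fdd M Y Z \<longleftrightarrow>
     (\<forall>I. finite I \<and> I \<subseteq> {0..} \<longrightarrow>
        distr M (\<Pi>\<^sub>M t\<in>I. borel) (\<lambda>\<omega>. \<lambda>t\<in>I. Y t \<omega>) = distr M (\<Pi>\<^sub>M t\<in>I. borel) (\<lambda>\<omega>. \<lambda>t\<in>I. Z t \<omega>))"

definition operator_semistable ::
    "'w measure \<Rightarrow> real \<Rightarrow> ('a::euclidean_space \<Rightarrow> 'a) \<Rightarrow> (real \<Rightarrow> 'w \<Rightarrow> 'a) \<Rightarrow> bool" where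
  "operator_semistable M c E X \<longleftrightarrow>
     full_distribution M (X 1) \<and>
     same_fdd M (\<lambda>t. X (c * t)) (\<lambda>t \<omega>. op_powr c E (X t \<omega>))"

definition levy_measure :: "'a::euclidean_space measure \<Rightarrow> bool" where
  "levy_measure \<nu> \<longleftrightarrow>
     sets \<nu> = sets borel \<and> emeasure \<nu> {0} = 0 \<and> (\<integral>\<^sup>+x. ennreal (min 1 ((norm x)\<^sup>2)) \<partial>\<nu>) < \<infinity>"

text \<open>
  The Levy-Khintchine representation of the law of \<open>Y\<close> with Gaussian covariance operator \<open>A\<close>, Levy
  measure \<open>\<nu>\<close> and drift \<open>\<gamma>\<close>. It is written in the standard inner product of the ambient space;
  whether \<open>A\<close> vanishes does not depend on that choice.
\<close>

definition levy_khintchine ::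
    "'w measure \<Rightarrow> ('w \<Rightarrow> 'a::euclidean_space) \<Rightarrow> ('a \<Rightarrow> 'a) \<Rightarrow> 'a measure \<Rightarrow> 'a \<Rightarrow> bool" where
  "levy_khintchine M Y A \<nu> \<gamma> \<longleftrightarrow>
     linear A \<and> (\<forall>x y. A x \<bullet> y = x \<bullet> A y) \<and> (\<forall>x. 0 \<le> x \<bullet> A x) \<and>
     levy_measure \<nu> \<and>
     (\<forall>z. (LINT \<omega>|M. cis (z \<bullet> Y \<omega>)) =
        exp (complex_of_real (- (z \<bullet> A z) / 2) + \<i> * complex_of_real (z \<bullet> \<gamma>) +
             (LINT x|\<nu>. cis (z \<bullet> x) - 1
                - \<i> * complex_of_real ((z \<bullet> x) * indicat_real (cball 0 1) x))))"

definition no_gaussian_component :: "'w measure \<Rightarrow> (real \<Rightarrow> 'w \<Rightarrow> 'a::euclidean_space) \<Rightarrow> bool" where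
  "no_gaussian_component M X \<longleftrightarrow> (\<exists>\<nu> \<gamma>. levy_khintchine M (X 1) (\<lambda>_. 0) \<nu> \<gamma>)"

definition continuous_density :: "'w measure \<Rightarrow> ('w \<Rightarrow> 'a::euclidean_space) \<Rightarrow> ('a \<Rightarrow> real) \<Rightarrow> bool" where
  "continuous_density M Y f \<longleftrightarrow>
     continuous_on UNIV f \<and> (\<forall>x. 0 \<le> f x) \<and> distributed M lborel Y (\<lambda>x. ennreal (f x))"

definition type_A :: "'w measure \<Rightarrow> (real \<Rightarrow> 'w \<Rightarrow> 'a::euclidean_space) \<Rightarrow> bool" where
  "type_A M X \<longleftrightarrow> (\<exists>f. continuous_density M (X 1) f \<and> f 0 > 0)"

definition type_B :: "'w measure \<Rightarrow> (real \<Rightarrow> 'w \<Rightarrow> 'a::euclidean_space) \<Rightarrow> bool" where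
  "type_B M X \<longleftrightarrow> (\<exists>f. continuous_density M (X 1) f \<and> f 0 = 0)"

definition sojourn_time ::
    "('a::euclidean_space \<Rightarrow> 'a \<Rightarrow> real) \<Rightarrow> (real \<Rightarrow> 'w \<Rightarrow> 'a) \<Rightarrow> real \<Rightarrow> real \<Rightarrow> 'w \<Rightarrow> real" where
  "sojourn_time ip X r s \<omega> = (LINT t:{0..s}|lborel. indicat_real (ip_cball ip 0 r) (X t \<omega>))"


section \<open>Hausdorff measure\<close>

definition hausdorff_gauge :: "(real \<Rightarrow> real) \<Rightarrow> bool" where
  "hausdorff_gauge \<phi> \<longleftrightarrow>
     (\<exists>\<delta>>0. mono_on {0<..<\<delta>} \<phi> \<and> (\<forall>s\<in>{0<..<\<delta>}. (\<phi> \<longlongrightarrow> \<phi> s) (at_right s)) \<and>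
        (\<exists>K>0. \<forall>s. 0 < s \<and> s < \<delta> / 2 \<longrightarrow> \<phi> (2 * s) / \<phi> s \<le> K)) \<and>
     (\<phi> \<longlongrightarrow> 0) (at_right 0)"

text \<open>
  The diameter is valued in \<open>ennreal\<close>, so that unbounded sets have diameter \<open>\<infinity>\<close> and are not
  admissible in a covering. The empty set has diameter \<open>0\<close>.
\<close>

definition ip_diam :: "('a::euclidean_space \<Rightarrow> 'a \<Rightarrow> real) \<Rightarrow> 'a set \<Rightarrow> ennreal" where
  "ip_diam ip F = (SUP x\<in>F. SUP y\<in>F. ennreal (ip_norm ip (x - y)))"

definition gauge_value :: "(real \<Rightarrow> real) \<Rightarrow> ennreal \<Rightarrow> ennreal" where
  "gauge_value \<phi> r = (if r = 0 then 0 else ennreal (\<phi> (enn2real r)))"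

definition hausdorff_premeasure ::
    "('a::euclidean_space \<Rightarrow> 'a \<Rightarrow> real) \<Rightarrow> (real \<Rightarrow> real) \<Rightarrow> 'a set \<Rightarrow> real \<Rightarrow> ennreal" where
  "hausdorff_premeasure ip \<phi> F \<epsilon> =
     Inf {(\<Sum>i. gauge_value \<phi> (ip_diam ip (C i))) | C :: nat \<Rightarrow> 'a set.
            F \<subseteq> (\<Union>i. C i) \<and> (\<forall>i. ip_diam ip (C i) < ennreal \<epsilon>)}"

text \<open>
  A gauge is only specified near \<open>0\<close>. Its values elsewhere (where \<open>ennreal\<close> would truncate negative
  ones) do not affect the limit below.
\<close>

definition hausdorff_measure ::
    "('a::euclidean_space \<Rightarrow> 'a \<Rightarrow> real) \<Rightarrow> (real \<Rightarrow> real) \<Rightarrow> 'a set \<Rightarrow> ennreal" where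
  "hausdorff_measure ip \<phi> F = Lim (at_right 0) (hausdorff_premeasure ip \<phi> F)"

definition exact_hausdorff_function ::
    "('a::euclidean_space \<Rightarrow> 'a \<Rightarrow> real) \<Rightarrow> (real \<Rightarrow> real) \<Rightarrow> 'a set \<Rightarrow> bool" where
  "exact_hausdorff_function ip \<phi> F \<longleftrightarrow>
     hausdorff_gauge \<phi> \<and> 0 < hausdorff_measure ip \<phi> F \<and> hausdorff_measure ip \<phi> F < \<infinity>"

lemma hausdorff_premeasure_antimono:
  assumes "\<epsilon> \<le> \<epsilon>'"
  shows "hausdorff_premeasure ip \<phi> F \<epsilon>' \<le> hausdorff_premeasure ip \<phi> F \<epsilon>"
  unfolding hausdorff_premeasure_def
  using ennreal_leI[OF assms] by (intro Inf_superset_mono) (blast intro: less_le_trans)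

text \<open>The limit in the definition of the Hausdorff measure always exists.\<close>

lemma hausdorff_premeasure_tendsto:
  "(hausdorff_premeasure ip \<phi> F \<longlongrightarrow> (SUP \<epsilon>\<in>{0<..}. hausdorff_premeasure ip \<phi> F \<epsilon>)) (at_right 0)"
proof (rule order_tendstoI)
  fix l assume "l < (SUP \<epsilon>\<in>{0<..}. hausdorff_premeasure ip \<phi> F \<epsilon>)"
  then obtain e where e: "e > 0" "l < hausdorff_premeasure ip \<phi> F e"
    by (auto simp: less_SUP_iff)
  have "l < hausdorff_premeasure ip \<phi> F x" if "0 < x" "x < e" for x
    using e(2) hausdorff_premeasure_antimono[of x e] that by (meson less_le_trans less_imp_le)
  then show "\<forall>\<^sub>F x in at_right 0. l < hausdorff_premeasure ip \<phi> F x"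
    using e(1) by (auto simp: eventually_at_right_field)
next
  fix u assume u: "(SUP \<epsilon>\<in>{0<..}. hausdorff_premeasure ip \<phi> F \<epsilon>) < u"
  have "hausdorff_premeasure ip \<phi> F x < u" if "0 < x" for x
    by (rule le_less_trans[OF SUP_upper u]) (use that in auto)
  then show "\<forall>\<^sub>F x in at_right 0. hausdorff_premeasure ip \<phi> F x < u"
    by (auto simp: eventually_at_right_field intro!: exI[of _ 1])
qed

lemma hausdorff_measure_eq_SUP:
  "hausdorff_measure ip \<phi> F = (SUP \<epsilon>\<in>{0<..}. hausdorff_premeasure ip \<phi> F \<epsilon>)"
  unfolding hausdorff_measure_def
  by (rule tendsto_Lim[OF _ hausdorff_premeasure_tendsto]) simp

end

theory Submission
  imports Defs "HOL-Real_Asymp.Real_Asymp" "HOL-Computational_Algebra.Fundamental_Theorem_Algebra"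
begin

text \<open>
  Write \<open>\<alpha>\<close> for \<open>\<alpha> 1\<close> and \<open>\<theta>\<close> for \<open>1\<close> in part (i) and \<open>1 - \<alpha>\<close> in part (ii). Since \<open>E\<close> is diagonal on the principal
  spectral space and the other eigenvalues have larger real part, the powers of \<open>op_powr c E\<close> expand every
  vector by at least a constant times \<open>c powr (n / \<alpha>)\<close>. By semistability, staying in a ball of radius \<open>1\<close> up to
  time \<open>l\<close> therefore entails (in law) staying in a ball of radius of order \<open>c powr (- n / \<alpha>)\<close> up to time \<open>l / c ^ n\<close>.

  Upper bound. The path stays in the unit ball up to time \<open>l\<close> with probability at least \<open>exp (- K * l powr (1 / \<theta>))\<close>:
  in type A because the process returns near the origin with positive probability in each unit of time, and for
  \<open>\<alpha> < 1\<close> by adding up small increments. So at the scales \<open>c ^ - n\<close> between \<open>s * s\<close> and \<open>2 * s * s\<close> nearly every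
  starting time sees some scale at which the path lingers in a small ball for a time that is larger than
  normal by the factor \<open>(ln (ln (1 / r))) powr \<theta>\<close>. These balls form covers of bounded cost.

  Lower bound. If the occupation time has tail \<open>exp (- K * l powr (1 / \<theta>))\<close>, then by Borel-Cantelli it is eventually bounded
  by the gauge from almost every starting time, and a density argument for the occupation measure applies. In part
  (ii) the tail is assumed. In part (i) it comes from Khasminskii's exponential moment bound, for which the
  expected occupation time of a ball is estimated by Fourier analysis on the adjoint eigenspace of \<open>E\<close>.
\<close>

section \<open>Levy processes and the Markov property\<close>

text \<open>Self-similarity holds only along powers of \<open>c\<close>, so estimates are made at
  the scales \<open>c ^ n\<close> and interpolated by monotonicity or by compactness of an annulus.
  Time windows at neighbouring scales overlap; with scales \<open>s\<close> apart, the initial piece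
  shared with the smaller scales is negligible, and the remaining pieces are disjoint, hence
  independent. There are \<open>s\<close> such scales with exponents between \<open>s * s\<close>
  and \<open>2 * s * s\<close>. With \<open>l = (ln s / (2 * K)) powr \<theta>\<close> the path
  lingers at each of them with probability at least \<open>s powr (- 1 / 2)\<close>, so all fail
  with probability about \<open>exp (- sqrt s)\<close>. This beats the polynomial factor in the cost
  of bad starting times. As \<open>ln (1 / r)\<close> is of order \<open>s * s\<close> there,
  \<open>ln s\<close> is comparable to \<open>ln (ln (1 / r))\<close>: this is the origin of the
  iterated logarithm. Random times are replaced by first indices on deterministic grids, to which
  the Markov property at fixed times applies; right-continuity then lets the mesh tend to 0.
  Probabilities are estimated in the Euclidean norm; \<open>ip\<close> enters through equivalence of
  norms.\<close>

lemma finite_real_enumeration: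
  fixes A :: "real set"
  assumes "finite A" "0 \<in> A" "A \<subseteq> {0..}"
  obtains n t where "t (0::nat) = 0" "mono_on {..n} t" "A = t ` {..n}"
proof -
  define l where "l = sorted_list_of_set A"
  define n where "n = length l - 1"
  have l: "set l = A" "sorted l" using assms by (auto simp: l_def)
  then have ne: "l \<noteq> []" using assms by auto
  have m: "mono_on {..n} ((!) l)"
    using l ne by (intro mono_onI sorted_nth_mono) (auto simp: n_def Suc_diff_le less_eq_Suc_le length_greater_0_conv[symmetric] simp del: length_greater_0_conv)
  have im: "A = (!) l ` {..n}"
  proof -
    have "{..n} = {..<length l}" using ne by (auto simp: n_def simp flip: length_greater_0_conv)
    then show ?thesis using l by (auto simp: set_conv_nth)
  qed
  obtain i where i: "i \<le> n" "l ! i = 0" using im assms(2) by auto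
  have "l ! 0 \<le> 0" using mono_onD[OF m, of 0 i] i by auto
  moreover have "l ! 0 \<ge> 0" using im assms(3) by auto
  ultimately show ?thesis using that[of "(!) l" n] m im by auto
qed

text \<open>Cylinders over finite index sets generate the product sigma-algebra and are stable under
  intersection, so finite-dimensional laws determine the law even for uncountable \<open>I\<close>.
  This carries stationarity and semistability from finitely many times to whole paths.\<close>

lemma distr_PiM_eqI:
  assumes P: "prob_space P" "prob_space Q"
    and Y: "\<And>i. i \<in> I \<Longrightarrow> Y i \<in> measurable P (N i)" and Z: "\<And>i. i \<in> I \<Longrightarrow> Z i \<in> measurable Q (N i)"
    and eq: "\<And>J. finite J \<Longrightarrow> J \<subseteq> I \<Longrightarrow>
      distr P (PiM J N) (\<lambda>\<omega>. \<lambda>i\<in>J. Y i \<omega>) = distr Q (PiM J N) (\<lambda>\<omega>. \<lambda>i\<in>J. Z i \<omega>)"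
  shows "distr P (PiM I N) (\<lambda>\<omega>. \<lambda>i\<in>I. Y i \<omega>) = distr Q (PiM I N) (\<lambda>\<omega>. \<lambda>i\<in>I. Z i \<omega>)"
proof (rule measure_eqI_PiM_infinite)
  have *: "emeasure (distr R (PiM I N) (\<lambda>\<omega>. \<lambda>i\<in>I. W i \<omega>)) (prod_emb I N J (Pi\<^sub>E J A))
      = emeasure (distr R (PiM J N) (\<lambda>\<omega>. \<lambda>i\<in>J. W i \<omega>)) (Pi\<^sub>E J A)"
    if W: "\<And>i. i \<in> I \<Longrightarrow> W i \<in> measurable R (N i)" and J: "finite J" "J \<subseteq> I" "\<And>i. i \<in> J \<Longrightarrow> A i \<in> sets (N i)"
    for J A W and R :: "'z measure"
  proof -
    have eq: "(\<lambda>\<omega>. \<lambda>i\<in>I. W i \<omega>) -` prod_emb I N J (Pi\<^sub>E J A) \<inter> space R = (\<lambda>\<omega>. \<lambda>i\<in>J. W i \<omega>) -` (Pi\<^sub>E J A) \<inter> space R"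
    proof -
      have "restrict (\<lambda>i\<in>I. W i \<omega>) J = (\<lambda>i\<in>J. W i \<omega>)" for \<omega>
        using J(2) by (auto simp: restrict_def fun_eq_iff)
      moreover have "(\<lambda>i\<in>I. W i \<omega>) \<in> (\<Pi>\<^sub>E i\<in>I. space (N i))" if "\<omega> \<in> space R" for \<omega>
        using measurable_space[OF W that] by auto
      ultimately show ?thesis by (auto simp: prod_emb_def)
    qed
    have m: "(\<lambda>\<omega>. \<lambda>i\<in>I. W i \<omega>) \<in> measurable R (PiM I N)" "(\<lambda>\<omega>. \<lambda>i\<in>J. W i \<omega>) \<in> measurable R (PiM J N)"
      using J(2) by (auto intro!: measurable_restrict W)
    show ?thesis
      using J by (simp add: emeasure_distr[OF m(1)] emeasure_distr[OF m(2)] eq sets_PiM_I_finite)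
  qed
  fix A J assume J: "finite J" "J \<subseteq> I" "\<And>i. i \<in> J \<Longrightarrow> A i \<in> sets (N i)"
  show "emeasure (distr P (PiM I N) (\<lambda>\<omega>. \<lambda>i\<in>I. Y i \<omega>)) (prod_emb I N J (Pi\<^sub>E J A))
      = emeasure (distr Q (PiM I N) (\<lambda>\<omega>. \<lambda>i\<in>I. Z i \<omega>)) (prod_emb I N J (Pi\<^sub>E J A))"
    by (subst *[OF Y J], assumption+, subst *[OF Z J], assumption+) (simp add: eq[OF J(1,2)])
next
  interpret P: prob_space P by fact
  show "finite_measure (distr P (PiM I N) (\<lambda>\<omega>. \<lambda>i\<in>I. Y i \<omega>))"
    by (intro P.finite_measure_distr measurable_restrict Y)
qed auto

text \<open>The start at 0 is required at every sample point, which spares a null set in each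
  pathwise argument. Subtracting the initial value of a \<open>levy_process\<close> leads to this
  situation.\<close>

locale levy_path = prob_space M for M :: "'w measure" +
  fixes X :: "real \<Rightarrow> 'w \<Rightarrow> 'a::euclidean_space"
  assumes X_meas: "0 \<le> t \<Longrightarrow> X t \<in> borel_measurable M"
    and X_zero: "\<omega> \<in> space M \<Longrightarrow> X 0 \<omega> = 0"
    and X_rc: "\<omega> \<in> space M \<Longrightarrow> 0 \<le> t \<Longrightarrow> ((\<lambda>s. X s \<omega>) \<longlongrightarrow> X t \<omega>) (at_right t)"
    and X_ll: "\<omega> \<in> space M \<Longrightarrow> 0 < t \<Longrightarrow> \<exists>l. ((\<lambda>s. X s \<omega>) \<longlongrightarrow> l) (at_left t)"
    and X_stat: "0 \<le> s \<Longrightarrow> 0 \<le> t \<Longrightarrow> distr M borel (\<lambda>\<omega>. X (s + t) \<omega> - X s \<omega>) = distr M borel (X t)"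
    and X_indep: "0 \<le> tt (0::nat) \<Longrightarrow> mono_on {..n} tt \<Longrightarrow>
        indep_vars (\<lambda>_. borel) (\<lambda>i \<omega>. X (tt (Suc i)) \<omega> - X (tt i) \<omega>) {..<n}"
begin

lemma mono_nonneg: "0 \<le> t (0::nat) \<Longrightarrow> mono_on {..n} t \<Longrightarrow> i \<le> n \<Longrightarrow> 0 \<le> (t i :: real)"
  using mono_onD[of "{..n}" t 0 i] by auto

lemma incr_law:
  assumes "0 \<le> t (0::nat)" "mono_on {..n} t"
  shows "distr M (PiM {..<n} (\<lambda>_. borel)) (\<lambda>\<omega>. \<lambda>i\<in>{..<n}. X (t (Suc i)) \<omega> - X (t i) \<omega>)
     = PiM {..<n} (\<lambda>i. distr M borel (X (t (Suc i) - t i)))"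
proof (cases "n = 0")
  case True
  have "emeasure (distr M (PiM {} (\<lambda>_. borel)) (\<lambda>\<omega>. \<lambda>i\<in>{}. X (t (Suc i)) \<omega> - X (t i) \<omega>)) {\<lambda>k. undefined} = 1"
    by (subst emeasure_distr) (auto simp: space_PiM sets_PiM_empty emeasure_space_1 restrict_def)
  then show ?thesis unfolding True
    by (intro measure_eqI) (auto simp: sets_PiM_empty)
next
  case False
  have t: "0 \<le> t i" "0 \<le> t (Suc i)" "t i \<le> t (Suc i)" if "i < n" for i
    using mono_nonneg[OF assms, of i] mono_nonneg[OF assms, of "Suc i"] mono_onD[OF assms(2), of i "Suc i"] that by auto
  have "distr M (PiM {..<n} (\<lambda>_. borel)) (\<lambda>\<omega>. \<lambda>i\<in>{..<n}. X (t (Suc i)) \<omega> - X (t i) \<omega>)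
     = PiM {..<n} (\<lambda>i. distr M borel (\<lambda>\<omega>. X (t (Suc i)) \<omega> - X (t i) \<omega>))"
    using False X_indep[OF assms] t X_meas
    by (subst (asm) indep_vars_iff_distr_eq_PiM') auto
  also have "\<dots> = PiM {..<n} (\<lambda>i. distr M borel (X (t (Suc i) - t i)))"
  proof (intro PiM_cong refl)
    fix i assume "i \<in> {..<n}"
    then show "distr M borel (\<lambda>\<omega>. X (t (Suc i)) \<omega> - X (t i) \<omega>) = distr M borel (X (t (Suc i) - t i))"
      using t[of i] X_stat[of "t i" "t (Suc i) - t i"] by simp
  qed
  finally show ?thesis .
qed

lemma sum_incr:
  "\<omega> \<in> space M \<Longrightarrow> (\<Sum>i<k. X (t (Suc i)) \<omega> - X (t i) \<omega>) = X (t k) \<omega> - X (t (0::nat)) \<omega>"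
  by (rule sum_lessThan_telescope)

text \<open>A displacement after time \<open>T\<close> is a partial sum of increments along a grid
  moved by \<open>T\<close>, and the joint law of these increments depends only on the mesh widths.
  Comparing with \<open>T = 0\<close> gives the claim.\<close>

lemma fd_shift:
  assumes J: "finite J" "J \<subseteq> {0..}" and T: "0 \<le> T"
  shows "distr M (PiM J (\<lambda>_. borel)) (\<lambda>\<omega>. \<lambda>u\<in>J. X (T + u) \<omega> - X T \<omega>)
       = distr M (PiM J (\<lambda>_. borel)) (\<lambda>\<omega>. \<lambda>u\<in>J. X u \<omega>)"
proof -
  obtain n t where t: "t (0::nat) = 0" "mono_on {..n} t" "insert 0 J = t ` {..n}"
    by (rule finite_real_enumeration[of "insert 0 J"]) (use J in auto)
  have "\<forall>u\<in>J. \<exists>i\<le>n. t i = u" using t(3) by (metis atMost_iff imageE insertCI)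
  then obtain k where k: "\<And>u. u \<in> J \<Longrightarrow> k u \<le> n \<and> t (k u) = u" by metis
  define g where "g d = (\<lambda>u\<in>J. \<Sum>i<k u. d i :: 'a)" for d :: "nat \<Rightarrow> 'a"
  have g: "g \<in> measurable (PiM {..<n} (\<lambda>_. borel)) (PiM J (\<lambda>_. borel))"
    unfolding g_def using k by (auto intro!: measurable_restrict borel_measurable_sum measurable_component_singleton) (meson less_le_trans)
  have main: "distr M (PiM J (\<lambda>_. borel)) (\<lambda>\<omega>. \<lambda>u\<in>J. X (S + u) \<omega> - X S \<omega>)
     = distr (PiM {..<n} (\<lambda>i. distr M borel (X (t (Suc i) - t i)))) (PiM J (\<lambda>_. borel)) g" if S: "0 \<le> S" for S
  proof -
    let ?t = "\<lambda>i. S + t i"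
    have m: "0 \<le> ?t 0" "mono_on {..n} ?t" using t S by (auto simp: mono_on_def)
    have t': "0 \<le> ?t i" "0 \<le> ?t (Suc i)" if "i < n" for i
      using mono_nonneg[OF m, of i] mono_nonneg[OF m, of "Suc i"] that by auto
    have "distr M (PiM J (\<lambda>_. borel)) (\<lambda>\<omega>. \<lambda>u\<in>J. X (S + u) \<omega> - X S \<omega>) =
       distr M (PiM J (\<lambda>_. borel)) (g \<circ> (\<lambda>\<omega>. \<lambda>i\<in>{..<n}. X (?t (Suc i)) \<omega> - X (?t i) \<omega>))"
    proof (rule distr_cong[OF refl refl])
      fix \<omega> assume w: "\<omega> \<in> space M"
      show "(\<lambda>u\<in>J. X (S + u) \<omega> - X S \<omega>) = (g \<circ> (\<lambda>\<omega>. \<lambda>i\<in>{..<n}. X (?t (Suc i)) \<omega> - X (?t i) \<omega>)) \<omega>"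
      proof
        fix u
        have "(\<Sum>i<k u. (\<lambda>i\<in>{..<n}. X (?t (Suc i)) \<omega> - X (?t i) \<omega>) i) = X (S + u) \<omega> - X S \<omega>" if "u \<in> J"
        proof -
          have "(\<Sum>i<k u. (\<lambda>i\<in>{..<n}. X (?t (Suc i)) \<omega> - X (?t i) \<omega>) i) = (\<Sum>i<k u. X (?t (Suc i)) \<omega> - X (?t i) \<omega>)"
            using k[OF that] by (intro sum.cong) auto
          then show ?thesis using sum_incr[OF w, of ?t "k u"] k[OF that] t(1) by simp
        qed
        then show "(\<lambda>u\<in>J. X (S + u) \<omega> - X S \<omega>) u = (g \<circ> (\<lambda>\<omega>. \<lambda>i\<in>{..<n}. X (?t (Suc i)) \<omega> - X (?t i) \<omega>)) \<omega> u"
          by (auto simp: g_def)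
      qed
    qed
    also have "\<dots> = distr (distr M (PiM {..<n} (\<lambda>_. borel)) (\<lambda>\<omega>. \<lambda>i\<in>{..<n}. X (?t (Suc i)) \<omega> - X (?t i) \<omega>)) (PiM J (\<lambda>_. borel)) g"
      using t' X_meas by (intro distr_distr[symmetric] g measurable_restrict borel_measurable_diff) auto
    finally show ?thesis unfolding incr_law[OF m] by simp
  qed
  have "distr M (PiM J (\<lambda>_. borel)) (\<lambda>\<omega>. \<lambda>u\<in>J. X u \<omega>) = distr M (PiM J (\<lambda>_. borel)) (\<lambda>\<omega>. \<lambda>u\<in>J. X (0 + u) \<omega> - X 0 \<omega>)"
    by (intro distr_cong refl) (auto simp: X_zero)
  then show ?thesis using main[OF T] main[of 0] by simp
qed

text \<open>One grid through \<open>T\<close> carries both vectors: the first is a function of the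
  increments with index below \<open>n1\<close>, the second of those from \<open>n1\<close>
  on.\<close>

lemma fd_indep:
  assumes I: "finite I" "I \<subseteq> {0..T}" and J: "finite J" "J \<subseteq> {0..}" and T: "0 \<le> T"
  shows "indep_var (PiM I (\<lambda>_. borel)) (\<lambda>\<omega>. \<lambda>s\<in>I. X s \<omega>) (PiM J (\<lambda>_. borel)) (\<lambda>\<omega>. \<lambda>u\<in>J. X (T + u) \<omega> - X T \<omega>)"
proof -
  obtain n1 t1 where t1: "t1 (0::nat) = 0" "mono_on {..n1} t1" "insert 0 (insert T I) = t1 ` {..n1}"
    by (rule finite_real_enumeration[of "insert 0 (insert T I)"]) (use I T in auto)
  obtain n2 t2 where t2: "t2 (0::nat) = 0" "mono_on {..n2} t2" "insert 0 J = t2 ` {..n2}"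
    by (rule finite_real_enumeration[of "insert 0 J"]) (use J in auto)
  have t1n: "t1 n1 = T"
  proof (rule antisym)
    show "t1 n1 \<le> T" using t1(3) I T by (metis atLeastAtMost_iff atMost_iff imageI insert_iff order_refl subsetD)
    obtain i where "i \<le> n1" "t1 i = T" using t1(3) by (metis atMost_iff imageE insertI1 insertI2)
    then show "T \<le> t1 n1" using mono_onD[OF t1(2), of i n1] by auto
  qed
  \<comment> \<open>The grid of the past ends in \<open>T\<close> at index \<open>n1\<close>, where
    the shifted grid of the future takes over; \<open>t2 0 = 0\<close> makes the two agree
    there.\<close>
  define t where "t i = (if i \<le> n1 then t1 i else T + t2 (i - n1))" for i
  have t0: "0 \<le> t 0" using t1 by (simp add: t_def)
  have mono: "mono_on {..n1+n2} t"
  proof (rule mono_onI)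
    fix i j assume ij: "i \<in> {..n1+n2}" "j \<in> {..n1+n2}" "i \<le> j"
    consider "j \<le> n1" | "i \<le> n1" "j > n1" | "i > n1" using ij by linarith
    then show "t i \<le> t j"
    proof cases
      case 1 then show ?thesis using mono_onD[OF t1(2), of i j] ij by (auto simp: t_def)
    next
      case 2
      have "t1 i \<le> T" using mono_onD[OF t1(2), of i n1] 2 t1n by auto
      moreover have "0 \<le> t2 (j - n1)" using mono_onD[OF t2(2), of 0 "j-n1"] t2 ij by auto
      ultimately show ?thesis using 2 by (auto simp: t_def)
    next
      case 3 then show ?thesis using mono_onD[OF t2(2), of "i-n1" "j-n1"] ij by (auto simp: t_def)
    qed
  qed
  have tT: "t n1 = T" using t1n by (simp add: t_def)
  have t2': "t (n1 + k) = T + t2 k" for k using t1n t2 by (cases k) (auto simp: t_def)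
  define D where "D i \<omega> = X (t (Suc i)) \<omega> - X (t i) \<omega>" for i \<omega>
  have ind: "indep_vars (\<lambda>_. borel) D {..<n1+n2}"
    using X_indep[OF t0 mono] by (simp add: D_def[abs_def])
  have "\<forall>u\<in>I. \<exists>i\<le>n1. t1 i = u" using t1(3) by (metis atMost_iff imageE insertCI)
  then obtain k1 where k1: "\<And>u. u \<in> I \<Longrightarrow> k1 u \<le> n1 \<and> t1 (k1 u) = u" by metis
  have "\<forall>u\<in>J. \<exists>i\<le>n2. t2 i = u" using t2(3) by (metis atMost_iff imageE insertCI)
  then obtain k2 where k2: "\<And>u. u \<in> J \<Longrightarrow> k2 u \<le> n2 \<and> t2 (k2 u) = u" by metis
  define g1 where "g1 d = (\<lambda>u\<in>I. \<Sum>i<k1 u. d i :: 'a)" for d :: "nat \<Rightarrow> 'a"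
  define g2 where "g2 d = (\<lambda>u\<in>J. \<Sum>i<k2 u. d (n1 + i) :: 'a)" for d :: "nat \<Rightarrow> 'a"
  have g1: "g1 \<in> measurable (PiM {..<n1} (\<lambda>_. borel)) (PiM I (\<lambda>_. borel))"
    unfolding g1_def using k1 by (auto intro!: measurable_restrict borel_measurable_sum measurable_component_singleton) (meson less_le_trans)
  have g2: "g2 \<in> measurable (PiM {n1..<n1+n2} (\<lambda>_. borel)) (PiM J (\<lambda>_. borel))"
    unfolding g2_def using k2 by (auto intro!: measurable_restrict borel_measurable_sum measurable_component_singleton) (meson less_le_trans)
  have "indep_var (PiM {..<n1} (\<lambda>_. borel)) (\<lambda>\<omega>. restrict (\<lambda>i. D i \<omega>) {..<n1})
      (PiM {n1..<n1+n2} (\<lambda>_. borel)) (\<lambda>\<omega>. restrict (\<lambda>i. D i \<omega>) {n1..<n1+n2})"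
    by (rule indep_var_restrict[OF ind]) auto
  from indep_var_compose[OF this g1 g2]
  have iv: "indep_var (PiM I (\<lambda>_. borel)) (g1 \<circ> (\<lambda>\<omega>. restrict (\<lambda>i. D i \<omega>) {..<n1}))
     (PiM J (\<lambda>_. borel)) (g2 \<circ> (\<lambda>\<omega>. restrict (\<lambda>i. D i \<omega>) {n1..<n1+n2}))" .
  have e1: "(g1 \<circ> (\<lambda>\<omega>. restrict (\<lambda>i. D i \<omega>) {..<n1})) \<omega> = (\<lambda>s\<in>I. X s \<omega>)" if w: "\<omega> \<in> space M" for \<omega>
  proof
    fix u
    show "(g1 \<circ> (\<lambda>\<omega>. restrict (\<lambda>i. D i \<omega>) {..<n1})) \<omega> u = (\<lambda>s\<in>I. X s \<omega>) u"
    proof (cases "u \<in> I")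
      case True
      have "(\<Sum>i<k1 u. restrict (\<lambda>i. D i \<omega>) {..<n1} i) = (\<Sum>i<k1 u. D i \<omega>)"
        using k1[OF True] by (intro sum.cong) auto
      then show ?thesis using sum_incr[OF w, of t "k1 u"] k1[OF True] t1(1) X_zero[OF w] True by (simp add: D_def g1_def t_def)
    qed (simp add: g1_def)
  qed
  have e2: "(g2 \<circ> (\<lambda>\<omega>. restrict (\<lambda>i. D i \<omega>) {n1..<n1+n2})) \<omega> = (\<lambda>u\<in>J. X (T + u) \<omega> - X T \<omega>)" if w: "\<omega> \<in> space M" for \<omega>
  proof
    fix u
    show "(g2 \<circ> (\<lambda>\<omega>. restrict (\<lambda>i. D i \<omega>) {n1..<n1+n2})) \<omega> u = (\<lambda>u\<in>J. X (T + u) \<omega> - X T \<omega>) u"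
    proof (cases "u \<in> J")
      case True
      have "(\<Sum>i<k2 u. restrict (\<lambda>i. D i \<omega>) {n1..<n1+n2} (n1 + i)) = (\<Sum>i<k2 u. D (n1 + i) \<omega>)"
        using k2[OF True] by (intro sum.cong) auto
      then show ?thesis using sum_incr[OF w, of "\<lambda>i. t (n1 + i)" "k2 u"] k2[OF True] t2(1) t2' tT True by (simp add: D_def g2_def)
    qed (simp add: g2_def)
  qed
  have m1: "(\<lambda>\<omega>. \<lambda>s\<in>I. X s \<omega>) \<in> measurable M (PiM I (\<lambda>_. borel))"
    using I by (intro measurable_restrict X_meas) auto
  have m2: "(\<lambda>\<omega>. \<lambda>u\<in>J. X (T + u) \<omega> - X T \<omega>) \<in> measurable M (PiM J (\<lambda>_. borel))"
    using J T by (intro measurable_restrict borel_measurable_diff X_meas) auto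
  show ?thesis
    using iv m1 m2 unfolding indep_var_distribution_eq
    using e1 e2 by (simp cong: distr_cong)
qed

abbreviation path_space :: "real set \<Rightarrow> (real \<Rightarrow> 'a) measure" where "path_space I \<equiv> PiM I (\<lambda>_. borel)"

definition xpath :: "'w \<Rightarrow> real \<Rightarrow> 'a" where "xpath \<omega> = (\<lambda>s\<in>{0..}. X s \<omega>)"
definition past :: "real \<Rightarrow> 'w \<Rightarrow> real \<Rightarrow> 'a" where "past t \<omega> = (\<lambda>s\<in>{0..t}. X s \<omega>)"
definition future :: "real \<Rightarrow> 'w \<Rightarrow> real \<Rightarrow> 'a" where "future t \<omega> = (\<lambda>u\<in>{0..}. X (t + u) \<omega> - X t \<omega>)"

lemma xpath_meas [measurable]: "xpath \<in> measurable M (path_space {0..})"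
  unfolding xpath_def by (intro measurable_restrict X_meas) auto

lemma past_meas [measurable]: "past t \<in> measurable M (path_space {0..t})"
  unfolding past_def by (intro measurable_restrict X_meas) auto

lemma future_meas [measurable]: "0 \<le> t \<Longrightarrow> future t \<in> measurable M (path_space {0..})"
  unfolding future_def by (intro measurable_restrict borel_measurable_diff X_meas) auto

lemma future_law: "0 \<le> t \<Longrightarrow> distr M (path_space {0..}) (future t) = distr M (path_space {0..}) xpath"
  unfolding future_def xpath_def
  by (rule distr_PiM_eqI[OF prob_space_axioms prob_space_axioms])
     (auto intro!: borel_measurable_diff X_meas fd_shift)

text \<open>For cylinders this is \<open>fd_indep\<close>. They form a generating system stable
  under intersection, so independence extends to the generated sigma-algebras.\<close>

lemma past_future_indep:
  assumes t: "0 \<le> t"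
  shows "indep_var (path_space {0..t}) (past t) (path_space {0..}) (future t)"
proof -
  have gen: "{Y -` A \<inter> space M | A. A \<in> sets (path_space I)} = sigma_sets (space M) {Y -` A \<inter> space M | A. A \<in> prod_algebra I (\<lambda>_. borel)}"
    if "Y \<in> measurable M (path_space I)" for Y and I :: "real set"
    unfolding sets_PiM using measurable_space[OF that]
    by (intro sigma_sets_vimage_commute) (auto simp: space_PiM)
  have stab: "Int_stable {Y -` A \<inter> space M | A. A \<in> prod_algebra I (\<lambda>_. borel)}" for Y :: "'w \<Rightarrow> real \<Rightarrow> 'a" and I
  proof (rule Int_stableI, clarsimp)
    fix A B assume "A \<in> prod_algebra I (\<lambda>_. borel :: 'a measure)" "B \<in> prod_algebra I (\<lambda>_. borel :: 'a measure)"
    then have "A \<inter> B \<in> prod_algebra I (\<lambda>_. borel)"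
      using Int_stable_prod_algebra by (auto simp: Int_stable_def)
    then show "\<exists>C. Y -` A \<inter> space M \<inter> (Y -` B \<inter> space M) = Y -` C \<inter> space M \<and> C \<in> prod_algebra I (\<lambda>_. borel)"
      by (intro exI[of _ "A \<inter> B"]) auto
  qed
  let ?G1 = "{past t -` A \<inter> space M | A. A \<in> prod_algebra {0..t} (\<lambda>_. borel)}"
  let ?G2 = "{future t -` A \<inter> space M | A. A \<in> prod_algebra {0..} (\<lambda>_. borel)}"
  have "indep_set ?G1 ?G2"
    unfolding indep_sets2_eq
  proof (intro conjI ballI)
    show "?G1 \<subseteq> events" "?G2 \<subseteq> events"
      using measurable_sets[OF past_meas] measurable_sets[OF future_meas[OF t]] by (auto simp: sets_PiM)
    fix a b assume "a \<in> ?G1" "b \<in> ?G2"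
    then obtain A B where AB: "A \<in> prod_algebra {0..t} (\<lambda>_. borel)" "B \<in> prod_algebra {0..} (\<lambda>_. borel)"
      and ab: "a = past t -` A \<inter> space M" "b = future t -` B \<inter> space M" by auto
    obtain I E where I: "A = prod_emb {0..t} (\<lambda>_. borel) I (Pi\<^sub>E I E)" "finite I" "I \<subseteq> {0..t}" "\<And>i. i \<in> I \<Longrightarrow> E i \<in> sets borel"
      using AB(1) by (elim prod_algebraE) auto
    obtain J F where J: "B = prod_emb {0..} (\<lambda>_. borel) J (Pi\<^sub>E J F)" "finite J" "J \<subseteq> {0..}" "\<And>i. i \<in> J \<Longrightarrow> F i \<in> sets borel"
      using AB(2) by (elim prod_algebraE) auto
    have a: "a = (\<lambda>\<omega>. \<lambda>s\<in>I. X s \<omega>) -` (Pi\<^sub>E I E) \<inter> space M"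
    proof -
      have "restrict (past t \<omega>) I = (\<lambda>s\<in>I. X s \<omega>)" for \<omega>
        using I(3) by (auto simp: past_def restrict_def fun_eq_iff)
      moreover have "past t \<omega> \<in> extensional {0..t}" for \<omega> by (simp add: past_def)
      ultimately show ?thesis by (auto simp: ab I(1) prod_emb_def PiE_def)
    qed
    have b: "b = (\<lambda>\<omega>. \<lambda>u\<in>J. X (t + u) \<omega> - X t \<omega>) -` (Pi\<^sub>E J F) \<inter> space M"
    proof -
      have "restrict (future t \<omega>) J = (\<lambda>u\<in>J. X (t + u) \<omega> - X t \<omega>)" for \<omega>
        using J(3) by (auto simp: future_def restrict_def fun_eq_iff)
      moreover have "future t \<omega> \<in> extensional {0..}" for \<omega> by (simp add: future_def)
      ultimately show ?thesis by (auto simp: ab J(1) prod_emb_def PiE_def)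
    qed
    have "Pi\<^sub>E I E \<in> sets (path_space I)" "Pi\<^sub>E J F \<in> sets (path_space J)"
      using I J by (auto intro!: sets_PiM_I_finite)
    note indep_varD[OF fd_indep[OF I(2,3) J(2,3) t] this]
    moreover have "(\<lambda>\<omega>. (\<lambda>s\<in>I. X s \<omega>, \<lambda>u\<in>J. X (t + u) \<omega> - X t \<omega>)) -` (Pi\<^sub>E I E \<times> Pi\<^sub>E J F) \<inter> space M = a \<inter> b"
      unfolding a b by auto
    ultimately show "prob (a \<inter> b) = prob a * prob b"
      unfolding a b by simp
  qed
  from indep_set_sigma_sets[OF this stab stab] show ?thesis
    unfolding indep_var_eq gen[OF past_meas] gen[OF future_meas[OF t]]
    using past_meas future_meas[OF t] by (subst (1 2) sigma_sets_sigma_sets_eq) auto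
qed

text \<open>By independence the joint law of past and future is a product, and by stationarity its
  second factor is the law of the path itself. What remains is Tonelli's theorem, with the future
  replaced by an independent copy of the path.\<close>

theorem markov:
  assumes t: "0 \<le> t" and g: "g \<in> borel_measurable (path_space {0..t} \<Otimes>\<^sub>M path_space {0..})"
  shows "(\<integral>\<^sup>+\<omega>. g (past t \<omega>, future t \<omega>) \<partial>M) = (\<integral>\<^sup>+\<omega>. (\<integral>\<^sup>+\<omega>'. g (past t \<omega>, xpath \<omega>') \<partial>M) \<partial>M)"
proof -
  define Q where "Q = distr M (path_space {0..}) xpath"
  interpret P: prob_space Q unfolding Q_def by (intro prob_space_distr xpath_meas)
  have sQ: "sets Q = sets (path_space {0..})" by (simp add: Q_def)
  have g': "g \<in> borel_measurable (path_space {0..t} \<Otimes>\<^sub>M Q)"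
    using g by (simp add: sQ cong: measurable_cong_sets sets_pair_measure_cong)
  have g'': "g \<in> borel_measurable (distr M (path_space {0..t}) (past t) \<Otimes>\<^sub>M Q)"
    using g by (simp add: sQ cong: measurable_cong_sets sets_pair_measure_cong)
  have "(\<integral>\<^sup>+\<omega>. g (past t \<omega>, future t \<omega>) \<partial>M) = (\<integral>\<^sup>+z. g z \<partial>distr M (path_space {0..t} \<Otimes>\<^sub>M path_space {0..}) (\<lambda>\<omega>. (past t \<omega>, future t \<omega>)))"
    by (rule nn_integral_distr[symmetric, OF measurable_Pair[OF past_meas future_meas[OF t]]]) (simp add: g)
  also have "distr M (path_space {0..t} \<Otimes>\<^sub>M path_space {0..}) (\<lambda>\<omega>. (past t \<omega>, future t \<omega>))
      = distr M (path_space {0..t}) (past t) \<Otimes>\<^sub>M Q"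
    using past_future_indep[OF t] unfolding indep_var_distribution_eq future_law[OF t] Q_def by simp
  also have "(\<integral>\<^sup>+z. g z \<partial>(distr M (path_space {0..t}) (past t) \<Otimes>\<^sub>M Q)) = (\<integral>\<^sup>+x. (\<integral>\<^sup>+y. g (x, y) \<partial>Q) \<partial>distr M (path_space {0..t}) (past t))"
    by (rule P.nn_integral_fst[symmetric, OF g''])
  also have "\<dots> = (\<integral>\<^sup>+\<omega>. (\<integral>\<^sup>+y. g (past t \<omega>, y) \<partial>Q) \<partial>M)"
    by (rule nn_integral_distr[OF past_meas]) (simp add: P.borel_measurable_nn_integral_fst[OF g'])
  also have "\<dots> = (\<integral>\<^sup>+\<omega>. (\<integral>\<^sup>+\<omega>'. g (past t \<omega>, xpath \<omega>') \<partial>M) \<partial>M)"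
  proof (rule nn_integral_cong)
    fix \<omega> assume "\<omega> \<in> space M"
    then have "past t \<omega> \<in> space (path_space {0..t})" by (rule measurable_space[OF past_meas])
    then have "(\<lambda>y. g (past t \<omega>, y)) \<in> borel_measurable (path_space {0..})"
      by (rule measurable_compose[OF measurable_Pair1' g])
    then show "(\<integral>\<^sup>+y. g (past t \<omega>, y) \<partial>Q) = (\<integral>\<^sup>+\<omega>'. g (past t \<omega>, xpath \<omega>') \<partial>M)"
      unfolding Q_def by (intro nn_integral_distr[OF xpath_meas]) simp
  qed
  finally show ?thesis .
qed

end

text \<open>Countably many times that decide whether a right-continuous path keeps to a closed set
  up to time \<open>h\<close>. The endpoint is added by hand, since no later times of the interval
  approach it.\<close>

definition dense_times :: "real \<Rightarrow> real set" where "dense_times h = insert h (\<rat> \<inter> {0..h})"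

lemma countable_dense_times [simp]: "countable (dense_times h)"
  unfolding dense_times_def using countable_rat by auto

lemma dense_times_subset: "0 \<le> h \<Longrightarrow> dense_times h \<subseteq> {0..h}" by (auto simp: dense_times_def)

text \<open>If the path is outside a closed set at a time before \<open>h\<close>, right-continuity
  keeps it outside for a short while, and that while contains a rational time below
  \<open>h\<close>.\<close>

lemma ball_right_continuous_dense_times:
  fixes f :: "real \<Rightarrow> 'a::topological_space"
  assumes rc: "\<And>t. 0 \<le> t \<Longrightarrow> (f \<longlongrightarrow> f t) (at_right t)" and C: "closed C" and h: "0 \<le> h"
  shows "(\<forall>s\<in>{0..h}. f s \<in> C) \<longleftrightarrow> (\<forall>s\<in>dense_times h. f s \<in> C)"
proof
  assume D: "\<forall>s\<in>dense_times h. f s \<in> C"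
  show "\<forall>s\<in>{0..h}. f s \<in> C"
  proof
    fix s assume s: "s \<in> {0..h}"
    show "f s \<in> C"
    proof (cases "s = h")
      case True then show ?thesis using D by (auto simp: dense_times_def)
    next
      case False
      show ?thesis
      proof (rule ccontr)
        assume n: "f s \<notin> C"
        have "\<forall>\<^sub>F x in at_right s. f x \<in> - C"
          using rc[of s] s n C by (intro topological_tendstoD[of f "f s"]) auto
        then obtain b where b: "b > s" "\<And>x. s < x \<Longrightarrow> x < b \<Longrightarrow> f x \<notin> C"
          by (auto simp: eventually_at_right_field)
        obtain r where "r \<in> \<rat>" "s < r" "r < min b h"
          using Rats_dense_in_real[of s "min b h"] b False s by auto
        then show False using D b(2)[of r] s by (auto simp: dense_times_def)
      qed
    qed
  qed
qed (use dense_times_subset[OF h] in auto)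

section \<open>The natural filtration and the events of confinement to a ball\<close>

context levy_path
begin

text \<open>The natural filtration, neither completed nor made right-continuous: restarts happen at
  deterministic times only, and each event is a preimage under \<open>past t\<close>.\<close>

definition past_algebra :: "real \<Rightarrow> 'w measure" where
  "past_algebra t = vimage_algebra (space M) (past t) (path_space {0..t})"

lemma space_past_algebra [simp]: "space (past_algebra t) = space M" by (simp add: past_algebra_def)

lemma past_past_algebra: "past t \<in> measurable (past_algebra t) (path_space {0..t})"
  unfolding past_algebra_def using measurable_space[OF past_meas] by (intro measurable_vimage_algebra1) auto

lemma X_past_algebra: "0 \<le> s \<Longrightarrow> s \<le> t \<Longrightarrow> X s \<in> borel_measurable (past_algebra t)"
proof -
  assume s: "0 \<le> s" "s \<le> t"
  then have "(\<lambda>\<omega>. past t \<omega> s) \<in> borel_measurable (past_algebra t)"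
    by (intro measurable_compose[OF past_past_algebra] measurable_component_singleton) auto
  then show ?thesis using s by (simp add: past_def)
qed

lemma sets_past_algebra: "E \<in> sets (past_algebra t) \<longleftrightarrow> (\<exists>B\<in>sets (path_space {0..t}). E = past t -` B \<inter> space M)"
  unfolding past_algebra_def using measurable_space[OF past_meas]
  by (subst sets_vimage_algebra2) auto

lemma past_algebra_events: "E \<in> sets (past_algebra t) \<Longrightarrow> E \<in> events"
  using measurable_sets[OF past_meas] by (auto simp: sets_past_algebra)

lemma past_algebra_mono: "s \<le> t \<Longrightarrow> E \<in> sets (past_algebra s) \<Longrightarrow> E \<in> sets (past_algebra t)"
proof -
  assume st: "s \<le> t" and E: "E \<in> sets (past_algebra s)"
  then obtain B where B: "B \<in> sets (path_space {0..s})" "E = past s -` B \<inter> space M" by (auto simp: sets_past_algebra)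
  have "restrict (past t \<omega>) {0..s} = past s \<omega>" for \<omega> using st by (auto simp: past_def restrict_def fun_eq_iff)
  then have "(\<lambda>\<omega>. past s \<omega>) \<in> measurable (past_algebra t) (path_space {0..s})"
    using measurable_compose[OF past_past_algebra[of t] measurable_restrict_subset[of "{0..s}" "{0..t}"]] st by simp
  from measurable_sets[OF this B(1)] show ?thesis by (simp add: B(2))
qed

text \<open>The form of the Markov property used for restarts: the present position stays fixed
  while the later increments are averaged as an independent path. This is what permits bounds
  uniform in the starting point.\<close>

theorem markov_event:
  assumes t: "0 \<le> t" and E: "E \<in> sets (past_algebra t)" and h: "h \<in> borel_measurable (borel \<Otimes>\<^sub>M path_space {0..})"
  shows "(\<integral>\<^sup>+\<omega>. indicator E \<omega> * h (X t \<omega>, future t \<omega>) \<partial>M)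
    = (\<integral>\<^sup>+\<omega>. indicator E \<omega> * (\<integral>\<^sup>+\<omega>'. h (X t \<omega>, xpath \<omega>') \<partial>M) \<partial>M)"
proof -
  obtain B where B: "B \<in> sets (path_space {0..t})" "E = past t -` B \<inter> space M" using E by (auto simp: sets_past_algebra)
  define g where "g z = indicator B (fst z) * h (fst z t, snd z)" for z :: "(real \<Rightarrow> 'a) \<times> (real \<Rightarrow> 'a)"
  have [measurable]: "(\<lambda>x. x t) \<in> measurable (path_space {0..t}) (borel :: 'a measure)"
    using t by (intro measurable_component_singleton) auto
  have "(\<lambda>z. h (fst z t, snd z)) \<in> borel_measurable (path_space {0..t} \<Otimes>\<^sub>M path_space {0..})"
    by (rule measurable_compose[OF _ h]) measurable
  then have g: "g \<in> borel_measurable (path_space {0..t} \<Otimes>\<^sub>M path_space {0..})"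
    unfolding g_def using B(1) by measurable
  have p: "past t \<omega> t = X t \<omega>" for \<omega> using t by (simp add: past_def)
  have "(\<integral>\<^sup>+\<omega>. indicator E \<omega> * h (X t \<omega>, future t \<omega>) \<partial>M) = (\<integral>\<^sup>+\<omega>. g (past t \<omega>, future t \<omega>) \<partial>M)"
    by (intro nn_integral_cong) (auto simp: g_def p B(2) split: split_indicator)
  also have "\<dots> = (\<integral>\<^sup>+\<omega>. (\<integral>\<^sup>+\<omega>'. g (past t \<omega>, xpath \<omega>') \<partial>M) \<partial>M)" by (rule markov[OF t g])
  also have "\<dots> = (\<integral>\<^sup>+\<omega>. indicator E \<omega> * (\<integral>\<^sup>+\<omega>'. h (X t \<omega>, xpath \<omega>') \<partial>M) \<partial>M)"
    by (intro nn_integral_cong) (auto simp: g_def p B(2) split: split_indicator)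
  finally show ?thesis .
qed

lemma markov_prob_ge:
  assumes t: "0 \<le> t" and E: "E \<in> sets (past_algebra t)" and A: "A \<in> sets (borel \<Otimes>\<^sub>M path_space {0..})"
    and p: "\<And>\<omega>. \<omega> \<in> E \<Longrightarrow> p \<le> prob {\<omega>'\<in>space M. (X t \<omega>, xpath \<omega>') \<in> A}"
  shows "p * prob E \<le> prob {\<omega>\<in>E. (X t \<omega>, future t \<omega>) \<in> A}"
proof -
  have Es: "E \<subseteq> space M" "E \<in> events" using past_algebra_events[OF E] sets.sets_into_space by auto
  have Xt: "X t \<in> borel_measurable M" by (rule X_meas[OF t])
  have m: "(\<lambda>\<omega>. (X t \<omega>, future t \<omega>)) \<in> measurable M (borel \<Otimes>\<^sub>M path_space {0..})"
    by (rule measurable_Pair[OF Xt future_meas[OF t]])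
  have S: "{\<omega>\<in>E. (X t \<omega>, future t \<omega>) \<in> A} = E \<inter> ((\<lambda>\<omega>. (X t \<omega>, future t \<omega>)) -` A \<inter> space M)"
    using Es by auto
  have Sev: "{\<omega>\<in>E. (X t \<omega>, future t \<omega>) \<in> A} \<in> events"
    unfolding S using measurable_sets[OF m A] Es by auto
  have "ennreal p * emeasure M E = (\<integral>\<^sup>+\<omega>. ennreal p * indicator E \<omega> \<partial>M)"
    using Es by (simp add: nn_integral_cmult_indicator)
  also have "\<dots> \<le> (\<integral>\<^sup>+\<omega>. indicator E \<omega> * (\<integral>\<^sup>+\<omega>'. indicator A (X t \<omega>, xpath \<omega>') \<partial>M) \<partial>M)"
  proof (rule nn_integral_mono)
    fix \<omega> assume w: "\<omega> \<in> space M"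
    have m': "(\<lambda>\<omega>'. (X t \<omega>, xpath \<omega>')) \<in> measurable M (borel \<Otimes>\<^sub>M path_space {0..})"
      by (intro measurable_Pair xpath_meas) auto
    have "(\<integral>\<^sup>+\<omega>'. indicator A (X t \<omega>, xpath \<omega>') \<partial>M) = emeasure M {\<omega>'\<in>space M. (X t \<omega>, xpath \<omega>') \<in> A}"
    proof -
      have "{\<omega>'\<in>space M. (X t \<omega>, xpath \<omega>') \<in> A} \<in> events"
        using measurable_sets[OF m' A] by (simp add: vimage_def Int_def conj_commute)
      from nn_integral_indicator[OF this, symmetric] show ?thesis
        by (simp only:) (rule nn_integral_cong, simp split: split_indicator)
    qed
    also have "\<dots> = ennreal (prob {\<omega>'\<in>space M. (X t \<omega>, xpath \<omega>') \<in> A})"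
      by (rule emeasure_eq_measure)
    finally show "ennreal p * indicator E \<omega> \<le> indicator E \<omega> * (\<integral>\<^sup>+\<omega>'. indicator A (X t \<omega>, xpath \<omega>') \<partial>M)"
      using p[of \<omega>] by (auto split: split_indicator intro: ennreal_leI)
  qed
  also have "\<dots> = (\<integral>\<^sup>+\<omega>. indicator E \<omega> * indicator A (X t \<omega>, future t \<omega>) \<partial>M)"
    using A by (intro markov_event[OF t E, symmetric]) auto
  also have "\<dots> = (\<integral>\<^sup>+\<omega>. indicator {\<omega>\<in>E. (X t \<omega>, future t \<omega>) \<in> A} \<omega> \<partial>M)"
    by (intro nn_integral_cong) (auto split: split_indicator)
  also have "\<dots> = emeasure M {\<omega>\<in>E. (X t \<omega>, future t \<omega>) \<in> A}"
    using Sev by simp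
  finally have fin: "ennreal p * emeasure M E \<le> emeasure M {\<omega>\<in>E. (X t \<omega>, future t \<omega>) \<in> A}" .
  show ?thesis
  proof (cases "p \<ge> 0")
    case True
    then show ?thesis using fin by (simp add: emeasure_eq_measure ennreal_mult[symmetric])
  next
    case False
    then have "p * prob E \<le> 0" by (intro mult_nonpos_nonneg) auto
    then show ?thesis using measure_nonneg[of M] by (rule order_trans)
  qed
qed

lemma markov_indep:
  assumes t: "0 \<le> t" and E: "E \<in> sets (past_algebra t)" and A: "A \<in> sets (path_space {0..})"
  shows "prob {\<omega>\<in>E. future t \<omega> \<in> A} = prob E * prob {\<omega>\<in>space M. xpath \<omega> \<in> A}"
proof -
  obtain B where B: "B \<in> sets (path_space {0..t})" "E = past t -` B \<inter> space M" using E by (auto simp: sets_past_algebra)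
  have eq: "(\<lambda>\<omega>. (past t \<omega>, future t \<omega>)) -` (B \<times> A) \<inter> space M = {\<omega>\<in>E. future t \<omega> \<in> A}"
    by (auto simp: B(2))
  have "prob (future t -` A \<inter> space M) = measure (distr M (path_space {0..}) (future t)) A"
    using A future_meas[OF t] by (simp add: measure_distr)
  also have "\<dots> = prob (xpath -` A \<inter> space M)"
    unfolding future_law[OF t] using A by (simp add: measure_distr)
  finally show ?thesis
    using indep_varD[OF past_future_indep[OF t] B(1) A] unfolding eq
    by (simp add: B(2) vimage_def Int_def conj_commute)
qed

definition stay :: "real \<Rightarrow> real \<Rightarrow> 'w set" where
  "stay h a = {\<omega>\<in>space M. \<forall>s\<in>{0..h}. norm (X s \<omega>) \<le> a}"

definition fstay :: "real \<Rightarrow> real \<Rightarrow> real \<Rightarrow> 'w set" where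
  "fstay t h a = {\<omega>\<in>space M. \<forall>u\<in>{0..h}. norm (X (t + u) \<omega> - X t \<omega>) \<le> a}"

text \<open>Testing only the times in \<open>dense_times\<close> makes the set measurable in the
  product space; for right-continuous paths it amounts to confinement at all times up to
  \<open>h\<close>.\<close>

definition stay_paths :: "real \<Rightarrow> real \<Rightarrow> (real \<Rightarrow> 'a) set" where
  "stay_paths h a = {w\<in>space (path_space {0..}). \<forall>s\<in>dense_times h. norm (w s) \<le> a}"

lemma stay_paths_sets: "0 \<le> h \<Longrightarrow> stay_paths h a \<in> sets (path_space {0..})"
proof -
  assume h: "0 \<le> h"
  have "{w\<in>space (path_space {0..}). norm (w s) \<le> a} \<in> sets (path_space {0..})" if "s \<in> dense_times h" for s
  proof -
    have "(\<lambda>w. w s) \<in> borel_measurable (path_space {0..})"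
      using dense_times_subset[OF h] that by (intro measurable_component_singleton) auto
    then show ?thesis by measurable
  qed
  then show ?thesis unfolding stay_paths_def
    by (intro sets.sets_Collect_countable_All' countable_dense_times) auto
qed

lemma rc_shift:
  assumes w: "\<omega> \<in> space M" and t: "0 \<le> t" and u: "0 \<le> u"
  shows "((\<lambda>u. X (t + u) \<omega> - X t \<omega>) \<longlongrightarrow> X (t + u) \<omega> - X t \<omega>) (at_right u)"
proof -
  have "((\<lambda>s. X s \<omega>) \<longlongrightarrow> X (t + u) \<omega>) (at_right (t + u))" using X_rc[OF w] t u by simp
  then have "((\<lambda>s. X (t + s) \<omega>) \<longlongrightarrow> X (t + u) \<omega>) (at_right u)"
    unfolding at_right_to_0[of "t+u"] at_right_to_0[of u] filterlim_filtermap by (simp add: ac_simps)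
  then show ?thesis by (intro tendsto_diff tendsto_const)
qed

lemma fstay_future: "0 \<le> t \<Longrightarrow> 0 \<le> h \<Longrightarrow> fstay t h a = {\<omega>\<in>space M. future t \<omega> \<in> stay_paths h a}"
proof -
  assume t: "0 \<le> t" and h: "0 \<le> h"
  have "(\<forall>u\<in>{0..h}. norm (X (t + u) \<omega> - X t \<omega>) \<le> a) \<longleftrightarrow> future t \<omega> \<in> stay_paths h a" if w: "\<omega> \<in> space M" for \<omega>
  proof -
    have "(\<forall>u\<in>{0..h}. X (t + u) \<omega> - X t \<omega> \<in> cball 0 a) \<longleftrightarrow> (\<forall>u\<in>dense_times h. X (t + u) \<omega> - X t \<omega> \<in> cball 0 a)"
      using rc_shift[OF w t] h by (intro ball_right_continuous_dense_times) auto
    then show ?thesis using measurable_space[OF future_meas[OF t] w] dense_times_subset[OF h]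
      by (auto simp: stay_paths_def future_def subset_eq)
  qed
  then show ?thesis by (auto simp: fstay_def)
qed

lemma stay_eq_fstay: "stay h a = fstay 0 h a"
  by (auto simp: stay_def fstay_def X_zero)

lemma future_0: "\<omega> \<in> space M \<Longrightarrow> future 0 \<omega> = xpath \<omega>"
  by (auto simp: future_def xpath_def X_zero)

lemma stay_path: "0 \<le> h \<Longrightarrow> stay h a = {\<omega>\<in>space M. xpath \<omega> \<in> stay_paths h a}"
  unfolding stay_eq_fstay by (subst fstay_future) (auto simp: future_0)

lemma stay_past_algebra: "0 \<le> h \<Longrightarrow> h \<le> t \<Longrightarrow> stay h a \<in> sets (past_algebra t)"
proof -
  assume h: "0 \<le> h" "h \<le> t"
  have "stay h a = {\<omega>\<in>space M. \<forall>u\<in>dense_times h. norm (X u \<omega>) \<le> a}"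
    using ball_right_continuous_dense_times[of "\<lambda>s. X s _" "cball 0 a" h] X_rc h by (auto simp: stay_def)
  also have "\<dots> \<in> sets (past_algebra t)"
  proof -
    have "{\<omega>\<in>space (past_algebra t). norm (X u \<omega>) \<le> a} \<in> sets (past_algebra t)" if "u \<in> dense_times h" for u
    proof -
      have "X u \<in> borel_measurable (past_algebra t)" using dense_times_subset[OF h(1)] that h by (intro X_past_algebra) auto
      then show ?thesis by measurable
    qed
    then have "{\<omega>\<in>space (past_algebra t). \<forall>u\<in>dense_times h. norm (X u \<omega>) \<le> a} \<in> sets (past_algebra t)"
      by (intro sets.sets_Collect_countable_All' countable_dense_times) auto
    then show ?thesis by simp
  qed
  finally show ?thesis .
qed

lemma fstay_past_algebra: "0 \<le> s \<Longrightarrow> 0 \<le> h \<Longrightarrow> s + h \<le> t \<Longrightarrow> fstay s h a \<in> sets (past_algebra t)"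
proof -
  assume h: "0 \<le> s" "0 \<le> h" "s + h \<le> t"
  have "(\<forall>u\<in>{0..h}. norm (X (s + u) \<omega> - X s \<omega>) \<le> a) \<longleftrightarrow> (\<forall>u\<in>dense_times h. norm (X (s + u) \<omega> - X s \<omega>) \<le> a)"
    if "\<omega> \<in> space M" for \<omega>
    using ball_right_continuous_dense_times[of "\<lambda>u. X (s + u) \<omega> - X s \<omega>" "cball 0 a" h] rc_shift[OF that h(1)] h by auto
  then have "fstay s h a = {\<omega>\<in>space (past_algebra t). \<forall>u\<in>dense_times h. norm (X (s + u) \<omega> - X s \<omega>) \<le> a}"
    by (auto simp: fstay_def)
  also have "\<dots> \<in> sets (past_algebra t)"
  proof -
    have "{\<omega>\<in>space (past_algebra t). norm (X (s + u) \<omega> - X s \<omega>) \<le> a} \<in> sets (past_algebra t)" if "u \<in> dense_times h" for u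
    proof -
      have "X (s + u) \<in> borel_measurable (past_algebra t)" "X s \<in> borel_measurable (past_algebra t)"
        using dense_times_subset[OF h(2)] that h by (auto intro!: X_past_algebra)
      then show ?thesis by measurable
    qed
    then show ?thesis
      by (intro sets.sets_Collect_countable_All' countable_dense_times) auto
  qed
  finally show ?thesis .
qed

lemma prob_fstay: "0 \<le> t \<Longrightarrow> 0 \<le> h \<Longrightarrow> prob (fstay t h a) = prob (stay h a)"
  using markov_indep[of t "space M", OF _ _ stay_paths_sets[of h a]] sets.top[of "past_algebra t"]
  by (simp add: fstay_future stay_path prob_space)

lemma prob_indep_fstay:
  "0 \<le> t \<Longrightarrow> 0 \<le> h \<Longrightarrow> E \<in> sets (past_algebra t) \<Longrightarrow> prob (E \<inter> fstay t h a) = prob E * prob (stay h a)"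
proof -
  assume a: "0 \<le> t" "0 \<le> h" "E \<in> sets (past_algebra t)"
  have "E \<inter> fstay t h a = {\<omega>\<in>E. future t \<omega> \<in> stay_paths h a}"
    using past_algebra_events[OF a(3)] sets.sets_into_space[of E M] a by (auto simp: fstay_future)
  then show ?thesis
    using markov_indep[OF a(1,3) stay_paths_sets[OF a(2)]] by (simp add: stay_path[OF a(2)])
qed

end

section \<open>Exits and small ball probabilities\<close>

lemma exp_minus_1_less_half: "exp (- 1) < (1 / 2 :: real)"
proof -
  have "1 + 1 + 1\<^sup>2 / 2 \<le> exp (1::real)" by (rule exp_lower_Taylor_quadratic[OF zero_le_one])
  then have "2 < exp (1::real)" by (subst (asm) power_one) linarith
  then have "inverse (exp 1) < inverse (2::real)" by (rule less_imp_inverse_less) linarith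
  then show ?thesis unfolding exp_minus inverse_eq_divide .
qed

text \<open>
  Three ways of counting large displacements. For a path on a grid, \<open>exits\<close> counts successive first exits
  from balls and is controlled by the Markov property; \<open>grid_chain\<close> asks only for large jumps along some
  increasing sequence. The latter passes to the limit of refining grids, which gives \<open>chain\<close>.
\<close>

fun exits :: "nat \<Rightarrow> real \<Rightarrow> nat \<Rightarrow> (nat \<Rightarrow> 'a::real_normed_vector) \<Rightarrow> nat \<Rightarrow> bool" where
  "exits m b 0 w i \<longleftrightarrow> True"
| "exits m b (Suc k) w i \<longleftrightarrow>
     (\<exists>j\<in>{i<..m}. (\<forall>l\<in>{i..<j}. norm (w l - w i) \<le> b) \<and> b < norm (w j - w i) \<and> exits m b k w j)"

fun grid_chain :: "nat \<Rightarrow> real \<Rightarrow> nat \<Rightarrow> (nat \<Rightarrow> 'a::real_normed_vector) \<Rightarrow> nat \<Rightarrow> bool" where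
  "grid_chain m b 0 w i \<longleftrightarrow> True"
| "grid_chain m b (Suc k) w i \<longleftrightarrow> (\<exists>j\<in>{i<..m}. b < norm (w j - w i) \<and> grid_chain m b k w j)"

fun chain :: "(real \<Rightarrow> 'a::real_normed_vector) \<Rightarrow> real \<Rightarrow> real \<Rightarrow> nat \<Rightarrow> real \<Rightarrow> bool" where
  "chain f h b 0 u \<longleftrightarrow> True"
| "chain f h b (Suc k) u \<longleftrightarrow> (\<exists>v\<in>{u<..h}. b < norm (f v - f u) \<and> chain f h b k v)"

text \<open>Two points in a ball of radius \<open>b\<close> are at most \<open>2 * b\<close> apart,
  so a jump larger than that forces an exit from the ball about \<open>w i\<close> by time
  \<open>j'\<close>. The exit may come before \<open>j'\<close>, where the rest of the chain starts;
  hence the induction allows the exits to start earlier than the chain.\<close>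

lemma grid_chain_imp_exits:
  "0 \<le> b \<Longrightarrow> i \<le> j \<Longrightarrow> grid_chain m (2 * b) k w j \<Longrightarrow> exits m b k w i"
proof (induction k arbitrary: i j)
  case (Suc k)
  obtain j' where j': "j < j'" "j' \<le> m" "2 * b < norm (w j' - w j)" "grid_chain m (2 * b) k w j'"
    using Suc.prems(3) by auto
  have ex: "\<exists>l. i \<le> l \<and> l \<le> j' \<and> b < norm (w l - w i)"
  proof (rule ccontr)
    assume "\<not> ?thesis"
    then have "norm (w j' - w i) \<le> b" "norm (w j - w i) \<le> b" using Suc.prems(2) j' by (auto simp: not_less)
    then have "norm ((w j' - w i) - (w j - w i)) \<le> b + b" by (rule norm_triangle_le_diff[OF add_mono])
    then show False using j' by simp
  qed
  define e where "e = (LEAST l. i \<le> l \<and> l \<le> j' \<and> b < norm (w l - w i))"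
  have e: "i \<le> e \<and> e \<le> j' \<and> b < norm (w e - w i)" unfolding e_def by (rule LeastI_ex[OF ex])
  have b: "norm (w l - w i) \<le> b" if "i \<le> l" "l < e" for l
    using not_less_Least[of l "\<lambda>l. i \<le> l \<and> l \<le> j' \<and> b < norm (w l - w i)"] that e by (force simp: e_def[symmetric])
  have "e \<noteq> i" using e Suc.prems(1) by auto
  then show ?case using e b Suc.IH[of e j'] Suc.prems(1) j' by (auto intro!: bexI[of _ e])
qed simp

text \<open>Rounding goes up, so that the grid points approach \<open>v\<close> from the right,
  where the path is continuous.\<close>

definition grid_index :: "real \<Rightarrow> nat \<Rightarrow> real \<Rightarrow> nat" where
  "grid_index h n v = nat \<lceil>v * 2 ^ n / h\<rceil>"

lemma grid_index_bounds:
  assumes "0 < h" "0 \<le> v"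
  shows "v \<le> h * real (grid_index h n v) / 2 ^ n" "h * real (grid_index h n v) / 2 ^ n < v + h / 2 ^ n"
proof -
  have c: "real (grid_index h n v) = of_int \<lceil>v * 2 ^ n / h\<rceil>" using assms by (simp add: grid_index_def)
  have "v * 2 ^ n / h \<le> real (grid_index h n v)" "real (grid_index h n v) < v * 2 ^ n / h + 1"
    unfolding c by linarith+
  then show "v \<le> h * real (grid_index h n v) / 2 ^ n" "h * real (grid_index h n v) / 2 ^ n < v + h / 2 ^ n"
    using assms by (auto simp: field_simps)
qed

lemma grid_index_le: "0 < h \<Longrightarrow> v \<le> h \<Longrightarrow> grid_index h n v \<le> 2 ^ n"
proof -
  assume "0 < h" "v \<le> h"
  then have "v * 2 ^ n / h \<le> of_int (2 ^ n)" by (simp add: field_simps)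
  then have "\<lceil>v * 2 ^ n / h\<rceil> \<le> 2 ^ n" by (simp only: ceiling_le_iff)
  then show ?thesis by (simp add: grid_index_def nat_le_iff)
qed

lemma tendsto_grid_index:
  fixes f :: "real \<Rightarrow> 'a::real_normed_vector"
  assumes h: "0 < h" and v: "0 \<le> v" and rc: "(f \<longlongrightarrow> f v) (at_right v)"
  shows "(\<lambda>n. f (h * real (grid_index h n v) / 2 ^ n)) \<longlonglongrightarrow> f v"
proof (rule tendstoI)
  fix e :: real assume "0 < e"
  then obtain d where d: "d > v" "\<And>y. v < y \<Longrightarrow> y < d \<Longrightarrow> dist (f y) (f v) < e"
    using tendstoD[OF rc \<open>0 < e\<close>] by (auto simp: eventually_at_right_field)
  have "(\<lambda>n. h / 2 ^ n) \<longlonglongrightarrow> 0" by real_asymp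
  then have "\<forall>\<^sub>F n in sequentially. h / 2 ^ n < d - v" using d(1) by (intro order_tendstoD(2)) auto
  then show "\<forall>\<^sub>F n in sequentially. dist (f (h * real (grid_index h n v) / 2 ^ n)) (f v) < e"
  proof eventually_elim
    case (elim n)
    then show ?case using grid_index_bounds[OF h v, of n] d(2)[of "h * real (grid_index h n v) / 2 ^ n"] \<open>0 < e\<close>
      by (cases "h * real (grid_index h n v) / 2 ^ n = v") auto
  qed
qed

text \<open>A chain consists of finitely many strict inequalities. Rounding its times up to a fine
  grid changes the values little by right-continuity and eventually keeps distinct times distinct,
  so the inequalities survive.\<close>

lemma chain_imp_grid_chain:
  fixes f :: "real \<Rightarrow> 'a::real_normed_vector"
  assumes h: "0 < h" and rc: "\<And>t. 0 \<le> t \<Longrightarrow> (f \<longlongrightarrow> f t) (at_right t)"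
  shows "0 \<le> u \<Longrightarrow> chain f h b k u \<Longrightarrow>
    \<forall>\<^sub>F n in sequentially. grid_chain (2 ^ n) b k (\<lambda>l. f (h * real l / 2 ^ n)) (grid_index h n u)"
proof (induction k arbitrary: u)
  case (Suc k)
  then obtain v where v: "u < v" "v \<le> h" "b < norm (f v - f u)" "chain f h b k v" by auto
  have v0: "0 \<le> v" using v Suc.prems by simp
  have IH: "\<forall>\<^sub>F n in sequentially. grid_chain (2 ^ n) b k (\<lambda>l. f (h * real l / 2 ^ n)) (grid_index h n v)"
    by (rule Suc.IH[OF v0 v(4)])
  have "(\<lambda>n. norm (f (h * real (grid_index h n v) / 2 ^ n) - f (h * real (grid_index h n u) / 2 ^ n))) \<longlonglongrightarrow> norm (f v - f u)"
    by (intro tendsto_norm tendsto_diff tendsto_grid_index[OF h] rc v0 Suc.prems)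
  then have n: "\<forall>\<^sub>F n in sequentially. b < norm (f (h * real (grid_index h n v) / 2 ^ n) - f (h * real (grid_index h n u) / 2 ^ n))"
    using v(3) by (rule order_tendstoD(1))
  have "(\<lambda>n. h / 2 ^ n) \<longlonglongrightarrow> 0" by real_asymp
  then have "\<forall>\<^sub>F n in sequentially. h / 2 ^ n < v - u" using v(1) by (intro order_tendstoD(2)) auto
  with IH n show ?case
  proof eventually_elim
    case (elim n)
    have "h * real (grid_index h n u) / 2 ^ n < h * real (grid_index h n v) / 2 ^ n"
      using grid_index_bounds(2)[OF h Suc.prems(1), of n] grid_index_bounds(1)[OF h v0, of n] elim(3) by linarith
    then have "grid_index h n u < grid_index h n v" using h by (simp add: divide_strict_right_mono field_simps)
    then show ?case using elim(1,2) grid_index_le[OF h v(2), of n] by auto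
  qed
qed simp

text \<open>Let \<open>s1\<close> be the infimum of the times at which the path is farther than
  \<open>b\<close> from \<open>f u\<close>. Before \<open>s1\<close> the ball about
  \<open>f u\<close> suffices; from \<open>s1\<close> up to some such time \<open>v\<close> the ball
  about \<open>f s1\<close> does, by right-continuity; from \<open>v\<close> on there is no chain
  with \<open>k\<close> jumps. Each step costs two balls.\<close>

lemma not_chain_cover:
  fixes f :: "real \<Rightarrow> 'a::real_normed_vector"
  assumes b: "0 < b" and rc: "\<And>t. 0 \<le> t \<Longrightarrow> (f \<longlongrightarrow> f t) (at_right t)"
  shows "0 \<le> u \<Longrightarrow> u \<le> h \<Longrightarrow> \<not> chain f h b k u \<Longrightarrow>
    \<exists>Z. finite Z \<and> card Z \<le> 2 * k \<and> f ` {u..h} \<subseteq> (\<Union>z\<in>Z. cball z b)"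
proof (induction k arbitrary: u)
  case (Suc k)
  define S where "S = {v\<in>{u<..h}. b < norm (f v - f u)}"
  show ?case
  proof (cases "S = {}")
    case True
    then have "f s \<in> cball (f u) b" if "s \<in> {u..h}" for s
      using that b by (cases "s = u") (auto simp: S_def dist_norm norm_minus_commute)
    then show ?thesis by (intro exI[of _ "{f u}"]) auto
  next
    case False
    define s1 where "s1 = Inf S"
    have bdd: "bdd_below S" by (rule bdd_belowI[of _ u]) (auto simp: S_def)
    have us1: "u \<le> s1" unfolding s1_def using False by (intro cInf_greatest) (auto simp: S_def)
    then have s10: "0 \<le> s1" using Suc.prems by simp
    obtain d where d: "d > s1" "\<And>y. s1 < y \<Longrightarrow> y < d \<Longrightarrow> dist (f y) (f s1) < b"
      using tendstoD[OF rc[OF s10] b] by (auto simp: eventually_at_right_field)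
    obtain v where v: "v \<in> S" "v < d" using cInf_lessD[OF False, of d] d(1) by (auto simp: s1_def)
    have vs1: "s1 \<le> v" unfolding s1_def using v(1) bdd by (rule cInf_lower)
    have "\<not> chain f h b k v" using Suc.prems(3) v(1) by (auto simp: S_def)
    then obtain Z where Z: "finite Z" "card Z \<le> 2 * k" "f ` {v..h} \<subseteq> (\<Union>z\<in>Z. cball z b)"
      using Suc.IH[of v] v(1) Suc.prems by (auto simp: S_def)
    have "f s \<in> (\<Union>z\<in>insert (f u) (insert (f s1) Z). cball z b)" if s: "s \<in> {u..h}" for s
    proof -
      consider "s < s1" | "s1 \<le> s" "s \<le> v" | "v \<le> s" by linarith
      then show ?thesis
      proof cases
        case 1
        then have "s \<notin> S" using cInf_lower[OF _ bdd, of s] by (auto simp: s1_def)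
        then have "f s \<in> cball (f u) b"
          using s b by (cases "s = u") (auto simp: S_def dist_norm norm_minus_commute)
        then show ?thesis by auto
      next
        case 2
        then have "f s \<in> cball (f s1) b"
          using d(2)[of s] v(2) b by (cases "s = s1") (auto simp: dist_commute less_imp_le)
        then show ?thesis by auto
      next
        case 3
        then have "f s \<in> f ` {v..h}" using s by auto
        then show ?thesis using Z(3) by auto
      qed
    qed
    moreover have "card (insert (f u) (insert (f s1) Z)) \<le> 2 * Suc k"
      using Z(1,2) by (auto simp: card_insert_if)
    ultimately show ?thesis using Z(1) by (intro exI[of _ "insert (f u) (insert (f s1) Z)"] conjI) blast+
  qed
qed simp

lemma exits_cong:
  "(\<And>l. i \<le> l \<Longrightarrow> l \<le> m \<Longrightarrow> w' l = w l - z) \<Longrightarrow> i \<le> m \<Longrightarrow> exits m b k w' i = exits m b k w i"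
proof (induction k arbitrary: i)
  case (Suc k)
  have "(\<forall>l\<in>{i..<j}. norm (w' l - w' i) \<le> b) \<and> b < norm (w' j - w' i) \<and> exits m b k w' j \<longleftrightarrow>
    (\<forall>l\<in>{i..<j}. norm (w l - w i) \<le> b) \<and> b < norm (w j - w i) \<and> exits m b k w j" if "j \<in> {i<..m}" for j
  proof -
    have "exits m b k w' j = exits m b k w j" using that Suc.prems by (intro Suc.IH) auto
    then show ?thesis using that Suc.prems by (auto simp: Ball_def)
  qed
  then show ?case by auto
qed simp

section \<open>Independent blocks of time and probabilities of confinement\<close>

context levy_path
begin

text \<open>One-sided limits make the path bounded near each time, and bisection of the interval
  passes from local to global.\<close>

lemma path_bounded:
  assumes w: "\<omega> \<in> space M" and h: "0 \<le> h"
  shows "\<exists>B. \<forall>s\<in>{0..h}. norm (X s \<omega>) \<le> B"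
proof -
  \<comment> \<open>The cutoff at 0 lets the small intervals around the time 0 extend to its left,
    where the path is not controlled.\<close>
  let ?P = "\<lambda>a b. \<exists>B. \<forall>s\<in>{max 0 a..b}. norm (X s \<omega>) \<le> B"
  have "?P 0 h"
  proof (rule Bolzano[OF h, of ?P])
    fix a b c assume "?P a b" "?P b c" "a \<le> b" "b \<le> c"
    then obtain B1 B2 where B: "\<forall>s\<in>{max 0 a..b}. norm (X s \<omega>) \<le> B1" "\<forall>s\<in>{max 0 b..c}. norm (X s \<omega>) \<le> B2" by auto
    have "norm (X s \<omega>) \<le> max B1 B2" if "s \<in> {max 0 a..c}" for s
      using B that by (cases "s \<le> b") (auto simp: le_max_iff_disj)
    then show "?P a c" by blast
  next
    fix x assume x: "0 \<le> x" "x \<le> h"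
    obtain d1 where d1: "d1 > x" "\<And>y. x < y \<Longrightarrow> y < d1 \<Longrightarrow> dist (X y \<omega>) (X x \<omega>) < 1"
      using tendstoD[OF X_rc[OF w x(1)], of 1] by (auto simp: eventually_at_right_field)
    obtain d2 B2 where d2: "d2 < x" "\<And>y. 0 \<le> y \<Longrightarrow> d2 < y \<Longrightarrow> y < x \<Longrightarrow> norm (X y \<omega>) \<le> B2"
    proof (cases "x = 0")
      case True then show ?thesis by (intro that[of "-1" 0]) auto
    next
      case False
      then obtain l where "((\<lambda>s. X s \<omega>) \<longlongrightarrow> l) (at_left x)" using X_ll[OF w, of x] x by auto
      from tendstoD[OF this, of 1] obtain b where b: "b < x" "\<And>y. b < y \<Longrightarrow> y < x \<Longrightarrow> dist (X y \<omega>) l < 1"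
        by (auto simp: eventually_at_left_field)
      show ?thesis
      proof (rule that[of b "norm l + 1"])
        fix y assume "b < y" "y < x"
        then have "norm (X y \<omega> - l) < 1" using b(2) by (simp add: dist_norm)
        then show "norm (X y \<omega>) \<le> norm l + 1" using norm_triangle_ineq2[of "X y \<omega>" l] by linarith
      qed fact
    qed
    define B where "B = max B2 (norm (X x \<omega>) + 1)"
    have "norm (X y \<omega>) \<le> B" if "0 \<le> y" "d2 < y" "y < d1" for y
    proof -
      consider "y < x" | "y = x" | "x < y" by linarith
      then show ?thesis
      proof cases
        case 3
        then have "norm (X y \<omega> - X x \<omega>) < 1" using d1(2) that by (simp add: dist_norm)
        then show ?thesis using norm_triangle_ineq2[of "X y \<omega>" "X x \<omega>"] by (auto simp: B_def)
      qed (use d2(2) that in \<open>auto simp: B_def le_max_iff_disj\<close>)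
    qed
    then have "\<forall>a b. a \<le> x \<and> x \<le> b \<and> b - a < min (d1 - x) (x - d2) \<longrightarrow> ?P a b"
      by (intro allI impI exI[of _ B]) auto
    then show "\<exists>d>0. \<forall>a b. a \<le> x \<and> x \<le> b \<and> b - a < d \<longrightarrow> ?P a b"
      using d1(1) d2(1) by (intro exI[of _ "min (d1 - x) (x - d2)"]) auto
  qed
  then show ?thesis by auto
qed

lemma stay_events: "0 \<le> h \<Longrightarrow> stay h a \<in> events"
  using stay_past_algebra[of h h a] past_algebra_events by auto

lemma fstay_events: "0 \<le> t \<Longrightarrow> 0 \<le> h \<Longrightarrow> fstay t h a \<in> events"
  using fstay_past_algebra[of t h "t + h" a] past_algebra_events by auto

lemma fstay_D: "\<omega> \<in> fstay t h a \<Longrightarrow> 0 \<le> u \<Longrightarrow> u \<le> h \<Longrightarrow> norm (X (t + u) \<omega> - X t \<omega>) \<le> a"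
  by (auto simp: fstay_def)

lemma stay_D: "\<omega> \<in> stay h a \<Longrightarrow> 0 \<le> u \<Longrightarrow> u \<le> h \<Longrightarrow> norm (X u \<omega>) \<le> a"
  by (auto simp: stay_def)

lemma stay_mono: "h' \<le> h \<Longrightarrow> a \<le> a' \<Longrightarrow> stay h a \<subseteq> stay h' a'"
  by (auto simp: stay_def intro: order_trans)

lemma prob_stay_mono: "0 \<le> h' \<Longrightarrow> h' \<le> h \<Longrightarrow> a \<le> a' \<Longrightarrow> prob (stay h a) \<le> prob (stay h' a')"
  by (intro finite_measure_mono stay_mono stay_events)

lemma prob_stay_limit:
  assumes h: "0 \<le> h" and e: "0 < e"
  shows "\<exists>a>0. 1 - e \<le> prob (stay h a)"
proof -
  have "(\<Union>n. stay h (real n)) = space M"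
  proof
    show "space M \<subseteq> (\<Union>n. stay h (real n))"
    proof
      fix \<omega> assume w: "\<omega> \<in> space M"
      obtain B where "\<forall>s\<in>{0..h}. norm (X s \<omega>) \<le> B" using path_bounded[OF w h] by auto
      moreover obtain n where "B \<le> real n" using real_arch_simple by auto
      ultimately have "\<omega> \<in> stay h (real n)" using w by (fastforce simp: stay_def)
      then show "\<omega> \<in> (\<Union>n. stay h (real n))" by auto
    qed
  qed (auto simp: stay_def)
  moreover have "(\<lambda>n. prob (stay h (real n))) \<longlonglongrightarrow> prob (\<Union>n. stay h (real n))"
  proof (intro finite_Lim_measure_incseq)
    show "incseq (\<lambda>n. stay h (real n))" unfolding incseq_def by (intro allI impI stay_mono) auto
  qed (use h in \<open>auto intro: stay_events\<close>)
  ultimately have "(\<lambda>n. prob (stay h (real n))) \<longlonglongrightarrow> 1" by (simp add: prob_space)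
  then have "\<forall>\<^sub>F n in sequentially. 1 - e < prob (stay h (real n))"
    using e by (intro order_tendstoD(1)) auto
  then obtain N where "1 - e < prob (stay h (real n))" if "n \<ge> N" for n by (auto simp: eventually_sequentially)
  from this[of "Suc N"] show ?thesis by (intro exI[of _ "real (Suc N)"]) auto
qed

text \<open>Moving by at most \<open>b\<close> within each of \<open>m\<close> blocks of length
  \<open>d\<close> keeps the path within \<open>m * b\<close> of the origin, and the blocks are
  independent.\<close>

lemma prob_stay_mult:
  assumes d: "0 \<le> d" and b: "0 \<le> b"
  shows "prob (stay d b) ^ m \<le> prob (stay (real m * d) (real m * b))"
proof (induction m)
  case 0
  have "stay 0 0 = space M" by (auto simp: stay_def X_zero)
  then show ?case by (simp add: prob_space)
next
  case (Suc m)
  have "prob (stay d b) ^ Suc m \<le> prob (stay (real m * d) (real m * b)) * prob (stay d b)"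
    unfolding power_Suc2 by (rule mult_right_mono[OF Suc.IH]) simp
  also have "\<dots> = prob (stay (real m * d) (real m * b) \<inter> fstay (real m * d) d b)"
    using d by (intro prob_indep_fstay[symmetric] stay_past_algebra) auto
  also have "\<dots> \<le> prob (stay (real (Suc m) * d) (real (Suc m) * b))"
  proof (rule finite_measure_mono)
    show "stay (real m * d) (real m * b) \<inter> fstay (real m * d) d b \<subseteq> stay (real (Suc m) * d) (real (Suc m) * b)"
    proof
      fix \<omega> assume w: "\<omega> \<in> stay (real m * d) (real m * b) \<inter> fstay (real m * d) d b"
      have "norm (X s \<omega>) \<le> real (Suc m) * b" if s: "s \<in> {0..real (Suc m) * d}" for s
      proof (cases "s \<le> real m * d")
        case True
        then have "norm (X s \<omega>) \<le> real m * b" using w s by (auto simp: stay_def)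
        then show ?thesis using b by (simp add: algebra_simps)
      next
        case False
        then have "norm (X (real m * d + (s - real m * d)) \<omega> - X (real m * d) \<omega>) \<le> b"
          using w s by (intro fstay_D) (auto simp: algebra_simps)
        moreover have "norm (X (real m * d) \<omega>) \<le> real m * b" using w d by (auto simp: stay_def)
        ultimately show ?thesis using norm_triangle_ineq2[of "X s \<omega>" "X (real m * d) \<omega>"] by (simp add: algebra_simps)
      qed
      then show "\<omega> \<in> stay (real (Suc m) * d) (real (Suc m) * b)" using w by (auto simp: stay_def)
    qed
  qed (use d in \<open>auto intro!: stay_events\<close>)
  finally show ?case .
qed

definition fstay_blocks :: "nat \<Rightarrow> real \<Rightarrow> real \<Rightarrow> 'w set" where
  "fstay_blocks m d b = {\<omega>\<in>space M. \<forall>i<m. \<omega> \<in> fstay (real i * d) d b}"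

lemma fstay_blocks_Suc: "fstay_blocks (Suc m) d b = fstay_blocks m d b \<inter> fstay (real m * d) d b"
  by (auto simp: fstay_blocks_def less_Suc_eq)

lemma fstay_blocks_past_algebra:
  assumes d: "0 \<le> d"
  shows "fstay_blocks m d b \<in> sets (past_algebra (real m * d))"
proof (induction m)
  case 0
  show ?case using sets.top[of "past_algebra 0"] by (simp add: fstay_blocks_def)
next
  case (Suc m)
  have le: "real m * d \<le> real (Suc m) * d" using d by (intro mult_right_mono) simp_all
  have "fstay (real m * d) d b \<in> sets (past_algebra (real (Suc m) * d))"
    by (rule fstay_past_algebra) (use d in \<open>simp_all add: algebra_simps\<close>)
  then show ?case unfolding fstay_blocks_Suc by (intro sets.Int past_algebra_mono[OF le Suc.IH])
qed

lemma prob_fstay_blocks: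
  assumes d: "0 \<le> d"
  shows "prob (fstay_blocks m d b) = prob (stay d b) ^ m"
proof (induction m)
  case 0
  show ?case by (simp add: fstay_blocks_def prob_space)
next
  case (Suc m)
  have "prob (fstay_blocks m d b \<inter> fstay (real m * d) d b) = prob (fstay_blocks m d b) * prob (stay d b)"
    using d by (intro prob_indep_fstay fstay_blocks_past_algebra mult_nonneg_nonneg) simp_all
  then show ?case unfolding fstay_blocks_Suc Suc.IH by (simp only: power_Suc2)
qed

text \<open>A path that stays within \<open>L\<close> up to time 1 moves by at most
  \<open>2 * L\<close> in each of the \<open>m\<close> blocks. By independence the
  \<open>m\<close>-th power of the block probability is at least \<open>1 / 2\<close>; a block
  probability below \<open>1 - 1 / m\<close> would make it at most \<open>exp (- 1)\<close>, which
  is smaller.\<close>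

lemma prob_stay_small_time:
  assumes L: "1 / 2 \<le> prob (stay 1 L)" and m: "1 \<le> m"
  shows "1 - 1 / real m \<le> prob (stay (1 / real m) (2 * L))"
proof (rule ccontr)
  assume n: "\<not> ?thesis"
  define d where "d = 1 / real m"
  define E where "E = fstay_blocks m d (2 * L)"
  have d: "0 \<le> d" and md: "real m * d = 1" using m by (auto simp: d_def)
  have E: "E \<in> events" "prob E = prob (stay d (2 * L)) ^ m"
    unfolding E_def by (rule past_algebra_events[OF fstay_blocks_past_algebra[OF d]], rule prob_fstay_blocks[OF d])
  have "stay 1 L \<subseteq> E"
  proof
    fix \<omega> assume w: "\<omega> \<in> stay 1 L"
    have "norm (X (real i * d + u) \<omega> - X (real i * d) \<omega>) \<le> 2 * L" if "i < m" "u \<in> {0..d}" for i u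
    proof -
      have "real i * d + u \<le> (real i + 1) * d" using that by (simp add: algebra_simps)
      also have "\<dots> \<le> real m * d" using that d by (intro mult_right_mono) auto
      finally have le: "real i * d + u \<le> 1" unfolding md .
      moreover have "0 \<le> real i * d" "0 \<le> u" using that d by auto
      ultimately have "norm (X (real i * d + u) \<omega>) \<le> L" "norm (X (real i * d) \<omega>) \<le> L"
        using stay_D[OF w, of "real i * d + u"] stay_D[OF w, of "real i * d"] by linarith+
      then show ?thesis using norm_triangle_ineq4[of "X (real i * d + u) \<omega>" "X (real i * d) \<omega>"] by linarith
    qed
    moreover have "\<omega> \<in> space M" using w by (simp add: stay_def)
    ultimately have "\<omega> \<in> fstay (real i * d) d (2 * L)" if "i < m" for i
      using that by (simp add: fstay_def)
    then show "\<omega> \<in> E" using \<open>\<omega> \<in> space M\<close> by (simp add: E_def fstay_blocks_def)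
  qed
  from finite_measure_mono[OF this E(1)] have "1 / 2 \<le> prob (stay d (2 * L)) ^ m"
    using L E(2) by linarith
  also have "\<dots> \<le> (1 - 1 / real m) ^ m"
    using n unfolding d_def by (intro power_mono measure_nonneg) linarith
  also have "\<dots> \<le> exp (- 1)"
    using m by (intro exp_ge_one_minus_x_over_n_power_n) auto
  finally show False using exp_minus_1_less_half by linarith
qed

end

lemma sets_exits:
  assumes W: "\<And>l. i \<le> l \<Longrightarrow> l \<le> m \<Longrightarrow> W l \<in> borel_measurable N" and "i \<le> m"
  shows "{x\<in>space N. exits m b k (\<lambda>l. W l x :: 'a::euclidean_space) i} \<in> sets N"
  using assms
proof (induction k arbitrary: i)
  case (Suc k)
  have "{x\<in>space N. (\<forall>l\<in>{i..<j}. norm (W l x - W i x) \<le> b) \<and> b < norm (W j x - W i x) \<and> exits m b k (\<lambda>l. W l x) j} \<in> sets N"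
    if j: "j \<in> {i<..m}" for j
  proof -
    have n: "(\<lambda>x. norm (W l x - W i x)) \<in> borel_measurable N" if "i \<le> l" "l \<le> m" for l
    proof -
      have [measurable]: "W l \<in> borel_measurable N" "W i \<in> borel_measurable N"
        using Suc.prems that by auto
      show ?thesis by measurable
    qed
    have "{x\<in>space N. norm (W l x - W i x) \<le> b} \<in> sets N" if "l \<in> {i..<j}" for l
    proof -
      have [measurable]: "(\<lambda>x. norm (W l x - W i x)) \<in> borel_measurable N" using n[of l] j that by auto
      show ?thesis by measurable
    qed
    moreover have "{x\<in>space N. b < norm (W j x - W i x)} \<in> sets N"
    proof -
      have [measurable]: "(\<lambda>x. norm (W j x - W i x)) \<in> borel_measurable N" using n[of j] j by auto
      show ?thesis by measurable
    qed
    moreover have "{x\<in>space N. exits m b k (\<lambda>l. W l x) j} \<in> sets N" using j Suc.prems by (intro Suc.IH) auto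
    ultimately show ?thesis by (intro sets.sets_Collect_conj sets.sets_Collect_finite_All) auto
  qed
  then show ?case by (simp only: exits.simps) (intro sets.sets_Collect_finite_Ex, auto)
qed simp

section \<open>Geometric tails for the number of exits, and covers by few balls\<close>

context levy_path
begin

context
  fixes tt :: "nat \<Rightarrow> real" and m :: nat and h b q :: real
  assumes tt0: "0 \<le> tt 0" and tt_mono: "mono_on {..m} tt" and tt_h: "tt m - tt 0 \<le> h" and h: "0 \<le> h"
    and q: "1 - prob (stay h b) \<le> q"
begin

definition exits_ev :: "nat \<Rightarrow> nat \<Rightarrow> 'w set" where
  "exits_ev k i = {\<omega>\<in>space M. exits m b k (\<lambda>l. X (tt l) \<omega>) i}"

definition first_exit :: "nat \<Rightarrow> nat \<Rightarrow> 'w set" where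
  "first_exit i j = {\<omega>\<in>space M. (\<forall>l\<in>{i..<j}. norm (X (tt l) \<omega> - X (tt i) \<omega>) \<le> b) \<and> b < norm (X (tt j) \<omega> - X (tt i) \<omega>)}"

lemma tt_nonneg: "i \<le> m \<Longrightarrow> 0 \<le> tt i"
  using mono_onD[OF tt_mono, of 0 i] tt0 by auto

lemma tt_le: "i \<le> j \<Longrightarrow> j \<le> m \<Longrightarrow> tt i \<le> tt j"
  using mono_onD[OF tt_mono, of i j] by auto

lemma exits_ev_events: "i \<le> m \<Longrightarrow> exits_ev k i \<in> events"
  unfolding exits_ev_def using tt_nonneg by (intro sets_exits X_meas) auto

lemma first_exit_past_algebra:
  assumes "i < j" "j \<le> m"
  shows "first_exit i j \<in> sets (past_algebra (tt j))"
proof -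
  have X: "X (tt l) \<in> borel_measurable (past_algebra (tt j))" if "l \<le> j" for l
    using that assms by (intro X_past_algebra tt_nonneg tt_le) auto
  have "{\<omega>\<in>space (past_algebra (tt j)). norm (X (tt l) \<omega> - X (tt i) \<omega>) \<le> b} \<in> sets (past_algebra (tt j))" if "l \<in> {i..<j}" for l
  proof -
    have [measurable]: "X (tt l) \<in> borel_measurable (past_algebra (tt j))" "X (tt i) \<in> borel_measurable (past_algebra (tt j))"
      using X[of l] X[of i] assms that by auto
    show ?thesis by measurable
  qed
  moreover have "{\<omega>\<in>space (past_algebra (tt j)). b < norm (X (tt j) \<omega> - X (tt i) \<omega>)} \<in> sets (past_algebra (tt j))"
  proof -
    have [measurable]: "X (tt j) \<in> borel_measurable (past_algebra (tt j))" "X (tt i) \<in> borel_measurable (past_algebra (tt j))"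
      using X[of j] X[of i] assms by auto
    show ?thesis by measurable
  qed
  ultimately have "{\<omega>\<in>space (past_algebra (tt j)). (\<forall>l\<in>{i..<j}. norm (X (tt l) \<omega> - X (tt i) \<omega>) \<le> b) \<and> b < norm (X (tt j) \<omega> - X (tt i) \<omega>)} \<in> sets (past_algebra (tt j))"
    by (intro sets.sets_Collect_conj sets.sets_Collect_finite_All) auto
  then show ?thesis by (simp add: first_exit_def)
qed

text \<open>The first exit is decided by time \<open>tt j\<close>, while the later exits are
  invariant under translation and so depend only on the increments after
  \<open>tt j\<close>.\<close>

lemma first_exit_indep:
  assumes "i < j" "j \<le> m"
  shows "prob (first_exit i j \<inter> exits_ev k j) = prob (first_exit i j) * prob (exits_ev k j)"
proof -
  define A where "A = {v\<in>space (path_space {0..}). exits m b k (\<lambda>l. v (tt l - tt j)) j}"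
  have A: "A \<in> sets (path_space {0..})"
    unfolding A_def using assms tt_le by (intro sets_exits measurable_component_singleton) auto
  have t: "0 \<le> tt j" using assms by (intro tt_nonneg)
  have eq: "future (tt j) \<omega> \<in> A \<longleftrightarrow> \<omega> \<in> exits_ev k j" if w: "\<omega> \<in> space M" for \<omega>
  proof -
    have "exits m b k (\<lambda>l. future (tt j) \<omega> (tt l - tt j)) j = exits m b k (\<lambda>l. X (tt l) \<omega>) j"
      using assms tt_le by (intro exits_cong[of _ _ _ _ "X (tt j) \<omega>"]) (auto simp: future_def)
    then show ?thesis using measurable_space[OF future_meas[OF t] w] w by (simp add: A_def exits_ev_def)
  qed
  have fe: "first_exit i j \<subseteq> space M" "exits_ev k j \<subseteq> space M" by (auto simp: first_exit_def exits_ev_def)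
  have 1: "{\<omega>\<in>first_exit i j. future (tt j) \<omega> \<in> A} = first_exit i j \<inter> exits_ev k j"
    using eq fe by auto
  have 2: "{\<omega>\<in>space M. future (tt j) \<omega> \<in> A} = exits_ev k j"
    using eq fe by auto
  show ?thesis
    using markov_indep[OF t first_exit_past_algebra[OF assms] A] markov_indep[OF t, of "space M" A] A sets.top[of "past_algebra (tt j)"]
    by (simp add: 1 2 prob_space)
qed

text \<open>Split according to the index of the first exit and restart there. The first-exit events
  are disjoint, and each forces the path to leave a ball of radius \<open>b\<close> within time
  \<open>h\<close>, so their probabilities add up to at most \<open>q\<close>.\<close>

lemma prob_exits_ev: "i \<le> m \<Longrightarrow> prob (exits_ev k i) \<le> q ^ k"
proof (induction k arbitrary: i)
  case 0
  then show ?case by simp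
next
  case (Suc k)
  have q0: "0 \<le> q" using q prob_le_1[of "stay h b"] by linarith
  have ev: "first_exit i j \<in> events" if "j \<in> {i<..m}" for j using that past_algebra_events[OF first_exit_past_algebra] by auto
  have disj: "disjoint_family_on (first_exit i) {i<..m}"
    unfolding disjoint_family_on_def
  proof (intro ballI impI)
    fix j j' assume j: "j \<in> {i<..m}" "j' \<in> {i<..m}" "j \<noteq> j'"
    have *: "first_exit i j1 \<inter> first_exit i j2 = {}" if "i < j1" "j1 < j2" for j1 j2
    proof (rule equals0I)
      fix \<omega> assume w: "\<omega> \<in> first_exit i j1 \<inter> first_exit i j2"
      have "j1 \<in> {i..<j2}" using that by auto
      then have "norm (X (tt j1) \<omega> - X (tt i) \<omega>) \<le> b" using w unfolding first_exit_def by blast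
      then show False using w by (simp add: first_exit_def)
    qed
    show "first_exit i j \<inter> first_exit i j' = {}"
    proof (cases "j < j'")
      case True then show ?thesis using j by (intro *) auto
    next
      case False then have "first_exit i j' \<inter> first_exit i j = {}" using j by (intro *) auto
      then show ?thesis by (simp add: Int_commute)
    qed
  qed
  have "exits_ev (Suc k) i \<subseteq> (\<Union>j\<in>{i<..m}. first_exit i j \<inter> exits_ev k j)"
    by (auto simp: exits_ev_def first_exit_def)
  then have "prob (exits_ev (Suc k) i) \<le> prob (\<Union>j\<in>{i<..m}. first_exit i j \<inter> exits_ev k j)"
    using ev exits_ev_events by (intro finite_measure_mono sets.finite_UN) auto
  also have "\<dots> \<le> (\<Sum>j\<in>{i<..m}. prob (first_exit i j \<inter> exits_ev k j))"
    using ev exits_ev_events by (intro finite_measure_subadditive_finite) auto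
  also have "\<dots> \<le> (\<Sum>j\<in>{i<..m}. prob (first_exit i j) * q ^ k)"
  proof (rule sum_mono)
    fix j assume j: "j \<in> {i<..m}"
    show "prob (first_exit i j \<inter> exits_ev k j) \<le> prob (first_exit i j) * q ^ k"
      using j by (subst first_exit_indep) (auto intro!: mult_left_mono Suc.IH)
  qed
  also have "\<dots> = prob (\<Union>j\<in>{i<..m}. first_exit i j) * q ^ k"
    using ev disj by (subst finite_measure_finite_Union) (auto simp: sum_distrib_right)
  also have "\<dots> \<le> q * q ^ k"
  proof (rule mult_right_mono)
    have "(\<Union>j\<in>{i<..m}. first_exit i j) \<subseteq> space M - fstay (tt i) h b"
    proof
      fix \<omega> assume "\<omega> \<in> (\<Union>j\<in>{i<..m}. first_exit i j)"
      then obtain j where j: "j \<in> {i<..m}" "\<omega> \<in> first_exit i j" by blast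
      have "tt i \<le> tt j" "tt j \<le> tt m" "tt 0 \<le> tt i" using j(1) Suc.prems by (auto intro!: tt_le)
      then have "\<omega> \<notin> fstay (tt i) h b"
        using j(2) fstay_D[of \<omega> "tt i" h b "tt j - tt i"] tt_h by (auto simp: first_exit_def)
      then show "\<omega> \<in> space M - fstay (tt i) h b" using j(2) by (simp add: first_exit_def)
    qed
    then have "prob (\<Union>j\<in>{i<..m}. first_exit i j) \<le> prob (space M - fstay (tt i) h b)"
      using fstay_events[of "tt i" h b] tt_nonneg Suc.prems h by (intro finite_measure_mono) auto
    also have "\<dots> = 1 - prob (stay h b)"
      using fstay_events[of "tt i" h b] tt_nonneg[OF Suc.prems] h by (subst prob_compl) (auto simp: prob_fstay)
    finally show "prob (\<Union>j\<in>{i<..m}. first_exit i j) \<le> q" using q by linarith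
  qed (use q0 in simp)
  finally show ?case by simp
qed

end

text \<open>The bound \<open>q ^ k\<close> holds on every dyadic grid. A path without a short cover
  has a chain of \<open>k\<close> jumps beyond \<open>2 * b\<close>, hence shows \<open>k\<close>
  exits beyond \<open>b\<close> on all fine grids; this doubling is why the covering radius is
  \<open>2 * b\<close>.\<close>

lemma prob_cover:
  assumes t: "0 \<le> t" and h: "0 < h" and b: "0 < b" and q: "1 - prob (stay h b) \<le> q"
  shows "\<exists>N\<in>events. prob N \<le> q ^ k \<and>
    (\<forall>\<omega>\<in>space M - N. \<exists>Z. finite Z \<and> card Z \<le> 2 * k \<and> (\<lambda>s. X s \<omega>) ` {t..t + h} \<subseteq> (\<Union>z\<in>Z. cball z (2 * b)))"
proof -
  define tt where "tt n l = t + h * real l / 2 ^ n" for n l :: nat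
  define E where "E n = exits_ev (tt n) (2 ^ n) b k 0" for n
  have tt: "0 \<le> tt n 0" "mono_on {..2 ^ n} (tt n)" "tt n (2 ^ n) - tt n 0 \<le> h" for n
    using t h by (auto simp: tt_def intro!: mono_onI divide_right_mono mult_left_mono)
  have Eev: "E n \<in> events" and Ep: "prob (E n) \<le> q ^ k" for n
    unfolding E_def
    by (rule exits_ev_events[where h = h]; use tt[of n] h q in simp)
       (rule prob_exits_ev[where h = h]; use tt[of n] h q in simp)
  \<comment> \<open>All sufficiently fine grids show \<open>k\<close> exits. The union over
    \<open>n0\<close> is increasing, so its probability inherits the bound valid for each
    grid.\<close>
  define N where "N = (\<Union>n0. \<Inter>n\<in>{n0..}. E n)"
  have N: "N \<in> events" unfolding N_def using Eev by auto
  have "(\<lambda>n0. prob (\<Inter>n\<in>{n0..}. E n)) \<longlonglongrightarrow> prob N"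
    unfolding N_def using Eev by (intro finite_Lim_measure_incseq) (auto simp: incseq_def)
  moreover have "prob (\<Inter>n\<in>{n0..}. E n) \<le> q ^ k" for n0
    using Eev by (intro order_trans[OF finite_measure_mono Ep[of n0]]) auto
  ultimately have "prob N \<le> q ^ k" by (intro LIMSEQ_le_const2) auto
  moreover have "\<exists>Z. finite Z \<and> card Z \<le> 2 * k \<and> (\<lambda>s. X s \<omega>) ` {t..t + h} \<subseteq> (\<Union>z\<in>Z. cball z (2 * b))"
    if w: "\<omega> \<in> space M - N" for \<omega>
  proof -
    define f where "f u = X (t + u) \<omega> - X t \<omega>" for u
    have rc: "(f \<longlongrightarrow> f u) (at_right u)" if "0 \<le> u" for u
      unfolding f_def using w t that by (intro rc_shift) auto
    have "\<not> chain f h (2 * b) k 0"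
    proof
      assume "chain f h (2 * b) k 0"
      from chain_imp_grid_chain[OF h rc order_refl this]
      have "\<forall>\<^sub>F n in sequentially. grid_chain (2 ^ n) (2 * b) k (\<lambda>l. f (h * real l / 2 ^ n)) (grid_index h n 0)" by auto
      then have "\<forall>\<^sub>F n in sequentially. \<omega> \<in> E n"
      proof eventually_elim
        case (elim n)
        have "exits (2 ^ n) b k (\<lambda>l. f (h * real l / 2 ^ n)) 0"
          using b by (intro grid_chain_imp_exits[OF _ _ elim]) auto
        also have "exits (2 ^ n) b k (\<lambda>l. f (h * real l / 2 ^ n)) 0 = exits (2 ^ n) b k (\<lambda>l. X (tt n l) \<omega>) 0"
          by (rule exits_cong[of _ _ _ _ "X t \<omega>"]) (auto simp: f_def tt_def)
        finally show ?case using w by (simp add: E_def exits_ev_def[where tt = "tt n", OF tt less_imp_le[OF h] q])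
      qed
      then have "\<omega> \<in> N" by (auto simp: N_def eventually_sequentially)
      then show False using w by simp
    qed
    from not_chain_cover[OF _ rc order_refl _ this] b h
    obtain Z where Z: "finite Z" "card Z \<le> 2 * k" "f ` {0..h} \<subseteq> (\<Union>z\<in>Z. cball z (2 * b))" by auto
    have "(\<lambda>s. X s \<omega>) ` {t..t + h} \<subseteq> (\<Union>z\<in>(\<lambda>z. z + X t \<omega>) ` Z. cball z (2 * b))"
    proof
      fix y assume "y \<in> (\<lambda>s. X s \<omega>) ` {t..t + h}"
      then obtain s where s: "s \<in> {t..t + h}" "y = X s \<omega>" by auto
      then have "f (s - t) \<in> f ` {0..h}" by auto
      then obtain z where z: "z \<in> Z" "dist z (f (s - t)) \<le> 2 * b" using Z(3) by fastforce
      then have "dist (z + X t \<omega>) y \<le> 2 * b" by (simp add: f_def s dist_norm algebra_simps)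
      then show "y \<in> (\<Union>z\<in>(\<lambda>z. z + X t \<omega>) ` Z. cball z (2 * b))" using z(1) by auto
    qed
    moreover have "card ((\<lambda>z. z + X t \<omega>) ` Z) \<le> 2 * k" using card_image_le[OF Z(1)] Z(2) order_trans by blast
    ultimately show ?thesis using Z(1) by blast
  qed
  ultimately show ?thesis using N by blast
qed

text \<open>From inside the ball of radius \<open>R\<close> the path is back in it one unit of time
  later with probability at least \<open>2 * p\<close>, and strays farther than \<open>L\<close>
  meanwhile with probability at most \<open>p\<close>. So both demands are met with probability at
  least \<open>p\<close>, at every integer time anew.\<close>

lemma prob_stay_recurrent:
  assumes R: "0 < R" and p: "0 < p"
    and ret: "\<And>x. norm x \<le> R \<Longrightarrow> 2 * p \<le> prob {\<omega>\<in>space M. norm (x + X 1 \<omega>) \<le> R}"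
    and L: "0 \<le> L" "1 - p \<le> prob (stay 1 L)"
  shows "p ^ m \<le> prob (stay (real m) (R + L))"
proof -
  \<comment> \<open>Confinement to the larger ball alone could not be iterated; the return to the
    smaller ball at integer times is carried along.\<close>
  define E where "E m = {\<omega>\<in>stay (real m) (R + L). norm (X (real m) \<omega>) \<le> R}" for m :: nat
  have EF: "E m \<in> sets (past_algebra (real m))" for m
  proof -
    have [measurable]: "X (real m) \<in> borel_measurable (past_algebra (real m))" by (intro X_past_algebra) auto
    have "{\<omega>\<in>space (past_algebra (real m)). norm (X (real m) \<omega>) \<le> R} \<in> sets (past_algebra (real m))" by measurable
    moreover have "E m = stay (real m) (R + L) \<inter> {\<omega>\<in>space (past_algebra (real m)). norm (X (real m) \<omega>) \<le> R}"
      by (auto simp: E_def stay_def)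
    ultimately show ?thesis by (auto intro!: sets.Int stay_past_algebra)
  qed
  have "p ^ m \<le> prob (E m)"
  proof (induction m)
    case 0
    have "E 0 = space M" using R L by (auto simp: E_def stay_def X_zero)
    then show ?case by (simp add: prob_space)
  next
    case (Suc m)
    define A where "A = {z \<in> space (borel \<Otimes>\<^sub>M path_space {0..}). norm (fst z + snd z 1) \<le> R} \<inter> (UNIV \<times> stay_paths 1 L)"
    have A: "A \<in> sets (borel \<Otimes>\<^sub>M path_space {0..})"
    proof -
      have [measurable]: "(\<lambda>z. snd z 1) \<in> measurable (borel \<Otimes>\<^sub>M path_space {0..}) (borel :: 'a measure)"
        by (rule measurable_compose[OF measurable_snd measurable_component_singleton]) auto
      have "{z \<in> space (borel \<Otimes>\<^sub>M path_space {0..}). norm (fst z + snd z 1) \<le> R} \<in> sets (borel \<Otimes>\<^sub>M path_space {0..})"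
        by measurable
      moreover have "UNIV \<times> stay_paths 1 L \<in> sets (borel \<Otimes>\<^sub>M path_space {0..})"
        by (intro pair_measureI stay_paths_sets) auto
      ultimately show ?thesis unfolding A_def by (rule sets.Int)
    qed
    have Ap: "(x, v) \<in> A \<longleftrightarrow> norm (x + v 1) \<le> R \<and> v \<in> stay_paths 1 L" if "v \<in> space (path_space {0..})" for x v
      using that by (auto simp: A_def space_pair_measure)
    have "p * prob (E m) \<le> prob {\<omega>\<in>E m. (X (real m) \<omega>, future (real m) \<omega>) \<in> A}"
    proof (rule markov_prob_ge[OF _ EF A])
      fix \<omega> assume w: "\<omega> \<in> E m"
      define x where "x = X (real m) \<omega>"
      define S where "S = {\<omega>'\<in>space M. norm (x + X 1 \<omega>') \<le> R}"
      have [measurable]: "X 1 \<in> borel_measurable M" by (rule X_meas) simp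
      have S: "S \<in> events" unfolding S_def by measurable
      have st: "stay 1 L \<in> events" by (rule stay_events) simp
      have "{\<omega>'\<in>space M. (x, xpath \<omega>') \<in> A} = S \<inter> stay 1 L"
        using measurable_space[OF xpath_meas] by (auto simp: Ap S_def stay_path) (simp_all add: xpath_def)
      moreover have "2 * p \<le> prob S" unfolding S_def using w by (intro ret) (simp add: x_def E_def)
      moreover have "prob S + prob (stay 1 L) - 1 \<le> prob (S \<inter> stay 1 L)"
      proof -
        have "prob (S \<union> stay 1 L) = prob S + prob (stay 1 L) - prob (S \<inter> stay 1 L)"
          using S st by (intro measure_Un3) (auto simp: fmeasurable_eq_sets)
        then show ?thesis using prob_le_1[of "S \<union> stay 1 L"] by linarith
      qed
      ultimately show "p \<le> prob {\<omega>'\<in>space M. (X (real m) \<omega>, xpath \<omega>') \<in> A}" using L(2) by (simp add: x_def)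
    qed simp
    also have "\<dots> \<le> prob (E (Suc m))"
    proof (rule finite_measure_mono)
      show "{\<omega>\<in>E m. (X (real m) \<omega>, future (real m) \<omega>) \<in> A} \<subseteq> E (Suc m)"
      proof
        fix \<omega> assume "\<omega> \<in> {\<omega>\<in>E m. (X (real m) \<omega>, future (real m) \<omega>) \<in> A}"
        then have w: "\<omega> \<in> E m" "(X (real m) \<omega>, future (real m) \<omega>) \<in> A" by auto
        then have ws: "\<omega> \<in> space M" by (auto simp: E_def stay_def)
        have f: "future (real m) \<omega> \<in> space (path_space {0..})" using measurable_space[OF future_meas ws] by simp
        have a: "norm (X (real m) \<omega> + future (real m) \<omega> 1) \<le> R" and b: "\<omega> \<in> fstay (real m) 1 L"
          using w(2) f ws by (auto simp: Ap fstay_future)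
        have a': "norm (X (real (Suc m)) \<omega>) \<le> R" using a by (simp add: future_def algebra_simps)
        have "norm (X s \<omega>) \<le> R + L" if s: "0 \<le> s" "s \<le> real (Suc m)" for s
        proof (cases "s \<le> real m")
          case True then show ?thesis using w(1) s by (auto simp: E_def intro: stay_D)
        next
          case False
          then have "norm (X s \<omega> - X (real m) \<omega>) \<le> L" using fstay_D[OF b, of "s - real m"] s by simp
          moreover have "norm (X (real m) \<omega>) \<le> R" using w(1) by (simp add: E_def)
          ultimately show ?thesis using norm_triangle_ineq2[of "X s \<omega>" "X (real m) \<omega>"] by linarith
        qed
        then show "\<omega> \<in> E (Suc m)" using a' ws by (auto simp: E_def stay_def)
      qed
      show "E (Suc m) \<in> events" using past_algebra_events[OF EF] by auto
    qed
    finally have "p * prob (E m) \<le> prob (E (Suc m))" .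
    moreover have "p ^ Suc m \<le> p * prob (E m)" using Suc.IH p by simp
    ultimately show ?case by linarith
  qed
  also have "\<dots> \<le> prob (stay (real m) (R + L))"
    by (intro finite_measure_mono stay_events) (auto simp: E_def)
  finally show ?thesis .
qed

section \<open>Consequences of semistability: scaling and small ball probabilities\<close>

definition stay_scaling :: "real \<Rightarrow> real \<Rightarrow> real \<Rightarrow> bool" where
  "stay_scaling c \<alpha> C \<longleftrightarrow> (\<forall>n h a. 0 \<le> h \<longrightarrow> 0 \<le> a \<longrightarrow>
     prob (stay h a) \<le> prob (stay (h / c ^ n) (C * c powr (- real n / \<alpha>) * a)))"

text \<open>At scale \<open>n\<close> the natural time is \<open>1 / c ^ n\<close> and the natural
  radius is of order \<open>c powr (- n / \<alpha>)\<close>, so \<open>l\<close> measures how much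
  longer than normal the path lingers. The exponent \<open>\<gamma>\<close> is
  \<open>1 / \<theta>\<close> in the notation of the gauge.\<close>

definition small_ball_bound :: "real \<Rightarrow> real \<Rightarrow> real \<Rightarrow> real \<Rightarrow> real \<Rightarrow> bool" where
  "small_ball_bound c \<alpha> \<gamma> K L \<longleftrightarrow>
     (\<forall>l\<ge>1. \<forall>n. exp (- K * l powr \<gamma>) \<le> prob (stay (l / c ^ n) (L * c powr (- real n / \<alpha>))))"

lemma small_ball_recurrent:
  assumes sc: "stay_scaling c \<alpha> C" and c: "c > 1" and C: "C > 0"
    and R: "0 < R" and p: "0 < p" "p < 1"
    and ret: "\<And>x. norm x \<le> R \<Longrightarrow> 2 * p \<le> prob {\<omega>\<in>space M. norm (x + X 1 \<omega>) \<le> R}"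
  shows "\<exists>K>0. \<exists>L>0. small_ball_bound c \<alpha> 1 K L"
proof -
  obtain L0 where L0: "L0 > 0" "1 - p \<le> prob (stay 1 L0)" using prob_stay_limit[of 1 p] p by auto
  \<comment> \<open>The factor 2 pays for rounding \<open>l\<close> up to an integer, which at most
    doubles it because \<open>l\<close> is at least 1.\<close>
  define K where "K = - 2 * ln p"
  define L where "L = C * (R + L0)"
  have K: "K > 0" using p by (simp add: K_def ln_less_zero)
  have "exp (- K * l powr 1) \<le> prob (stay (l / c ^ n) (L * c powr (- real n / \<alpha>)))" if l: "l \<ge> 1" for l n
  proof -
    define m where "m = nat \<lceil>l\<rceil>"
    have m: "l \<le> real m" "real m \<le> 2 * l" using l by (auto simp: m_def) linarith+
    have "exp (- K * l powr 1) = exp (2 * l * ln p)" using l by (simp add: K_def)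
    also have "\<dots> \<le> exp (real m * ln p)"
      using m(2) p by (simp add: ln_less_zero mult_right_mono_neg less_imp_le)
    also have "\<dots> = p ^ m" using p by (simp add: exp_of_nat_mult)
    also have "\<dots> \<le> prob (stay (real m) (R + L0))"
      using prob_stay_recurrent[OF R p(1) ret _ L0(2)] L0(1) by auto
    also have "\<dots> \<le> prob (stay l (R + L0))" using m l by (intro prob_stay_mono) auto
    also have "\<dots> \<le> prob (stay (l / c ^ n) (C * c powr (- real n / \<alpha>) * (R + L0)))"
      using sc l R L0 unfolding stay_scaling_def by auto
    finally show ?thesis by (simp add: L_def mult.assoc mult.commute mult.left_commute)
  qed
  moreover have "L > 0" using C R L0 by (simp add: L_def)
  ultimately show ?thesis using K unfolding small_ball_bound_def by blast
qed

text \<open>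
  The idea is to cut the time interval of length \<open>l\<close> into pieces of length \<open>l / m\<close> on each of which the path
  moves by at most \<open>1 / m\<close> with probability at least \<open>1 / 2\<close>: by scaling this needs \<open>l / m\<close> of order
  \<open>m powr - \<alpha>\<close>, that is \<open>m\<close> of order \<open>l powr (1 / (1 - \<alpha>))\<close>.
\<close>

lemma small_ball_transient:
  assumes sc: "stay_scaling c \<alpha> C" and c: "c > 1" and C: "C > 0" and \<alpha>: "0 < \<alpha>" "\<alpha> < 1"
  shows "\<exists>K>0. \<exists>L>0. small_ball_bound c \<alpha> (1 / (1 - \<alpha>)) K L"
proof -
  obtain a0 where a0: "a0 > 0" "1 - 1/2 \<le> prob (stay 1 a0)" using prob_stay_limit[of 1 "1/2"] by auto
  define K where "K = 2 * c * ln 2"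
  define L where "L = 2 * C * a0"
  have K: "K > 0" using c by (simp add: K_def)
  have L: "L > 0" using C a0 by (simp add: L_def)
  have "exp (- K * l powr (1 / (1 - \<alpha>))) \<le> prob (stay (l / c ^ n) (L * c powr (- real n / \<alpha>)))" if l: "l \<ge> 1" for l n
  proof -
    \<comment> \<open>With \<open>c ^ j\<close> of order \<open>l powr e\<close>, the number
      \<open>m\<close> of pieces is of order \<open>l * c ^ j\<close>, that is
      \<open>l powr (1 + e)\<close>, and \<open>1 + e = 1 / (1 - \<alpha>)\<close>.\<close>
    define e where "e = \<alpha> / (1 - \<alpha>)"
    have e: "e > 0" using \<alpha> by (simp add: e_def)
    define j where "j = nat \<lceil>log c (l powr e)\<rceil>"
    have lg: "log c (l powr e) \<ge> 0" using l e c by (simp add: ge_one_powr_ge_zero)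
    have j: "log c (l powr e) \<le> real j" "real j \<le> log c (l powr e) + 1" using lg unfolding j_def by linarith+
    have cj: "c ^ j = c powr real j" using c by (simp add: powr_realpow)
    have le0: "l powr e > 0" using l by simp
    have cj1: "l powr e \<le> c ^ j" unfolding cj using j(1) c le0 by (simp add: log_le_iff)
    have cj2: "c ^ j \<le> c * l powr e"
    proof -
      have "c powr real j \<le> c powr (log c (l powr e) + 1)" using j(2) c by simp
      also have "\<dots> = c * l powr e" using c le0 by (simp add: powr_add)
      finally show ?thesis by (simp add: cj)
    qed
    define m where "m = nat \<lceil>l * c ^ j\<rceil>"
    have lc: "1 \<le> l * c ^ j" using l c mult_mono[of 1 l 1 "c ^ j"] by simp
    have m: "l * c ^ j \<le> real m" "real m \<le> 2 * (l * c ^ j)" using lc by (auto simp: m_def) linarith+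
    define b where "b = C * c powr (- real (n + j) / \<alpha>) * a0"
    have b: "b \<ge> 0" using C a0 by (simp add: b_def)
    have "exp (- K * l powr (1 / (1 - \<alpha>))) \<le> (1 / 2) ^ m"
    proof -
      have "1 + e = 1 / (1 - \<alpha>)" using \<alpha> by (simp add: e_def field_simps)
      then have "l * l powr e = l powr (1 / (1 - \<alpha>))" using l by (metis powr_add powr_one less_le_trans zero_less_one order_less_imp_le)
      then have "l * c ^ j \<le> c * l powr (1 / (1 - \<alpha>))"
        using mult_left_mono[OF cj2, of l] l by (simp add: mult.left_commute)
      then have "real m \<le> 2 * c * l powr (1 / (1 - \<alpha>))" using m(2) by linarith
      then have "real m * ln 2 \<le> K * l powr (1 / (1 - \<alpha>))"
        using mult_right_mono[of "real m" _ "ln 2"] by (simp add: K_def mult.assoc mult.left_commute mult.commute)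
      then have "exp (- K * l powr (1 / (1 - \<alpha>))) \<le> exp (- (real m * ln 2))" by simp
      also have "\<dots> = (1 / 2) ^ m" by (simp add: exp_minus exp_of_nat_mult power_one_over inverse_eq_divide)
      finally show ?thesis .
    qed
    also have "\<dots> \<le> prob (stay (1 / c ^ (n + j)) b) ^ m"
    proof (intro power_mono)
      have "1 / 2 \<le> prob (stay 1 a0)" using a0 by simp
      also have "\<dots> \<le> prob (stay (1 / c ^ (n + j)) b)"
        using sc[unfolded stay_scaling_def, rule_format, of 1 a0 "n + j"] a0 by (simp add: b_def)
      finally show "1 / 2 \<le> prob (stay (1 / c ^ (n + j)) b)" .
    qed simp
    also have "\<dots> \<le> prob (stay (real m * (1 / c ^ (n + j))) (real m * b))"
      using c b by (intro prob_stay_mult) auto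
    also have "\<dots> \<le> prob (stay (l / c ^ n) (L * c powr (- real n / \<alpha>)))"
    proof (rule prob_stay_mono)
      show "0 \<le> l / c ^ n" using l c by simp
      show "l / c ^ n \<le> real m * (1 / c ^ (n + j))"
        using m(1) c by (simp add: field_simps power_add)
      \<comment> \<open>This determines \<open>e\<close>: about \<open>l * c ^ j\<close>
        displacements, each smaller by the factor \<open>c powr (- j / \<alpha>)\<close>, must add
        up to a bounded multiple of the radius at scale \<open>n\<close>.\<close>
      have "l * c powr (real j) * c powr (- real j / \<alpha>) \<le> 1"
      proof -
        have "c powr (real j) * c powr (- real j / \<alpha>) = (c ^ j) powr (- ((1 - \<alpha>) / \<alpha>))"
        proof -
          have "real j + - real j / \<alpha> = real j * - ((1 - \<alpha>) / \<alpha>)" using \<alpha> by (simp add: field_simps)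
          then show ?thesis unfolding cj powr_powr powr_add[symmetric] by simp
        qed
        also have "\<dots> \<le> (l powr e) powr (- ((1 - \<alpha>) / \<alpha>))"
          using cj1 le0 \<alpha> by (intro powr_mono2') (auto simp: field_simps)
        also have "\<dots> = l powr (- 1)" using \<alpha> l by (simp add: powr_powr e_def)
        also have "\<dots> = 1 / l" using l by (simp add: powr_minus_divide)
        finally show ?thesis using l by (simp add: field_simps)
      qed
      then have "real m * (c powr (- real j / \<alpha>)) \<le> 2"
        using mult_right_mono[OF m(2), of "c powr (- real j / \<alpha>)"] by (simp add: cj)
      then have "real m * c powr (- real j / \<alpha>) * (C * c powr (- real n / \<alpha>) * a0) \<le> 2 * (C * c powr (- real n / \<alpha>) * a0)"
        using C a0 by (intro mult_right_mono) auto
      moreover have "real m * b = real m * c powr (- real j / \<alpha>) * (C * c powr (- real n / \<alpha>) * a0)"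
      proof -
        have "- real (n + j) / \<alpha> = - real j / \<alpha> + - real n / \<alpha>" by (simp add: diff_divide_distrib)
        then show ?thesis unfolding b_def by (simp only: powr_add mult_ac)
      qed
      ultimately have "real m * b \<le> 2 * (C * c powr (- real n / \<alpha>) * a0)" by linarith
      then show "real m * b \<le> L * c powr (- real n / \<alpha>)" by (simp add: L_def mult_ac)
    qed
    finally show ?thesis .
  qed
  then show ?thesis using K L unfolding small_ball_bound_def by blast
qed

text \<open>With \<open>m\<close> the integer part of \<open>1 / t\<close>, the time
  \<open>t\<close> is at most \<open>1 / m\<close> and the failure probability \<open>1 / m\<close>
  is at most \<open>2 * t\<close>. The linear rate makes the initial piece of each window negligible
  even when summed over \<open>s\<close> windows.\<close>

lemma small_time_bound:
  assumes sc: "stay_scaling c \<alpha> C" and c: "c > 1" and C: "C > 0"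
  shows "\<exists>L>0. \<forall>n. \<forall>t\<in>{0<..1}. 1 - prob (stay (t / c ^ n) (L * c powr (- real n / \<alpha>))) \<le> 2 * t"
proof -
  obtain L1 where L1: "L1 > 0" "1 - 1/2 \<le> prob (stay 1 L1)" using prob_stay_limit[of 1 "1/2"] by auto
  have "1 - prob (stay (t / c ^ n) (C * (2 * L1) * c powr (- real n / \<alpha>))) \<le> 2 * t" if t: "0 < t" "t \<le> 1" for t n
  proof -
    define m where "m = nat \<lfloor>1 / t\<rfloor>"
    have t1: "1 \<le> 1 / t" using t by (simp add: field_simps)
    have m: "1 \<le> m" "real m \<le> 1 / t" "1 / t < real m + 1" using t1 by (auto simp: m_def le_nat_floor) linarith+
    have "1 / t < 2 * real m" using m by linarith
    then have mt: "1 / real m < 2 * t" using t m(1) by (simp add: field_simps)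
    have tm: "t \<le> 1 / real m" using m(1,2) t by (simp add: field_simps)
    have "1 - 2 * t \<le> 1 - 1 / real m" using mt by simp
    also have "\<dots> \<le> prob (stay (1 / real m) (2 * L1))" using L1 m by (intro prob_stay_small_time) auto
    also have "\<dots> \<le> prob (stay t (2 * L1))" using t tm by (intro prob_stay_mono) auto
    also have "\<dots> \<le> prob (stay (t / c ^ n) (C * c powr (- real n / \<alpha>) * (2 * L1)))"
      using sc t L1 unfolding stay_scaling_def by auto
    finally show ?thesis by (simp add: mult_ac)
  qed
  then show ?thesis using C L1 by (intro exI[of _ "C * (2 * L1)"]) auto
qed

section \<open>Efficient covers of the range\<close>

text \<open>The times \<open>\<tau>\<close> decrease in the index, so the windows with index above
  \<open>j\<close> all end by \<open>\<tau> (Suc j)\<close>, where window \<open>j\<close> begins.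
  Adding windows from the innermost outwards, each new one is independent of those treated
  before.\<close>

lemma prob_windows:
  assumes t: "0 \<le> t" and mono: "\<And>j. j < s \<Longrightarrow> \<tau> (Suc j) \<le> \<tau> j" and \<tau>s: "0 \<le> \<tau> s"
    and \<rho>: "\<And>j. j < s \<Longrightarrow> \<rho> \<le> prob (stay (\<tau> j - \<tau> (Suc j)) (b j))" and \<rho>1: "\<rho> \<le> 1"
  shows "prob {\<omega>\<in>space M. \<forall>j<s. \<omega> \<notin> fstay (t + \<tau> (Suc j)) (\<tau> j - \<tau> (Suc j)) (b j)} \<le> (1 - \<rho>) ^ s"
proof -
  define G where "G j = fstay (t + \<tau> (Suc j)) (\<tau> j - \<tau> (Suc j)) (b j)" for j
  define B where "B i = {\<omega>\<in>space M. \<forall>j\<in>{i..<s}. \<omega> \<notin> G j}" for i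
  have \<tau>0: "0 \<le> \<tau> j" if "j \<le> s" for j
    using that
  proof (induction rule: inc_induct)
    case (step n)
    then show ?case using mono[of n] by linarith
  qed (rule \<tau>s)
  have "B (s - k) \<in> sets (past_algebra (t + \<tau> (s - k))) \<and> prob (B (s - k)) \<le> (1 - \<rho>) ^ k" if "k \<le> s" for k
    using that
  proof (induction k)
    case 0
    have "B s = space M" by (auto simp: B_def)
    then show ?case using sets.top[of "past_algebra (t + \<tau> s)"] by (simp add: prob_space)
  next
    case (Suc k)
    define j where "j = s - Suc k"
    have j: "j < s" "s - k = Suc j" using Suc.prems by (auto simp: j_def)
    have IH: "B (Suc j) \<in> sets (past_algebra (t + \<tau> (Suc j)))" "prob (B (Suc j)) \<le> (1 - \<rho>) ^ k"
      using Suc.IH[OF Suc_leD[OF Suc.prems]] unfolding j(2) by blast+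
    have B: "B j = B (Suc j) - B (Suc j) \<inter> G j"
    proof -
      have "{j..<s} = insert j {Suc j..<s}" using j(1) by auto
      then show ?thesis by (auto simp: B_def)
    qed
    have Gt: "0 \<le> t + \<tau> (Suc j)" "0 \<le> \<tau> j - \<tau> (Suc j)" using t \<tau>0[of "Suc j"] mono[of j] j(1) by auto
    have GF: "G j \<in> sets (past_algebra (t + \<tau> j))" unfolding G_def using Gt by (intro fstay_past_algebra) auto
    have BF: "B (Suc j) \<in> sets (past_algebra (t + \<tau> j))" by (rule past_algebra_mono[OF _ IH(1)]) (use mono[of j] j(1) in auto)
    have "prob (B j) = prob (B (Suc j)) - prob (B (Suc j) \<inter> G j)"
      unfolding B using past_algebra_events[OF BF] past_algebra_events[OF GF] by (intro finite_measure_Diff) auto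
    also have "prob (B (Suc j) \<inter> G j) = prob (B (Suc j)) * prob (stay (\<tau> j - \<tau> (Suc j)) (b j))"
      unfolding G_def by (rule prob_indep_fstay[OF Gt IH(1)])
    also have "prob (B (Suc j)) - prob (B (Suc j)) * prob (stay (\<tau> j - \<tau> (Suc j)) (b j)) = prob (B (Suc j)) * (1 - prob (stay (\<tau> j - \<tau> (Suc j)) (b j)))"
      by (simp add: algebra_simps)
    also have "\<dots> \<le> (1 - \<rho>) ^ k * (1 - \<rho>)"
      using IH(2) \<rho>[OF j(1)] \<rho>1 by (intro mult_mono measure_nonneg zero_le_power) (auto simp: prob_le_1)
    finally have "prob (B j) \<le> (1 - \<rho>) ^ Suc k" by (simp add: mult.commute)
    moreover have "B j \<in> sets (past_algebra (t + \<tau> j))" unfolding B using BF GF by auto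
    ultimately show ?case by (simp add: j_def)
  qed
  from this[of s] have "prob (B 0) \<le> (1 - \<rho>) ^ s" by simp
  moreover have "B 0 = {\<omega>\<in>space M. \<forall>j<s. \<omega> \<notin> G j}" by (auto simp: B_def)
  ultimately show ?thesis by (simp add: G_def)
qed

text \<open>
  The window after \<open>t\<close> is split at the times \<open>\<tau> j\<close>, which decrease in \<open>j\<close>. That the path stays small between \<open>\<tau> (Suc j)\<close> and
  \<open>\<tau> j\<close> are independent events for different \<open>j\<close>; that it stays small up to \<open>\<tau> (Suc j)\<close> on the scale \<open>b j\<close> is
  very likely.
\<close>

lemma prob_bad_start:
  assumes t: "0 \<le> t" and mono: "\<And>j. j < s \<Longrightarrow> \<tau> (Suc j) \<le> \<tau> j" and \<tau>s: "0 \<le> \<tau> s"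
    and \<rho>: "\<And>j. j < s \<Longrightarrow> \<rho> \<le> prob (stay (\<tau> j) (b j))" and \<rho>1: "\<rho> \<le> 1"
    and e: "\<And>j. j < s \<Longrightarrow> 1 - prob (stay (\<tau> (Suc j)) (b j)) \<le> e"
  shows "{\<omega>\<in>space M. \<forall>j<s. \<omega> \<notin> fstay t (\<tau> j) (2 * b j)} \<in> events"
    and "prob {\<omega>\<in>space M. \<forall>j<s. \<omega> \<notin> fstay t (\<tau> j) (2 * b j)} \<le> (1 - \<rho>) ^ s + real s * e"
proof -
  have \<tau>0: "0 \<le> \<tau> j" if "j \<le> s" for j
    using that
  proof (induction rule: inc_induct)
    case (step n)
    then show ?case using mono[of n] by linarith
  qed (rule \<tau>s)
  let ?bad = "{\<omega>\<in>space M. \<forall>j<s. \<omega> \<notin> fstay t (\<tau> j) (2 * b j)}"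
  have *: "{\<omega>\<in>space M. \<forall>j<s. \<omega> \<notin> S j} \<in> events" if "\<And>j. j < s \<Longrightarrow> S j \<in> events" for S :: "nat \<Rightarrow> 'w set"
  proof -
    have "{\<omega>\<in>space M. \<forall>j<s. \<omega> \<notin> S j} = space M - (\<Union>j\<in>{..<s}. S j)" by auto
    then show ?thesis using that by auto
  qed
  show bad: "?bad \<in> events" using \<tau>0 t by (intro * fstay_events) auto
  define G where "G j = fstay (t + \<tau> (Suc j)) (\<tau> j - \<tau> (Suc j)) (b j)" for j
  define H where "H j = fstay t (\<tau> (Suc j)) (b j)" for j
  have GE: "G j \<in> events" if "j < s" for j
    unfolding G_def using that mono[of j] \<tau>0[of "Suc j"] t by (intro fstay_events) auto
  have HE: "H j \<in> events" if "j < s" for j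
    unfolding H_def using that \<tau>0[of "Suc j"] t by (intro fstay_events) auto
  \<comment> \<open>The displacement up to \<open>\<tau> (Suc j)\<close> and the further
    displacement inside the window are at most \<open>b j\<close> each.\<close>
  have sub: "G j \<inter> H j \<subseteq> fstay t (\<tau> j) (2 * b j)" if "j < s" for j
  proof
    fix \<omega> assume w: "\<omega> \<in> G j \<inter> H j"
    have "norm (X (t + u) \<omega> - X t \<omega>) \<le> 2 * b j" if u: "u \<in> {0..\<tau> j}" for u
    proof (cases "u \<le> \<tau> (Suc j)")
      case True
      then have "norm (X (t + u) \<omega> - X t \<omega>) \<le> b j" using w u by (auto simp: H_def intro: fstay_D)
      then show ?thesis using norm_ge_zero[of "X (t + u) \<omega> - X t \<omega>"] by linarith
    next
      case False
      have "norm (X (t + \<tau> (Suc j) + (u - \<tau> (Suc j))) \<omega> - X (t + \<tau> (Suc j)) \<omega>) \<le> b j"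
        using w u False by (intro fstay_D) (auto simp: G_def)
      moreover have "norm (X (t + \<tau> (Suc j)) \<omega> - X t \<omega>) \<le> b j"
        using w \<tau>0[of "Suc j"] \<open>j < s\<close> by (intro fstay_D[of _ t "\<tau> (Suc j)"]) (auto simp: H_def)
      ultimately show ?thesis
        using norm_triangle_ineq[of "X (t + u) \<omega> - X (t + \<tau> (Suc j)) \<omega>" "X (t + \<tau> (Suc j)) \<omega> - X t \<omega>"] by simp
    qed
    then show "\<omega> \<in> fstay t (\<tau> j) (2 * b j)" using w by (auto simp: fstay_def G_def)
  qed
  have "?bad \<subseteq> {\<omega>\<in>space M. \<forall>j<s. \<omega> \<notin> G j} \<union> (\<Union>j\<in>{..<s}. space M - H j)"
    using sub by auto
  then have "prob ?bad \<le> prob ({\<omega>\<in>space M. \<forall>j<s. \<omega> \<notin> G j} \<union> (\<Union>j\<in>{..<s}. space M - H j))"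
    using GE HE by (intro finite_measure_mono sets.Un * sets.finite_UN) auto
  also have "\<dots> \<le> prob {\<omega>\<in>space M. \<forall>j<s. \<omega> \<notin> G j} + prob (\<Union>j\<in>{..<s}. space M - H j)"
    using GE HE by (intro measure_Un_le * sets.finite_UN) auto
  also have "prob (\<Union>j\<in>{..<s}. space M - H j) \<le> (\<Sum>j\<in>{..<s}. prob (space M - H j))"
    using HE by (intro finite_measure_subadditive_finite) auto
  also have "\<dots> \<le> (\<Sum>j\<in>{..<s}. e)"
  proof (intro sum_mono)
    fix j assume j: "j \<in> {..<s}"
    have "prob (space M - H j) = 1 - prob (H j)" using HE j by (intro prob_compl) auto
    also have "prob (H j) = prob (stay (\<tau> (Suc j)) (b j))"
      unfolding H_def using t \<tau>0[of "Suc j"] j by (intro prob_fstay) auto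
    finally show "prob (space M - H j) \<le> e" using e[of j] j by simp
  qed
  also have "prob {\<omega>\<in>space M. \<forall>j<s. \<omega> \<notin> G j} \<le> (1 - \<rho>) ^ s"
    unfolding G_def
  proof (rule prob_windows[OF t mono \<tau>s _ \<rho>1])
    fix j assume j: "j < s"
    have "prob (stay (\<tau> j) (b j)) \<le> prob (stay (\<tau> j - \<tau> (Suc j)) (b j))"
      using mono[OF j] \<tau>0[of "Suc j"] j by (intro prob_stay_mono) auto
    then show "\<rho> \<le> prob (stay (\<tau> j - \<tau> (Suc j)) (b j))" using \<rho>[OF j] by simp
  qed
  finally show "prob ?bad \<le> (1 - \<rho>) ^ s + real s * e" by simp
qed

end

section \<open>Finite covers by balls, their cost, and the greedy choice\<close>

definition ball_cover :: "(real \<Rightarrow> real) \<Rightarrow> real \<Rightarrow> 'a::real_normed_vector set \<Rightarrow> real \<Rightarrow> bool" where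
  "ball_cover \<psi> r A v \<longleftrightarrow> (\<exists>xs. A \<subseteq> (\<Union>(z, \<rho>)\<in>set xs. cball z \<rho>) \<and>
     (\<forall>(z, \<rho>)\<in>set xs. 0 < \<rho> \<and> \<rho> \<le> r) \<and> (\<Sum>(z, \<rho>)\<leftarrow>xs. \<psi> \<rho>) \<le> v)"

lemma ball_cover_empty: "0 \<le> v \<Longrightarrow> ball_cover \<psi> r {} v"
  unfolding ball_cover_def by (intro exI[of _ "[]"]) auto

lemma ball_cover_mono: "ball_cover \<psi> r A v \<Longrightarrow> B \<subseteq> A \<Longrightarrow> v \<le> w \<Longrightarrow> ball_cover \<psi> r B w"
  unfolding ball_cover_def by (meson order_trans)

text \<open>Covers are lists, so concatenation adds the costs without any bookkeeping of repeated
  balls.\<close>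

lemma ball_cover_Un: "ball_cover \<psi> r A v \<Longrightarrow> ball_cover \<psi> r B w \<Longrightarrow> ball_cover \<psi> r (A \<union> B) (v + w)"
  unfolding ball_cover_def
proof (elim exE conjE)
  fix xs ys assume *: "A \<subseteq> (\<Union>(z, \<rho>)\<in>set xs. cball z \<rho>)" "B \<subseteq> (\<Union>(z, \<rho>)\<in>set ys. cball z \<rho>)"
    "\<forall>(z, \<rho>)\<in>set xs. 0 < \<rho> \<and> \<rho> \<le> r" "\<forall>(z, \<rho>)\<in>set ys. 0 < \<rho> \<and> \<rho> \<le> r"
    "(\<Sum>(z, \<rho>)\<leftarrow>xs. \<psi> \<rho>) \<le> v" "(\<Sum>(z, \<rho>)\<leftarrow>ys. \<psi> \<rho>) \<le> w"
  then show "\<exists>xs. A \<union> B \<subseteq> (\<Union>(z, \<rho>)\<in>set xs. cball z \<rho>) \<and>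
     (\<forall>(z, \<rho>)\<in>set xs. 0 < \<rho> \<and> \<rho> \<le> r) \<and> (\<Sum>(z, \<rho>)\<leftarrow>xs. \<psi> \<rho>) \<le> v + w"
    by (intro exI[of _ "xs @ ys"]) auto
qed

lemma ball_cover_cball: "0 < \<rho> \<Longrightarrow> \<rho> \<le> r \<Longrightarrow> ball_cover \<psi> r (cball z \<rho>) (\<psi> \<rho>)"
  unfolding ball_cover_def by (intro exI[of _ "[(z, \<rho>)]"]) auto

lemma ball_cover_finite:
  assumes "finite Z" "0 < \<rho>" "\<rho> \<le> r"
  shows "ball_cover \<psi> r (\<Union>z\<in>Z. cball z \<rho>) (real (card Z) * \<psi> \<rho>)"
  using assms
proof (induction Z rule: finite_induct)
  case (insert z Z)
  then have "ball_cover \<psi> r (cball z \<rho> \<union> (\<Union>z\<in>Z. cball z \<rho>)) (\<psi> \<rho> + real (card Z) * \<psi> \<rho>)"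
    by (intro ball_cover_Un ball_cover_cball) auto
  then show ?case using insert by (simp add: algebra_simps)
qed (simp add: ball_cover_empty)

text \<open>At the current cell either a cheap stretch is available and the procedure jumps to its
  end, or the cell is bad and is paid for by \<open>\<beta>\<close>. Stretches do not overlap, so
  their cost is proportional to total time; the last one may overshoot by up to \<open>m\<close>
  cells, which is the reason for \<open>N + 1 + m\<close>.\<close>

lemma greedy_ball_cover:
  fixes f :: "real \<Rightarrow> 'a::real_normed_vector"
  assumes h: "0 < h" and D: "0 \<le> D" and \<beta>: "0 \<le> \<beta>"
    and cell: "\<And>i. i \<le> N \<Longrightarrow>
      (\<exists>l. 1 \<le> l \<and> l \<le> m \<and> ball_cover \<psi> r (f ` {real i * h..<real (i + l) * h}) (D * (real l * h))) \<or>
      (i \<in> Bad \<and> ball_cover \<psi> r (f ` {real i * h..<real (i + 1) * h}) \<beta>)"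
    and m: "1 \<le> m"
  shows "i \<le> N + 1 + m \<Longrightarrow> ball_cover \<psi> r (f ` {real i * h..<real (N + 1) * h})
    (D * (real (N + 1 + m - i) * h) + \<beta> * real (card (Bad \<inter> {i..N})))"
proof (induction "N + 1 + m - i" arbitrary: i rule: less_induct)
  case less
  show ?case
  proof (cases "i \<le> N")
    case False
    then have "{real i * h..<real (N + 1) * h} = {}" using h by (auto simp: not_less)
    then show ?thesis using h D \<beta> by (auto intro!: ball_cover_empty add_nonneg_nonneg mult_nonneg_nonneg)
  next
    case True
    have split: "f ` {real i * h..<real (N + 1) * h} \<subseteq> f ` {real i * h..<real (i + l) * h} \<union> f ` {real (i + l) * h..<real (N + 1) * h}" for l
      unfolding image_Un[symmetric] by (intro image_mono) auto
    from cell[OF True] show ?thesis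
    proof (elim disjE exE conjE)
      fix l assume l: "1 \<le> l" "l \<le> m" "ball_cover \<psi> r (f ` {real i * h..<real (i + l) * h}) (D * (real l * h))"
      have IH: "ball_cover \<psi> r (f ` {real (i + l) * h..<real (N + 1) * h})
        (D * (real (N + 1 + m - (i + l)) * h) + \<beta> * real (card (Bad \<inter> {i + l..N})))"
        using l True by (intro less) auto
      have "card (Bad \<inter> {i + l..N}) \<le> card (Bad \<inter> {i..N})" by (intro card_mono) auto
      then have "\<beta> * real (card (Bad \<inter> {i + l..N})) \<le> \<beta> * real (card (Bad \<inter> {i..N}))"
        using \<beta> by (intro mult_left_mono) auto
      then have "D * (real (N + 1 + m - i) * h) + \<beta> * real (card (Bad \<inter> {i + l..N}))
          \<le> D * (real (N + 1 + m - i) * h) + \<beta> * real (card (Bad \<inter> {i..N}))"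
        by (rule add_left_mono)
      moreover have "D * (real l * h) + D * (real (N + 1 + m - (i + l)) * h) = D * (real (N + 1 + m - i) * h)"
      proof -
        have "real l + real (N + 1 + m - (i + l)) = real (N + 1 + m - i)" using l True by linarith
        then show ?thesis by (simp only: distrib_left[symmetric] distrib_right[symmetric])
      qed
      ultimately have "D * (real l * h) + (D * (real (N + 1 + m - (i + l)) * h) + \<beta> * real (card (Bad \<inter> {i + l..N})))
          \<le> D * (real (N + 1 + m - i) * h) + \<beta> * real (card (Bad \<inter> {i..N}))"
        by (simp only: add.assoc[symmetric])
      then show ?thesis
        by (rule ball_cover_mono[OF ball_cover_Un[OF l(3) IH] split[of l]])
    next
      assume b: "i \<in> Bad" "ball_cover \<psi> r (f ` {real i * h..<real (i + 1) * h}) \<beta>"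
      have IH: "ball_cover \<psi> r (f ` {real (i + 1) * h..<real (N + 1) * h})
        (D * (real (N + 1 + m - (i + 1)) * h) + \<beta> * real (card (Bad \<inter> {i + 1..N})))"
        using m True by (intro less) auto
      have "Bad \<inter> {i..N} = insert i (Bad \<inter> {i + 1..N})" using b True by auto
      then have "card (Bad \<inter> {i..N}) = Suc (card (Bad \<inter> {i + 1..N}))" by simp
      then have eq: "\<beta> + \<beta> * real (card (Bad \<inter> {i + 1..N})) = \<beta> * real (card (Bad \<inter> {i..N}))"
        by (simp only: of_nat_Suc distrib_left mult_1_right)
      have le: "D * (real (N + 1 + m - (i + 1)) * h) \<le> D * (real (N + 1 + m - i) * h)"
        using h D by (intro mult_left_mono mult_right_mono) auto
      have "\<beta> + (D * (real (N + 1 + m - (i + 1)) * h) + \<beta> * real (card (Bad \<inter> {i + 1..N})))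
          \<le> D * (real (N + 1 + m - i) * h) + \<beta> * real (card (Bad \<inter> {i..N}))"
        unfolding eq[symmetric] add.left_commute[of \<beta>] by (rule add_right_mono[OF le])
      then show ?thesis
        by (rule ball_cover_mono[OF ball_cover_Un[OF b(2) IH] split[of 1]])
    qed
  qed
qed

lemma nat_floor_ge_half:
  fixes x :: real
  assumes "1 \<le> x"
  shows "real (nat \<lfloor>x\<rfloor>) \<le> x" "x \<le> 2 * real (nat \<lfloor>x\<rfloor>)" "1 \<le> nat \<lfloor>x\<rfloor>"
proof -
  have f: "1 \<le> \<lfloor>x\<rfloor>" using assms by (simp add: le_floor_iff)
  then have e: "real (nat \<lfloor>x\<rfloor>) = of_int \<lfloor>x\<rfloor>" by simp
  have "(1::real) \<le> of_int \<lfloor>x\<rfloor>" using f by simp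
  then show "real (nat \<lfloor>x\<rfloor>) \<le> x" "x \<le> 2 * real (nat \<lfloor>x\<rfloor>)" unfolding e by linarith+
  show "1 \<le> nat \<lfloor>x\<rfloor>" using f by (simp add: le_nat_iff)
qed

context levy_path
begin

text \<open>
  The interval is split into cells of length \<open>h\<close>. A cell is bad if at none of the scales \<open>n j\<close> the path
  stays, during the following time \<open>\<tau> j\<close>, in a ball that is cheap for the gauge. Good stretches are covered
  greedily from the left by one ball each; a bad cell is covered by \<open>2 * k\<close> small balls.
\<close>

lemma cover_step:
  fixes s k :: nat and c \<alpha> \<gamma> K L l D :: real and \<psi> :: "real \<Rightarrow> real"
  assumes c: "1 < c" and s: "1 \<le> s" and L: "0 < L" and \<alpha>: "0 < \<alpha>"
    and l: "1 \<le> l" "l \<le> c ^ s"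
    and K: "0 \<le> K" and sb: "small_ball_bound c \<alpha> \<gamma> K L"
    and st: "\<And>n t. 0 < t \<Longrightarrow> t \<le> 1 \<Longrightarrow> 1 - prob (stay (t / c ^ n) (L * c powr (- real n / \<alpha>))) \<le> 2 * t"
    and D: "0 \<le> D"
    and \<psi>: "\<And>n. s * s \<le> n \<Longrightarrow> n \<le> 2 * (s * s) \<Longrightarrow> \<psi> (2 * (L * c powr (- real n / \<alpha>))) \<le> D * (l / c ^ n)"
  defines "\<beta> \<equiv> 2 * real k * (D * (l / c ^ (2 * (s * s))))"
    and "pb \<equiv> (1 - exp (- K * l powr \<gamma>)) ^ s + real s * (2 * (l / c ^ s))"
  shows "\<exists>\<Omega>\<in>events. 1 - (8 * c ^ (2 * (s * s)) * (1 / 2) ^ k + 8 * c ^ (2 * (s * s)) * (\<beta> * pb)) \<le> prob \<Omega> \<and>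
    (\<forall>\<omega>\<in>\<Omega>. ball_cover \<psi> (2 * (L * c powr (- real (s * s) / \<alpha>))) ((\<lambda>t. X t \<omega>) ` {0..1}) (6 * D + 1))"
proof -
  \<comment> \<open>The time unit at the finest scale is \<open>1 / Q\<close>. A cell is a quarter
    of it, so the number of cells is of order \<open>Q\<close>.\<close>
  define Q where "Q = c ^ (2 * (s * s))"
  define h where "h = 1 / (4 * Q)"
  define N where "N = nat \<lfloor>4 * Q\<rfloor>"
  \<comment> \<open>Consecutive scales differ by \<open>s\<close>, so \<open>\<tau> (Suc j)\<close>
    is at most the fraction \<open>l / c ^ s\<close> of the time unit of scale \<open>n j\<close>,
    and \<open>st\<close> applies to it.\<close>
  define n where "n j = s * (s + j)" for j
  define b where "b j = L * c powr (- real (n j) / \<alpha>)" for j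
  \<comment> \<open>For \<open>j \<le> s\<close> the argument of the floor is
    \<open>l / c ^ n j\<close> divided by \<open>h\<close>. Rounding makes every window a whole
    number of cells and loses at most a factor 2.\<close>
  define ell where "ell j = nat \<lfloor>4 * l * c ^ (s * (s - j))\<rfloor>" for j
  define \<tau> where "\<tau> j = real (ell j) * h" for j
  have Q1: "1 \<le> Q" using c by (simp add: Q_def)
  have h0: "0 < h" "h \<le> 1" using Q1 by (auto simp: h_def)
  have N: "real N \<le> 4 * Q" "4 * Q < real N + 1" using Q1 unfolding N_def by linarith+
  have N1: "1 < real (N + 1) * h" using N Q1 by (simp add: h_def field_simps)
  have N2: "real (N + 1) * h \<le> 2"
  proof -
    have "real (N + 1) \<le> 8 * Q" using N Q1 by simp
    then show ?thesis using Q1 by (simp add: h_def field_simps)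
  qed
  have b0: "0 < b j" for j using L c by (simp add: b_def)
  have b_anti: "b j \<le> b 0" for j
  proof -
    have "real (n 0) \<le> real (n j)" by (simp only: n_def of_nat_le_iff) simp
    then show ?thesis using L c \<alpha> unfolding b_def by (intro mult_left_mono powr_mono divide_right_mono) auto
  qed
  have Qn: "c ^ (s * (s - j)) / Q = 1 / c ^ n j" if "j \<le> s" for j
  proof -
    have "s * (s - j) + n j = 2 * (s * s)" using that by (simp add: n_def diff_mult_distrib2 add_mult_distrib2)
    then have "Q = c ^ (s * (s - j)) * c ^ n j" by (simp add: Q_def power_add[symmetric])
    then show ?thesis using c by simp
  qed
  have x1: "1 \<le> 4 * l * c ^ (s * (s - j))" for j
  proof -
    have "1 * 1 \<le> l * c ^ (s * (s - j))" using l(1) c by (intro mult_mono) auto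
    then show ?thesis by simp
  qed
  have ell: "real (ell j) \<le> 4 * l * c ^ (s * (s - j))" "4 * l * c ^ (s * (s - j)) \<le> 2 * real (ell j)" "1 \<le> ell j" for j
    unfolding ell_def by (rule nat_floor_ge_half[OF x1])+
  have \<tau>0: "0 < \<tau> j" for j using ell(3)[of j] h0 by (simp add: \<tau>_def)
  have \<tau>le: "\<tau> j \<le> l / c ^ n j" and \<tau>ge: "l / c ^ n j \<le> 2 * \<tau> j" if "j \<le> s" for j
  proof -
    have *: "4 * l * c ^ (s * (s - j)) * h = l / c ^ n j"
    proof -
      have "4 * l * c ^ (s * (s - j)) * h = l * (c ^ (s * (s - j)) / Q)" by (simp add: h_def)
      then show ?thesis unfolding Qn[OF that] by simp
    qed
    show "\<tau> j \<le> l / c ^ n j" unfolding \<tau>_def *[symmetric] using ell(1) h0 by (intro mult_right_mono) auto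
    show "l / c ^ n j \<le> 2 * \<tau> j"
      using mult_right_mono[OF ell(2)[of j], of h] h0 unfolding \<tau>_def *[symmetric] by simp
  qed
  have \<tau>_anti: "\<tau> (Suc j) \<le> \<tau> j" and ell_anti: "ell j \<le> ell 0" for j
  proof -
    have "c ^ (s * (s - Suc j)) \<le> c ^ (s * (s - j))" "c ^ (s * (s - j)) \<le> c ^ (s * (s - 0))"
      using c by (auto intro!: power_increasing mult_le_mono)
    then have "4 * l * c ^ (s * (s - Suc j)) \<le> 4 * l * c ^ (s * (s - j))" "4 * l * c ^ (s * (s - j)) \<le> 4 * l * c ^ (s * (s - 0))"
      using l(1) by (intro mult_left_mono; simp)+
    then have "ell (Suc j) \<le> ell j" "ell j \<le> ell 0" unfolding ell_def by (intro nat_mono floor_mono; simp)+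
    then show "\<tau> (Suc j) \<le> \<tau> j" "ell j \<le> ell 0" unfolding \<tau>_def using h0 by (auto intro!: mult_right_mono)
  qed
  define \<rho> where "\<rho> = exp (- K * l powr \<gamma>)"
  have \<rho>1: "\<rho> \<le> 1" using K by (simp add: \<rho>_def)
  have \<rho>: "\<rho> \<le> prob (stay (\<tau> j) (b j))" if "j < s" for j
  proof -
    have "\<rho> \<le> prob (stay (l / c ^ n j) (b j))"
      using sb l(1) unfolding small_ball_bound_def \<rho>_def b_def by auto
    also have "\<dots> \<le> prob (stay (\<tau> j) (b j))"
      using \<tau>le[of j] \<tau>0[of j] that by (intro prob_stay_mono) auto
    finally show ?thesis .
  qed
  have e: "1 - prob (stay (\<tau> (Suc j)) (b j)) \<le> 2 * (l / c ^ s)" if "j < s" for j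
  proof -
    have "n (Suc j) = n j + s" by (simp add: n_def)
    then have le: "\<tau> (Suc j) \<le> (l / c ^ s) / c ^ n j"
      using \<tau>le[of "Suc j"] that by (simp add: power_add mult.commute)
    have "1 - prob (stay ((l / c ^ s) / c ^ n j) (b j)) \<le> 2 * (l / c ^ s)"
      unfolding b_def using l c by (intro st) auto
    moreover have "prob (stay ((l / c ^ s) / c ^ n j) (b j)) \<le> prob (stay (\<tau> (Suc j)) (b j))"
      using le \<tau>0[of "Suc j"] by (intro prob_stay_mono) auto
    ultimately show ?thesis by linarith
  qed
  define bad where "bad i = {\<omega>\<in>space M. \<forall>j<s. \<omega> \<notin> fstay (real i * h) (\<tau> j) (2 * b j)}" for i :: nat
  have badE: "bad i \<in> events" and badp: "prob (bad i) \<le> pb" for i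
  proof -
    have t: "0 \<le> real i * h" using h0 by simp
    show "bad i \<in> events" unfolding bad_def
      by (rule prob_bad_start(1)[where \<tau> = \<tau> and b = b and s = s, OF t \<tau>_anti less_imp_le[OF \<tau>0] \<rho> \<rho>1 e])
    show "prob (bad i) \<le> pb" unfolding bad_def pb_def \<rho>_def[symmetric]
      by (rule prob_bad_start(2)[where \<tau> = \<tau> and b = b and s = s, OF t \<tau>_anti less_imp_le[OF \<tau>0] \<rho> \<rho>1 e])
  qed
  \<comment> \<open>A cell is a quarter of the finest time unit, so the linear bound gives
    \<open>2 * (1 / 4)\<close>. This is the ratio of the geometric tail for covering a bad
    cell.\<close>
  have qh: "1 - prob (stay h (b s)) \<le> 1 / 2"
  proof -
    have "n s = 2 * (s * s)" by (simp add: n_def)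
    then have "h = (1 / 4) / c ^ n s" by (simp add: h_def Q_def)
    then show ?thesis using st[of "1/4" "n s"] by (simp add: b_def)
  qed
  have "\<exists>Nn\<in>events. prob Nn \<le> (1 / 2) ^ k \<and>
    (\<forall>\<omega>\<in>space M - Nn. \<exists>Z. finite Z \<and> card Z \<le> 2 * k \<and> (\<lambda>t. X t \<omega>) ` {real i * h..real i * h + h} \<subseteq> (\<Union>z\<in>Z. cball z (2 * b s)))" for i :: nat
    using h0 b0 qh by (intro prob_cover) auto
  then obtain Nn where Nn: "\<And>i::nat. Nn i \<in> events" "\<And>i. prob (Nn i) \<le> (1 / 2) ^ k"
    "\<And>i \<omega>. \<omega> \<in> space M - Nn i \<Longrightarrow> \<exists>Z. finite Z \<and> card Z \<le> 2 * k \<and> (\<lambda>t. X t \<omega>) ` {real i * h..real i * h + h} \<subseteq> (\<Union>z\<in>Z. cball z (2 * b s))"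
    by metis
  \<comment> \<open>The number of bad cells. Only its expectation is controlled, and Markov's
    inequality bounds the probability that the bad cells together cost 1 or more.\<close>
  define Y where "Y \<omega> = (\<Sum>i\<le>N. indicat_real (bad i) \<omega>)" for \<omega>
  define U where "U = (\<Union>i\<le>N. Nn i)"
  define W where "W = {\<omega>\<in>space M. 1 \<le> \<beta> * Y \<omega>}"
  have \<beta>0: "0 \<le> \<beta>" using D l c by (simp add: \<beta>_def)
  have pb0: "0 \<le> pb" using badp[of 0] measure_nonneg[of M "bad 0"] by linarith
  have N8: "real (N + 1) \<le> 8 * Q" using N Q1 by simp
  have UE: "U \<in> events" unfolding U_def using Nn(1) by (intro sets.finite_UN) auto
  have Up: "prob U \<le> 8 * Q * (1 / 2) ^ k"
  proof -
    have "prob U \<le> (\<Sum>i\<le>N. prob (Nn i))" unfolding U_def using Nn(1) by (intro finite_measure_subadditive_finite) auto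
    also have "\<dots> \<le> (\<Sum>i\<le>N. (1 / 2) ^ k)" by (intro sum_mono Nn(2))
    also have "\<dots> = real (N + 1) * (1 / 2) ^ k" by simp
    also have "\<dots> \<le> 8 * Q * (1 / 2) ^ k" using N8 by (intro mult_right_mono) auto
    finally show ?thesis .
  qed
  have Ym: "Y \<in> borel_measurable M" unfolding Y_def using badE by (intro borel_measurable_sum borel_measurable_indicator) auto
  have WE: "W \<in> events" unfolding W_def using Ym by measurable
  have Wp: "prob W \<le> 8 * Q * (\<beta> * pb)"
  proof -
    have int: "integrable M (\<lambda>\<omega>. \<beta> * Y \<omega>)"
      unfolding Y_def using badE by (intro integrable_mult_right integrable_sum integrable_real_indicator) (auto simp: emeasure_eq_measure)
    have "prob W \<le> (\<integral>\<omega>. \<beta> * Y \<omega> \<partial>M) / 1"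
      unfolding W_def using int \<beta>0 by (intro integral_Markov_inequality_measure[where A = "{}"]) (auto simp: Y_def sum_nonneg)
    also have "(\<integral>\<omega>. \<beta> * Y \<omega> \<partial>M) = \<beta> * (\<Sum>i\<le>N. prob (bad i))"
      unfolding Y_def using badE by (subst integral_mult_right_zero, subst Bochner_Integration.integral_sum) (auto simp: emeasure_eq_measure)
    also have "\<dots> \<le> \<beta> * (\<Sum>i\<le>N. pb)" using \<beta>0 by (intro mult_left_mono sum_mono badp)
    also have "\<dots> = real (N + 1) * (\<beta> * pb)" by simp
    also have "\<dots> \<le> 8 * Q * (\<beta> * pb)" using N8 \<beta>0 pb0 by (intro mult_right_mono) auto
    finally show ?thesis by simp
  qed
  define \<Omega> where "\<Omega> = space M - (U \<union> W)"
  have \<Omega>E: "\<Omega> \<in> events" unfolding \<Omega>_def using UE WE by auto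
  have "prob \<Omega> = 1 - prob (U \<union> W)" unfolding \<Omega>_def using UE WE by (intro prob_compl) auto
  moreover have "prob (U \<union> W) \<le> prob U + prob W" using UE WE by (intro measure_Un_le)
  ultimately have \<Omega>p: "1 - (8 * Q * (1 / 2) ^ k + 8 * Q * (\<beta> * pb)) \<le> prob \<Omega>" using Up Wp by linarith
  have "ball_cover \<psi> (2 * b 0) ((\<lambda>t. X t \<omega>) ` {0..1}) (6 * D + 1)" if w: "\<omega> \<in> \<Omega>" for \<omega>
  proof -
    have ws: "\<omega> \<in> space M" using w by (simp add: \<Omega>_def)
    define Bad where "Bad = {i. \<omega> \<in> bad i}"
    have cell: "(\<exists>m. 1 \<le> m \<and> m \<le> ell 0 \<and> ball_cover \<psi> (2 * b 0) ((\<lambda>t. X t \<omega>) ` {real i * h..<real (i + m) * h}) ((2 * D) * (real m * h))) \<or>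
      (i \<in> Bad \<and> ball_cover \<psi> (2 * b 0) ((\<lambda>t. X t \<omega>) ` {real i * h..<real (i + 1) * h}) \<beta>)" if i: "i \<le> N" for i
    proof (cases "\<omega> \<in> bad i")
      case False
      then obtain j where j: "j < s" "\<omega> \<in> fstay (real i * h) (\<tau> j) (2 * b j)" using ws by (auto simp: bad_def)
      have sub: "(\<lambda>t. X t \<omega>) ` {real i * h..<real (i + ell j) * h} \<subseteq> cball (X (real i * h) \<omega>) (2 * b j)"
      proof
        fix y assume "y \<in> (\<lambda>t. X t \<omega>) ` {real i * h..<real (i + ell j) * h}"
        then obtain t where t: "real i * h \<le> t" "t < real (i + ell j) * h" "y = X t \<omega>" by auto
        have "norm (X (real i * h + (t - real i * h)) \<omega> - X (real i * h) \<omega>) \<le> 2 * b j"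
          using t by (intro fstay_D[OF j(2)]) (auto simp: \<tau>_def algebra_simps)
        then show "y \<in> cball (X (real i * h) \<omega>) (2 * b j)" by (simp add: t(3) dist_norm norm_minus_commute)
      qed
      have nj: "s * s \<le> n j" "n j \<le> 2 * (s * s)"
      proof -
        have "s * (s + j) \<le> s * (2 * s)" by (intro mult_le_mono2) (use j(1) in linarith)
        then show "n j \<le> 2 * (s * s)" by (simp add: n_def mult.left_commute)
        show "s * s \<le> n j" unfolding n_def by (intro mult_le_mono2) simp
      qed
      have "\<psi> (2 * b j) \<le> D * (l / c ^ n j)" unfolding b_def by (rule \<psi>[OF nj])
      also have "\<dots> \<le> D * (2 * \<tau> j)" using \<tau>ge[of j] j(1) D by (intro mult_left_mono) auto
      finally have "\<psi> (2 * b j) \<le> (2 * D) * (real (ell j) * h)" by (simp add: \<tau>_def mult_ac)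
      then have "ball_cover \<psi> (2 * b 0) ((\<lambda>t. X t \<omega>) ` {real i * h..<real (i + ell j) * h}) ((2 * D) * (real (ell j) * h))"
        using b0[of j] b_anti[of j] by (intro ball_cover_mono[OF ball_cover_cball sub]) auto
      then show ?thesis using ell(3)[of j] ell_anti[of j] by blast
    next
      case True
      have "\<omega> \<in> space M - Nn i" using w i by (auto simp: \<Omega>_def U_def)
      from Nn(3)[OF this] obtain Z where Z: "finite Z" "card Z \<le> 2 * k"
        "(\<lambda>t. X t \<omega>) ` {real i * h..real i * h + h} \<subseteq> (\<Union>z\<in>Z. cball z (2 * b s))" by auto
      have sub: "(\<lambda>t. X t \<omega>) ` {real i * h..<real (i + 1) * h} \<subseteq> (\<Union>z\<in>Z. cball z (2 * b s))"
      proof (rule order_trans[OF image_mono Z(3)])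
        have "real (i + 1) * h = real i * h + h" by (simp add: distrib_right)
        then show "{real i * h..<real (i + 1) * h} \<subseteq> {real i * h..real i * h + h}" by auto
      qed
      have "\<psi> (2 * b s) \<le> D * (l / Q)"
      proof -
        have "n s = 2 * (s * s)" by (simp add: n_def)
        then show ?thesis using \<psi>[of "n s"] unfolding b_def Q_def by simp
      qed
      then have "real (card Z) * \<psi> (2 * b s) \<le> real (card Z) * (D * (l / Q))" by (intro mult_left_mono) auto
      also have "\<dots> \<le> real (2 * k) * (D * (l / Q))"
        using Z(2) D l Q1 by (intro mult_right_mono mult_nonneg_nonneg divide_nonneg_nonneg) auto
      also have "\<dots> = \<beta>" by (simp add: \<beta>_def Q_def)
      finally have "ball_cover \<psi> (2 * b 0) ((\<lambda>t. X t \<omega>) ` {real i * h..<real (i + 1) * h}) \<beta>"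
        using b0[of s] b_anti[of s] by (intro ball_cover_mono[OF ball_cover_finite[OF Z(1)] sub]) auto
      then show ?thesis using True by (simp add: Bad_def)
    qed
    have "ball_cover \<psi> (2 * b 0) ((\<lambda>t. X t \<omega>) ` {real 0 * h..<real (N + 1) * h})
      ((2 * D) * (real (N + 1 + ell 0 - 0) * h) + \<beta> * real (card (Bad \<inter> {0..N})))"
      using D by (intro greedy_ball_cover[OF h0(1) _ \<beta>0 cell ell(3)]) auto
    moreover have "(\<lambda>t. X t \<omega>) ` {0..1} \<subseteq> (\<lambda>t. X t \<omega>) ` {real 0 * h..<real (N + 1) * h}"
      using N1 by (intro image_mono) auto
    \<comment> \<open>The cells have total length at most 2 and the overshoot is at most 1, at cost
      \<open>2 * D\<close> per unit of time; the bad cells contribute at most 1.\<close>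
    moreover have "(2 * D) * (real (N + 1 + ell 0 - 0) * h) + \<beta> * real (card (Bad \<inter> {0..N})) \<le> 6 * D + 1"
    proof -
      have "Y \<omega> = real (card (Bad \<inter> {0..N}))"
      proof -
        have "Y \<omega> = (\<Sum>i\<in>{0..N}. if i \<in> Bad then 1 else 0)"
          unfolding Y_def by (intro sum.cong) (auto simp: Bad_def)
        also have "\<dots> = real (card (Bad \<inter> {0..N}))" by (simp add: sum.If_cases Int_commute)
        finally show ?thesis .
      qed
      moreover have "\<beta> * Y \<omega> \<le> 1" using w ws by (auto simp: \<Omega>_def W_def)
      moreover have "real (ell 0) * h \<le> 1"
      proof -
        have "l \<le> c ^ n 0" using l(2) s c by (intro order_trans[OF l(2) power_increasing]) (auto simp: n_def)
        then have "l / c ^ n 0 \<le> 1" using c by simp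
        then show ?thesis using \<tau>le[of 0] by (simp add: \<tau>_def)
      qed
      then have "real (N + 1 + ell 0 - 0) * h \<le> 3" using N2 by (simp add: algebra_simps)
      then have "(2 * D) * (real (N + 1 + ell 0 - 0) * h) \<le> (2 * D) * 3" using D by (intro mult_left_mono) auto
      then have "(2 * D) * (real (N + 1 + ell 0 - 0) * h) \<le> 6 * D" by simp
      ultimately show ?thesis by (metis add_mono)
    qed
    ultimately show ?thesis by (rule ball_cover_mono)
  qed
  moreover have "b 0 = L * c powr (- real (s * s) / \<alpha>)" unfolding b_def n_def add_0_right by (rule refl)
  ultimately have "\<forall>\<omega>\<in>\<Omega>. ball_cover \<psi> (2 * (L * c powr (- real (s * s) / \<alpha>))) ((\<lambda>t. X t \<omega>) ` {0..1}) (6 * D + 1)"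
    by (intro ballI) (simp only:)
  with \<Omega>p \<Omega>E show ?thesis unfolding Q_def by blast
qed

end

section \<open>Choice of the parameters and passage to arbitrarily small radii\<close>

lemma ball_cover_radius_mono: "ball_cover \<psi> r A v \<Longrightarrow> r \<le> r' \<Longrightarrow> ball_cover \<psi> r' A v"
  unfolding ball_cover_def
proof (elim exE conjE)
  fix xs assume *: "A \<subseteq> (\<Union>(z, \<rho>)\<in>set xs. cball z \<rho>)" "\<forall>(z, \<rho>)\<in>set xs. 0 < \<rho> \<and> \<rho> \<le> r" "(\<Sum>(z, \<rho>)\<leftarrow>xs. \<psi> \<rho>) \<le> v" and r: "r \<le> r'"
  have "\<forall>(z, \<rho>)\<in>set xs. 0 < \<rho> \<and> \<rho> \<le> r'" using *(2) r by auto
  with *(1,3) show "\<exists>xs. A \<subseteq> (\<Union>(z, \<rho>)\<in>set xs. cball z \<rho>) \<and> (\<forall>(z, \<rho>)\<in>set xs. 0 < \<rho> \<and> \<rho> \<le> r') \<and> (\<Sum>(z, \<rho>)\<leftarrow>xs. \<psi> \<rho>) \<le> v" by blast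
qed

text \<open>For all scales in the range, \<open>ln (1 / r)\<close> is of order \<open>s * s\<close>,
  hence at most \<open>s ^ 3\<close> eventually, so \<open>ln (ln (1 / r)) \<le> 3 * ln s\<close>.
  One lingering factor, of order \<open>ln s powr \<theta>\<close>, therefore matches the gauge at
  all these scales at once.\<close>

lemma gauge_scale_bound:
  fixes \<alpha> \<theta> B c L \<kappa> r0 :: real
  assumes c: "1 < c" and \<alpha>: "0 < \<alpha>" and \<theta>: "0 < \<theta>" and \<kappa>: "0 < \<kappa>" and L: "0 < L" and r0: "0 < r0" and B: "0 \<le> B"
    and \<psi>: "\<And>r. 0 < r \<Longrightarrow> r < r0 \<Longrightarrow> \<psi> r \<le> B * r powr \<alpha> * ln (ln (1 / r)) powr \<theta>"
  shows "\<forall>\<^sub>F s in sequentially. \<forall>n. s * s \<le> n \<longrightarrow> n \<le> 2 * (s * s) \<longrightarrow>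
    \<psi> (2 * (L * c powr (- real n / \<alpha>))) \<le> B * (2 * L) powr \<alpha> * (3 / \<kappa>) powr \<theta> * ((\<kappa> * ln (real s)) powr \<theta> / c ^ n)"
proof -
  define a where "a = ln c / \<alpha>"
  have a: "0 < a" using c \<alpha> by (simp add: a_def)
  have e1: "\<forall>\<^sub>F s in sequentially. 1 \<le> a * real s ^ 2 - ln (2 * L)" using a by real_asymp
  have e2: "\<forall>\<^sub>F s in sequentially. 2 * a * real s ^ 2 - ln (2 * L) \<le> real s ^ 3" using a by real_asymp
  have e3: "\<forall>\<^sub>F s in sequentially. ln (1 / r0) < a * real s ^ 2 - ln (2 * L)" using a by real_asymp
  show ?thesis
    using e1 e2 e3 eventually_ge_at_top[of 3]
  proof eventually_elim
    case (elim s)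
    show ?case
    proof (intro allI impI)
      fix n assume n: "s * s \<le> n" "n \<le> 2 * (s * s)"
      define r where "r = 2 * (L * c powr (- real n / \<alpha>))"
      have r: "0 < r" using L c by (simp add: r_def)
      have lr: "ln (1 / r) = a * real n - ln (2 * L)"
        using L c by (simp add: r_def ln_div ln_mult ln_powr a_def)
      have n': "real s ^ 2 \<le> real n" "real n \<le> 2 * real s ^ 2"
      proof -
        have "real (s * s) \<le> real n" using n(1) by (rule of_nat_mono)
        moreover have "real n \<le> real (2 * (s * s))" using n(2) by (rule of_nat_mono)
        ultimately show "real s ^ 2 \<le> real n" "real n \<le> 2 * real s ^ 2" by (simp_all add: power2_eq_square)
      qed
      have b1: "a * real s ^ 2 \<le> a * real n" "a * real n \<le> 2 * a * real s ^ 2"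
        using mult_left_mono[OF n'(1), of a] mult_left_mono[OF n'(2), of a] a by simp_all
      have l1: "1 \<le> ln (1 / r)" "ln (1 / r) \<le> real s ^ 3" "ln (1 / r0) < ln (1 / r)"
        using b1 elim unfolding lr by linarith+
      have "r < r0" using l1(3) r r0 by (simp add: ln_div)
      have ll: "0 \<le> ln (ln (1 / r))" using l1(1) by simp
      have "ln (ln (1 / r)) \<le> ln (real s ^ 3)" using l1 elim by (subst ln_le_cancel_iff) auto
      also have "\<dots> = (3 / \<kappa>) * (\<kappa> * ln (real s))" using \<kappa> elim by (simp add: ln_realpow)
      finally have "ln (ln (1 / r)) powr \<theta> \<le> ((3 / \<kappa>) * (\<kappa> * ln (real s))) powr \<theta>"
        using ll \<theta> by (intro powr_mono2) auto
      also have "\<dots> = (3 / \<kappa>) powr \<theta> * (\<kappa> * ln (real s)) powr \<theta>"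
        by (rule powr_mult)
      finally have A: "ln (ln (1 / r)) powr \<theta> \<le> (3 / \<kappa>) powr \<theta> * (\<kappa> * ln (real s)) powr \<theta>" .
      have "r powr \<alpha> = (2 * L) powr \<alpha> * (c powr (- real n / \<alpha>)) powr \<alpha>"
        unfolding r_def mult.assoc[symmetric] by (rule powr_mult)
      also have "(c powr (- real n / \<alpha>)) powr \<alpha> = 1 / c ^ n"
      proof -
        have "(c powr (- real n / \<alpha>)) powr \<alpha> = c powr - real n" using \<alpha> by (simp only: powr_powr) simp
        then show ?thesis using c by (simp add: powr_minus_divide powr_realpow)
      qed
      finally have R: "r powr \<alpha> = (2 * L) powr \<alpha> * (1 / c ^ n)" .
      have "\<psi> r \<le> B * r powr \<alpha> * ln (ln (1 / r)) powr \<theta>" by (rule \<psi>[OF r \<open>r < r0\<close>])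
      also have "\<dots> \<le> B * r powr \<alpha> * ((3 / \<kappa>) powr \<theta> * (\<kappa> * ln (real s)) powr \<theta>)"
        using B by (intro mult_left_mono[OF A]) auto
      also have "\<dots> = B * (2 * L) powr \<alpha> * (3 / \<kappa>) powr \<theta> * ((\<kappa> * ln (real s)) powr \<theta> / c ^ n)"
        unfolding R by simp
      finally show "\<psi> (2 * (L * c powr (- real n / \<alpha>))) \<le> B * (2 * L) powr \<alpha> * (3 / \<kappa>) powr \<theta> * ((\<kappa> * ln (real s)) powr \<theta> / c ^ n)"
        unfolding r_def .
    qed
  qed
qed

context levy_path
begin

text \<open>The union of the events from any index on has probability at least that of each of them,
  hence 1. Infinitely many good \<open>s\<close> suffice, as covers are only asked for at
  arbitrarily small radii.\<close>

lemma AE_infinitely_often: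
  assumes \<Omega>: "\<And>s. s0 \<le> s \<Longrightarrow> \<Omega> s \<in> events" and g: "\<And>s. s0 \<le> s \<Longrightarrow> 1 - g s \<le> prob (\<Omega> s)" and g0: "g \<longlonglongrightarrow> (0::real)"
  shows "AE \<omega> in M. \<forall>n. \<exists>s\<ge>n. s0 \<le> s \<and> \<omega> \<in> \<Omega> (s::nat)"
proof -
  have "AE \<omega> in M. \<exists>s\<ge>n. s0 \<le> s \<and> \<omega> \<in> \<Omega> s" for n
  proof -
    define U where "U = (\<Union>s\<in>{max n s0..}. \<Omega> s)"
    have U: "U \<in> events" unfolding U_def using \<Omega> by (intro sets.countable_UN') auto
    have "1 - g s \<le> prob U" if "max n s0 \<le> s" for s
      using g[of s] that \<Omega> U by (intro order_trans[OF g finite_measure_mono]) (auto simp: U_def)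
    moreover have "(\<lambda>s. 1 - g s) \<longlonglongrightarrow> 1 - 0" by (intro tendsto_diff tendsto_const g0)
    ultimately have "1 - 0 \<le> prob U" by (intro LIMSEQ_le_const2[of "\<lambda>s. 1 - g s"] exI[of _ "max n s0"]) auto
    then have "prob U = 1" using prob_le_1[of U] by linarith
    then have "AE \<omega> in M. \<omega> \<in> U" using U by (simp add: prob_eq_1)
    then show ?thesis by eventually_elim (auto simp: U_def)
  qed
  then show ?thesis by (simp add: AE_all_countable)
qed

text \<open>The number of cells, of order \<open>Q\<close>, cancels against the time unit
  \<open>1 / Q\<close> in the cost of a bad cell, so the expected cost of bad cells is polynomial in
  \<open>s\<close> times \<open>pb\<close>. Since \<open>pb\<close> is at most
  \<open>exp (- sqrt s)\<close> plus a term decaying exponentially in \<open>s\<close>, this tends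
  to 0.\<close>

theorem ball_cover_AE:
  fixes c \<alpha> \<theta> K L B r0 :: real and \<psi> :: "real \<Rightarrow> real"
  assumes c: "1 < c" and \<alpha>: "0 < \<alpha>" and \<theta>: "0 < \<theta>" "\<theta> \<le> 1" and K: "0 < K" and L: "0 < L"
    and sb: "small_ball_bound c \<alpha> (1 / \<theta>) K L"
    and st: "\<And>n t. 0 < t \<Longrightarrow> t \<le> 1 \<Longrightarrow> 1 - prob (stay (t / c ^ n) (L * c powr (- real n / \<alpha>))) \<le> 2 * t"
    and r0: "0 < r0" and B: "0 \<le> B"
    and \<psi>: "\<And>r. 0 < r \<Longrightarrow> r < r0 \<Longrightarrow> \<psi> r \<le> B * r powr \<alpha> * ln (ln (1 / r)) powr \<theta>"
  shows "\<exists>V. AE \<omega> in M. \<forall>r>0. ball_cover \<psi> r ((\<lambda>t. X t \<omega>) ` {0..1}) V"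
proof -
  \<comment> \<open>With this choice \<open>exp (- K * l s powr (1 / \<theta>))\<close> is exactly
    \<open>1 / sqrt s\<close>, and \<open>s\<close> independent trials fail with probability at most
    \<open>exp (- sqrt s)\<close>.\<close>
  define \<kappa> where "\<kappa> = 1 / (2 * K)"
  have \<kappa>: "0 < \<kappa>" using K by (simp add: \<kappa>_def)
  define l where "l s = (\<kappa> * ln (real s)) powr \<theta>" for s :: nat
  define D where "D = B * (2 * L) powr \<alpha> * (3 / \<kappa>) powr \<theta>"
  have D: "0 \<le> D" using B by (simp add: D_def)
  \<comment> \<open>With \<open>k = m0 * (s * s)\<close> the exceptional probability
    \<open>(1 / 2) ^ k\<close> of one cell is at most \<open>1 / (Q * Q)\<close>, small enough for a
    union bound over all cells.\<close>
  obtain m0 :: nat where m0: "c ^ 4 \<le> 2 ^ m0" using real_arch_pow[of 2 "c ^ 4"] by (auto intro: less_imp_le)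
  define a where "a = ln c"
  have a: "0 < a" using c by (simp add: a_def)
  have cs: "c ^ n = exp (a * real n)" for n using c by (simp add: a_def exp_of_nat2_mult)
  define g where "g s = 8 / exp (a * real s) + 16 * real m0 * D * real s ^ 3 * (exp (- sqrt (real s)) + 2 * real s ^ 2 / exp (a * real s))" for s :: nat
  have g0: "g \<longlonglongrightarrow> 0"
  proof -
    have 1: "(\<lambda>s::nat. 8 / exp (a * real s)) \<longlonglongrightarrow> 0" using a by real_asymp
    have 2: "(\<lambda>s::nat. real s ^ 3 * (exp (- sqrt (real s)) + 2 * real s ^ 2 / exp (a * real s))) \<longlonglongrightarrow> 0" using a by real_asymp
    show ?thesis unfolding g_def
      using tendsto_add[OF 1 tendsto_mult[OF tendsto_const[of "16 * real m0 * D"] 2]] by (simp add: mult.assoc)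
  qed
  have "\<forall>\<^sub>F s in sequentially. \<exists>\<Omega>\<in>events. 1 - g s \<le> prob \<Omega> \<and>
    (\<forall>\<omega>\<in>\<Omega>. ball_cover \<psi> (2 * (L * c powr (- real (s * s) / \<alpha>))) ((\<lambda>t. X t \<omega>) ` {0..1}) (6 * D + 1))"
  proof -
    have e1: "\<forall>\<^sub>F s in sequentially. 1 \<le> \<kappa> * ln (real s)" using \<kappa> by real_asymp
    have e2: "\<forall>\<^sub>F s in sequentially. \<kappa> * ln (real s) \<le> real s" using \<kappa> by real_asymp
    have e3: "\<forall>\<^sub>F s in sequentially. real s \<le> exp (a * real s)" using a by real_asymp
    have e5: "\<forall>\<^sub>F s in sequentially. \<forall>n. s * s \<le> n \<longrightarrow> n \<le> 2 * (s * s) \<longrightarrow>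
        \<psi> (2 * (L * c powr (- real n / \<alpha>))) \<le> D * (l s / c ^ n)"
      unfolding D_def l_def by (rule gauge_scale_bound[OF c \<alpha> \<theta>(1) \<kappa> L r0 B]) (rule \<psi>)
    show ?thesis
      using e1 e2 e3 eventually_ge_at_top[of 1] e5
    proof eventually_elim
      case (elim s)
      have l1: "1 \<le> l s" unfolding l_def using elim(1) \<theta> by (intro ge_one_powr_ge_zero) auto
      have "l s \<le> (\<kappa> * ln (real s)) powr 1" unfolding l_def using elim(1) \<theta> by (intro powr_mono) auto
      then have l2: "l s \<le> real s" using elim(1,2) by simp
      have l3: "l s \<le> c ^ s" using l2 elim(3) by (simp add: cs)
      define k where "k = m0 * (s * s)"
      define Q where "Q = c ^ (2 * (s * s))"
      have Q1: "1 \<le> Q" using c by (simp add: Q_def)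
      define pb where "pb = (1 - exp (- K * l s powr (1 / \<theta>))) ^ s + real s * (2 * (l s / c ^ s))"
      define \<beta> where "\<beta> = 2 * real k * (D * (l s / Q))"
      have \<psi>': "\<psi> (2 * (L * c powr (- real n / \<alpha>))) \<le> D * (l s / c ^ n)"
        if "s * s \<le> n" "n \<le> 2 * (s * s)" for n
        using elim(5) that by blast
      have step: "\<exists>\<Omega>\<in>events. 1 - (8 * Q * (1 / 2) ^ k + 8 * Q * (\<beta> * pb)) \<le> prob \<Omega> \<and>
        (\<forall>\<omega>\<in>\<Omega>. ball_cover \<psi> (2 * (L * c powr (- real (s * s) / \<alpha>))) ((\<lambda>t. X t \<omega>) ` {0..1}) (6 * D + 1))"
        unfolding Q_def \<beta>_def pb_def
        by (rule cover_step[OF c elim(4) L \<alpha> l1 l3 less_imp_le[OF K] sb st D \<psi>'])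
      have A: "8 * Q * (1 / 2) ^ k \<le> 8 / exp (a * real s)"
      proof -
        have "(1 / 2 :: real) ^ k = 1 / (2 ^ m0) ^ (s * s)" unfolding k_def power_mult by (simp add: power_one_over)
        also have "\<dots> \<le> 1 / (c ^ 4) ^ (s * s)" using m0 c by (intro divide_left_mono power_mono) auto
        also have "\<dots> = 1 / (Q * Q)" by (simp add: Q_def flip: power_mult power_add)
        finally have "8 * Q * (1 / 2) ^ k \<le> 8 * Q * (1 / (Q * Q))" using Q1 by (intro mult_left_mono) auto
        also have "\<dots> = 8 / Q" using Q1 by simp
        also have "\<dots> \<le> 8 / c ^ s"
        proof -
          have "s \<le> 2 * (s * s)" by (cases s) auto
          then have "c ^ s \<le> Q" unfolding Q_def using c by (intro power_increasing) auto
          then show ?thesis using c Q1 by (intro divide_left_mono mult_pos_pos) auto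
        qed
        finally show ?thesis by (simp add: cs)
      qed
      have pb: "pb \<le> exp (- sqrt (real s)) + 2 * real s ^ 2 / exp (a * real s)"
      proof -
        define \<rho> where "\<rho> = exp (- K * l s powr (1 / \<theta>))"
        have "l s powr (1 / \<theta>) = \<kappa> * ln (real s)" using elim(1) \<theta> by (simp add: l_def powr_powr)
        then have "\<rho> = exp (- (ln (real s) / 2))" using K by (simp add: \<rho>_def \<kappa>_def)
        also have "\<dots> = 1 / sqrt (real s)" using elim(4) by (simp add: exp_minus ln_sqrt[symmetric] inverse_eq_divide)
        finally have \<rho>: "\<rho> = 1 / sqrt (real s)" .
        have "\<rho> \<le> 1" using elim(4) by (simp add: \<rho>)
        then have "(1 - \<rho>) ^ s \<le> exp (- \<rho>) ^ s" using exp_ge_add_one_self[of "- \<rho>"] by (intro power_mono) auto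
        also have "\<dots> = exp (- (real s * \<rho>))" by (simp add: exp_of_nat_mult[symmetric])
        also have "real s * \<rho> = sqrt (real s)" by (simp add: \<rho> real_div_sqrt)
        finally have 1: "(1 - \<rho>) ^ s \<le> exp (- sqrt (real s))" .
        have "real s * (2 * (l s / c ^ s)) \<le> real s * (2 * (real s / c ^ s))"
          using l2 c by (intro mult_left_mono divide_right_mono) auto
        also have "\<dots> = 2 * real s ^ 2 / exp (a * real s)" by (simp add: cs power2_eq_square)
        finally show ?thesis using 1 unfolding pb_def \<rho>_def by linarith
      qed
      have Bb: "8 * Q * (\<beta> * pb) \<le> 16 * real m0 * D * real s ^ 3 * (exp (- sqrt (real s)) + 2 * real s ^ 2 / exp (a * real s))"
      proof -
        have "8 * Q * (\<beta> * pb) = 16 * real k * D * l s * pb" using Q1 by (simp add: \<beta>_def)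
        also have "\<dots> \<le> 16 * real k * D * l s * (exp (- sqrt (real s)) + 2 * real s ^ 2 / exp (a * real s))"
          using D l1 by (intro mult_left_mono[OF pb]) auto
        also have "\<dots> \<le> 16 * real k * D * real s * (exp (- sqrt (real s)) + 2 * real s ^ 2 / exp (a * real s))"
          using D l2 by (intro mult_right_mono mult_left_mono) auto
        also have "\<dots> = 16 * real m0 * D * real s ^ 3 * (exp (- sqrt (real s)) + 2 * real s ^ 2 / exp (a * real s))"
          by (simp add: k_def power3_eq_cube)
        finally show ?thesis .
      qed
      have "1 - g s \<le> 1 - (8 * Q * (1 / 2) ^ k + 8 * Q * (\<beta> * pb))" using A Bb unfolding g_def by linarith
      with step show ?case by (meson order_trans)
    qed
  qed
  then obtain s0 where s0: "\<And>s. s0 \<le> s \<Longrightarrow> \<exists>\<Omega>\<in>events. 1 - g s \<le> prob \<Omega> \<and>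
    (\<forall>\<omega>\<in>\<Omega>. ball_cover \<psi> (2 * (L * c powr (- real (s * s) / \<alpha>))) ((\<lambda>t. X t \<omega>) ` {0..1}) (6 * D + 1))"
    by (auto simp: eventually_sequentially)
  then obtain \<Omega> where \<Omega>: "\<And>s. s0 \<le> s \<Longrightarrow> \<Omega> s \<in> events" "\<And>s. s0 \<le> s \<Longrightarrow> 1 - g s \<le> prob (\<Omega> s)"
    "\<And>s \<omega>. s0 \<le> s \<Longrightarrow> \<omega> \<in> \<Omega> s \<Longrightarrow> ball_cover \<psi> (2 * (L * c powr (- real (s * s) / \<alpha>))) ((\<lambda>t. X t \<omega>) ` {0..1}) (6 * D + 1)"
    by metis
  have "AE \<omega> in M. \<forall>n. \<exists>s\<ge>n. s0 \<le> s \<and> \<omega> \<in> \<Omega> s" by (rule AE_infinitely_often[OF \<Omega>(1,2) g0])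
  then have "AE \<omega> in M. \<forall>r>0. ball_cover \<psi> r ((\<lambda>t. X t \<omega>) ` {0..1}) (6 * D + 1)"
  proof eventually_elim
    case (elim \<omega>)
    show ?case
    proof (intro allI impI)
      fix r :: real assume r: "0 < r"
      define a' where "a' = a / \<alpha>"
      have a': "0 < a'" using a \<alpha> by (simp add: a'_def)
      have "(\<lambda>s. 2 * (L * exp (- a' * real s ^ 2))) \<longlonglongrightarrow> 0" using a' by real_asymp
      then have "\<forall>\<^sub>F s in sequentially. 2 * (L * exp (- a' * real s ^ 2)) < r" using r by (intro order_tendstoD(2)) auto
      then obtain n where n: "\<And>s. n \<le> s \<Longrightarrow> 2 * (L * exp (- a' * real s ^ 2)) < r" by (auto simp: eventually_sequentially)
      obtain s where s: "n \<le> s" "s0 \<le> s" "\<omega> \<in> \<Omega> s" using elim by blast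
      have "c powr (- real (s * s) / \<alpha>) = exp (- a' * real s ^ 2)"
        using c by (simp add: powr_def a'_def a_def power2_eq_square)
      then have "2 * (L * c powr (- real (s * s) / \<alpha>)) \<le> r" using n[OF s(1)] by (simp only: less_imp_le)
      then show "ball_cover \<psi> r ((\<lambda>t. X t \<omega>) ` {0..1}) (6 * D + 1)"
        by (rule ball_cover_radius_mono[OF \<Omega>(3)[OF s(2,3)]])
    qed
  qed
  then show ?thesis by blast
qed

end

section \<open>Hausdorff measure\<close>

text \<open>Compactness of the Euclidean unit sphere. The comparison links the Euclidean balls of
  the probabilistic estimates to diameters and sojourn times in \<open>ip\<close>.\<close>

lemma ip_norm_equiv:
  fixes ip :: "'a::euclidean_space \<Rightarrow> 'a \<Rightarrow> real"
  assumes ip: "inner_product ip"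
  shows "continuous_on UNIV (ip_norm ip)" "\<exists>c1>0. \<exists>c2>0. \<forall>x. c1 * norm x \<le> ip_norm ip x \<and> ip_norm ip x \<le> c2 * norm x"
proof -
  have bl: "bilinear ip" and pos: "\<And>x. x \<noteq> 0 \<Longrightarrow> 0 < ip x x" using ip by (auto simp: inner_product_def)
  have bb: "bounded_bilinear ip" using bl by (simp add: bilinear_conv_bounded_bilinear)
  have cont: "continuous_on UNIV (\<lambda>x. ip x x)"
    by (rule bounded_bilinear.continuous_on[OF bb]) (auto intro: continuous_intros)
  show c: "continuous_on UNIV (ip_norm ip)" unfolding ip_norm_def using cont by (intro continuous_intros)
  have sc: "ip_norm ip (a *\<^sub>R x) = \<bar>a\<bar> * ip_norm ip x" for a x
  proof -
    have "ip (a *\<^sub>R x) (a *\<^sub>R x) = a\<^sup>2 * ip x x"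
      using bounded_bilinear.scaleR_left[OF bb] bounded_bilinear.scaleR_right[OF bb] by (simp add: power2_eq_square)
    then show ?thesis by (simp add: ip_norm_def real_sqrt_mult)
  qed
  have ne: "sphere (0::'a) 1 \<noteq> {}" by simp
  have comp: "compact (sphere (0::'a) 1)" by simp
  have c': "continuous_on (sphere 0 1) (ip_norm ip)" using c by (rule continuous_on_subset) simp
  obtain u where u: "u \<in> sphere 0 1" "\<And>x. x \<in> sphere 0 1 \<Longrightarrow> ip_norm ip u \<le> ip_norm ip x"
    using continuous_attains_inf[OF comp ne c'] by auto
  obtain v where v: "v \<in> sphere 0 1" "\<And>x. x \<in> sphere 0 1 \<Longrightarrow> ip_norm ip x \<le> ip_norm ip v"
    using continuous_attains_sup[OF comp ne c'] by auto
  have pu: "0 < ip_norm ip u" using pos[of u] norm_zero[where 'a = 'a] u(1) by (cases "u = 0") (auto simp: ip_norm_def)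
  have pv: "0 < ip_norm ip v" using pos[of v] norm_zero[where 'a = 'a] v(1) by (cases "v = 0") (auto simp: ip_norm_def)
  have "ip_norm ip u * norm x \<le> ip_norm ip x \<and> ip_norm ip x \<le> ip_norm ip v * norm x" for x
  proof (cases "x = 0")
    case True
    then show ?thesis using sc[of 0 0] by simp
  next
    case False
    define y where "y = (1 / norm x) *\<^sub>R x"
    have y: "y \<in> sphere 0 1" and x: "x = norm x *\<^sub>R y" using False by (auto simp: y_def)
    have "ip_norm ip x = norm x * ip_norm ip y" by (subst x) (simp add: sc)
    then show ?thesis using u(2)[OF y] v(2)[OF y] by (simp add: mult.commute mult_left_mono)
  qed
  then show "\<exists>c1>0. \<exists>c2>0. \<forall>x. c1 * norm x \<le> ip_norm ip x \<and> ip_norm ip x \<le> c2 * norm x"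
    using pu pv by blast
qed

lemma ip_norm_le_diam: "x \<in> F \<Longrightarrow> y \<in> F \<Longrightarrow> ennreal (ip_norm ip (x - y)) \<le> ip_diam ip F"
  unfolding ip_diam_def by (intro SUP_upper2[of x] SUP_upper2[of y]) auto

lemma ip_diam_cball:
  assumes c2: "\<And>x. ip_norm ip x \<le> c2 * norm x" "0 < c2" and r: "0 \<le> r"
  shows "ip_diam ip (cball z r) \<le> ennreal (2 * c2 * r)"
  unfolding ip_diam_def
proof (intro SUP_least ennreal_leI)
  fix x y assume "x \<in> cball z r" "y \<in> cball z r"
  then have "norm (x - z) \<le> r" "norm (y - z) \<le> r" by (auto simp: dist_norm norm_minus_commute)
  then have "norm ((x - z) - (y - z)) \<le> r + r" by (rule norm_triangle_le_diff[OF add_mono])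
  then have n: "norm (x - y) \<le> 2 * r" by simp
  have "ip_norm ip (x - y) \<le> c2 * norm (x - y)" by (rule c2)
  also have "\<dots> \<le> c2 * (2 * r)" using n c2(2) by (intro mult_left_mono) auto
  finally show "ip_norm ip (x - y) \<le> 2 * c2 * r" by (simp add: mult_ac)
qed

text \<open>A Euclidean ball of radius \<open>r\<close> has diameter at most
  \<open>2 * c2 * r\<close> in \<open>ip\<close>, whence the argument of \<open>\<phi>\<close> in
  the cost. Monotonicity of \<open>\<phi>\<close> takes care of smaller diameters, and the finite
  cover is filled up with empty sets.\<close>

lemma hausdorff_measure_le:
  fixes A :: "'a::euclidean_space set"
  assumes c2: "\<And>x. ip_norm ip x \<le> c2 * norm x" "0 < c2"
    and \<delta>: "0 < \<delta>" and mono: "mono_on {0<..<\<delta>} \<phi>" and nn: "\<And>r. 0 < r \<Longrightarrow> r < \<delta> \<Longrightarrow> 0 \<le> \<phi> r"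
    and cov: "\<And>r. 0 < r \<Longrightarrow> ball_cover (\<lambda>r. \<phi> (2 * c2 * r)) r A V"
  shows "hausdorff_measure ip \<phi> A \<le> ennreal V"
  unfolding hausdorff_measure_eq_SUP
proof (rule SUP_least)
  fix \<epsilon> :: real assume "\<epsilon> \<in> {0<..}"
  then have \<epsilon>: "0 < \<epsilon>" by simp
  define r where "r = min \<epsilon> \<delta> / (4 * c2)"
  have r: "0 < r" using \<epsilon> \<delta> c2(2) by (simp add: r_def)
  have r2: "2 * c2 * r < \<epsilon>" "2 * c2 * r < \<delta>" using \<epsilon> \<delta> c2(2) by (auto simp: r_def)
  obtain xs where xs: "A \<subseteq> (\<Union>(z, \<rho>)\<in>set xs. cball z \<rho>)" "\<And>z \<rho>. (z, \<rho>) \<in> set xs \<Longrightarrow> 0 < \<rho> \<and> \<rho> \<le> r"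
    "(\<Sum>(z, \<rho>)\<leftarrow>xs. \<phi> (2 * c2 * \<rho>)) \<le> V"
    using cov[OF r] unfolding ball_cover_def by fast
  define C where "C i = (if i < length xs then cball (fst (xs ! i)) (snd (xs ! i)) else {})" for i
  have e: "ip_diam ip ({} :: 'a set) = 0" by (simp add: ip_diam_def bot_ennreal)
  have xi: "0 < snd (xs ! i)" "snd (xs ! i) \<le> r" if "i < length xs" for i
    using xs(2)[of "fst (xs ! i)" "snd (xs ! i)"] that by auto
  have d: "ip_diam ip (C i) \<le> ennreal (2 * c2 * snd (xs ! i))" if "i < length xs" for i
    using that xi[OF that] ip_diam_cball[OF c2, of "snd (xs ! i)"] by (simp add: C_def)
  have lt: "2 * c2 * snd (xs ! i) < min \<epsilon> \<delta>" if "i < length xs" for i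
  proof -
    have "2 * c2 * snd (xs ! i) \<le> 2 * c2 * r" using xi[OF that] c2(2) by (intro mult_left_mono) auto
    then show ?thesis using r2 by simp
  qed
  have g: "gauge_value \<phi> (ip_diam ip (C i)) \<le> (if i < length xs then ennreal (\<phi> (2 * c2 * snd (xs ! i))) else 0)" for i
  proof (cases "i < length xs \<and> ip_diam ip (C i) \<noteq> 0")
    case True
    define D where "D = enn2real (ip_diam ip (C i))"
    have D: "ip_diam ip (C i) = ennreal D" using d[of i] True unfolding D_def
      by (metis ennreal_enn2real_if ennreal_less_top neq_top_trans ennreal_neq_top)
    have "0 < D" using True D by (cases "D \<le> 0") (auto simp: ennreal_neg)
    moreover have "D \<le> 2 * c2 * snd (xs ! i)" using d[of i] True D xi[of i] c2(2) by (simp add: ennreal_le_iff)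
    ultimately have "\<phi> D \<le> \<phi> (2 * c2 * snd (xs ! i))" using lt[of i] True by (intro mono_onD[OF mono]) auto
    then show ?thesis using True by (simp add: gauge_value_def D_def ennreal_leI)
  next
    case False
    then have "ip_diam ip (C i) = 0" by (auto simp: C_def e)
    then show ?thesis by (simp add: gauge_value_def)
  qed
  have "(\<Sum>i. gauge_value \<phi> (ip_diam ip (C i))) \<le> (\<Sum>i. if i < length xs then ennreal (\<phi> (2 * c2 * snd (xs ! i))) else 0)"
    by (intro suminf_le g) auto
  also have "\<dots> = (\<Sum>i<length xs. ennreal (\<phi> (2 * c2 * snd (xs ! i))))"
    by (subst suminf_finite[of "{..<length xs}"]) auto
  also have "\<dots> = ennreal (\<Sum>i<length xs. \<phi> (2 * c2 * snd (xs ! i)))"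
  proof (rule sum_ennreal)
    fix i assume "i \<in> {..<length xs}"
    then show "0 \<le> \<phi> (2 * c2 * snd (xs ! i))" using xi[of i] lt[of i] c2(2) by (intro nn) auto
  qed
  also have "(\<Sum>i<length xs. \<phi> (2 * c2 * snd (xs ! i))) = (\<Sum>(z, \<rho>)\<leftarrow>xs. \<phi> (2 * c2 * \<rho>))"
    by (simp add: sum_list_sum_nth case_prod_beta atLeast0LessThan)
  finally have le: "(\<Sum>i. gauge_value \<phi> (ip_diam ip (C i))) \<le> ennreal V" using xs(3) by (meson ennreal_leI order_trans)
  have "A \<subseteq> (\<Union>i. C i)"
  proof
    fix x assume "x \<in> A"
    then obtain z \<rho> where z: "(z, \<rho>) \<in> set xs" "x \<in> cball z \<rho>" using xs(1) by fast
    then obtain i where "i < length xs" "xs ! i = (z, \<rho>)" by (metis in_set_conv_nth)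
    then have "x \<in> C i" using z(2) by (simp add: C_def)
    then show "x \<in> (\<Union>i. C i)" by blast
  qed
  moreover have "ip_diam ip (C i) < ennreal \<epsilon>" for i
  proof (cases "i < length xs")
    case True
    then show ?thesis using lt[OF True] \<epsilon> by (intro le_less_trans[OF d]) (auto simp: ennreal_less_iff c2(2) xi less_imp_le)
  next
    case False then show ?thesis using \<epsilon> by (simp add: C_def e)
  qed
  ultimately show "hausdorff_premeasure ip \<phi> A \<epsilon> \<le> ennreal V"
    unfolding hausdorff_premeasure_def by (intro Inf_lower2[OF _ le]) blast
qed

text \<open>
  A set of positive length on which the occupation measure seen from the future is bounded by the
  gauge forces positive Hausdorff measure: for each covering set look at the first time in the
  good set at which it is visited. Only the forward sojourn time enters, so no time reversal is needed.
\<close>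

lemma hausdorff_measure_pos:
  fixes f :: "real \<Rightarrow> 'a::euclidean_space"
  assumes f: "f \<in> borel_measurable borel" and ip: "inner_product ip"
    and G: "G \<in> sets borel" "G \<subseteq> {0..1}" "1 / 2 \<le> measure lborel G"
    and C0: "0 < C0" and r0: "0 < r0" and \<phi>: "(\<phi> \<longlongrightarrow> 0) (at_right 0)"
    and bound: "\<And>t r. t \<in> G \<Longrightarrow> 0 < r \<Longrightarrow> r \<le> r0 \<Longrightarrow>
      measure lborel {s\<in>{0..1}. ip_norm ip (f (t + s) - f t) \<le> r} \<le> C0 * \<phi> r"
  shows "0 < hausdorff_measure ip \<phi> (f ` {0..1})"
proof -
  define S where "S t r = {s\<in>{0..1}. ip_norm ip (f (t + s) - f t) \<le> r}" for t r
  have ipm: "ip_norm ip \<in> borel_measurable borel" using ip_norm_equiv(1)[OF ip] by (rule borel_measurable_continuous_onI)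
  have Sm: "S t r \<in> sets borel" for t r
  proof -
    have "(\<lambda>s. f (t + s)) \<in> borel_measurable borel" by (rule measurable_compose[OF _ f]) simp
    then have "(\<lambda>s. ip_norm ip (f (t + s) - f t)) \<in> borel_measurable borel"
      by (intro measurable_compose[OF _ ipm]) simp
    then have "{s. ip_norm ip (f (t + s) - f t) \<le> r} \<in> sets borel" by measurable
    moreover have "S t r = {0..1} \<inter> {s. ip_norm ip (f (t + s) - f t) \<le> r}" by (auto simp: S_def)
    ultimately show ?thesis by auto
  qed
  have Sfin: "emeasure lborel (S t r) = ennreal (measure lborel (S t r))" for t r
  proof (rule emeasure_eq_ennreal_measure)
    have "emeasure lborel (S t r) \<le> emeasure lborel {0..1::real}" by (intro emeasure_mono) (auto simp: S_def)
    then show "emeasure lborel (S t r) \<noteq> top" by (auto simp: top_unique)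
  qed
  \<comment> \<open>The error allows for two defects: the first visit to \<open>F\<close> need not
    be attained, and a set of diameter 0 has gauge value 0 while \<open>bound\<close> asks for a
    positive radius. The set \<open>B\<close> is there because \<open>F\<close> is arbitrary and its
    visiting times need not be measurable.\<close>
  have one: "\<exists>B\<in>sets borel. {t\<in>G. f t \<in> F} \<subseteq> B \<and> emeasure lborel B \<le> ennreal C0 * gauge_value \<phi> (ip_diam ip F) + ennreal (2 * \<eta>)"
    if F: "ip_diam ip F < ennreal r0" and \<eta>: "0 < \<eta>" for F \<eta>
  proof (cases "{t\<in>G. f t \<in> F} = {}")
    case True then show ?thesis by (intro bexI[of _ "{}"]) auto
  next
    case False
    define A where "A = {t\<in>G. f t \<in> F}"
    have A: "A \<noteq> {}" "bdd_below A" using False G(2) by (auto simp: A_def intro!: bdd_belowI[of _ 0])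
    obtain t where t: "t \<in> A" "t < Inf A + \<eta>" using cInf_lessD[OF A(1), of "Inf A + \<eta>"] \<eta> by auto
    define d where "d = enn2real (ip_diam ip F)"
    have d: "ip_diam ip F = ennreal d" "0 \<le> d" unfolding d_def using F
      by (auto simp: ennreal_enn2real_if top_unique)
    have dr0: "d < r0" using F d r0 by (simp add: ennreal_less_iff)
    have "\<exists>r. d \<le> r \<and> 0 < r \<and> r \<le> r0 \<and> ennreal (C0 * \<phi> r) \<le> ennreal C0 * gauge_value \<phi> (ip_diam ip F) + ennreal \<eta>"
    proof (cases "d = 0")
      case False
      then show ?thesis using d dr0 C0
        by (intro exI[of _ d]) (auto simp: gauge_value_def ennreal_mult' intro: order_trans[OF _ add_increasing2])
    next
      case True
      have "\<forall>\<^sub>F r in at_right 0. \<phi> r < \<eta> / C0" using order_tendstoD(2)[OF \<phi>, of "\<eta> / C0"] \<eta> C0 by simp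
      then obtain b where b: "0 < b" "\<And>r. 0 < r \<Longrightarrow> r < b \<Longrightarrow> \<phi> r < \<eta> / C0" by (auto simp: eventually_at_right_field)
      define r where "r = min (b / 2) r0"
      have r: "0 < r" "r \<le> r0" "r < b" using b(1) r0 by (auto simp: r_def)
      have "C0 * \<phi> r \<le> \<eta>" using b(2)[OF r(1,3)] C0 by (simp add: field_simps)
      then have "ennreal (C0 * \<phi> r) \<le> ennreal C0 * gauge_value \<phi> (ip_diam ip F) + ennreal \<eta>"
        by (intro order_trans[OF ennreal_leI add_increasing]) auto
      then show ?thesis using r(1,2) True by (intro exI[of _ r]) simp
    qed
    then obtain r where r: "d \<le> r" "0 < r" "r \<le> r0" "ennreal (C0 * \<phi> r) \<le> ennreal C0 * gauge_value \<phi> (ip_diam ip F) + ennreal \<eta>" by auto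
    define B where "B = {Inf A..Inf A + \<eta>} \<union> (\<lambda>s. s - t) -` S t r"
    have tr: "(\<lambda>s. s - t) -` S t r \<in> sets borel" using measurable_sets[of "\<lambda>s. s - t" borel borel, OF _ Sm] by simp
    have B: "B \<in> sets borel" unfolding B_def using tr by simp
    have "A \<subseteq> B"
    proof
      fix s assume s: "s \<in> A"
      have sI: "Inf A \<le> s" using A(2) s by (simp add: cInf_lower)
      show "s \<in> B"
      proof (cases "s \<le> t")
        case True then show ?thesis using sI t(2) by (auto simp: B_def)
      next
        case False
        have "ennreal (ip_norm ip (f s - f t)) \<le> ennreal d" unfolding d(1)[symmetric]
          using s t(1) by (intro ip_norm_le_diam) (auto simp: A_def)
        then have "ip_norm ip (f s - f t) \<le> d" using d(2) by (simp add: ennreal_le_iff)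
        moreover have "s \<le> 1" "0 \<le> t" using s t(1) G(2) by (auto simp: A_def)
        ultimately have "s - t \<in> S t r" using False r(1) by (auto simp: S_def)
        then show ?thesis by (simp add: B_def)
      qed
    qed
    moreover have "emeasure lborel B \<le> ennreal C0 * gauge_value \<phi> (ip_diam ip F) + ennreal (2 * \<eta>)"
    proof -
      have "emeasure lborel B \<le> emeasure lborel {Inf A..Inf A + \<eta>} + emeasure lborel ((\<lambda>s. s - t) -` S t r)"
        unfolding B_def using tr by (intro emeasure_subadditive) auto
      also have "emeasure lborel {Inf A..Inf A + \<eta>} = ennreal \<eta>" using \<eta> by simp
      also have "emeasure lborel ((\<lambda>s. s - t) -` S t r) = emeasure (distr lborel borel ((+) (- t))) (S t r)"
        using Sm by (subst emeasure_distr) (auto intro!: arg_cong[where f = "emeasure lborel"])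
      also have "distr lborel borel ((+) (- t)) = lborel" by (rule lborel_distr_plus)
      also have "emeasure lborel (S t r) \<le> ennreal (C0 * \<phi> r)"
        unfolding Sfin unfolding S_def using t(1) r by (intro ennreal_leI bound) (auto simp: A_def)
      also have "ennreal \<eta> + ennreal (C0 * \<phi> r) \<le> ennreal \<eta> + (ennreal C0 * gauge_value \<phi> (ip_diam ip F) + ennreal \<eta>)"
        using r(4) by (rule add_left_mono)
      also have "\<dots> = ennreal C0 * gauge_value \<phi> (ip_diam ip F) + ennreal (2 * \<eta>)"
        using \<eta> by (simp add: ac_simps ennreal_plus[symmetric] del: ennreal_plus)
      finally show ?thesis by (simp add: add_left_mono)
    qed
    ultimately show ?thesis using B unfolding A_def by blast
  qed
  have "ennreal (1 / (4 * C0)) \<le> hausdorff_premeasure ip \<phi> (f ` {0..1}) r0"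
  proof -
    have "ennreal (1 / (4 * C0)) \<le> (\<Sum>i. gauge_value \<phi> (ip_diam ip (C i)))"
      if C: "f ` {0..1} \<subseteq> (\<Union>i. C i)" "\<And>i. ip_diam ip (C i) < ennreal r0" for C :: "nat \<Rightarrow> 'a set"
    proof -
      have "\<forall>i. \<exists>B. B \<in> sets borel \<and> {t\<in>G. f t \<in> C i} \<subseteq> B \<and> emeasure lborel B \<le> ennreal C0 * gauge_value \<phi> (ip_diam ip (C i)) + ennreal (2 * (1 / 16 * (1/2) ^ i))"
      proof
        fix i :: nat
        have "0 < 1 / 16 * (1 / 2 :: real) ^ i" by simp
        from one[OF C(2)[of i] this]
        show "\<exists>B. B \<in> sets borel \<and> {t\<in>G. f t \<in> C i} \<subseteq> B \<and> emeasure lborel B \<le> ennreal C0 * gauge_value \<phi> (ip_diam ip (C i)) + ennreal (2 * (1 / 16 * (1/2) ^ i))"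
          unfolding Bex_def .
      qed
      from choice[OF this] obtain B where B': "\<forall>i. B i \<in> sets borel \<and> {t\<in>G. f t \<in> C i} \<subseteq> B i \<and>
        emeasure lborel (B i) \<le> ennreal C0 * gauge_value \<phi> (ip_diam ip (C i)) + ennreal (2 * (1 / 16 * (1/2) ^ i))" by (elim exE)
      have B: "\<And>i. B i \<in> sets borel" "\<And>i. {t\<in>G. f t \<in> C i} \<subseteq> B i"
        "\<And>i. emeasure lborel (B i) \<le> ennreal C0 * gauge_value \<phi> (ip_diam ip (C i)) + ennreal (2 * (1 / 16 * (1/2) ^ i))"
        using B' by blast+
      have GB: "G \<subseteq> (\<Union>i. B i)"
      proof
        fix t assume t: "t \<in> G"
        then have "f t \<in> f ` {0..1}" using G(2) by (intro imageI) auto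
        then obtain i where "f t \<in> C i" using C(1) by (elim subsetD[THEN UN_E]) 
        then have "t \<in> B i" using B(2)[of i] t by (intro subsetD[OF B(2)]) simp
        then show "t \<in> (\<Union>i. B i)" by (rule UN_I[OF UNIV_I])
      qed
      have "emeasure lborel G \<le> emeasure lborel {0..1::real}" using G(2) by (intro emeasure_mono) auto
      then have "emeasure lborel G = ennreal (measure lborel G)"
        by (intro emeasure_eq_ennreal_measure) (auto simp: top_unique)
      then have "ennreal (1 / 2) \<le> emeasure lborel G" by (simp only: ennreal_leI[OF G(3)])
      also have "\<dots> \<le> emeasure lborel (\<Union>i. B i)" using GB B(1) by (intro emeasure_mono) auto
      also have "\<dots> \<le> (\<Sum>i. emeasure lborel (B i))" using B(1) by (intro emeasure_subadditive_countably) auto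
      also have "\<dots> \<le> (\<Sum>i. ennreal C0 * gauge_value \<phi> (ip_diam ip (C i)) + ennreal (2 * (1 / 16 * (1/2) ^ i)))"
        by (intro suminf_le B(3)) auto
      also have "\<dots> = (\<Sum>i. ennreal C0 * gauge_value \<phi> (ip_diam ip (C i))) + (\<Sum>i. ennreal (2 * (1 / 16 * (1/2) ^ i)))"
        by (intro suminf_add[symmetric]) auto
      \<comment> \<open>The errors use up only half of the length \<open>1 / 2\<close> guaranteed
        for \<open>G\<close>; the other half bounds the cost of the cover from below.\<close>
      also have "(\<Sum>i. ennreal (2 * (1 / 16 * (1/2) ^ i))) = ennreal (1 / 4)"
      proof -
        have "(\<lambda>i. 2 * (1 / 16 * (1/2::real) ^ i)) sums (2 * (1 / 16 * (1 / (1 - 1 / 2))))"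
          by (intro sums_mult geometric_sums) auto
        then have "(\<lambda>i. 2 * (1 / 16 * (1/2::real) ^ i)) sums (1 / 4)" by simp
        then show ?thesis by (subst suminf_ennreal_eq) auto
      qed
      also have "(\<Sum>i. ennreal C0 * gauge_value \<phi> (ip_diam ip (C i))) = ennreal C0 * (\<Sum>i. gauge_value \<phi> (ip_diam ip (C i)))"
        by simp
      finally have le: "ennreal (1 / 2) \<le> ennreal C0 * (\<Sum>i. gauge_value \<phi> (ip_diam ip (C i))) + ennreal (1 / 4)" .
      have "ennreal (1 / 2) = ennreal (1 / 4 + 1 / 4)" by (rule arg_cong[where f = ennreal]) simp
      also have "\<dots> = ennreal (1 / 4) + ennreal (1 / 4)" by (rule ennreal_plus) simp_all
      finally have half: "ennreal (1 / 2) = ennreal (1 / 4) + ennreal (1 / 4)" .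
      have "ennreal (1 / 4) + ennreal (1 / 4) \<le> ennreal (1 / 4) + ennreal C0 * (\<Sum>i. gauge_value \<phi> (ip_diam ip (C i)))"
        using le unfolding half by (simp only: add.commute)
      then have "ennreal (1 / 4) \<le> ennreal C0 * (\<Sum>i. gauge_value \<phi> (ip_diam ip (C i)))"
        unfolding ennreal_add_left_cancel_le by simp
      also have "ennreal (1 / 4) = ennreal C0 * ennreal (1 / (4 * C0))"
      proof -
        have "1 / 4 = C0 * (1 / (4 * C0))" using C0 by simp
        then show ?thesis using C0 by (simp only: ennreal_mult'[OF less_imp_le[OF C0]])
      qed
      finally show ?thesis using C0 by (subst (asm) ennreal_mult_le_mult_iff) simp_all
    qed
    note main = this
    show ?thesis unfolding hausdorff_premeasure_def
    proof (rule Inf_greatest)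
      fix x assume "x \<in> {(\<Sum>i. gauge_value \<phi> (ip_diam ip (C i))) |C.
        f ` {0..1} \<subseteq> (\<Union>i. C i) \<and> (\<forall>i. ip_diam ip (C i) < ennreal r0)}"
      then obtain C where x: "x = (\<Sum>i. gauge_value \<phi> (ip_diam ip (C i)))"
        and C: "f ` {0..1} \<subseteq> (\<Union>i. C i)" "\<forall>i. ip_diam ip (C i) < ennreal r0" by blast
      show "ennreal (1 / (4 * C0)) \<le> x" unfolding x by (rule main[OF C(1) C(2)[rule_format]])
    qed
  qed
  moreover have "0 < ennreal (1 / (4 * C0))" unfolding ennreal_less_zero_iff using C0 by simp
  ultimately have p: "0 < hausdorff_premeasure ip \<phi> (f ` {0..1}) r0" by (rule less_le_trans[rotated])
  have r0': "r0 \<in> {0<..}" using r0 by simp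
  show ?thesis unfolding hausdorff_measure_eq_SUP by (rule less_le_trans[OF p], rule SUP_upper, rule r0')
qed

section \<open>Occupation times\<close>

text \<open>The added 1 places the dyadic point strictly to the right of \<open>max 0 s\<close>, as
  a limit along \<open>at_right\<close> requires. The maximum extends the construction to negative
  times.\<close>

definition dyadic_up :: "nat \<Rightarrow> real \<Rightarrow> real" where
  "dyadic_up n s = (of_int \<lfloor>2 ^ n * max 0 s\<rfloor> + 1) / 2 ^ n"

lemma dyadic_up_bounds: "max 0 s < dyadic_up n s" "dyadic_up n s \<le> max 0 s + 1 / 2 ^ n"
proof -
  define m where "m = max 0 s"
  define q where "q = (2::real) ^ n"
  have q: "0 < q" by (simp add: q_def)
  have "m * q < of_int \<lfloor>q * m\<rfloor> + 1" "of_int \<lfloor>q * m\<rfloor> \<le> m * q" unfolding mult.commute[of m] by linarith+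
  then have "m < (of_int \<lfloor>q * m\<rfloor> + 1) / q" "(of_int \<lfloor>q * m\<rfloor> + 1) / q \<le> m + 1 / q"
    using q by (simp_all only: pos_less_divide_eq pos_divide_le_eq distrib_right) simp
  then show "max 0 s < dyadic_up n s" "dyadic_up n s \<le> max 0 s + 1 / 2 ^ n"
    unfolding dyadic_up_def m_def q_def by blast+
qed

text \<open>Evaluation is not jointly measurable on the full product space of paths. This limit
  reads countably many coordinates only, is jointly measurable, and agrees with evaluation on
  right-continuous paths.\<close>

definition rc_value :: "(real \<Rightarrow> 'a::euclidean_space) \<Rightarrow> real \<Rightarrow> 'a" where
  "rc_value w s = lim (\<lambda>n. w (dyadic_up n s))"

lemma rc_value_eq:
  assumes "(f \<longlongrightarrow> f (max 0 s)) (at_right (max 0 s))" and "\<And>u. 0 \<le> u \<Longrightarrow> w u = f u"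
  shows "rc_value w s = f (max 0 s)"
proof -
  have gt: "max 0 s < dyadic_up n s" for n by (rule dyadic_up_bounds(1))
  have lim: "(\<lambda>n. dyadic_up n s) \<longlonglongrightarrow> max 0 s"
  proof (rule tendsto_sandwich[OF _ _ tendsto_const])
    have "(\<lambda>n. 1 / 2 ^ n :: real) \<longlonglongrightarrow> 0" by real_asymp
    from tendsto_add[OF tendsto_const[of "max 0 s"] this]
    show "(\<lambda>n. max 0 s + 1 / 2 ^ n) \<longlonglongrightarrow> max 0 s" by (simp only: add_0_right)
    show "\<forall>\<^sub>F n in sequentially. max 0 s \<le> dyadic_up n s"
      by (intro always_eventually allI less_imp_le gt)
    show "\<forall>\<^sub>F n in sequentially. dyadic_up n s \<le> max 0 s + 1 / 2 ^ n"
      by (intro always_eventually allI dyadic_up_bounds(2))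
  qed
  have l: "filterlim (\<lambda>n. dyadic_up n s) (at_right (max 0 s)) sequentially"
    by (intro tendsto_imp_filterlim_at_right lim always_eventually allI gt)
  have "(\<lambda>n. f (dyadic_up n s)) \<longlonglongrightarrow> f (max 0 s)" by (rule filterlim_compose[OF assms(1) l])
  moreover have "w (dyadic_up n s) = f (dyadic_up n s)" for n
    by (rule assms(2)) (rule order_trans[OF max.cobounded1 less_imp_le[OF gt]])
  ultimately show ?thesis unfolding rc_value_def by (simp only: limI)
qed

lemma rc_value_meas:
  "(\<lambda>z. rc_value (snd z) (fst z)) \<in> borel_measurable (borel \<Otimes>\<^sub>M (PiM {0..} (\<lambda>_. borel :: 'a::euclidean_space measure)))"
  unfolding rc_value_def
proof (rule borel_measurable_lim_metric)
  fix n
  let ?N = "(borel :: real measure) \<Otimes>\<^sub>M (PiM {0::real..} (\<lambda>_. borel :: 'a measure))"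
  \<comment> \<open>The coordinate read depends on time through an integer, so measurability reduces
    to countably many fixed coordinates. Replacing \<open>i\<close> by \<open>max 0 i\<close> keeps
    all of them in the index set and changes nothing at the floors that occur.\<close>
  have "(\<lambda>z. snd z ((of_int (max 0 \<lfloor>2 ^ n * max 0 (fst z)\<rfloor>) + 1) / 2 ^ n)) \<in> borel_measurable ?N"
  proof (rule measurable_compose_countable[where f = "\<lambda>i z. snd z ((of_int (max 0 i) + 1) / 2 ^ n)" and g = "\<lambda>z. \<lfloor>2 ^ n * max 0 (fst z)\<rfloor>"])
    fix i :: int
    have "(\<lambda>w. w ((of_int (max 0 i) + 1) / 2 ^ n)) \<in> borel_measurable (PiM {0::real..} (\<lambda>_. borel :: 'a measure))"
    proof (rule measurable_component_singleton)
      have "0 \<le> real_of_int (max 0 i)" by (simp only: of_int_0_le_iff max.cobounded1)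
      then have "0 \<le> (real_of_int (max 0 i) + 1) / 2 ^ n" by (intro divide_nonneg_nonneg add_nonneg_nonneg) simp_all
      then show "(real_of_int (max 0 i) + 1) / 2 ^ n \<in> {0..}" by (simp only: atLeast_iff)
    qed
    then show "(\<lambda>z. snd z ((of_int (max 0 i) + 1) / 2 ^ n)) \<in> borel_measurable ?N"
      by (rule measurable_compose[OF measurable_snd])
    show "(\<lambda>z. \<lfloor>2 ^ n * max 0 (fst z)\<rfloor>) \<in> measurable ?N (count_space UNIV)" by measurable
  qed
  moreover have "max 0 \<lfloor>2 ^ n * max 0 s\<rfloor> = \<lfloor>2 ^ n * max 0 s\<rfloor>" for s :: real
    by (rule max_absorb2) (simp only: zero_le_floor, rule mult_nonneg_nonneg, simp_all)
  ultimately show "(\<lambda>z. snd z (dyadic_up n (fst z))) \<in> borel_measurable ?N" by (simp only: dyadic_up_def)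
qed

section \<open>Measurability and stationarity of the occupation time\<close>

context levy_path
begin

lemma rc_value_xpath: "\<omega> \<in> space M \<Longrightarrow> rc_value (xpath \<omega>) s = X (max 0 s) \<omega>"
  by (rule rc_value_eq) (auto intro!: X_rc simp: xpath_def)

lemma rc_value_future:
  assumes "\<omega> \<in> space M" "0 \<le> t"
  shows "rc_value (future t \<omega>) s = X (t + max 0 s) \<omega> - X t \<omega>"
  by (rule rc_value_eq[of "\<lambda>u. X (t + u) \<omega> - X t \<omega>"]) (use rc_shift[OF assms] in \<open>auto simp: future_def\<close>)

lemma X_joint: "(\<lambda>z. X (max 0 (fst z)) (snd z)) \<in> borel_measurable (borel \<Otimes>\<^sub>M M)"
proof -
  have "(\<lambda>z. (fst z, xpath (snd z))) \<in> measurable (borel \<Otimes>\<^sub>M M) ((borel :: real measure) \<Otimes>\<^sub>M path_space {0..})"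
    by (intro measurable_Pair measurable_fst measurable_compose[OF measurable_snd xpath_meas])
  from measurable_compose[OF this rc_value_meas]
  have 1: "(\<lambda>z. rc_value (xpath (snd z)) (fst z)) \<in> borel_measurable (borel \<Otimes>\<^sub>M M)"
    by (simp only: fst_conv snd_conv)
  have 2: "rc_value (xpath (snd z)) (fst z) = X (max 0 (fst z)) (snd z)" if "z \<in> space (borel \<Otimes>\<^sub>M M)" for z
    using that by (intro rc_value_xpath) (auto simp: space_pair_measure)
  show ?thesis by (rule measurable_cong[THEN iffD1, OF 2 1])
qed

text \<open>The sojourn time near the position at time \<open>t\<close>, during the following unit
  of time. The maxima make it a function on all of the real line, as needed for joint measurability
  in \<open>t\<close>.\<close>

definition occupation :: "('a \<Rightarrow> 'a \<Rightarrow> real) \<Rightarrow> real \<Rightarrow> real \<Rightarrow> 'w \<Rightarrow> real" where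
  "occupation ip t r \<omega> = measure lborel {s\<in>{0..1}. ip_norm ip (X (max 0 (t + s)) \<omega> - X (max 0 t) \<omega>) \<le> r}"

lemma ip_norm_meas: "inner_product ip \<Longrightarrow> ip_norm ip \<in> borel_measurable (borel :: 'a measure)"
  using ip_norm_equiv(1) by (rule borel_measurable_continuous_onI)

lemma X_path_meas: "\<omega> \<in> space M \<Longrightarrow> (\<lambda>t. X (max 0 t) \<omega>) \<in> borel_measurable borel"
proof -
  assume w: "\<omega> \<in> space M"
  have "(\<lambda>t. (t, \<omega>)) \<in> measurable borel (borel \<Otimes>\<^sub>M M)" by (rule measurable_Pair2'[OF w])
  from measurable_compose[OF this X_joint] show ?thesis by (simp only: fst_conv snd_conv)
qed

lemma occupation_meas:
  assumes ip: "inner_product ip"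
  shows "(\<lambda>z. occupation ip (fst z) r (snd z)) \<in> borel_measurable (borel \<Otimes>\<^sub>M M)"
proof -
  let ?N = "((borel :: real measure) \<Otimes>\<^sub>M M) \<Otimes>\<^sub>M (lborel :: real measure)"
  define Q where "Q = {z\<in>space ?N. snd z \<in> {0..1} \<and> ip_norm ip (X (max 0 (fst (fst z) + snd z)) (snd (fst z)) - X (max 0 (fst (fst z))) (snd (fst z))) \<le> r}"
  have 1: "(\<lambda>z. X (max 0 (fst (fst z) + snd z)) (snd (fst z))) \<in> borel_measurable ?N"
    using measurable_compose[OF _ X_joint, of "\<lambda>z. (fst (fst z) + snd z, snd (fst z))" ?N] by simp
  have 2: "(\<lambda>z. X (max 0 (fst (fst z))) (snd (fst z))) \<in> borel_measurable ?N"
    using measurable_compose[OF _ X_joint, of "\<lambda>z. (fst (fst z), snd (fst z))" ?N] by simp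
  have [measurable]: "(\<lambda>z. ip_norm ip (X (max 0 (fst (fst z) + snd z)) (snd (fst z)) - X (max 0 (fst (fst z))) (snd (fst z)))) \<in> borel_measurable ?N"
    by (rule measurable_compose[OF borel_measurable_diff[OF 1 2] ip_norm_meas[OF ip]])
  have Q: "Q \<in> sets ?N" unfolding Q_def by measurable
  have "(\<lambda>x. emeasure lborel (Pair x -` Q)) \<in> borel_measurable (borel \<Otimes>\<^sub>M M)"
    by (rule lborel.measurable_emeasure_Pair[OF Q])
  then have "(\<lambda>x. measure lborel (Pair x -` Q)) \<in> borel_measurable (borel \<Otimes>\<^sub>M M)"
    unfolding measure_def by (rule borel_measurable_enn2real)
  then show ?thesis
    by (rule measurable_cong[THEN iffD1, rotated])
       (simp only: occupation_def, rule arg_cong[where f = "measure lborel"], auto simp: Q_def space_pair_measure)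
qed

text \<open>Seen from \<open>t\<close>, the occupation time is a measurable functional of
  \<open>future t\<close>, whose law does not depend on \<open>t\<close>.\<close>

lemma occupation_law:
  assumes ip: "inner_product ip" and t: "0 \<le> t"
  shows "prob {\<omega>\<in>space M. v < occupation ip t r \<omega>} = prob {\<omega>\<in>space M. v < occupation ip 0 r \<omega>}"
proof -
  let ?N = "path_space {0..} \<Otimes>\<^sub>M (lborel :: real measure)"
  define \<Phi> where "\<Phi> w = measure lborel {s\<in>{0..1}. ip_norm ip (rc_value w s) \<le> r}" for w :: "real \<Rightarrow> 'a"
  have \<Phi>: "\<Phi> \<in> borel_measurable (path_space {0..})"
  proof -
    define Q where "Q = {z\<in>space ?N. snd z \<in> {0..1} \<and> ip_norm ip (rc_value (fst z) (snd z)) \<le> r}"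
    have "(\<lambda>z. rc_value (fst z) (snd z)) \<in> borel_measurable ?N"
      using measurable_compose[OF _ rc_value_meas, of "\<lambda>z. (snd z, fst z)" ?N] by simp
    then have [measurable]: "(\<lambda>z. ip_norm ip (rc_value (fst z) (snd z))) \<in> borel_measurable ?N"
      by (rule measurable_compose[OF _ ip_norm_meas[OF ip]])
    have Q: "Q \<in> sets ?N" unfolding Q_def by measurable
    have "(\<lambda>x. emeasure lborel (Pair x -` Q)) \<in> borel_measurable (path_space {0..})"
      by (rule lborel.measurable_emeasure_Pair[OF Q])
    then have "(\<lambda>x. measure lborel (Pair x -` Q)) \<in> borel_measurable (path_space {0..})"
      unfolding measure_def by (rule borel_measurable_enn2real)
    then show ?thesis
      by (rule measurable_cong[THEN iffD1, rotated])
         (simp only: \<Phi>_def, rule arg_cong[where f = "measure lborel"], auto simp: Q_def space_pair_measure)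
  qed
  have A: "{w\<in>space (path_space {0..}). v < \<Phi> w} \<in> sets (path_space {0..})" using \<Phi> by measurable
  have 1: "occupation ip t r \<omega> = \<Phi> (future t \<omega>)" and 2: "occupation ip 0 r \<omega> = \<Phi> (xpath \<omega>)" if w: "\<omega> \<in> space M" for \<omega>
    using t unfolding occupation_def \<Phi>_def
    by (auto simp: rc_value_future[OF w t] rc_value_xpath[OF w] X_zero[OF w] intro!: arg_cong[where f = "measure lborel"])
  let ?A = "{w\<in>space (path_space {0..}). v < \<Phi> w}"
  have sf: "future t \<omega> \<in> space (path_space {0..})" and sx: "xpath \<omega> \<in> space (path_space {0..})" if w: "\<omega> \<in> space M" for \<omega>
    using measurable_space[OF future_meas[OF t] w] measurable_space[OF xpath_meas w] by blast+
  have "{\<omega>\<in>space M. v < occupation ip t r \<omega>} = {\<omega>\<in>space M. future t \<omega> \<in> ?A}"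
    by (rule Collect_cong, rule conj_cong[OF refl]) (simp add: 1 sf)
  also have "prob \<dots> = prob {\<omega>\<in>space M. xpath \<omega> \<in> ?A}"
  proof -
    have "space M \<in> sets (past_algebra t)" using sets.top[of "past_algebra t"] by simp
    from markov_indep[OF t this A] show ?thesis by (simp only: prob_space mult_1)
  qed
  also have "{\<omega>\<in>space M. xpath \<omega> \<in> ?A} = {\<omega>\<in>space M. v < occupation ip 0 r \<omega>}"
    by (rule Collect_cong, rule conj_cong[OF refl]) (simp add: 2 sx)
  finally show ?thesis .
qed

lemma occupation_0_sojourn:
  assumes ip: "inner_product ip" and w: "\<omega> \<in> space M"
  shows "occupation ip 0 r \<omega> = sojourn_time ip X r 1 \<omega>"
proof -
  let ?S = "{s\<in>{0..1}. ip_norm ip (X (max 0 s) \<omega>) \<le> r}"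
  have [measurable]: "(\<lambda>s. ip_norm ip (X (max 0 s) \<omega>)) \<in> borel_measurable borel"
    by (rule measurable_compose[OF X_path_meas[OF w] ip_norm_meas[OF ip]])
  have "{s. ip_norm ip (X (max 0 s) \<omega>) \<le> r} \<in> sets borel" by measurable
  moreover have "?S = {0..1} \<inter> {s. ip_norm ip (X (max 0 s) \<omega>) \<le> r}" by blast
  moreover have "{0..1::real} \<in> sets borel" by simp
  ultimately have S: "?S \<in> sets borel" by (simp only: sets.Int)
  have "sojourn_time ip X r 1 \<omega> = (LINT s|lborel. indicat_real ?S s)"
    unfolding sojourn_time_def set_lebesgue_integral_def ip_cball_def
    by (intro Bochner_Integration.integral_cong) (auto split: split_indicator)
  also have "\<dots> = measure lborel ?S" using S by simp
  also have "\<dots> = occupation ip 0 r \<omega>" by (simp add: occupation_def X_zero[OF w])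
  finally show ?thesis by simp
qed

end

text \<open>Compares the threshold at radius \<open>(1 / 2) ^ n\<close> with the gauge in the dyadic
  shell below it. The radius changes by at most a factor 2, giving \<open>2 powr \<alpha>\<close>;
  and \<open>ln (1 / r)\<close> exceeds \<open>sqrt n\<close>, so the iterated logarithm is at least
  \<open>ln n / 2\<close>, which turns \<open>2 / K\<close> into \<open>4 / K\<close>.\<close>

lemma gauge_dyadic_bound:
  fixes \<alpha> \<theta> K \<delta> :: real
  assumes \<alpha>: "0 < \<alpha>" and \<theta>: "0 < \<theta>" and K: "0 < K" and \<delta>: "0 < \<delta>"
    and \<phi>: "\<And>r. 0 < r \<Longrightarrow> r < \<delta> \<Longrightarrow> \<phi> r = r powr \<alpha> * ln (ln (1 / r)) powr \<theta>"
  shows "\<forall>\<^sub>F n in sequentially. \<forall>r. (1 / 2) ^ Suc n < r \<longrightarrow> r \<le> (1 / 2) ^ n \<longrightarrow>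
    (2 / K * ln (real n)) powr \<theta> * ((1 / 2) ^ n) powr \<alpha> \<le> (4 / K) powr \<theta> * 2 powr \<alpha> * \<phi> r"
proof -
  have e1: "\<forall>\<^sub>F n in sequentially. (1 / 2 :: real) ^ n < \<delta>"
  proof -
    have "(\<lambda>n. (1 / 2 :: real) ^ n) \<longlonglongrightarrow> 0" by (rule LIMSEQ_power_zero) simp
    then show ?thesis using \<delta> by (rule order_tendstoD(2))
  qed
  have e2: "\<forall>\<^sub>F n in sequentially. sqrt (real n) \<le> real n * ln 2" by real_asymp
  show ?thesis
    using e1 e2 eventually_ge_at_top[of 1]
  proof eventually_elim
    case (elim n)
    show ?case
    proof (intro allI impI)
      fix r :: real assume r: "(1 / 2) ^ Suc n < r" "r \<le> (1 / 2) ^ n"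
      define x where "x = (1 / 2 :: real) ^ n"
      have x: "0 < x" by (simp add: x_def)
      have rx: "x / 2 < r" "r \<le> x" using r by (simp_all add: x_def)
      have r0: "0 < r" using rx(1) x by linarith
      have rd: "r < \<delta>" using rx(2) elim(1) by (simp only: x_def)
      have "ln x = - (real n * ln 2)" by (simp add: x_def ln_realpow ln_div)
      then have "real n * ln 2 = ln (1 / x)" using x by (simp add: ln_div)
      also have "\<dots> \<le> ln (1 / r)" using rx(2) r0 x by (subst ln_le_cancel_iff) (simp_all add: frac_le)
      finally have l: "sqrt (real n) \<le> ln (1 / r)" using elim(2) by linarith
      have n1: "1 \<le> real n" using elim(3) by simp
      have "ln (real n) / 2 = ln (sqrt (real n))" using n1 by (simp add: ln_sqrt)
      also have "\<dots> \<le> ln (ln (1 / r))"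
      proof -
        have "0 < sqrt (real n)" using n1 by simp
        then show ?thesis using l by (subst ln_le_cancel_iff) linarith+
      qed
      finally have ll: "ln (real n) / 2 \<le> ln (ln (1 / r))" .
      have ln0: "0 \<le> ln (real n)" using n1 by simp
      have "x powr \<alpha> = 2 powr \<alpha> * (x / 2) powr \<alpha>" using x by (simp add: powr_mult[symmetric])
      also have "\<dots> \<le> 2 powr \<alpha> * r powr \<alpha>" using rx(1) x \<alpha> by (intro mult_left_mono powr_mono2) auto
      finally have A: "x powr \<alpha> \<le> 2 powr \<alpha> * r powr \<alpha>" .
      have "(2 / K * ln (real n)) powr \<theta> = (4 / K * (ln (real n) / 2)) powr \<theta>" by simp
      also have "\<dots> = (4 / K) powr \<theta> * (ln (real n) / 2) powr \<theta>" by (rule powr_mult)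
      also have "\<dots> \<le> (4 / K) powr \<theta> * ln (ln (1 / r)) powr \<theta>"
        using ll ln0 \<theta> by (intro mult_left_mono powr_mono2) auto
      finally have B: "(2 / K * ln (real n)) powr \<theta> \<le> (4 / K) powr \<theta> * ln (ln (1 / r)) powr \<theta>" .
      have "(2 / K * ln (real n)) powr \<theta> * x powr \<alpha> \<le> ((4 / K) powr \<theta> * ln (ln (1 / r)) powr \<theta>) * (2 powr \<alpha> * r powr \<alpha>)"
        by (rule mult_mono[OF B A]) simp_all
      also have "\<dots> = (4 / K) powr \<theta> * 2 powr \<alpha> * \<phi> r" unfolding \<phi>[OF r0 rd] by (simp only: mult_ac)
      finally show "(2 / K * ln (real n)) powr \<theta> * ((1 / 2) ^ n) powr \<alpha> \<le> (4 / K) powr \<theta> * 2 powr \<alpha> * \<phi> r"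
        unfolding x_def .
    qed
  qed
qed

lemma dyadic_scale_exists:
  fixes r :: real
  assumes "0 < r" "r \<le> (1 / 2) ^ N"
  shows "\<exists>n\<ge>N. (1 / 2) ^ Suc n < r \<and> r \<le> (1 / 2) ^ n"
proof -
  have "\<exists>m. (1 / 2) ^ m < r" using assms(1) by (intro real_arch_pow_inv) auto
  define m where "m = (LEAST m. (1 / 2) ^ m < r)"
  have m: "(1 / 2) ^ m < r" unfolding m_def by (rule LeastI_ex) fact
  have m': "r \<le> (1 / 2) ^ k" if "k < m" for k
    using not_less_Least[of k "\<lambda>m. (1 / 2) ^ m < r"] that by (simp add: m_def not_less)
  have "N < m"
  proof (rule ccontr)
    assume "\<not> N < m"
    then have "(1 / 2 :: real) ^ N \<le> (1 / 2) ^ m" by (intro power_decreasing) auto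
    then show False using m assms(2) by linarith
  qed
  then obtain n where "m = Suc n" "N \<le> n" by (cases m) auto
  then show ?thesis using m m'[of n] by auto
qed

section \<open>From tails of the occupation time to positive Hausdorff measure\<close>

context levy_path
begin

lemma occupation_mono: "r \<le> r' \<Longrightarrow> inner_product ip \<Longrightarrow> \<omega> \<in> space M \<Longrightarrow> occupation ip t r \<omega> \<le> occupation ip t r' \<omega>"
proof -
  assume r: "r \<le> r'" and ip: "inner_product ip" and w: "\<omega> \<in> space M"
  let ?S = "\<lambda>r. {s\<in>{0..1}. ip_norm ip (X (max 0 (t + s)) \<omega> - X (max 0 t) \<omega>) \<le> r}"
  have "(\<lambda>s. X (max 0 (t + s)) \<omega>) \<in> borel_measurable borel"
    by (rule measurable_compose[OF _ X_path_meas[OF w]]) simp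
  then have "(\<lambda>s. X (max 0 (t + s)) \<omega> - X (max 0 t) \<omega>) \<in> borel_measurable borel" by simp
  from measurable_compose[OF this ip_norm_meas[OF ip]]
  have [measurable]: "(\<lambda>s. ip_norm ip (X (max 0 (t + s)) \<omega> - X (max 0 t) \<omega>)) \<in> borel_measurable borel" .
  have "{s. ip_norm ip (X (max 0 (t + s)) \<omega> - X (max 0 t) \<omega>) \<le> r'} \<in> sets borel" by measurable
  moreover have "?S r' = {0..1} \<inter> {s. ip_norm ip (X (max 0 (t + s)) \<omega> - X (max 0 t) \<omega>) \<le> r'}" by blast
  moreover have "{0..1::real} \<in> sets borel" by simp
  ultimately have S: "?S r' \<in> sets borel" by (simp only: sets.Int)
  have "emeasure lborel (?S r') \<le> emeasure lborel {0..1::real}" by (intro emeasure_mono) auto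
  then have fin: "emeasure lborel (?S r') < \<infinity>" by (rule le_less_trans) simp
  show ?thesis unfolding occupation_def
  proof (rule measure_mono_fmeasurable)
    show "?S r \<subseteq> ?S r'" using r by (blast intro: order_trans)
    have "?S r = {0..1} \<inter> {s. ip_norm ip (X (max 0 (t + s)) \<omega> - X (max 0 t) \<omega>) \<le> r}" by blast
    moreover have "{s. ip_norm ip (X (max 0 (t + s)) \<omega> - X (max 0 t) \<omega>) \<le> r} \<in> sets borel" by measurable
    ultimately show "?S r \<in> sets lborel" by (simp only: sets.Int \<open>{0..1::real} \<in> sets borel\<close> sets_lborel)
    show "?S r' \<in> fmeasurable lborel" using S fin by (intro fmeasurableI) simp_all
  qed
qed

text \<open>Borel-Cantelli gives the bound on the occupation time almost surely for each fixed time;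
  Fubini turns this into almost every time for almost every path. The times at which it holds from
  level \<open>N\<close> on then have total length above \<open>1 / 2\<close> for large
  \<open>N\<close>.\<close>

theorem hausdorff_pos_AE:
  fixes \<alpha> \<theta> K C l0 \<delta> :: real
  assumes ip: "inner_product ip"
    and \<alpha>: "0 < \<alpha>" and \<theta>: "0 < \<theta>" and K: "0 < K" and \<delta>: "0 < \<delta>"
    and \<phi>: "\<And>r. 0 < r \<Longrightarrow> r < \<delta> \<Longrightarrow> \<phi> r = r powr \<alpha> * ln (ln (1 / r)) powr \<theta>"
    and \<phi>0: "(\<phi> \<longlongrightarrow> 0) (at_right 0)"
    and tail: "\<And>l r. l0 \<le> l \<Longrightarrow> 0 < r \<Longrightarrow> r \<le> 1 \<Longrightarrow>
      prob {\<omega>\<in>space M. l * r powr \<alpha> < occupation ip 0 r \<omega>} \<le> C * exp (- K * l powr (1 / \<theta>))"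
  shows "AE \<omega> in M. 0 < hausdorff_measure ip \<phi> ((\<lambda>t. X t \<omega>) ` {0..1})"
proof -
  \<comment> \<open>The constant 2 makes the tail at level \<open>l n\<close> equal to
    \<open>C / n ^ 2\<close>, which is summable.\<close>
  define l where "l n = (2 / K * ln (real n)) powr \<theta>" for n :: nat
  define b where "b n = l n * ((1 / 2) ^ n) powr \<alpha>" for n :: nat
  define P where "P t \<omega> \<longleftrightarrow> (\<exists>N. \<forall>n\<ge>N. occupation ip t ((1 / 2) ^ n) \<omega> \<le> b n)" for t \<omega>
  have om [measurable]: "(\<lambda>z. occupation ip (fst z) r (snd z)) \<in> borel_measurable (borel \<Otimes>\<^sub>M M)" for r
    by (rule occupation_meas[OF ip])
  have om1: "occupation ip t r \<in> borel_measurable M" for t r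
  proof -
    have "(\<lambda>\<omega>. (t, \<omega>)) \<in> measurable M (borel \<Otimes>\<^sub>M M)" by (rule measurable_Pair1') simp
    from measurable_compose[OF this om[of r]] show ?thesis by (simp only: fst_conv snd_conv eta_contract_eq)
  qed
  have om2: "(\<lambda>t. occupation ip t r \<omega>) \<in> borel_measurable borel" if w: "\<omega> \<in> space M" for \<omega> r
  proof -
    have "(\<lambda>t. (t, \<omega>)) \<in> measurable borel (borel \<Otimes>\<^sub>M M)" by (rule measurable_Pair2'[OF w])
    from measurable_compose[OF this om[of r]] show ?thesis by (simp only: fst_conv snd_conv)
  qed
  have PAE: "AE \<omega> in M. P t \<omega>" if t: "0 \<le> t" for t
  proof -
    define A where "A n = {\<omega>\<in>space M. b n < occupation ip t ((1 / 2) ^ n) \<omega>}" for n :: nat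
    have A: "A n \<in> events" for n unfolding A_def using om1[of t "(1/2)^n"] by measurable
    have e1: "\<forall>\<^sub>F n in sequentially. l0 \<le> l n" unfolding l_def using \<theta> K by real_asymp
    have bd: "\<forall>\<^sub>F n in sequentially. norm (prob (A n)) \<le> C * (1 / real n ^ 2)"
      using e1 eventually_ge_at_top[of 1]
    proof eventually_elim
      case (elim n)
      have "prob (A n) = prob {\<omega>\<in>space M. b n < occupation ip 0 ((1 / 2) ^ n) \<omega>}"
        unfolding A_def by (rule occupation_law[OF ip t])
      also have "\<dots> \<le> C * exp (- K * l n powr (1 / \<theta>))"
        unfolding b_def by (rule tail[OF elim(1)]) (simp_all add: power_le_one)
      also have "l n powr (1 / \<theta>) = 2 / K * ln (real n)"
      proof -
        have "0 \<le> 2 / K * ln (real n)" using K elim(2) by simp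
        moreover have "\<theta> * (1 / \<theta>) = 1" using \<theta> by simp
        ultimately show ?thesis unfolding l_def powr_powr by (simp only: powr_one)
      qed
      also have "exp (- K * (2 / K * ln (real n))) = 1 / real n ^ 2"
      proof -
        have "- K * (2 / K * ln (real n)) = - ln (real n ^ 2)" using K elim(2) by (simp add: ln_realpow)
        then show ?thesis using elim(2) by (simp add: exp_minus inverse_eq_divide)
      qed
      finally show ?case by (simp only: real_norm_def abs_of_nonneg[OF measure_nonneg])
    qed
    have "summable (\<lambda>n. C * (1 / real n ^ 2))"
      by (intro summable_mult) (use inverse_power_summable[of 2, where 'a = real] in \<open>simp add: inverse_eq_divide\<close>)
    then have sm: "summable (\<lambda>n. prob (A n))" by (rule summable_comparison_test_ev[OF bd])
    have "AE \<omega> in M. \<forall>\<^sub>F n in sequentially. \<omega> \<in> space M - A n"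
      by (rule borel_cantelli_AE1[OF A _ sm]) (simp add: emeasure_eq_measure)
    then show ?thesis
    proof eventually_elim
      case (elim \<omega>)
      then obtain N where N: "\<And>n. N \<le> n \<Longrightarrow> \<omega> \<in> space M - A n" by (auto simp: eventually_sequentially)
      have "occupation ip t ((1 / 2) ^ n) \<omega> \<le> b n" if "N \<le> n" for n
        using N[OF that] by (simp add: A_def not_less)
      then show "P t \<omega>" unfolding P_def by blast
    qed
  qed
  have "AE t in lborel. AE \<omega> in M. t \<in> {0..1} \<longrightarrow> P t \<omega>"
  proof (rule AE_I2)
    fix t :: real
    show "AE \<omega> in M. t \<in> {0..1} \<longrightarrow> P t \<omega>"
    proof (cases "t \<in> {0..1}")
      case True then show ?thesis using PAE[of t] by simp
    next
      case False then show ?thesis by (intro AE_I2) blast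
    qed
  qed
  moreover have "{z\<in>space (lborel \<Otimes>\<^sub>M M). fst z \<in> {0..1} \<longrightarrow> P (fst z) (snd z)} \<in> sets (lborel \<Otimes>\<^sub>M M)"
  proof -
    have [measurable]: "(\<lambda>z. occupation ip (fst z) r (snd z)) \<in> borel_measurable (lborel \<Otimes>\<^sub>M M)" for r
      using om[of r] by (simp cong: measurable_cong_sets sets_pair_measure_cong)
    show ?thesis unfolding P_def by measurable
  qed
  ultimately have "AE \<omega> in M. AE t in lborel. t \<in> {0..1} \<longrightarrow> P t \<omega>"
  proof -
    interpret L: pair_sigma_finite lborel M ..
    assume a: "AE t in lborel. AE \<omega> in M. t \<in> {0..1} \<longrightarrow> P t \<omega>"
      and m: "{z\<in>space (lborel \<Otimes>\<^sub>M M). fst z \<in> {0..1} \<longrightarrow> P (fst z) (snd z)} \<in> sets (lborel \<Otimes>\<^sub>M M)"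
    show ?thesis using L.AE_commute[of "\<lambda>t \<omega>. t \<in> {0..1} \<longrightarrow> P t \<omega>", OF m] a by blast
  qed
  then have "AE \<omega> in M. \<omega> \<in> space M \<and> (AE t in lborel. t \<in> {0..1} \<longrightarrow> P t \<omega>)" by (simp add: AE_conj_iff)
  then show ?thesis
  proof eventually_elim
    case (elim \<omega>)
    then have w: "\<omega> \<in> space M" and AEt: "AE t in lborel. t \<in> {0..1} \<longrightarrow> P t \<omega>" by auto
    define f where "f t = X (max 0 t) \<omega>" for t
    have f: "f \<in> borel_measurable borel" unfolding f_def by (rule X_path_meas[OF w])
    define G where "G N = {t\<in>{0..1}. \<forall>n\<ge>N. occupation ip t ((1 / 2) ^ n) \<omega> \<le> b n}" for N :: nat
    have G: "G N \<in> sets borel" for N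
    proof -
      have [measurable]: "(\<lambda>t. occupation ip t r \<omega>) \<in> borel_measurable borel" for r by (rule om2[OF w])
      have "{t. \<forall>n\<ge>N. occupation ip t ((1 / 2) ^ n) \<omega> \<le> b n} \<in> sets borel" by measurable
      moreover have "G N = {0..1} \<inter> {t. \<forall>n\<ge>N. occupation ip t ((1 / 2) ^ n) \<omega> \<le> b n}" unfolding G_def by blast
      moreover have "{0..1::real} \<in> sets borel" by simp
      ultimately show ?thesis by (simp only: sets.Int)
    qed
    have "(\<lambda>N. measure lborel (G N)) \<longlonglongrightarrow> measure lborel (\<Union>N. G N)"
    proof (rule Lim_measure_incseq)
      show "range G \<subseteq> sets lborel" using G by auto
      show "incseq G" unfolding incseq_def G_def by fastforce
      have "emeasure lborel (\<Union>N. G N) \<le> emeasure lborel {0..1::real}" by (intro emeasure_mono) (auto simp: G_def)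
      then show "emeasure lborel (\<Union>N. G N) \<noteq> \<infinity>" by (auto simp: top_unique)
    qed
    also have "measure lborel (\<Union>N. G N) = measure lborel {0..1::real}"
    proof (rule measure_eq_AE)
      show "AE t in lborel. (t \<in> (\<Union>N. G N)) = (t \<in> {0..1})"
        using AEt by eventually_elim (auto simp: G_def P_def)
    qed (use G in auto)
    finally have "(\<lambda>N. measure lborel (G N)) \<longlonglongrightarrow> 1" by simp
    then have ev: "\<forall>\<^sub>F N in sequentially. 1 / 2 < measure lborel (G N)" by (rule order_tendstoD(1)) simp
    obtain N1 where N1: "\<And>n r. N1 \<le> n \<Longrightarrow> (1 / 2) ^ Suc n < r \<Longrightarrow> r \<le> (1 / 2) ^ n \<Longrightarrow> b n \<le> (4 / K) powr \<theta> * 2 powr \<alpha> * \<phi> r"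
      using gauge_dyadic_bound[OF \<alpha> \<theta> K \<delta> \<phi>] unfolding b_def l_def eventually_sequentially by blast
    obtain N where N: "1 / 2 < measure lborel (G N)" "N1 \<le> N"
      using eventually_conj[OF ev eventually_ge_at_top[of N1]] unfolding eventually_sequentially by blast
    have "0 < hausdorff_measure ip \<phi> (f ` {0..1})"
    proof (rule hausdorff_measure_pos[OF f ip G[of N]])
      show "G N \<subseteq> {0..1}" by (auto simp: G_def)
      show "1 / 2 \<le> measure lborel (G N)" using N(1) by simp
      show "0 < (4 / K) powr \<theta> * 2 powr \<alpha>" using K by simp
      show "0 < (1 / 2 :: real) ^ N" by simp
      show "(\<phi> \<longlongrightarrow> 0) (at_right 0)" by (rule \<phi>0)
      fix t r :: real assume t: "t \<in> G N" and r: "0 < r" "r \<le> (1 / 2) ^ N"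
      obtain n where n: "N \<le> n" "(1 / 2) ^ Suc n < r" "r \<le> (1 / 2) ^ n" using dyadic_scale_exists[OF r] by blast
      have "measure lborel {s\<in>{0..1}. ip_norm ip (f (t + s) - f t) \<le> r} = occupation ip t r \<omega>"
        unfolding occupation_def f_def by (rule refl)
      also have "\<dots> \<le> occupation ip t ((1 / 2) ^ n) \<omega>" by (rule occupation_mono[OF n(3) ip w])
      also have "\<dots> \<le> b n" using t n(1) unfolding G_def by blast
      also have "\<dots> \<le> (4 / K) powr \<theta> * 2 powr \<alpha> * \<phi> r" by (rule N1[OF order_trans[OF N(2) n(1)] n(2,3)])
      finally show "measure lborel {s\<in>{0..1}. ip_norm ip (f (t + s) - f t) \<le> r} \<le> (4 / K) powr \<theta> * 2 powr \<alpha> * \<phi> r" .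
    qed
    moreover have "f ` {0..1} = (\<lambda>t. X t \<omega>) ` {0..1}"
      by (rule image_cong) (auto simp: f_def max_def)
    ultimately show ?case by (simp only:)
  qed
qed

end

section \<open>Gaussian vectors on a subspace\<close>

definition orthonormal :: "'a::euclidean_space set \<Rightarrow> bool" where
  "orthonormal B \<longleftrightarrow> finite B \<and> pairwise orthogonal B \<and> (\<forall>u\<in>B. norm u = 1)"

definition gauss_coords :: "'a::euclidean_space set \<Rightarrow> ('a \<Rightarrow> real) measure" where
  "gauss_coords B = PiM B (\<lambda>_. std_normal_distribution)"

text \<open>For orthonormal \<open>B\<close> and coordinates distributed as
  \<open>gauss_coords B\<close>, a standard Gaussian vector on \<open>span B\<close>; coordinates
  are indexed by the basis vectors themselves.\<close>

definition gauss_vec :: "'a::euclidean_space set \<Rightarrow> ('a \<Rightarrow> real) \<Rightarrow> 'a" where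
  "gauss_vec B g = (\<Sum>u\<in>B. g u *\<^sub>R u)"

lemma prob_space_std_normal: "prob_space std_normal_distribution"
  using real_dist_normal_dist real_distribution.axioms(1) by blast

lemma prob_space_gauss_coords: "prob_space (gauss_coords B)"
  unfolding gauss_coords_def by (intro prob_space_PiM prob_space_std_normal)

lemma component_meas_gauss: "u \<in> B \<Longrightarrow> (\<lambda>g. g u) \<in> borel_measurable (gauss_coords B)"
proof -
  assume "u \<in> B"
  then have "(\<lambda>g. g u) \<in> measurable (gauss_coords B) std_normal_distribution"
    unfolding gauss_coords_def by (rule measurable_component_singleton)
  then show ?thesis by (simp cong: measurable_cong_sets)
qed

lemma gauss_vec_meas: "gauss_vec B \<in> borel_measurable (gauss_coords B)"
  unfolding gauss_vec_def[abs_def]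
  by (intro borel_measurable_sum borel_measurable_scaleR component_meas_gauss) auto

lemma bessel:
  assumes B: "orthonormal B"
  shows "(\<Sum>u\<in>B. (y \<bullet> u)\<^sup>2) \<le> (norm y)\<^sup>2"
proof -
  define p where "p = (\<Sum>u\<in>B. (y \<bullet> u) *\<^sub>R u)"
  have np: "(norm p)\<^sup>2 = (\<Sum>u\<in>B. (y \<bullet> u)\<^sup>2)"
  proof -
    have "(norm p)\<^sup>2 = (\<Sum>u\<in>B. (norm ((y \<bullet> u) *\<^sub>R u))\<^sup>2)"
      unfolding p_def using B
      by (intro norm_sum_Pythagorean) (auto simp: orthonormal_def pairwise_def orthogonal_def)
    also have "\<dots> = (\<Sum>u\<in>B. (y \<bullet> u)\<^sup>2)"
      using B by (intro sum.cong) (auto simp: orthonormal_def)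
    finally show ?thesis .
  qed
  have yp: "y \<bullet> p = (\<Sum>u\<in>B. (y \<bullet> u)\<^sup>2)"
    by (simp add: p_def inner_sum_right power2_eq_square)
  have "0 \<le> (norm (y - p))\<^sup>2" by simp
  also have "(norm (y - p))\<^sup>2 = (norm y)\<^sup>2 - 2 * (y \<bullet> p) + (norm p)\<^sup>2"
    by (simp only: power2_norm_eq_inner inner_diff_left inner_diff_right inner_commute[of p y])
  finally show ?thesis unfolding np yp by linarith
qed

lemma gauss_vec_component_le:
  assumes B: "orthonormal B" and u: "u \<in> B"
  shows "\<bar>g u\<bar> \<le> norm (gauss_vec B g)"
proof -
  have fin: "finite B" using B by (simp add: orthonormal_def)
  have "gauss_vec B g \<bullet> u = (\<Sum>v\<in>B. g v * (v \<bullet> u))" by (simp add: gauss_vec_def inner_sum_left)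
  also have "\<dots> = (\<Sum>v\<in>B. if v = u then g u else 0)"
  proof (rule sum.cong[OF refl])
    fix v assume v: "v \<in> B"
    show "g v * (v \<bullet> u) = (if v = u then g u else 0)"
    proof (cases "v = u")
      case True
      then show ?thesis using B u by (simp add: orthonormal_def dot_square_norm)
    next
      case False
      then have "v \<bullet> u = 0" using B u v by (auto simp: orthonormal_def pairwise_def orthogonal_def)
      then show ?thesis using False by simp
    qed
  qed
  also have "\<dots> = g u" using fin u by simp
  finally have "\<bar>g u\<bar> = \<bar>gauss_vec B g \<bullet> u\<bar>" by simp
  also have "\<dots> \<le> norm (gauss_vec B g) * norm u" by (rule Cauchy_Schwarz_ineq2)
  finally show ?thesis using B u by (simp add: orthonormal_def)
qed

lemma gauss_vec_char:
  assumes B: "finite B"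
  shows "(LINT g|gauss_coords B. cis (y \<bullet> gauss_vec B g)) = complex_of_real (exp (- (\<Sum>u\<in>B. (y \<bullet> u)\<^sup>2) / 2))"
proof -
  interpret P: product_sigma_finite "\<lambda>_::'a. std_normal_distribution"
    using prob_space_std_normal by (intro product_sigma_finite.intro prob_space_imp_sigma_finite)
  have cisx: "cis x = iexp x" for x by (simp add: cis_conv_exp)
  have eq: "cis (y \<bullet> gauss_vec B g) = (\<Prod>u\<in>B. iexp ((y \<bullet> u) * g u))" for g
  proof -
    have "y \<bullet> gauss_vec B g = (\<Sum>u\<in>B. (y \<bullet> u) * g u)" by (simp add: gauss_vec_def inner_sum_right mult.commute)
    then show ?thesis by (simp only: cisx of_real_sum sum_distrib_left exp_sum[OF B])
  qed
  have int: "integrable std_normal_distribution (\<lambda>x. iexp (a * x))" for a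
  proof -
    interpret N: prob_space std_normal_distribution by (rule prob_space_std_normal)
    show ?thesis by (intro N.integrable_const_bound[of _ 1]) (auto simp: norm_exp_i_times)
  qed
  have "(LINT g|gauss_coords B. cis (y \<bullet> gauss_vec B g)) = (\<Prod>u\<in>B. char std_normal_distribution (y \<bullet> u))"
    unfolding eq gauss_coords_def char_def by (rule P.product_integral_prod[OF B int])
  also have "\<dots> = (\<Prod>u\<in>B. complex_of_real (exp (- ((y \<bullet> u)\<^sup>2) / 2)))" by (simp only: char_std_normal_distribution)
  also have "\<dots> = complex_of_real (exp (\<Sum>u\<in>B. - ((y \<bullet> u)\<^sup>2) / 2))" by (simp only: of_real_prod exp_sum[OF B])
  also have "(\<Sum>u\<in>B. - ((y \<bullet> u)\<^sup>2) / 2) = - (\<Sum>u\<in>B. (y \<bullet> u)\<^sup>2) / 2" by (simp only: sum_divide_distrib[symmetric] sum_negf)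
  finally show ?thesis .
qed

text \<open>The density is at most 1, so near 0 the integrand is dominated by the power itself,
  integrable because \<open>\<beta> < 1\<close>; outside the unit interval the power is at most 1
  and the density is left.\<close>

lemma std_normal_neg_moment:
  assumes \<beta>: "0 < \<beta>" "\<beta> < 1"
  shows "(\<integral>\<^sup>+x. ennreal (\<bar>x\<bar> powr (- \<beta>)) \<partial>std_normal_distribution) < \<infinity>"
proof -
  define f where "f x = indicator {0..1} x * x powr (- \<beta>)" for x :: real
  have fm: "f \<in> borel_measurable borel" unfolding f_def by measurable
  have f0: "0 \<le> f x" for x by (simp add: f_def)
  have "((\<lambda>x. x powr (- \<beta>)) has_integral (1 powr (- \<beta> + 1) / (- \<beta> + 1))) {0..1}"
    using \<beta> by (intro has_integral_powr_from_0) auto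
  then have "((\<lambda>x. if x \<in> {0..1} then x powr (- \<beta>) else 0) has_integral (1 powr (- \<beta> + 1) / (- \<beta> + 1))) UNIV"
    by (rule has_integral_restrict_UNIV[THEN iffD2])
  moreover have "(\<lambda>x. if x \<in> {0..1} then x powr (- \<beta>) else 0) = f" by (auto simp: f_def)
  ultimately have hi: "(f has_integral (1 powr (- \<beta> + 1) / (- \<beta> + 1))) UNIV" by simp
  have If: "(\<integral>\<^sup>+x. ennreal (f x) \<partial>lborel) < \<infinity>"
    unfolding nn_integral_has_integral_lborel[OF fm f0 hi] by simp
  have If': "(\<integral>\<^sup>+x. ennreal (f (- x)) \<partial>lborel) < \<infinity>"
  proof -
    have "(\<integral>\<^sup>+x. ennreal (f x) \<partial>lborel) = ennreal \<bar>- 1\<bar> * (\<integral>\<^sup>+x. ennreal (f (0 + - 1 * x)) \<partial>lborel)"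
      using fm by (intro nn_integral_real_affine) auto
    then show ?thesis using If by simp
  qed
  have ptw: "ennreal (std_normal_density x) * ennreal (\<bar>x\<bar> powr (- \<beta>)) \<le> ennreal (f x) + ennreal (f (- x)) + ennreal (std_normal_density x)" for x
  proof -
    have d0: "0 \<le> std_normal_density x" by simp
    have d1: "std_normal_density x \<le> 1"
    proof -
      have "1 \<le> sqrt (2 * pi)" using pi_ge_two by simp
      then have "1 / sqrt (2 * pi) \<le> 1" by (simp add: divide_le_eq_1)
      moreover have "exp (- x\<^sup>2 / 2) \<le> 1" by simp
      ultimately have "1 / sqrt (2 * pi) * exp (- x\<^sup>2 / 2) \<le> 1 * 1" by (intro mult_mono) simp_all
      then show ?thesis by (simp add: std_normal_density_def)
    qed
    have "std_normal_density x * \<bar>x\<bar> powr (- \<beta>) \<le> f x + f (- x) + std_normal_density x"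
    proof (cases "\<bar>x\<bar> \<le> 1")
      case True
      have "std_normal_density x * \<bar>x\<bar> powr (- \<beta>) \<le> 1 * \<bar>x\<bar> powr (- \<beta>)" using d1 by (intro mult_right_mono) auto
      also have "\<dots> \<le> f x + f (- x)" using True f0[of x] f0[of "- x"] by (cases "0 \<le> x") (auto simp: f_def)
      finally show ?thesis using d0 by linarith
    next
      case False
      have "\<bar>x\<bar> powr (- \<beta>) \<le> \<bar>x\<bar> powr 0" using False \<beta> by (intro powr_mono) auto
      moreover have "\<bar>x\<bar> powr 0 = 1" using False by auto
      ultimately have "\<bar>x\<bar> powr (- \<beta>) \<le> 1" by linarith
      then have "std_normal_density x * \<bar>x\<bar> powr (- \<beta>) \<le> std_normal_density x * 1" using d0 by (intro mult_left_mono)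
      then show ?thesis using f0[of x] f0[of "- x"] by linarith
    qed
    then show ?thesis using d0 f0 by (simp add: ennreal_mult'[symmetric] ennreal_plus[symmetric] ennreal_leI del: ennreal_plus)
  qed
  have "(\<integral>\<^sup>+x. ennreal (\<bar>x\<bar> powr (- \<beta>)) \<partial>std_normal_distribution)
      = (\<integral>\<^sup>+x. ennreal (std_normal_density x) * ennreal (\<bar>x\<bar> powr (- \<beta>)) \<partial>lborel)"
    by (intro nn_integral_density) auto
  also have "\<dots> \<le> (\<integral>\<^sup>+x. ennreal (f x) + ennreal (f (- x)) + ennreal (std_normal_density x) \<partial>lborel)"
    by (intro nn_integral_mono ptw)
  also have "\<dots> = (\<integral>\<^sup>+x. ennreal (f x) \<partial>lborel) + (\<integral>\<^sup>+x. ennreal (f (- x)) \<partial>lborel) + (\<integral>\<^sup>+x. ennreal (std_normal_density x) \<partial>lborel)"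
    using fm by (subst nn_integral_add; (subst nn_integral_add)?) auto
  also have "(\<integral>\<^sup>+x. ennreal (std_normal_density x) \<partial>lborel) = 1"
  proof -
    interpret N: prob_space std_normal_distribution by (rule prob_space_std_normal)
    show ?thesis using N.emeasure_space_1 by (simp add: emeasure_density)
  qed
  finally have A: "(\<integral>\<^sup>+x. ennreal (\<bar>x\<bar> powr (- \<beta>)) \<partial>std_normal_distribution)
    \<le> (\<integral>\<^sup>+x. ennreal (f x) \<partial>lborel) + (\<integral>\<^sup>+x. ennreal (f (- x)) \<partial>lborel) + 1" .
  have "(\<integral>\<^sup>+x. ennreal (f x) \<partial>lborel) + (\<integral>\<^sup>+x. ennreal (f (- x)) \<partial>lborel) + 1 < \<infinity>"
    using If If' by (simp add: ennreal_add_less_top)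
  then show ?thesis by (rule le_less_trans[OF A])
qed

text \<open>
  The negative moment is finite because the norm dominates the geometric mean of the coordinates, whose
  negative moments factorize.
\<close>

lemma gauss_vec_neg_moment:
  assumes B: "orthonormal B" and \<alpha>: "0 < \<alpha>" "\<alpha> < real (card B)"
  shows "(\<integral>\<^sup>+g. ennreal (norm (gauss_vec B g) powr (- \<alpha>)) \<partial>gauss_coords B) < \<infinity>"
    and "AE g in gauss_coords B. gauss_vec B g \<noteq> 0"
proof -
  interpret P: product_sigma_finite "\<lambda>_::'a. std_normal_distribution"
    using prob_space_std_normal by (intro product_sigma_finite.intro prob_space_imp_sigma_finite)
  have fin: "finite B" using B by (simp add: orthonormal_def)
  define m where "m = real (card B)"
  have m: "0 < m" "\<alpha> < m" using \<alpha> by (auto simp: m_def)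
  have "AE g in gauss_coords B. \<forall>u\<in>B. g u \<noteq> 0"
  proof (rule AE_finite_allI[OF fin])
    fix u assume u: "u \<in> B"
    have "AE x in std_normal_distribution. x \<noteq> 0"
    proof (subst AE_density)
      show "AE x in lborel. 0 < ennreal (std_normal_density x) \<longrightarrow> x \<noteq> 0"
        using AE_lborel_singleton[of "0::real"] by eventually_elim blast
    qed simp
    then show "AE g in gauss_coords B. g u \<noteq> 0"
      unfolding gauss_coords_def by (intro AE_PiM_component prob_space_std_normal u)
  qed
  then have nz: "AE g in gauss_coords B. 0 < norm (gauss_vec B g) \<and> (\<forall>u\<in>B. g u \<noteq> 0)"
  proof eventually_elim
    case (elim g)
    have "B \<noteq> {}" using m by (auto simp: m_def)
    then obtain u where u: "u \<in> B" by auto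
    have "0 < \<bar>g u\<bar>" using elim u by simp
    then have "0 < norm (gauss_vec B g)" using gauss_vec_component_le[OF B u, of g] by linarith
    then show ?case using elim by simp
  qed
  then show "AE g in gauss_coords B. gauss_vec B g \<noteq> 0" by eventually_elim auto
  \<comment> \<open>The power is split into \<open>card B\<close> equal factors, one for each
    coordinate. Their exponent \<open>\<alpha> / m\<close> is below 1, which is where \<alpha> being
    less than the dimension enters.\<close>
  have ptw: "AE g in gauss_coords B. ennreal (norm (gauss_vec B g) powr (- \<alpha>)) \<le> (\<Prod>u\<in>B. ennreal (\<bar>g u\<bar> powr (- (\<alpha> / m))))"
    using nz
  proof eventually_elim
    case (elim g)
    let ?n = "norm (gauss_vec B g)"
    have "?n powr (- \<alpha>) = (?n powr (- (\<alpha> / m))) ^ card B"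
      using elim m by (simp add: powr_realpow[symmetric] powr_powr m_def)
    also have "\<dots> = (\<Prod>u\<in>B. ?n powr (- (\<alpha> / m)))" by simp
    also have "\<dots> \<le> (\<Prod>u\<in>B. \<bar>g u\<bar> powr (- (\<alpha> / m)))"
    proof (rule prod_mono, intro conjI)
      fix u assume u: "u \<in> B"
      show "?n powr (- (\<alpha> / m)) \<le> \<bar>g u\<bar> powr (- (\<alpha> / m))"
        using gauss_vec_component_le[OF B u, of g] elim u \<alpha> m by (intro powr_mono2') auto
    qed simp
    finally show ?case by (simp add: prod_ennreal ennreal_leI)
  qed
  have "(\<integral>\<^sup>+g. ennreal (norm (gauss_vec B g) powr (- \<alpha>)) \<partial>gauss_coords B) \<le> (\<integral>\<^sup>+g. (\<Prod>u\<in>B. ennreal (\<bar>g u\<bar> powr (- (\<alpha> / m)))) \<partial>gauss_coords B)"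
    by (rule nn_integral_mono_AE[OF ptw])
  also have "\<dots> = (\<Prod>u\<in>B. \<integral>\<^sup>+x. ennreal (\<bar>x\<bar> powr (- (\<alpha> / m))) \<partial>std_normal_distribution)"
    unfolding gauss_coords_def by (rule P.product_nn_integral_prod[OF fin]) simp
  also have "\<dots> < \<infinity>"
  proof -
    have "(\<integral>\<^sup>+x. ennreal (\<bar>x\<bar> powr (- (\<alpha> / m))) \<partial>std_normal_distribution) < \<infinity>"
      using \<alpha> m by (intro std_normal_neg_moment) auto
    then show ?thesis
      unfolding prod_constant infinity_ennreal_def less_top[symmetric] power_eq_top_ennreal by blast
  qed
  finally show "(\<integral>\<^sup>+g. ennreal (norm (gauss_vec B g) powr (- \<alpha>)) \<partial>gauss_coords B) < \<infinity>" .
qed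

section \<open>Exponential moments of the occupation time\<close>

text \<open>A Riemann sum at right endpoints of a decreasing exponential, so at most its integral
  over the half-line. The comparison is made by telescoping.\<close>

lemma sum_exp_le_inverse:
  fixes z :: real
  assumes z: "0 < z" and n: "0 < n"
  shows "(\<Sum>i<n. exp (- z * (real (Suc i) / real n))) \<le> real n / z"
proof -
  define h where "h = z / real n"
  have h: "0 < h" using z n by (simp add: h_def)
  define q where "q i = exp (- h * real i)" for i
  have step: "h * q (Suc i) \<le> q i - q (Suc i)" for i
  proof -
    have "q i = exp h * q (Suc i)" by (simp add: q_def exp_add[symmetric] algebra_simps)
    then have "q i - q (Suc i) = (exp h - 1) * q (Suc i)" by (simp add: algebra_simps)
    moreover have "h \<le> exp h - 1" using exp_ge_add_one_self[of h] by linarith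
    ultimately show ?thesis by (simp add: q_def mult_right_mono)
  qed
  have "h * (\<Sum>i<n. q (Suc i)) \<le> (\<Sum>i<n. q i - q (Suc i))"
    unfolding sum_distrib_left by (intro sum_mono step)
  also have "\<dots> = q 0 - q n" by (rule sum_lessThan_telescope')
  also have "\<dots> \<le> 1" by (simp add: q_def)
  finally have le: "h * (\<Sum>i<n. q (Suc i)) \<le> 1" .
  have "(\<Sum>i<n. exp (- z * (real (Suc i) / real n))) = (\<Sum>i<n. q (Suc i))"
    by (intro sum.cong refl) (simp add: q_def h_def)
  also have "\<dots> \<le> 1 / h" using le h by (simp add: pos_le_divide_eq mult.commute)
  also have "1 / h = real n / z" by (simp add: h_def)
  finally show ?thesis .
qed

text \<open>The exponentials of the sums from index \<open>i\<close> on telescope; a difference is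
  nonzero only if \<open>a i = 1\<close>, and then \<open>exp b - 1 \<le> 2 * b\<close>. Each term
  pairs a hit at \<open>i\<close> with a sum over strictly later indices, the shape needed for a
  restart.\<close>

lemma exp_sum_telescope_le:
  fixes a :: "nat \<Rightarrow> real"
  assumes b: "0 \<le> b" "b \<le> 1" and a: "\<And>i. a i = 0 \<or> a i = 1"
  shows "exp (b * (\<Sum>l<k. a l)) \<le> 1 + (\<Sum>i<k. 2 * b * (a i * exp (b * (\<Sum>l<k - Suc i. a (l + Suc i)))))"
proof -
  define R where "R i = exp (b * (\<Sum>l\<in>{i..<k}. a l))" for i
  have exp_b: "exp b - 1 \<le> 2 * b"
  proof -
    have "exp b \<le> 1 + b + b\<^sup>2" using b by (intro exp_bound) auto
    moreover have "b\<^sup>2 \<le> b" using b by (simp add: power2_eq_square mult_left_le)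
    ultimately show ?thesis by linarith
  qed
  have step: "R i - R (Suc i) \<le> 2 * b * (a i * R (Suc i))" if "i < k" for i
  proof -
    have "(\<Sum>l\<in>{i..<k}. a l) = a i + (\<Sum>l\<in>{Suc i..<k}. a l)" using that by (rule sum.atLeast_Suc_lessThan)
    then have "R i = exp (b * a i) * R (Suc i)" by (simp only: R_def distrib_left exp_add)
    then have "R i - R (Suc i) = (exp (b * a i) - 1) * R (Suc i)" by (simp only: left_diff_distrib mult_1_left)
    moreover have "exp (b * a i) - 1 \<le> 2 * b * a i" using a[of i] exp_b by auto
    ultimately show ?thesis by (simp only: mult.assoc[symmetric]) (intro mult_right_mono, simp_all add: R_def)
  qed
  have Rs: "R (Suc i) = exp (b * (\<Sum>l<k - Suc i. a (l + Suc i)))" for i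
    unfolding R_def by (simp only: sum.atLeastLessThan_shift_0[of _ "Suc i"] atLeast0LessThan comp_def plus_nat.add_Suc add.commute)
  have "R 0 - R k = (\<Sum>i<k. R i - R (Suc i))" by (rule sum_lessThan_telescope'[symmetric])
  also have "\<dots> \<le> (\<Sum>i<k. 2 * b * (a i * R (Suc i)))" by (intro sum_mono step) simp
  finally have "R 0 \<le> R k + (\<Sum>i<k. 2 * b * (a i * R (Suc i)))" by linarith
  moreover have "R k = 1" by (simp add: R_def)
  moreover have "R 0 = exp (b * (\<Sum>l<k. a l))" by (simp add: R_def atLeast0LessThan)
  ultimately show ?thesis by (simp only: Rs)
qed

section \<open>Hitting probabilities by Fourier analysis, and Khasminskii's bound\<close>

context levy_path
begin

text \<open>
  The indicator of the unit ball is at most \<open>exp (1 / 2)\<close> times the Gaussian average of the characters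
  with frequencies in the span of \<open>B\<close>, so a hitting probability is at most an average of characteristic functions.
\<close>

lemma hit_prob_bound:
  assumes B: "orthonormal B" and t: "0 \<le> t" and \<rho>: "0 < \<rho>"
    and char_fun: "\<And>\<xi>. \<xi> \<in> span B \<Longrightarrow> norm (LINT \<omega>|M. cis (\<xi> \<bullet> X t \<omega>)) \<le> \<psi> (norm \<xi>)"
    and \<psi>: "\<psi> \<in> borel_measurable borel" "\<And>r. 0 \<le> r \<Longrightarrow> 0 \<le> \<psi> r"
  shows "ennreal (prob {\<omega>\<in>space M. norm (x + X t \<omega>) \<le> \<rho>}) \<le> (\<integral>\<^sup>+g. ennreal (exp (1 / 2) * \<psi> (norm (gauss_vec B g) / \<rho>)) \<partial>gauss_coords B)"
proof -
  let ?G = "gauss_coords B"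
  interpret G: prob_space ?G by (rule prob_space_gauss_coords)
  interpret MG: pair_prob_space M ?G ..
  define y where "y \<omega> = (1 / \<rho>) *\<^sub>R (x + X t \<omega>)" for \<omega>
  define E where "E \<omega> = exp (- (\<Sum>u\<in>B. (y \<omega> \<bullet> u)\<^sup>2) / 2)" for \<omega>
  define S where "S = {\<omega>\<in>space M. norm (x + X t \<omega>) \<le> \<rho>}"
  have [measurable]: "X t \<in> borel_measurable M" by (rule X_meas[OF t])
  have [measurable]: "y \<in> borel_measurable M" unfolding y_def[abs_def] by measurable
  have [measurable]: "gauss_vec B \<in> borel_measurable ?G" by (rule gauss_vec_meas)
  have S: "S \<in> events" unfolding S_def by measurable
  have fin: "finite B" using B by (simp add: orthonormal_def)
  have E_meas [measurable]: "E \<in> borel_measurable M" unfolding E_def[abs_def] by measurable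
  have E01: "0 \<le> E \<omega>" "E \<omega> \<le> 1" for \<omega> by (auto simp: E_def sum_nonneg)
  have ES: "exp (- (1 / 2)) \<le> E \<omega>" if "\<omega> \<in> S" for \<omega>
  proof -
    have "norm (y \<omega>) \<le> 1" using that \<rho> by (simp add: S_def y_def divide_le_eq_1)
    then have "(norm (y \<omega>))\<^sup>2 \<le> 1" by (simp add: power_le_one)
    then have "(\<Sum>u\<in>B. (y \<omega> \<bullet> u)\<^sup>2) \<le> 1" using bessel[OF B, of "y \<omega>"] by linarith
    then show ?thesis by (simp add: E_def)
  qed
  have intE: "integrable M E" by (rule integrable_const_bound[of _ 1]) (auto simp: E01)
  have "exp (- (1 / 2)) * prob S = (\<integral>\<omega>. exp (- (1 / 2)) * indicator S \<omega> \<partial>M)" using S by simp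
  also have "\<dots> \<le> (\<integral>\<omega>. E \<omega> \<partial>M)"
  proof (rule integral_mono)
    show "integrable M (\<lambda>\<omega>. exp (- (1 / 2)) * indicat_real S \<omega>)"
      using S by (intro integrable_mult_right integrable_real_indicator) (auto simp: emeasure_eq_measure)
    show "exp (- (1 / 2)) * indicat_real S \<omega> \<le> E \<omega>" for \<omega>
      using ES[of \<omega>] E01(1)[of \<omega>] by (auto split: split_indicator)
  qed (rule intE)
  finally have 1: "prob S \<le> exp (1 / 2) * (\<integral>\<omega>. E \<omega> \<partial>M)"
    by (simp add: exp_minus field_simps)
  have cm: "(\<lambda>z. cis (y (fst z) \<bullet> gauss_vec B (snd z))) \<in> borel_measurable (M \<Otimes>\<^sub>M ?G)"
    unfolding cis_conv_exp by measurable
  have ci: "integrable (M \<Otimes>\<^sub>M ?G) (\<lambda>(\<omega>, g). cis (y \<omega> \<bullet> gauss_vec B g))"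
    by (rule MG.P.integrable_const_bound[of _ 1]) (use cm in \<open>auto simp: case_prod_beta\<close>)
  have "complex_of_real (\<integral>\<omega>. E \<omega> \<partial>M) = (\<integral>\<omega>. complex_of_real (E \<omega>) \<partial>M)" by simp
  also have "\<dots> = (\<integral>\<omega>. (\<integral>g. cis (y \<omega> \<bullet> gauss_vec B g) \<partial>?G) \<partial>M)"
    unfolding E_def by (simp only: gauss_vec_char[OF fin])
  also have "\<dots> = (\<integral>g. (\<integral>\<omega>. cis (y \<omega> \<bullet> gauss_vec B g) \<partial>M) \<partial>?G)"
    by (rule MG.Fubini_integral[OF ci, symmetric])
  finally have 2: "complex_of_real (\<integral>\<omega>. E \<omega> \<partial>M) = (\<integral>g. (\<integral>\<omega>. cis (y \<omega> \<bullet> gauss_vec B g) \<partial>M) \<partial>?G)" .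
  have inner: "norm (\<integral>\<omega>. cis (y \<omega> \<bullet> gauss_vec B g) \<partial>M) \<le> \<psi> (norm (gauss_vec B g) / \<rho>)" for g
  proof -
    define \<xi> where "\<xi> = (1 / \<rho>) *\<^sub>R gauss_vec B g"
    have sp: "\<xi> \<in> span B" unfolding \<xi>_def gauss_vec_def
      by (intro span_scale span_sum span_base)
    have "y \<omega> \<bullet> gauss_vec B g = x \<bullet> \<xi> + \<xi> \<bullet> X t \<omega>" for \<omega>
      by (simp add: y_def \<xi>_def inner_add_left inner_add_right inner_commute add_divide_distrib)
    then have "(\<integral>\<omega>. cis (y \<omega> \<bullet> gauss_vec B g) \<partial>M) = (\<integral>\<omega>. cis (x \<bullet> \<xi>) * cis (\<xi> \<bullet> X t \<omega>) \<partial>M)"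
      by (simp only: cis_mult)
    also have "\<dots> = cis (x \<bullet> \<xi>) * (\<integral>\<omega>. cis (\<xi> \<bullet> X t \<omega>) \<partial>M)" by (rule integral_mult_right_zero)
    finally have "norm (\<integral>\<omega>. cis (y \<omega> \<bullet> gauss_vec B g) \<partial>M) = norm (\<integral>\<omega>. cis (\<xi> \<bullet> X t \<omega>) \<partial>M)"
      by (simp only: norm_mult norm_cis mult_1_left)
    also have "\<dots> \<le> \<psi> (norm \<xi>)" by (rule char_fun[OF sp])
    also have "norm \<xi> = norm (gauss_vec B g) / \<rho>" using \<rho> by (simp add: \<xi>_def)
    finally show ?thesis .
  qed
  have Eint: "0 \<le> (\<integral>\<omega>. E \<omega> \<partial>M)" by (rule integral_nonneg_AE) (simp add: E01)
  have "ennreal (\<integral>\<omega>. E \<omega> \<partial>M) = ennreal (norm (complex_of_real (\<integral>\<omega>. E \<omega> \<partial>M)))" using Eint by simp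
  also have "\<dots> \<le> (\<integral>\<^sup>+g. ennreal (norm (\<integral>\<omega>. cis (y \<omega> \<bullet> gauss_vec B g) \<partial>M)) \<partial>?G)"
    unfolding 2 by (rule integral_norm_bound_ennreal) (rule MG.integrable_snd[OF ci])
  also have "\<dots> \<le> (\<integral>\<^sup>+g. ennreal (\<psi> (norm (gauss_vec B g) / \<rho>)) \<partial>?G)"
    by (intro nn_integral_mono ennreal_leI inner)
  finally have 3: "ennreal (\<integral>\<omega>. E \<omega> \<partial>M) \<le> (\<integral>\<^sup>+g. ennreal (\<psi> (norm (gauss_vec B g) / \<rho>)) \<partial>?G)" .
  have [measurable]: "(\<lambda>g. \<psi> (norm (gauss_vec B g) / \<rho>)) \<in> borel_measurable ?G"
    by (rule measurable_compose[OF _ \<psi>(1)]) measurable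
  have "ennreal (prob S) \<le> ennreal (exp (1 / 2) * (\<integral>\<omega>. E \<omega> \<partial>M))" by (rule ennreal_leI[OF 1])
  also have "\<dots> = ennreal (exp (1 / 2)) * ennreal (\<integral>\<omega>. E \<omega> \<partial>M)" by (rule ennreal_mult') simp
  also have "\<dots> \<le> ennreal (exp (1 / 2)) * (\<integral>\<^sup>+g. ennreal (\<psi> (norm (gauss_vec B g) / \<rho>)) \<partial>?G)" by (rule mult_left_mono[OF 3]) simp
  also have "\<dots> = (\<integral>\<^sup>+g. ennreal (exp (1 / 2)) * ennreal (\<psi> (norm (gauss_vec B g) / \<rho>)) \<partial>?G)"
    by (rule nn_integral_cmult[symmetric]) measurable
  also have "\<dots> = (\<integral>\<^sup>+g. ennreal (exp (1 / 2) * \<psi> (norm (gauss_vec B g) / \<rho>)) \<partial>?G)"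
    by (intro nn_integral_cong ennreal_mult'[symmetric]) simp
  finally show ?thesis unfolding S_def .
qed

text \<open>The grid times begin at \<open>1 / n\<close> rather than 0, because the decay of the
  characteristic function is only available at positive times. The starting point \<open>x\<close>
  is free, to allow restarts.\<close>

definition hits :: "real \<Rightarrow> nat \<Rightarrow> 'a \<Rightarrow> nat \<Rightarrow> 'w \<Rightarrow> real" where
  "hits \<rho> n x i \<omega> = of_bool (norm (x + X (real (Suc i) / real n) \<omega>) \<le> \<rho>)"

lemma hits_meas [measurable]: "hits \<rho> n x i \<in> borel_measurable M"
proof -
  have [measurable]: "X (real (Suc i) / real n) \<in> borel_measurable M" by (rule X_meas) simp
  show ?thesis unfolding hits_def[abs_def] by measurable
qed

text \<open>
  Khasminskii's argument in discrete time: bound the exponential by a sum over the hits and restart the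
  process at each of them.
\<close>

lemma exp_hits_bound:
  assumes b: "0 \<le> b" "b \<le> 1" and n: "0 < n"
    and P: "\<And>x. 4 * b * (\<Sum>i<n. prob {\<omega>\<in>space M. norm (x + X (real (Suc i) / real n) \<omega>) \<le> \<rho>}) \<le> 1"
  shows "k \<le> n \<Longrightarrow> (\<integral>\<^sup>+\<omega>. ennreal (exp (b * (\<Sum>i<k. hits \<rho> n x i \<omega>))) \<partial>M) \<le> 2"
proof (induction k arbitrary: x rule: less_induct)
  case (less k)
  define E where "E i = {\<omega>\<in>space M. norm (x + X (real (Suc i) / real n) \<omega>) \<le> \<rho>}" for i
  define tail where "tail i \<omega> = exp (b * (\<Sum>l<k - Suc i. hits \<rho> n x (l + Suc i) \<omega>))" for i \<omega>
  have EF: "E i \<in> sets (past_algebra (real (Suc i) / real n))" for i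
  proof -
    have [measurable]: "X (real (Suc i) / real n) \<in> borel_measurable (past_algebra (real (Suc i) / real n))" by (rule X_past_algebra) simp_all
    have "{\<omega>\<in>space (past_algebra (real (Suc i) / real n)). norm (x + X (real (Suc i) / real n) \<omega>) \<le> \<rho>} \<in> sets (past_algebra (real (Suc i) / real n))" by measurable
    then show ?thesis by (simp only: E_def space_past_algebra)
  qed
  have tm [measurable]: "tail i \<in> borel_measurable M" for i unfolding tail_def[abs_def] by measurable
  \<comment> \<open>After a hit the remaining exponential is the same functional with fewer steps,
    started at \<open>x + X t\<close>. The induction hypothesis is uniform in the starting point and
    bounds it by 2.\<close>
  have main: "(\<integral>\<^sup>+\<omega>. ennreal (hits \<rho> n x i \<omega> * tail i \<omega>) \<partial>M) \<le> 2 * ennreal (prob (E i))" if i: "i < k" for i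
  proof -
    define t where "t = real (Suc i) / real n"
    define j where "j = k - Suc i"
    have t: "0 \<le> t" by (simp add: t_def)
    define h where "h z = ennreal (exp (b * (\<Sum>l<j. of_bool (norm (x + fst z + snd z (real (Suc l) / real n)) \<le> \<rho>))))" for z :: "'a \<times> (real \<Rightarrow> 'a)"
    have h: "h \<in> borel_measurable (borel \<Otimes>\<^sub>M path_space {0..})"
    proof -
      have [measurable]: "(\<lambda>z. snd z (real (Suc l) / real n)) \<in> borel_measurable (borel \<Otimes>\<^sub>M path_space {0..})" for l :: nat
        by (rule measurable_compose[OF measurable_snd], rule measurable_component_singleton) simp
      show ?thesis unfolding h_def[abs_def] by measurable
    qed
    have "(\<integral>\<^sup>+\<omega>. ennreal (hits \<rho> n x i \<omega> * tail i \<omega>) \<partial>M) = (\<integral>\<^sup>+\<omega>. indicator (E i) \<omega> * h (X t \<omega>, future t \<omega>) \<partial>M)"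
    proof (rule nn_integral_cong)
      fix \<omega> assume w: "\<omega> \<in> space M"
      have "hits \<rho> n x (l + Suc i) \<omega> = of_bool (norm (x + X t \<omega> + future t \<omega> (real (Suc l) / real n)) \<le> \<rho>)" for l
      proof -
        have "t + real (Suc l) / real n = real (Suc (l + Suc i)) / real n"
          by (simp add: t_def add_divide_distrib)
        moreover have "future t \<omega> (real (Suc l) / real n) = X (t + real (Suc l) / real n) \<omega> - X t \<omega>"
          by (simp add: future_def)
        ultimately show ?thesis by (simp add: hits_def)
      qed
      then have "ennreal (tail i \<omega>) = h (X t \<omega>, future t \<omega>)"
        by (simp only: tail_def h_def j_def fst_conv snd_conv)
      moreover have "hits \<rho> n x i \<omega> = indicator (E i) \<omega>"
        using w by (simp add: hits_def E_def indicator_def)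
      ultimately show "ennreal (hits \<rho> n x i \<omega> * tail i \<omega>) = indicator (E i) \<omega> * h (X t \<omega>, future t \<omega>)"
        by (auto split: split_indicator)
    qed
    also have "\<dots> = (\<integral>\<^sup>+\<omega>. indicator (E i) \<omega> * (\<integral>\<^sup>+\<omega>'. h (X t \<omega>, xpath \<omega>') \<partial>M) \<partial>M)"
      by (rule markov_event[OF t EF[of i, folded t_def] h])
    also have "\<dots> \<le> (\<integral>\<^sup>+\<omega>. 2 * indicator (E i) \<omega> \<partial>M)"
    proof (rule nn_integral_mono)
      fix \<omega> assume "\<omega> \<in> space M"
      have "(\<integral>\<^sup>+\<omega>'. h (X t \<omega>, xpath \<omega>') \<partial>M) = (\<integral>\<^sup>+\<omega>'. ennreal (exp (b * (\<Sum>l<j. hits \<rho> n (x + X t \<omega>) l \<omega>'))) \<partial>M)"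
        by (simp add: h_def hits_def xpath_def)
      also have "\<dots> \<le> 2" by (rule less.IH) (use i less.prems in \<open>simp_all add: j_def\<close>)
      finally show "indicator (E i) \<omega> * (\<integral>\<^sup>+\<omega>'. h (X t \<omega>, xpath \<omega>') \<partial>M) \<le> 2 * indicator (E i) \<omega>"
        by (auto split: split_indicator)
    qed
    also have "\<dots> = 2 * emeasure M (E i)" using past_algebra_events[OF EF] by (rule nn_integral_cmult_indicator)
    finally show ?thesis by (simp only: emeasure_eq_measure)
  qed
  have "(\<integral>\<^sup>+\<omega>. ennreal (exp (b * (\<Sum>i<k. hits \<rho> n x i \<omega>))) \<partial>M)
    \<le> (\<integral>\<^sup>+\<omega>. 1 + (\<Sum>i<k. ennreal (2 * b) * ennreal (hits \<rho> n x i \<omega> * tail i \<omega>)) \<partial>M)"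
  proof (rule nn_integral_mono)
    fix \<omega>
    have nn: "0 \<le> hits \<rho> n x i \<omega> * tail i \<omega>" for i by (simp add: hits_def tail_def)
    have "ennreal (exp (b * (\<Sum>i<k. hits \<rho> n x i \<omega>))) \<le> ennreal (1 + (\<Sum>i<k. 2 * b * (hits \<rho> n x i \<omega> * tail i \<omega>)))"
      unfolding tail_def using b by (intro ennreal_leI exp_sum_telescope_le) (auto simp: hits_def)
    also have "\<dots> = 1 + ennreal (\<Sum>i<k. 2 * b * (hits \<rho> n x i \<omega> * tail i \<omega>))"
      using b nn by (subst ennreal_plus) (auto intro!: sum_nonneg)
    also have "ennreal (\<Sum>i<k. 2 * b * (hits \<rho> n x i \<omega> * tail i \<omega>)) = (\<Sum>i<k. ennreal (2 * b * (hits \<rho> n x i \<omega> * tail i \<omega>)))"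
      using b nn by (intro sum_ennreal[symmetric]) simp
    also have "\<dots> = (\<Sum>i<k. ennreal (2 * b) * ennreal (hits \<rho> n x i \<omega> * tail i \<omega>))"
      using b by (intro sum.cong refl ennreal_mult') simp
    finally show "ennreal (exp (b * (\<Sum>i<k. hits \<rho> n x i \<omega>))) \<le> 1 + (\<Sum>i<k. ennreal (2 * b) * ennreal (hits \<rho> n x i \<omega> * tail i \<omega>))" .
  qed
  also have "\<dots> = 1 + (\<Sum>i<k. ennreal (2 * b) * (\<integral>\<^sup>+\<omega>. ennreal (hits \<rho> n x i \<omega> * tail i \<omega>) \<partial>M))"
    by (subst nn_integral_add) (auto simp: nn_integral_sum nn_integral_cmult emeasure_space_1)
  also have "\<dots> \<le> 1 + (\<Sum>i<k. ennreal (2 * b) * (2 * ennreal (prob (E i))))"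
    by (intro add_left_mono sum_mono mult_left_mono main) auto
  also have "(\<Sum>i<k. ennreal (2 * b) * (2 * ennreal (prob (E i)))) = (\<Sum>i<k. ennreal (4 * b * prob (E i)))"
  proof (rule sum.cong[OF refl])
    fix i
    have "ennreal (4 * b * prob (E i)) = ennreal (2 * b * (2 * prob (E i)))" by (rule arg_cong[where f = ennreal]) simp
    also have "\<dots> = ennreal (2 * b) * (2 * ennreal (prob (E i)))"
      using b by (simp only: ennreal_mult' ennreal_numeral zero_le_numeral mult_nonneg_nonneg)
    finally show "ennreal (2 * b) * (2 * ennreal (prob (E i))) = ennreal (4 * b * prob (E i))" by (rule sym)
  qed
  also have "\<dots> = ennreal (4 * b * (\<Sum>i<k. prob (E i)))"
    unfolding sum_distrib_left using b by (intro sum_ennreal) simp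
  also have "\<dots> \<le> ennreal 1"
  proof (rule ennreal_leI)
    have "(\<Sum>i<k. prob (E i)) \<le> (\<Sum>i<n. prob (E i))" using less.prems by (intro sum_mono2) auto
    then have "4 * b * (\<Sum>i<k. prob (E i)) \<le> 4 * b * (\<Sum>i<n. prob (E i))" using b by (intro mult_left_mono) auto
    then show "4 * b * (\<Sum>i<k. prob (E i)) \<le> 1" using P[of x] unfolding E_def by linarith
  qed
  finally show ?case by (simp add: add_left_mono one_add_one)
qed

section \<open>The exponential tail of the occupation time\<close>

context
  fixes B :: "'a set" and \<alpha> \<kappa> Cc :: real
  assumes B: "orthonormal B" and \<alpha>: "0 < \<alpha>" "\<alpha> < real (card B)" and \<kappa>: "0 < \<kappa>" and Cc: "0 \<le> Cc"
    and char_fun: "\<And>t \<xi>. 0 < t \<Longrightarrow> \<xi> \<in> span B \<Longrightarrow>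
      norm (LINT \<omega>|M. cis (\<xi> \<bullet> X t \<omega>)) \<le> Cc * exp (- \<kappa> * t * norm \<xi> powr \<alpha>)"
begin

text \<open>Summing over the grid times inside the Gaussian integral gives at most
  \<open>n / z\<close> with \<open>z\<close> of order
  \<open>(norm (gauss_vec B g) / \<rho>) powr \<alpha>\<close>. What remains is the negative moment
  of order \<alpha> of the Gaussian vector, times \<open>\<rho> powr \<alpha>\<close>.\<close>

lemma sum_hit_prob_bound:
  "\<exists>A>0. \<forall>\<rho>>0. \<forall>n>0. \<forall>x. (\<Sum>i<n. prob {\<omega>\<in>space M. norm (x + X (real (Suc i) / real n) \<omega>) \<le> \<rho>}) \<le> real n * (A * \<rho> powr \<alpha>)"
proof -
  let ?G = "gauss_coords B"
  define E where "E = (\<integral>\<^sup>+g. ennreal (norm (gauss_vec B g) powr (- \<alpha>)) \<partial>?G)"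
  have Efin: "E < \<infinity>" unfolding E_def by (rule gauss_vec_neg_moment(1)[OF B \<alpha>])
  define Er where "Er = enn2real E"
  have Er: "E = ennreal Er" "0 \<le> Er" using Efin by (simp_all add: Er_def)
  define D where "D = exp (1 / 2) * Cc / \<kappa>"
  have D: "0 \<le> D" using Cc \<kappa> by (simp add: D_def)
  have [measurable]: "gauss_vec B \<in> borel_measurable ?G" by (rule gauss_vec_meas)
  \<comment> \<open>The added 1 only makes the constant positive.\<close>
  have "(\<Sum>i<n. prob {\<omega>\<in>space M. norm (x + X (real (Suc i) / real n) \<omega>) \<le> \<rho>}) \<le> real n * ((D * Er + 1) * \<rho> powr \<alpha>)"
    if \<rho>: "0 < \<rho>" and n: "0 < n" for \<rho> n x
  proof -
    define t where "t i = real (Suc i) / real n" for i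
    have t: "0 < t i" for i using n by (simp add: t_def)
    define \<psi> where "\<psi> i r = Cc * exp (- \<kappa> * t i * r powr \<alpha>)" for i r
    have \<psi>m [measurable]: "\<psi> i \<in> borel_measurable borel" for i unfolding \<psi>_def[abs_def] by measurable
    have \<psi>0: "0 \<le> \<psi> i r" for i r using Cc by (simp add: \<psi>_def)
    define p where "p i = prob {\<omega>\<in>space M. norm (x + X (t i) \<omega>) \<le> \<rho>}" for i
    have pi: "ennreal (p i) \<le> (\<integral>\<^sup>+g. ennreal (exp (1 / 2) * \<psi> i (norm (gauss_vec B g) / \<rho>)) \<partial>?G)" for i
      unfolding p_def
    proof (rule hit_prob_bound[OF B less_imp_le[OF t] \<rho> _ \<psi>m \<psi>0])
      fix \<xi> assume "\<xi> \<in> span B"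
      then show "norm (LINT \<omega>|M. cis (\<xi> \<bullet> X (t i) \<omega>)) \<le> \<psi> i (norm \<xi>)" unfolding \<psi>_def by (rule char_fun[OF t])
    qed
    have "ennreal (\<Sum>i<n. p i) = (\<Sum>i<n. ennreal (p i))" by (rule sum_ennreal[symmetric]) (simp add: p_def)
    also have "\<dots> \<le> (\<Sum>i<n. \<integral>\<^sup>+g. ennreal (exp (1 / 2) * \<psi> i (norm (gauss_vec B g) / \<rho>)) \<partial>?G)" by (intro sum_mono pi)
    also have "\<dots> = (\<integral>\<^sup>+g. (\<Sum>i<n. ennreal (exp (1 / 2) * \<psi> i (norm (gauss_vec B g) / \<rho>))) \<partial>?G)"
      by (rule nn_integral_sum[symmetric]) measurable
    also have "\<dots> \<le> (\<integral>\<^sup>+g. ennreal (real n * D * \<rho> powr \<alpha>) * ennreal (norm (gauss_vec B g) powr (- \<alpha>)) \<partial>?G)"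
    proof (rule nn_integral_mono_AE)
      show "AE g in ?G. (\<Sum>i<n. ennreal (exp (1 / 2) * \<psi> i (norm (gauss_vec B g) / \<rho>)))
          \<le> ennreal (real n * D * \<rho> powr \<alpha>) * ennreal (norm (gauss_vec B g) powr (- \<alpha>))"
        using gauss_vec_neg_moment(2)[OF B \<alpha>]
      proof eventually_elim
        case (elim g)
        define s where "s = norm (gauss_vec B g)"
        have s: "0 < s" using elim by (simp add: s_def)
        define z where "z = \<kappa> * (s / \<rho>) powr \<alpha>"
        have z: "0 < z" using \<kappa> s \<rho> by (simp add: z_def)
        have "(\<Sum>i<n. exp (1 / 2) * \<psi> i (s / \<rho>)) = exp (1 / 2) * Cc * (\<Sum>i<n. exp (- z * (real (Suc i) / real n)))"
          unfolding sum_distrib_left by (intro sum.cong refl) (simp add: \<psi>_def z_def t_def mult_ac)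
        also have "\<dots> \<le> exp (1 / 2) * Cc * (real n / z)"
          using Cc by (intro mult_left_mono sum_exp_le_inverse[OF z n]) simp
        also have "\<dots> = real n * D * \<rho> powr \<alpha> * s powr (- \<alpha>)"
        proof -
          have "1 / (s / \<rho>) powr \<alpha> = \<rho> powr \<alpha> * s powr (- \<alpha>)"
            using s \<rho> by (simp add: powr_divide powr_minus_divide)
          moreover have "real n / z = real n / \<kappa> * (1 / (s / \<rho>) powr \<alpha>)" by (simp add: z_def)
          ultimately show ?thesis by (simp add: D_def)
        qed
        finally have le: "(\<Sum>i<n. exp (1 / 2) * \<psi> i (s / \<rho>)) \<le> real n * D * \<rho> powr \<alpha> * s powr (- \<alpha>)" .
        have "(\<Sum>i<n. ennreal (exp (1 / 2) * \<psi> i (s / \<rho>))) = ennreal (\<Sum>i<n. exp (1 / 2) * \<psi> i (s / \<rho>))"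
          by (rule sum_ennreal) (simp add: \<psi>0)
        also have "\<dots> \<le> ennreal (real n * D * \<rho> powr \<alpha> * s powr (- \<alpha>))" by (rule ennreal_leI[OF le])
        also have "\<dots> = ennreal (real n * D * \<rho> powr \<alpha>) * ennreal (s powr (- \<alpha>))" using D by (intro ennreal_mult') simp
        finally show ?case unfolding s_def .
      qed
    qed
    also have "\<dots> = ennreal (real n * D * \<rho> powr \<alpha>) * E" unfolding E_def by (rule nn_integral_cmult) measurable
    also have "\<dots> = ennreal (real n * D * \<rho> powr \<alpha> * Er)" unfolding Er(1) using D by (intro ennreal_mult'[symmetric]) simp
    finally have "(\<Sum>i<n. p i) \<le> real n * D * \<rho> powr \<alpha> * Er" using D Er(2) by (subst (asm) ennreal_le_iff) simp_all
    also have "\<dots> = real n * ((D * Er) * \<rho> powr \<alpha>)" by (simp only: mult_ac)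
    also have "\<dots> \<le> real n * ((D * Er + 1) * \<rho> powr \<alpha>)" by (intro mult_left_mono mult_right_mono) simp_all
    finally show ?thesis unfolding p_def t_def .
  qed
  moreover have "0 < D * Er + 1"
    using mult_nonneg_nonneg[OF D Er(2)] by linarith
  ultimately show ?thesis by blast
qed

text \<open>Fatou's lemma for step functions that test the path at the right end of each dyadic
  cell: at a time when the path is in the open ball, right-continuity makes the test succeed on all
  fine grids. The strict inequality between \<open>r\<close> and \<open>c1 * \<rho>\<close> puts the
  closed \<open>ip\<close>-ball into that open ball.\<close>

lemma occupation_le_liminf_hits:
  assumes ip: "inner_product ip" and w: "\<omega> \<in> space M" and c1: "0 < c1" "\<And>x. c1 * norm x \<le> ip_norm ip x" and \<rho>: "r < c1 * \<rho>" and v: "v < occupation ip 0 r \<omega>"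
  shows "\<forall>\<^sub>F k in sequentially. 2 ^ k * v < (\<Sum>i<2 ^ k. hits \<rho> (2 ^ k) 0 i \<omega>)"
proof -
  define N where "N k i = hits \<rho> (2 ^ k) 0 i \<omega>" for k i
  define J where "J k i = {real i / 2 ^ k<..real (Suc i) / 2 ^ k}" for k i :: nat
  define u where "u k s = (\<Sum>i<2 ^ k. ennreal (N k i) * indicator (J k i) s)" for k s
  have u_int: "(\<integral>\<^sup>+s. u k s \<partial>lborel) = ennreal ((\<Sum>i<2 ^ k. N k i) / 2 ^ k)" for k
  proof -
    have J: "emeasure lborel (J k i) = ennreal (1 / 2 ^ k)" for i
    proof -
      have "real i / 2 ^ k \<le> real (Suc i) / 2 ^ k" by (intro divide_right_mono) simp_all
      moreover have "real (Suc i) / 2 ^ k - real i / 2 ^ k = 1 / 2 ^ k" by (simp add: diff_divide_distrib[symmetric])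
      ultimately show ?thesis unfolding J_def by (simp only: emeasure_lborel_Ioc)
    qed
    have "(\<integral>\<^sup>+s. u k s \<partial>lborel) = (\<Sum>i<2 ^ k. \<integral>\<^sup>+s. ennreal (N k i) * indicator (J k i) s \<partial>lborel)"
      unfolding u_def by (rule nn_integral_sum) (simp add: J_def)
    also have "\<dots> = (\<Sum>i<2 ^ k. ennreal (N k i) * ennreal (1 / 2 ^ k))"
      by (intro sum.cong refl, subst nn_integral_cmult_indicator) (simp_all add: J, simp add: J_def)
    also have "\<dots> = (\<Sum>i<2 ^ k. ennreal (N k i * (1 / 2 ^ k)))"
      by (intro sum.cong refl ennreal_mult'[symmetric]) (simp add: N_def hits_def)
    also have "\<dots> = ennreal (\<Sum>i<2 ^ k. N k i * (1 / 2 ^ k))" by (rule sum_ennreal) (simp add: N_def hits_def)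
    also have "(\<Sum>i<2 ^ k. N k i * (1 / 2 ^ k)) = (\<Sum>i<2 ^ k. N k i) / 2 ^ k" by (simp only: sum_distrib_right[symmetric]) simp
    finally show ?thesis .
  qed
  \<comment> \<open>The time 0 is left out since the cells are half-open on the left; it is a null
    set for the occupation time.\<close>
  define S where "S = {s\<in>{0<..1}. norm (X (max 0 s) \<omega>) < \<rho>}"
  have ptw: "indicator S s \<le> liminf (\<lambda>k. u k s)" for s
  proof (cases "s \<in> S")
    case True
    then have s: "0 < s" "s \<le> 1" "norm (X s \<omega>) < \<rho>" by (auto simp: S_def max_def)
    have "(\<lambda>k. X (1 * real (grid_index 1 k s) / 2 ^ k) \<omega>) \<longlonglongrightarrow> X s \<omega>"
      by (rule tendsto_grid_index[OF _ less_imp_le[OF s(1)] X_rc[OF w less_imp_le[OF s(1)]]]) simp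
    then have "(\<lambda>k. norm (X (1 * real (grid_index 1 k s) / 2 ^ k) \<omega>)) \<longlonglongrightarrow> norm (X s \<omega>)" by (rule tendsto_norm)
    then have "\<forall>\<^sub>F k in sequentially. norm (X (1 * real (grid_index 1 k s) / 2 ^ k) \<omega>) < \<rho>" using s(3) by (rule order_tendstoD(2))
    then have "\<forall>\<^sub>F k in sequentially. 1 \<le> u k s"
    proof eventually_elim
      case (elim k)
      have g1: "s \<le> real (grid_index 1 k s) / 2 ^ k" "real (grid_index 1 k s) / 2 ^ k < s + 1 / 2 ^ k"
        using grid_index_bounds[of 1 s k] s(1) by simp_all
      have "grid_index 1 k s \<noteq> 0" using g1(1) s(1) by (intro notI) simp
      then obtain i where i: "grid_index 1 k s = Suc i" by (cases "grid_index 1 k s") auto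
      have i2: "i < 2 ^ k" using grid_index_le[of 1 s k] s(2) i by simp
      have "real i / 2 ^ k = real (grid_index 1 k s) / 2 ^ k - 1 / 2 ^ k" unfolding i by (simp add: diff_divide_distrib[symmetric])
      then have "s \<in> J k i" using g1 unfolding J_def i by simp
      moreover have "N k i = 1" using elim unfolding N_def hits_def i by simp
      ultimately have "ennreal (N k i) * indicator (J k i) s = 1" by simp
      moreover have "ennreal (N k i) * indicator (J k i) s \<le> u k s"
        unfolding u_def using i2 by (intro member_le_sum) auto
      ultimately show ?case by simp
    qed
    then have "1 \<le> liminf (\<lambda>k. u k s)" by (rule Liminf_bounded)
    then show ?thesis using True by simp
  qed simp
  have [measurable]: "(\<lambda>s. X (max 0 s) \<omega>) \<in> borel_measurable borel" by (rule X_path_meas[OF w])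
  have Sm: "S \<in> sets borel"
  proof -
    have "{s. norm (X (max 0 s) \<omega>) < \<rho>} \<in> sets borel" by measurable
    moreover have "S = {0<..1} \<inter> {s. norm (X (max 0 s) \<omega>) < \<rho>}" unfolding S_def by blast
    moreover have "{0<..1::real} \<in> sets borel" by simp
    ultimately show ?thesis by (simp only: sets.Int)
  qed
  have um: "u k \<in> borel_measurable lborel" for k
  proof -
    have [measurable]: "J k i \<in> sets lborel" for i by (simp add: J_def)
    show ?thesis unfolding u_def[abs_def] by measurable
  qed
  have "emeasure lborel S \<le> emeasure lborel {0<..1::real}" by (intro emeasure_mono) (auto simp: S_def)
  then have Sfin: "emeasure lborel S < \<infinity>" by (rule le_less_trans) simp
  have occS: "occupation ip 0 r \<omega> \<le> measure lborel S"
  proof -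
    define T where "T = {s\<in>{0..1}. ip_norm ip (X (max 0 (0 + s)) \<omega> - X (max 0 0) \<omega>) \<le> r}"
    have sub: "T \<subseteq> insert 0 S"
    proof
      fix s assume s: "s \<in> T"
      then have s1: "s \<in> {0..1}" and s2: "ip_norm ip (X (max 0 (0 + s)) \<omega> - X (max 0 0) \<omega>) \<le> r"
        unfolding T_def by blast+
      have s': "0 \<le> s" "s \<le> 1" using s1 by simp_all
      have s'3: "ip_norm ip (X (max 0 s) \<omega>) \<le> r"
        using s2 by (simp only: add_0_left max.idem X_zero[OF w] diff_zero)
      have "c1 * norm (X (max 0 s) \<omega>) < c1 * \<rho>" using c1(2)[of "X (max 0 s) \<omega>"] s'3 \<rho> by linarith
      then have "norm (X (max 0 s) \<omega>) < \<rho>" using c1(1) by (simp only: mult_less_cancel_left_pos)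
      then show "s \<in> insert 0 S" using s' by (cases "s = 0") (simp_all add: S_def)
    qed
    have i0: "insert 0 S \<in> fmeasurable lborel"
    proof (rule fmeasurableI)
      show "insert 0 S \<in> sets lborel" using Sm by simp
      have "emeasure lborel (insert 0 S) \<le> emeasure lborel {0..1::real}" by (intro emeasure_mono) (auto simp: S_def)
      then show "emeasure lborel (insert 0 S) < \<infinity>" by (rule le_less_trans) simp
    qed
    have Tm: "T \<in> sets lborel"
    proof -
      have "(\<lambda>t. (t, \<omega>)) \<in> measurable borel (borel \<Otimes>\<^sub>M M)" by (rule measurable_Pair2'[OF w])
      have [measurable]: "(\<lambda>s. ip_norm ip (X (max 0 (0 + s)) \<omega> - X (max 0 0) \<omega>)) \<in> borel_measurable borel"
        by (rule measurable_compose[OF _ ip_norm_meas[OF ip]]) simp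
      have "{s. ip_norm ip (X (max 0 (0 + s)) \<omega> - X (max 0 0) \<omega>) \<le> r} \<in> sets borel" by measurable
      moreover have "T = {0..1} \<inter> {s. ip_norm ip (X (max 0 (0 + s)) \<omega> - X (max 0 0) \<omega>) \<le> r}" unfolding T_def by blast
      moreover have "{0..1::real} \<in> sets borel" by simp
      ultimately show ?thesis by (simp only: sets.Int sets_lborel)
    qed
    have "occupation ip 0 r \<omega> = measure lborel T" unfolding occupation_def T_def by (rule refl)
    also have "\<dots> \<le> measure lborel (insert 0 S)" by (rule measure_mono_fmeasurable[OF sub Tm i0])
    also have "\<dots> = measure lborel S"
    proof (rule measure_eq_AE)
      show "AE s in lborel. (s \<in> insert 0 S) = (s \<in> S)" using AE_lborel_singleton[of "0::real"] by eventually_elim blast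
    qed (use Sm in simp_all)
    finally show ?thesis .
  qed
  have "ennreal (measure lborel S) = emeasure lborel S" using Sfin by (intro emeasure_eq_ennreal_measure[symmetric]) simp
  also have "\<dots> = (\<integral>\<^sup>+s. indicator S s \<partial>lborel)" using Sm by simp
  also have "\<dots> \<le> (\<integral>\<^sup>+s. liminf (\<lambda>k. u k s) \<partial>lborel)" by (intro nn_integral_mono ptw)
  also have "\<dots> \<le> liminf (\<lambda>k. \<integral>\<^sup>+s. u k s \<partial>lborel)" by (rule nn_integral_liminf[OF um])
  finally have le: "ennreal (measure lborel S) \<le> liminf (\<lambda>k. ennreal ((\<Sum>i<2 ^ k. N k i) / 2 ^ k))" unfolding u_int .
  show ?thesis
  proof (cases "v < 0")
    case True
    have "2 ^ k * v < (\<Sum>i<2 ^ k. hits \<rho> (2 ^ k) 0 i \<omega>)" for k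
    proof -
      have "2 ^ k * v < 0" using True by (simp add: mult_pos_neg)
      moreover have "0 \<le> (\<Sum>i<2 ^ k. hits \<rho> (2 ^ k) 0 i \<omega>)" by (intro sum_nonneg) (simp add: hits_def)
      ultimately show ?thesis by linarith
    qed
    then show ?thesis by simp
  next
    case False
    have "ennreal v < ennreal (measure lborel S)" using v occS False by (intro ennreal_lessI) linarith+
    then have "ennreal v < liminf (\<lambda>k. ennreal ((\<Sum>i<2 ^ k. N k i) / 2 ^ k))" using le by (rule less_le_trans)
    from less_LiminfD[OF this] show ?thesis
    proof eventually_elim
      case (elim k)
      then have "v < (\<Sum>i<2 ^ k. N k i) / 2 ^ k" using False by (subst (asm) ennreal_less_iff) simp_all
      then show ?case unfolding N_def by (simp add: pos_less_divide_eq mult.commute)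
    qed
  qed
qed

text \<open>The exponential Markov inequality for the number of hits on dyadic grids. With weights
  inversely proportional to the number of grid points the bound is the same on every fine grid, and
  so it passes to the limit.\<close>

theorem occupation_tail_exponential:
  assumes ip: "inner_product ip"
  shows "\<exists>K>0. \<forall>l\<ge>0. \<forall>r>0. prob {\<omega>\<in>space M. l * r powr \<alpha> < occupation ip 0 r \<omega>} \<le> 2 * exp (- K * l)"
proof -
  obtain A where A: "0 < A" "\<And>\<rho> n x. 0 < \<rho> \<Longrightarrow> 0 < n \<Longrightarrow> (\<Sum>i<n. prob {\<omega>\<in>space M. norm (x + X (real (Suc i) / real n) \<omega>) \<le> \<rho>}) \<le> real n * (A * \<rho> powr \<alpha>)"
    using sum_hit_prob_bound by blast
  obtain c1 where c1: "0 < c1" "\<And>x. c1 * norm x \<le> ip_norm ip x" using ip_norm_equiv(2)[OF ip] by blast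
  define K where "K = 1 / (4 * A * (2 / c1) powr \<alpha>)"
  have K: "0 < K" using A c1 by (simp add: K_def)
  have "prob {\<omega>\<in>space M. l * r powr \<alpha> < occupation ip 0 r \<omega>} \<le> 2 * exp (- K * l)" if l: "0 \<le> l" and r: "0 < r" for l r
  proof -
    define \<rho> where "\<rho> = 2 / c1 * r"
    have \<rho>: "0 < \<rho>" "r < c1 * \<rho>" using r c1(1) by (simp_all add: \<rho>_def)
    \<comment> \<open>Chosen so that for \<open>b = \<beta> / 2 ^ k\<close> the estimate of the sum
      of hitting probabilities, multiplied by \<open>4 * b\<close>, is exactly 1. In
      \<open>\<beta> * v\<close> the powers of \<open>r\<close> cancel, which leaves
      \<open>K * l\<close>.\<close>
    define \<beta> where "\<beta> = 1 / (4 * A * \<rho> powr \<alpha>)"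
    have \<beta>: "0 < \<beta>" using A \<rho> by (simp add: \<beta>_def)
    define v where "v = l * r powr \<alpha>"
    have \<beta>v: "\<beta> * v = K * l"
    proof -
      have "\<rho> powr \<alpha> = (2 / c1) powr \<alpha> * r powr \<alpha>" unfolding \<rho>_def by (rule powr_mult)
      then show ?thesis using r by (simp add: \<beta>_def v_def K_def)
    qed
    define E where "E k = {\<omega>\<in>space M. 2 ^ k * v < (\<Sum>i<2 ^ k. hits \<rho> (2 ^ k) 0 i \<omega>)}" for k :: nat
    have E: "E k \<in> events" for k unfolding E_def by measurable
    have Ep: "prob (E k) \<le> 2 * exp (- K * l)" if k: "\<beta> \<le> 2 ^ k" for k
    proof -
      define b where "b = \<beta> / 2 ^ k"
      have b: "0 \<le> b" "b \<le> 1" using \<beta> k by (simp_all add: b_def)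
      define n where "n = (2 ^ k :: nat)"
      have n: "0 < n" "real n = 2 ^ k" by (simp_all add: n_def)
      have ex: "(\<integral>\<^sup>+\<omega>. ennreal (exp (b * (\<Sum>i<n. hits \<rho> n 0 i \<omega>))) \<partial>M) \<le> 2"
      proof (rule exp_hits_bound[OF b n(1) _ order_refl])
        fix x
        have "4 * b * (\<Sum>i<n. prob {\<omega>\<in>space M. norm (x + X (real (Suc i) / real n) \<omega>) \<le> \<rho>}) \<le> 4 * b * (real n * (A * \<rho> powr \<alpha>))"
          using b A(2)[OF \<rho>(1) n(1)] by (intro mult_left_mono) simp_all
        also have "\<dots> = 1" using A(1) \<rho>(1) by (simp add: b_def n(2) \<beta>_def)
        finally show "4 * b * (\<Sum>i<n. prob {\<omega>\<in>space M. norm (x + X (real (Suc i) / real n) \<omega>) \<le> \<rho>}) \<le> 1" .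
      qed
      have "ennreal (exp (K * l)) * emeasure M (E k) = (\<integral>\<^sup>+\<omega>. ennreal (exp (K * l)) * indicator (E k) \<omega> \<partial>M)"
        using E by (rule nn_integral_cmult_indicator[symmetric])
      also have "\<dots> \<le> (\<integral>\<^sup>+\<omega>. ennreal (exp (b * (\<Sum>i<n. hits \<rho> n 0 i \<omega>))) \<partial>M)"
      proof (rule nn_integral_mono)
        fix \<omega>
        show "ennreal (exp (K * l)) * indicator (E k) \<omega> \<le> ennreal (exp (b * (\<Sum>i<n. hits \<rho> n 0 i \<omega>)))"
        proof (cases "\<omega> \<in> E k")
          case True
          then have "b * (2 ^ k * v) \<le> b * (\<Sum>i<n. hits \<rho> n 0 i \<omega>)" using b by (intro mult_left_mono) (simp_all add: E_def n_def)
          moreover have "b * (2 ^ k * v) = K * l" by (simp add: b_def \<beta>v[symmetric])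
          ultimately show ?thesis using True by (simp add: ennreal_leI)
        qed simp
      qed
      also have "\<dots> \<le> 2" by (rule ex)
      finally have "ennreal (exp (K * l)) * ennreal (prob (E k)) \<le> 2" by (simp only: emeasure_eq_measure)
      then have "ennreal (exp (K * l) * prob (E k)) \<le> ennreal 2" by (simp only: ennreal_mult' exp_ge_zero ennreal_numeral)
      then have "exp (K * l) * prob (E k) \<le> 2" by (subst (asm) ennreal_le_iff) simp_all
      then show ?thesis by (simp add: exp_minus field_simps)
    qed
    \<comment> \<open>The requirement \<open>b \<le> 1\<close> holds only on fine enough
      grids.\<close>
    obtain k0 where k0: "\<beta> < 2 ^ k0" using real_arch_pow[of 2 \<beta>] by auto
    have Ep': "prob (E k) \<le> 2 * exp (- K * l)" if "k0 \<le> k" for k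
    proof (rule Ep)
      have "(2::real) ^ k0 \<le> 2 ^ k" using that by (intro power_increasing) simp_all
      then show "\<beta> \<le> 2 ^ k" using k0 by linarith
    qed
    define U where "U = (\<Union>n0. \<Inter>k\<in>{n0..}. E k)"
    have U: "U \<in> events" unfolding U_def using E by auto
    have "(\<lambda>n0. prob (\<Inter>k\<in>{n0..}. E k)) \<longlonglongrightarrow> prob U"
      unfolding U_def using E by (intro finite_Lim_measure_incseq) (auto simp: incseq_def)
    moreover have "\<exists>N. \<forall>n0\<ge>N. prob (\<Inter>k\<in>{n0..}. E k) \<le> 2 * exp (- K * l)"
    proof (intro exI[of _ k0] allI impI)
      fix n0 assume "k0 \<le> n0"
      have "prob (\<Inter>k\<in>{n0..}. E k) \<le> prob (E n0)" using E by (intro finite_measure_mono) auto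
      then show "prob (\<Inter>k\<in>{n0..}. E k) \<le> 2 * exp (- K * l)" using Ep'[OF \<open>k0 \<le> n0\<close>] by linarith
    qed
    ultimately have pU: "prob U \<le> 2 * exp (- K * l)" by (rule LIMSEQ_le_const2)
    have "{\<omega>\<in>space M. l * r powr \<alpha> < occupation ip 0 r \<omega>} \<subseteq> U"
    proof
      fix \<omega> assume "\<omega> \<in> {\<omega>\<in>space M. l * r powr \<alpha> < occupation ip 0 r \<omega>}"
      then have w: "\<omega> \<in> space M" "v < occupation ip 0 r \<omega>" by (simp_all add: v_def)
      from occupation_le_liminf_hits[OF ip w(1) c1 \<rho>(2) w(2)]
      obtain n0 where "\<And>k. n0 \<le> k \<Longrightarrow> \<omega> \<in> E k" using w(1) unfolding E_def eventually_sequentially by blast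
      then show "\<omega> \<in> U" unfolding U_def by blast
    qed
    then have "prob {\<omega>\<in>space M. l * r powr \<alpha> < occupation ip 0 r \<omega>} \<le> prob U" using U by (rule finite_measure_mono)
    then show ?thesis using pU by linarith
  qed
  then show ?thesis using K by blast
qed

end

end

section \<open>Decay of the characteristic function\<close>

lemma (in prob_space) norm_char_le_1: "norm (LINT \<omega>|M. cis (Y \<omega>)) \<le> 1"
proof -
  have "norm (LINT \<omega>|M. cis (Y \<omega>)) \<le> (LINT \<omega>|M. norm (cis (Y \<omega>)))" by (rule integral_norm_bound)
  then show ?thesis by (simp add: prob_space)
qed

text \<open>Modulus 1 is the case of equality in the triangle inequality for integrals, so
  \<open>cis (\<xi> \<bullet> Y)\<close> would be almost surely constant. Then \<open>Y\<close>
  would lie in countably many parallel hyperplanes, a null set for a law with a density.\<close>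

lemma (in prob_space) norm_char_less_1:
  fixes Y :: "'a \<Rightarrow> 'b::euclidean_space"
  assumes d: "distributed M lborel Y f" and \<xi>: "\<xi> \<noteq> 0"
  shows "norm (LINT \<omega>|M. cis (\<xi> \<bullet> Y \<omega>)) < 1"
proof (rule ccontr)
  have [measurable]: "Y \<in> borel_measurable M" using distributed_measurable[OF d] by simp
  have [measurable]: "f \<in> borel_measurable borel" using distributed_borel_measurable[OF d] by simp
  have [measurable]: "(\<lambda>\<omega>. cis (\<xi> \<bullet> Y \<omega>)) \<in> borel_measurable M"
    by (rule measurable_compose[of "\<lambda>\<omega>. \<xi> \<bullet> Y \<omega>" M borel]) (simp_all add: borel_measurable_continuous_onI continuous_on_cis)
  have int: "integrable M (\<lambda>\<omega>. cis (\<xi> \<bullet> Y \<omega>))"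
    by (rule integrable_const_bound[of _ 1]) simp_all
  define z where "z = (LINT \<omega>|M. cis (\<xi> \<bullet> Y \<omega>))"
  assume "\<not> norm (LINT \<omega>|M. cis (\<xi> \<bullet> Y \<omega>)) < 1"
  then have nz: "norm z = 1" using norm_char_le_1[of "\<lambda>\<omega>. \<xi> \<bullet> Y \<omega>"] unfolding z_def by linarith
  have int2: "integrable M (\<lambda>\<omega>. Re (cnj z * cis (\<xi> \<bullet> Y \<omega>)))"
    by (intro integrable_Re integrable_mult_right int)
  have "(LINT \<omega>|M. Re (cnj z * cis (\<xi> \<bullet> Y \<omega>))) = Re (cnj z * z)"
    using int by (simp only: z_def integral_Re integrable_mult_right integral_mult_right_zero)
  also have "cnj z * z = complex_of_real ((norm z)\<^sup>2)" using complex_norm_square[of z] by (simp only: mult.commute)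
  finally have "(LINT \<omega>|M. Re (cnj z * cis (\<xi> \<bullet> Y \<omega>))) = 1" using nz by simp
  then have i0: "(LINT \<omega>|M. 1 - Re (cnj z * cis (\<xi> \<bullet> Y \<omega>))) = 0"
    using int2 by (subst Bochner_Integration.integral_diff) (simp_all add: prob_space del: times_complex.simps)
  have le1: "Re (cnj z * cis y) \<le> 1" for y
    using complex_Re_le_cmod[of "cnj z * cis y"] nz by (simp only: norm_mult complex_mod_cnj norm_cis mult_1)
  have "AE \<omega> in M. 1 - Re (cnj z * cis (\<xi> \<bullet> Y \<omega>)) = 0"
  proof (rule integral_nonneg_eq_0_iff_AE[THEN iffD1, OF _ _ i0])
    show "integrable M (\<lambda>\<omega>. 1 - Re (cnj z * cis (\<xi> \<bullet> Y \<omega>)))" by (rule Bochner_Integration.integrable_diff[OF _ int2]) simp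
    show "AE \<omega> in M. 0 \<le> 1 - Re (cnj z * cis (\<xi> \<bullet> Y \<omega>))" using le1 by (simp only: le_diff_eq add_0_left eventually_True)
  qed
  then have AE1: "AE \<omega> in M. cis (\<xi> \<bullet> Y \<omega>) = z"
  proof eventually_elim
    case (elim \<omega>)
    define w where "w = cnj z * cis (\<xi> \<bullet> Y \<omega>)"
    have "Re w = 1" using elim unfolding w_def by linarith
    moreover have "norm w = 1" using nz unfolding w_def by (simp only: norm_mult complex_mod_cnj norm_cis mult_1)
    ultimately have "w = 1" using cmod_power2[of w] by (simp add: complex_eq_iff)
    then have "z * cnj z * cis (\<xi> \<bullet> Y \<omega>) = z" unfolding w_def by (simp only: mult.assoc mult_1_right)
    moreover have "z * cnj z = 1" using complex_norm_square[of z] nz by simp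
    ultimately show ?case by simp
  qed
  define H where "H = (\<Union>n::int. {x. \<xi> \<bullet> x = Arg z + 2 * pi * real_of_int n})"
  have N: "H \<in> null_sets lborel"
  proof -
    have "{x. \<xi> \<bullet> x = t} \<in> null_sets lborel" for t
    proof -
      have "negligible {x. \<xi> \<bullet> x = t}" using \<xi> by (intro negligible_hyperplane) simp
      then have "{x. \<xi> \<bullet> x = t} \<in> null_sets lebesgue" by (simp add: negligible_iff_null_sets)
      moreover have "{x. \<xi> \<bullet> x = t} \<in> sets lborel"
        using closed_hyperplane[of \<xi> t] by (simp add: borel_closed)
      ultimately show ?thesis by (simp add: null_sets_def emeasure_completion)
    qed
    then show ?thesis unfolding H_def by (intro null_sets_UN) auto
  qed
  have Hm: "H \<in> sets borel" using N by auto
  have sub: "\<xi> \<bullet> y \<in> range (\<lambda>n::int. Arg z + 2 * pi * real_of_int n)" if "cis (\<xi> \<bullet> y) = z" for y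
  proof -
    have "z = cis (Arg z)" using nz rcis_cmod_Arg[of z] by (simp add: rcis_def)
    then have "cis (\<xi> \<bullet> y) = cis (Arg z)" using that by simp
    then have "sin (\<xi> \<bullet> y) = sin (Arg z) \<and> cos (\<xi> \<bullet> y) = cos (Arg z)" by (simp add: complex_eq_iff)
    then show ?thesis unfolding sin_cos_eq_iff by blast
  qed
  have "AE \<omega> in M. Y \<omega> \<in> H" using AE1 by eventually_elim (use sub in \<open>auto simp: H_def\<close>)
  moreover have "AE \<omega> in M. Y \<omega> \<notin> H"
  proof -
    have "AE x in distr M lborel Y. x \<notin> H"
      unfolding distributed_distr_eq_density[OF d]
      using AE_not_in[OF N] by (subst AE_density) (auto elim: eventually_mono)
    then show ?thesis by (subst (asm) AE_distr_iff) (use Hm in simp_all)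
  qed
  ultimately have "AE \<omega> in M. False" by eventually_elim simp
  then show False by simp
qed

context levy_path
begin

definition char_fun :: "real \<Rightarrow> 'a \<Rightarrow> complex" where
  "char_fun t \<xi> = (LINT \<omega>|M. cis (\<xi> \<bullet> X t \<omega>))"

lemma char_fun_add:
  assumes s: "0 \<le> s" and t: "0 \<le> t"
  shows "char_fun (s + t) \<xi> = char_fun s \<xi> * char_fun t \<xi>"
proof -
  have cism: "(\<lambda>x. cis (\<xi> \<bullet> x)) \<in> borel_measurable borel"
    by (intro borel_measurable_continuous_onI continuous_on_cis continuous_intros)
  define tt where "tt i = (if i = 0 then 0 else if i = 1 then s else s + t)" for i :: nat
  have "indep_vars (\<lambda>_. borel) (\<lambda>i \<omega>. X (tt (Suc i)) \<omega> - X (tt i) \<omega>) {..<2}"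
    using s t by (intro X_indep) (auto simp: tt_def mono_on_def)
  then have ind: "indep_vars (\<lambda>_. borel) (\<lambda>i \<omega>. cis (\<xi> \<bullet> (X (tt (Suc i)) \<omega> - X (tt i) \<omega>))) {..<2}"
    using cism by (rule indep_vars_compose2)
  have ints: "integrable M (\<lambda>\<omega>. cis (\<xi> \<bullet> (X (tt (Suc i)) \<omega> - X (tt i) \<omega>)))" if "i < 2" for i
  proof (rule integrable_const_bound[of _ 1])
    show "(\<lambda>\<omega>. cis (\<xi> \<bullet> (X (tt (Suc i)) \<omega> - X (tt i) \<omega>))) \<in> borel_measurable M"
      using s t that by (intro measurable_compose[OF _ cism] borel_measurable_diff X_meas) (auto simp: tt_def)
  qed simp
  have "(LINT \<omega>|M. (\<Prod>i<2. cis (\<xi> \<bullet> (X (tt (Suc i)) \<omega> - X (tt i) \<omega>))))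
      = (\<Prod>i<2. (LINT \<omega>|M. cis (\<xi> \<bullet> (X (tt (Suc i)) \<omega> - X (tt i) \<omega>))))"
    by (rule indep_vars_lebesgue_integral[OF _ ind ints]) auto
  moreover have "(LINT \<omega>|M. (\<Prod>i<2. cis (\<xi> \<bullet> (X (tt (Suc i)) \<omega> - X (tt i) \<omega>)))) = char_fun (s + t) \<xi>"
    unfolding char_fun_def
  proof (rule Bochner_Integration.integral_cong[OF refl])
    fix \<omega> assume "\<omega> \<in> space M"
    then show "(\<Prod>i<2. cis (\<xi> \<bullet> (X (tt (Suc i)) \<omega> - X (tt i) \<omega>))) = cis (\<xi> \<bullet> X (s + t) \<omega>)"
      using X_zero by (simp add: numeral_2_eq_2 tt_def cis_mult inner_diff_right)
  qed
  moreover have "(LINT \<omega>|M. cis (\<xi> \<bullet> (X (tt (Suc 0)) \<omega> - X (tt 0) \<omega>))) = char_fun s \<xi>"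
    unfolding char_fun_def by (rule Bochner_Integration.integral_cong[OF refl]) (simp add: tt_def X_zero)
  moreover have "(LINT \<omega>|M. cis (\<xi> \<bullet> (X (tt (Suc 1)) \<omega> - X (tt 1) \<omega>))) = char_fun t \<xi>"
  proof -
    have "(LINT \<omega>|M. cis (\<xi> \<bullet> (X (s + t) \<omega> - X s \<omega>))) = (LINT x|distr M borel (\<lambda>\<omega>. X (s + t) \<omega> - X s \<omega>). cis (\<xi> \<bullet> x))"
      using s t by (intro integral_distr[symmetric] cism borel_measurable_diff X_meas) auto
    also have "\<dots> = (LINT x|distr M borel (X t). cis (\<xi> \<bullet> x))" by (simp only: X_stat[OF s t])
    also have "\<dots> = char_fun t \<xi>" unfolding char_fun_def using t by (intro integral_distr cism X_meas)
    finally show ?thesis by (simp add: tt_def)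
  qed
  ultimately show ?thesis by (simp add: numeral_2_eq_2)
qed

lemma norm_char_fun_le_1: "norm (char_fun t \<xi>) \<le> 1"
  unfolding char_fun_def by (rule norm_char_le_1)

lemma norm_char_fun_le_power:
  assumes "0 \<le> s" "norm (char_fun 1 \<xi>) \<le> \<rho>"
  shows "norm (char_fun (real n + s) \<xi>) \<le> \<rho> ^ n"
proof (induction n)
  case 0
  then show ?case by (simp add: norm_char_fun_le_1)
next
  case (Suc n)
  have "char_fun (real (Suc n) + s) \<xi> = char_fun 1 \<xi> * char_fun (real n + s) \<xi>"
    using char_fun_add[of 1 "real n + s" \<xi>] assms(1) by (simp add: algebra_simps)
  then have "norm (char_fun (real (Suc n) + s) \<xi>) = norm (char_fun 1 \<xi>) * norm (char_fun (real n + s) \<xi>)" by (simp only: norm_mult)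
  also have "\<dots> \<le> \<rho> * \<rho> ^ n" using Suc assms(2) by (intro mult_mono) (simp_all add: order_trans[OF norm_ge_zero])
  finally show ?case by simp
qed

lemma continuous_char_fun:
  assumes t: "0 \<le> t"
  shows "continuous_on UNIV (char_fun t)"
proof -
  have cism: "(\<lambda>x. cis (\<xi> \<bullet> x)) \<in> borel_measurable borel" for \<xi> :: 'a
    by (intro borel_measurable_continuous_onI continuous_on_cis continuous_intros)
  show ?thesis unfolding continuous_on_sequentially comp_def
  proof (intro ballI allI impI)
    fix x :: "nat \<Rightarrow> 'a" and \<xi> assume "(\<forall>n. x n \<in> UNIV) \<and> x \<longlonglongrightarrow> \<xi>"
    then have x: "x \<longlonglongrightarrow> \<xi>" by simp
    show "(\<lambda>n. char_fun t (x n)) \<longlonglongrightarrow> char_fun t \<xi>"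
      unfolding char_fun_def
    proof (rule integral_dominated_convergence[where w="\<lambda>_. 1"])
      show "AE \<omega> in M. (\<lambda>n. cis (x n \<bullet> X t \<omega>)) \<longlonglongrightarrow> cis (\<xi> \<bullet> X t \<omega>)"
      proof (rule AE_I2)
        fix \<omega>
        have "isCont cis (\<xi> \<bullet> X t \<omega>)" using continuous_on_cis[OF continuous_on_id, of UNIV] by (simp add: continuous_on_eq_continuous_at)
        then show "(\<lambda>n. cis (x n \<bullet> X t \<omega>)) \<longlonglongrightarrow> cis (\<xi> \<bullet> X t \<omega>)"
          by (rule isCont_tendsto_compose) (intro tendsto_intros x)
      qed
    qed (use t in \<open>auto intro: measurable_compose[OF X_meas cism]\<close>)
  qed
qed

text \<open>On the annulus \<open>K\<close> compactness gives a bound below 1 at time 1, and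
  multiplicativity in time turns it into exponential decay. Every nonzero frequency in
  \<open>U\<close> is brought into the annulus by an integer power of \<open>g\<close>, at the price
  of multiplying time by the same power of \<open>c\<close>, which is comparable to
  \<open>norm \<xi> powr \<alpha>\<close>.\<close>

lemma char_fun_bound:
  fixes \<alpha> c :: real and U :: "'a set"
  assumes c: "1 < c" and \<alpha>: "0 < \<alpha>" and U: "subspace U"
    and scale: "\<And>t \<xi>. 0 \<le> t \<Longrightarrow> \<xi> \<in> U \<Longrightarrow> char_fun (c * t) \<xi> = char_fun t (c powr (1 / \<alpha>) *\<^sub>R \<xi>)"
    and lt1: "\<And>\<xi>. \<xi> \<noteq> 0 \<Longrightarrow> norm (char_fun 1 \<xi>) < 1"
  shows "\<exists>\<kappa>>0. \<exists>C\<ge>0. \<forall>t>0. \<forall>\<xi>\<in>U. norm (char_fun t \<xi>) \<le> C * exp (- \<kappa> * t * norm \<xi> powr \<alpha>)"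
proof -
  define g where "g = c powr (1 / \<alpha>)"
  have g: "1 < g" unfolding g_def using c \<alpha> by simp
  have g\<alpha>: "g powr \<alpha> = c" unfolding g_def using c \<alpha> by (simp add: powr_powr)
  define K where "K = {\<xi>\<in>U. 1 \<le> norm \<xi> \<and> norm \<xi> \<le> g}"
  have "compact K"
  proof -
    have "K = U \<inter> (cball 0 g - ball 0 1)" by (auto simp: K_def)
    moreover have "closed U" by (rule closed_subspace[OF U])
    ultimately show ?thesis by (simp add: closed_Int_compact compact_diff)
  qed
  have "\<exists>\<rho><1. \<forall>\<xi>\<in>K. norm (char_fun 1 \<xi>) \<le> \<rho>"
  proof (cases "K = {}")
    case False
    have "continuous_on K (\<lambda>\<xi>. norm (char_fun 1 \<xi>))"
      using continuous_on_subset[OF continuous_char_fun[of 1], of K] by (intro continuous_on_norm) simp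
    then obtain \<xi> where \<xi>: "\<xi> \<in> K" "\<And>y. y \<in> K \<Longrightarrow> norm (char_fun 1 y) \<le> norm (char_fun 1 \<xi>)"
      using continuous_attains_sup[OF \<open>compact K\<close> False] by blast
    then have "\<xi> \<noteq> 0" by (auto simp: K_def)
    then show ?thesis using \<xi>(2) lt1 by blast
  qed (auto intro: exI[of _ 0])
  then obtain \<rho>0 where \<rho>0: "\<rho>0 < 1" "\<And>\<xi>. \<xi> \<in> K \<Longrightarrow> norm (char_fun 1 \<xi>) \<le> \<rho>0" by blast
  \<comment> \<open>The maximum makes \<rho> positive, so that real powers and the logarithm can be
    used even if \<open>K\<close> is empty or the characteristic function vanishes on it.\<close>
  define \<rho> where "\<rho> = max \<rho>0 (1/2)"
  have \<rho>: "0 < \<rho>" "\<rho> < 1" "\<And>\<xi>. \<xi> \<in> K \<Longrightarrow> norm (char_fun 1 \<xi>) \<le> \<rho>"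
    using \<rho>0(1) by (auto simp: \<rho>_def intro: order_trans[OF \<rho>0(2)])
  have Kb: "norm (char_fun u \<xi>) \<le> \<rho> powr (u - 1)" if u: "0 \<le> u" and \<xi>: "\<xi> \<in> K" for u \<xi>
  proof -
    define n where "n = nat \<lfloor>u\<rfloor>"
    have n: "real n \<le> u" "u - 1 \<le> real n" unfolding n_def using u by linarith+
    have "norm (char_fun u \<xi>) \<le> \<rho> ^ n" using norm_char_fun_le_power[of "u - real n" \<xi> \<rho> n] n(1) \<rho>(3)[OF \<xi>] by simp
    also have "\<dots> = \<rho> powr real n" using \<rho>(1) by (simp add: powr_realpow)
    also have "\<dots> \<le> \<rho> powr (u - 1)" using \<rho>(1,2) n(2) by (intro powr_mono') simp_all
    finally show ?thesis .
  qed
  have sc: "char_fun (c ^ n * t) \<xi> = char_fun t (g ^ n *\<^sub>R \<xi>)" if "0 \<le> t" "\<xi> \<in> U" for n t \<xi>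
    using that
  proof (induction n arbitrary: t)
    case (Suc n)
    have "char_fun (c ^ Suc n * t) \<xi> = char_fun (c ^ n * (c * t)) \<xi>" by (simp add: mult.assoc mult.left_commute)
    also have "\<dots> = char_fun (c * t) (g ^ n *\<^sub>R \<xi>)" using Suc c by simp
    also have "\<dots> = char_fun t (g *\<^sub>R (g ^ n *\<^sub>R \<xi>))" unfolding g_def using Suc.prems U by (intro scale subspace_scale)
    finally show ?case by simp
  qed simp
  have scz: "char_fun (c powr real_of_int k * t) \<xi> = char_fun t (g powr real_of_int k *\<^sub>R \<xi>)" if t: "0 \<le> t" and \<xi>: "\<xi> \<in> U" for k t \<xi>
  proof (cases "0 \<le> k")
    case True
    then obtain n where "k = int n" by (rule nonneg_int_cases)
    then show ?thesis using sc[OF t \<xi>, of n] c g by (simp add: powr_realpow)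
  next
    case False
    then obtain n where k: "k = - int n" by (metis nle_le nonpos_int_cases)
    have "char_fun (c ^ n * (c powr real_of_int k * t)) (g powr real_of_int k *\<^sub>R \<xi>) = char_fun (c powr real_of_int k * t) (g ^ n *\<^sub>R (g powr real_of_int k *\<^sub>R \<xi>))"
      using t \<xi> U by (intro sc subspace_scale) simp_all
    moreover have "c ^ n * (c powr real_of_int k * t) = t" using c by (simp add: k powr_minus powr_realpow)
    moreover have "g ^ n *\<^sub>R (g powr real_of_int k *\<^sub>R \<xi>) = \<xi>" using g by (simp add: k powr_minus powr_realpow)
    ultimately show ?thesis by simp
  qed
  \<comment> \<open>The division by \<open>c\<close> pays for the width of the annulus; the constant
    \<open>1 / \<rho>\<close> below pays for rounding the time down to an integer.\<close>
  define \<kappa> where "\<kappa> = - ln \<rho> / c"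
  have \<kappa>: "0 < \<kappa>" using \<rho> c by (simp add: \<kappa>_def divide_neg_pos ln_less_zero_iff)
  have "norm (char_fun t \<xi>) \<le> 1 / \<rho> * exp (- \<kappa> * t * norm \<xi> powr \<alpha>)" if t: "0 < t" and \<xi>: "\<xi> \<in> U" for t \<xi>
  proof (cases "\<xi> = 0")
    case True
    have "norm (char_fun t \<xi>) \<le> 1" by (rule norm_char_fun_le_1)
    also have "1 \<le> 1 / \<rho>" using \<rho> by simp
    finally show ?thesis using True \<alpha> by simp
  next
    case False
    define k where "k = \<lfloor>log g (norm \<xi>)\<rfloor>"
    define G where "G = g powr real_of_int k"
    have n0: "0 < norm \<xi>" using False by simp
    have G0: "0 < G" using g by (simp add: G_def)
    have "real_of_int k \<le> log g (norm \<xi>)" unfolding k_def by simp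
    then have G1: "G \<le> norm \<xi>" unfolding G_def using g n0 by (simp add: le_log_iff)
    have "log g (norm \<xi>) \<le> real_of_int k + 1" unfolding k_def by linarith
    then have "norm \<xi> \<le> g powr (real_of_int k + 1)" using g n0 by (simp add: log_le_iff)
    then have G2: "norm \<xi> \<le> G * g" using g by (simp add: G_def powr_add)
    define \<xi>0 where "\<xi>0 = (1 / G) *\<^sub>R \<xi>"
    have \<xi>0: "\<xi> = G *\<^sub>R \<xi>0" using G0 by (simp add: \<xi>0_def)
    have U0: "\<xi>0 \<in> U" unfolding \<xi>0_def by (intro subspace_scale U \<xi>)
    have nn: "norm \<xi> = G * norm \<xi>0" using G0 by (simp add: \<xi>0)
    have K0: "\<xi>0 \<in> K"
    proof -
      have "G * 1 \<le> G * norm \<xi>0" "G * norm \<xi>0 \<le> G * g" using G1 G2 nn by simp_all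
      then show ?thesis using U0 G0 by (simp add: K_def)
    qed
    have ck: "c powr real_of_int k = G powr \<alpha>" unfolding G_def g\<alpha>[symmetric] by (simp only: powr_powr mult.commute)
    have "char_fun t \<xi> = char_fun (c powr real_of_int k * t) \<xi>0" using scz[OF less_imp_le[OF t] U0, of k] unfolding \<xi>0 G_def by simp
    then have "norm (char_fun t \<xi>) \<le> \<rho> powr (c powr real_of_int k * t - 1)"
      using Kb[OF _ K0, of "c powr real_of_int k * t"] t by simp
    also have "\<dots> \<le> \<rho> powr (norm \<xi> powr \<alpha> / c * t - 1)"
    proof -
      have "norm \<xi> powr \<alpha> \<le> (G * g) powr \<alpha>" using G2 \<alpha> by (intro powr_mono2) simp_all
      also have "\<dots> = G powr \<alpha> * c" using G0 g by (simp add: powr_mult g\<alpha>)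
      finally have "norm \<xi> powr \<alpha> / c \<le> c powr real_of_int k" using c by (simp add: pos_divide_le_eq ck)
      then have "norm \<xi> powr \<alpha> / c * t \<le> c powr real_of_int k * t" using t by (intro mult_right_mono) simp_all
      then show ?thesis using \<rho>(1,2) by (intro powr_mono') simp_all
    qed
    also have "\<dots> = 1 / \<rho> * exp (- \<kappa> * t * norm \<xi> powr \<alpha>)"
    proof -
      have "- \<kappa> * t * norm \<xi> powr \<alpha> = (norm \<xi> powr \<alpha> / c * t) * ln \<rho>" by (simp add: \<kappa>_def)
      then have "exp (- \<kappa> * t * norm \<xi> powr \<alpha>) = \<rho> powr (norm \<xi> powr \<alpha> / c * t)"
        using \<rho>(1) by (simp only: powr_def) simp
      then show ?thesis using \<rho>(1) by (simp only: powr_diff) simp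
    qed
    finally show ?thesis .
  qed
  moreover have "0 \<le> 1 / \<rho>" using \<rho> by simp
  ultimately show ?thesis using \<kappa> by blast
qed

end

section \<open>Growth of the powers of the operator\<close>

text \<open>The one-parameter group generated by \<open>E\<close>; freeing the parameter makes
  differentiation in \<open>t\<close> available.\<close>

definition opexp :: "('a::euclidean_space \<Rightarrow> 'a) \<Rightarrow> real \<Rightarrow> 'a \<Rightarrow> 'a" where
  "opexp E t x = (\<Sum>n. (t ^ n / fact n) *\<^sub>R (E ^^ n) x)"

lemma op_powr_eq_opexp: "op_powr c E = opexp E (ln c)"
  by (rule ext) (simp add: op_powr_def opexp_def)

lemma linear_funpow: "linear E \<Longrightarrow> linear (E ^^ n)" for E :: "'a::real_vector \<Rightarrow> 'a"
  
proof (induction n)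
  case 0
  then show ?case by (simp add: linear_id[unfolded id_def] id_def)
next
  case (Suc n)
  then show ?case by (simp add: linear_compose[unfolded o_def] o_def)
qed

section \<open>The exponential of an operator, and polynomials of an operator\<close>

context
  fixes E :: "'a::euclidean_space \<Rightarrow> 'a"
  assumes E: "linear E"
begin

interpretation E: linear E by (rule E)

lemma norm_funpow_bound: "\<exists>K>0. \<forall>n x. norm ((E ^^ n) x) \<le> K ^ n * norm x"
proof -
  obtain K where K: "K > 0" "\<And>x. norm (E x) \<le> K * norm x" using linear_bounded_pos[OF E] by blast
  have "norm ((E ^^ n) x) \<le> K ^ n * norm x" for n x
  proof (induction n)
    case (Suc n)
    have "norm ((E ^^ Suc n) x) \<le> K * norm ((E ^^ n) x)" using K(2) by simp
    also have "\<dots> \<le> K * (K ^ n * norm x)" using Suc K(1) by (intro mult_left_mono) simp_all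
    finally show ?case by simp
  qed simp
  then show ?thesis using K(1) by blast
qed

lemma opexp_summable: "summable (\<lambda>n. (t ^ n / fact n) *\<^sub>R (E ^^ n) x)"
proof -
  obtain K where K: "K > 0" "\<And>n x. norm ((E ^^ n) x) \<le> K ^ n * norm x" using norm_funpow_bound by blast
  show ?thesis
  proof (rule summable_comparison_test'[where N=0])
    show "summable (\<lambda>n. ((\<bar>t\<bar> * K) ^ n /\<^sub>R fact n) * norm x)"
      by (intro summable_mult2 summable_exp_generic)
    fix n :: nat
    have "norm ((t ^ n / fact n) *\<^sub>R (E ^^ n) x) = \<bar>t\<bar> ^ n / fact n * norm ((E ^^ n) x)"
      by (simp add: power_abs)
    also have "\<dots> \<le> \<bar>t\<bar> ^ n / fact n * (K ^ n * norm x)" using K by (intro mult_left_mono) simp_all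
    finally show "norm ((t ^ n / fact n) *\<^sub>R (E ^^ n) x) \<le> ((\<bar>t\<bar> * K) ^ n /\<^sub>R fact n) * norm x"
      by (simp add: power_mult_distrib divide_inverse mult_ac)
  qed
qed

lemma linear_opexp: "linear (opexp E t)"
proof (rule linearI)
  fix x y r
  show "opexp E t (x + y) = opexp E t x + opexp E t y"
    unfolding opexp_def
    by (subst suminf_add[OF opexp_summable opexp_summable]) (simp add: linear_add[OF linear_funpow[OF E]] scaleR_add_right)
  show "opexp E t (r *\<^sub>R x) = r *\<^sub>R opexp E t x"
    unfolding opexp_def
    by (simp add: linear_scale[OF linear_funpow[OF E]] mult.commute suminf_scaleR_right[OF opexp_summable, of r t x])
qed

lemma opexp_commute: "E (opexp E t x) = opexp E t (E x)"
proof -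
  have bl: "bounded_linear E" using E by (rule linear_conv_bounded_linear[THEN iffD1])
  show ?thesis unfolding opexp_def
    by (subst bounded_linear.suminf[OF bl opexp_summable]) (simp add: E.scale funpow_swap1)
qed

lemma opexp_0: "opexp E 0 x = x"
proof -
  have "opexp E 0 x = (\<Sum>n. if n = 0 then x else 0)"
    unfolding opexp_def by (intro suminf_cong) simp
  also have "\<dots> = x" by (subst suminf_finite[of "{0}"]) auto
  finally show ?thesis .
qed

lemma opexp_eigen:
  assumes "E v = a *\<^sub>R v"
  shows "opexp E t v = exp (a * t) *\<^sub>R v"
proof -
  have p: "(E ^^ n) v = a ^ n *\<^sub>R v" for n by (induction n) (simp_all add: E.scale assms mult_ac)
  have "opexp E t v = (\<Sum>n. ((a * t) ^ n /\<^sub>R fact n) *\<^sub>R v)"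
    unfolding opexp_def by (intro suminf_cong) (simp add: p power_mult_distrib divide_inverse mult_ac)
  also have "\<dots> = (\<Sum>n. (a * t) ^ n /\<^sub>R fact n) *\<^sub>R v" by (rule suminf_scaleR_left[symmetric]) (rule summable_exp_generic)
  finally show ?thesis by (simp add: exp_def)
qed

lemma opexp_inner_sums: "(\<lambda>n. (((E ^^ n) y \<bullet> b) / fact n) * t ^ n) sums (opexp E t y \<bullet> b)"
proof -
  have "(\<lambda>n. ((t ^ n / fact n) *\<^sub>R (E ^^ n) y) \<bullet> b) sums (opexp E t y \<bullet> b)"
    unfolding opexp_def by (intro bounded_linear.sums[OF bounded_linear_inner_left] summable_sums opexp_summable)
  then show ?thesis by (simp add: mult.commute)
qed

lemma opexp_has_derivative:
  "((\<lambda>t. opexp E t y \<bullet> b) has_real_derivative (opexp E t (E y) \<bullet> b)) (at t)"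
proof -
  define k where "k n = ((E ^^ n) y \<bullet> b) / fact n" for n
  have s: "summable (\<lambda>n. k n * t ^ n)" for t
    using opexp_inner_sums[of y b t] unfolding k_def by (rule sums_summable)
  have e: "opexp E t y \<bullet> b = (\<Sum>n. k n * t ^ n)" for t
    using opexp_inner_sums[of y b t] unfolding k_def by (rule sums_unique)
  have "diffs k n = ((E ^^ n) (E y) \<bullet> b) / fact n" for n
    by (simp add: diffs_def k_def funpow_swap1 del: of_nat_Suc)
  then have e2: "(\<Sum>n. diffs k n * t ^ n) = opexp E t (E y) \<bullet> b"
    using sums_unique[OF opexp_inner_sums[of "E y" b t]] by simp
  show ?thesis using termdiffs_strong_converges_everywhere[of k t, OF s] unfolding e e2 .
qed

text \<open>The expression \<open>opexp E (s + t - r) (opexp E r y)\<close> has derivative 0 in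
  \<open>r\<close>, since \<open>E\<close> commutes with its exponential. Comparing
  \<open>r = 0\<close> with \<open>r = t\<close> gives the group law; the product rule is applied
  after expanding in the basis.\<close>

lemma opexp_add: "opexp E (s + t) y = opexp E s (opexp E t y)"
proof (rule euclidean_eqI)
  fix b :: 'a assume "b \<in> Basis"
  let ?T = "s + t"
  define h where "h r = opexp E (?T - r) (opexp E r y) \<bullet> b" for r
  have expand: "opexp E u x \<bullet> b = (\<Sum>e\<in>Basis. (x \<bullet> e) * (opexp E u e \<bullet> b))" for u x
  proof -
    have "opexp E u x = opexp E u (\<Sum>e\<in>Basis. (x \<bullet> e) *\<^sub>R e)" by (simp only: euclidean_representation)
    also have "\<dots> = (\<Sum>e\<in>Basis. (x \<bullet> e) *\<^sub>R opexp E u e)"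
      by (simp only: linear_sum[OF linear_opexp] linear_scale[OF linear_opexp])
    finally show ?thesis by (simp add: inner_sum_left)
  qed
  have "(h has_real_derivative 0) (at r)" for r
  proof -
    have d1: "((\<lambda>r. opexp E (?T - r) e \<bullet> b) has_real_derivative (- (opexp E (?T - r) (E e) \<bullet> b))) (at r)" for e
    proof -
      have "((\<lambda>r. ?T - r) has_real_derivative -1) (at r)" by (auto intro!: derivative_eq_intros)
      from DERIV_chain2[OF opexp_has_derivative this] show ?thesis by simp
    qed
    have "((\<lambda>r. \<Sum>e\<in>Basis. (opexp E r y \<bullet> e) * (opexp E (?T - r) e \<bullet> b)) has_real_derivative
        (\<Sum>e\<in>Basis. (opexp E r (E y) \<bullet> e) * (opexp E (?T - r) e \<bullet> b) + (- (opexp E (?T - r) (E e) \<bullet> b)) * (opexp E r y \<bullet> e))) (at r)"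
      by (intro DERIV_sum DERIV_mult opexp_has_derivative d1)
    moreover have "(\<Sum>e\<in>Basis. (opexp E r (E y) \<bullet> e) * (opexp E (?T - r) e \<bullet> b) + (- (opexp E (?T - r) (E e) \<bullet> b)) * (opexp E r y \<bullet> e)) = 0"
    proof -
      have "(\<Sum>e\<in>Basis. (opexp E r y \<bullet> e) * (opexp E (?T - r) (E e) \<bullet> b))
          = (\<Sum>e\<in>Basis. (opexp E r y \<bullet> e) *\<^sub>R opexp E (?T - r) (E e)) \<bullet> b" by (simp add: inner_sum_left)
      also have "(\<Sum>e\<in>Basis. (opexp E r y \<bullet> e) *\<^sub>R opexp E (?T - r) (E e)) = opexp E (?T - r) (E (\<Sum>e\<in>Basis. (opexp E r y \<bullet> e) *\<^sub>R e))"
        by (simp only: linear_sum[OF linear_opexp] linear_scale[OF linear_opexp] linear_sum[OF E] linear_scale[OF E])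
      also have "\<dots> = opexp E (?T - r) (opexp E r (E y))" by (simp only: euclidean_representation opexp_commute)
      finally show ?thesis using expand[of "?T - r" "opexp E r (E y)"]
        by (simp add: sum_subtractf mult.commute)
    qed
    moreover have "h = (\<lambda>r. \<Sum>e\<in>Basis. (opexp E r y \<bullet> e) * (opexp E (?T - r) e \<bullet> b))"
      unfolding h_def by (rule ext) (rule expand)
    ultimately show ?thesis by simp
  qed
  then have "h 0 = h t" by (intro DERIV_isconst_all) blast
  then show "opexp E (s + t) y \<bullet> b = opexp E s (opexp E t y) \<bullet> b" by (simp add: h_def opexp_0)
qed

lemma opexp_minus: "opexp E (- t) (opexp E t x) = x"
  using opexp_add[of "- t" t x] by (simp add: opexp_0)

lemma op_powr_funpow:
  assumes "0 < c"
  shows "(op_powr c E ^^ n) x = opexp E (real n * ln c) x"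
proof (induction n)
  case 0
  then show ?case by (simp add: opexp_0)
next
  case (Suc n)
  then show ?case by (simp add: op_powr_eq_opexp opexp_add[symmetric] algebra_simps)
qed

lemma poly_op_bound:
  assumes "degree P \<le> N"
  shows "poly_op P E x = (\<Sum>i\<le>N. coeff P i *\<^sub>R (E ^^ i) x)"
  unfolding poly_op_def using assms by (intro sum.mono_neutral_left) (auto intro: coeff_eq_0)

lemma poly_op_pCons: "poly_op (pCons a P) E x = a *\<^sub>R x + E (poly_op P E x)"
proof -
  have "poly_op (pCons a P) E x = (\<Sum>i\<le>Suc (degree P). coeff (pCons a P) i *\<^sub>R (E ^^ i) x)"
    by (rule poly_op_bound) (rule degree_pCons_le)
  also have "\<dots> = a *\<^sub>R x + (\<Sum>i\<le>degree P. coeff P i *\<^sub>R E ((E ^^ i) x))"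
    by (subst sum.atMost_Suc_shift) simp
  also have "(\<Sum>i\<le>degree P. coeff P i *\<^sub>R E ((E ^^ i) x)) = E (poly_op P E x)"
    by (simp add: poly_op_def E.sum E.scale)
  finally show ?thesis .
qed

lemma poly_op_0: "poly_op 0 E x = 0"
  by (simp add: poly_op_def)

lemma poly_op_add: "poly_op (P + Q) E x = poly_op P E x + poly_op Q E x"
proof -
  define N where "N = max (degree P) (degree Q)"
  have "degree P \<le> N" "degree Q \<le> N" "degree (P + Q) \<le> N" by (auto simp: N_def degree_add_le_max)
  then show ?thesis by (simp add: poly_op_bound[where N=N] scaleR_add_left sum.distrib)
qed

lemma poly_op_smult: "poly_op (smult a P) E x = a *\<^sub>R poly_op P E x"
  by (subst poly_op_bound[OF degree_smult_le]) (simp add: poly_op_def scaleR_sum_right)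

lemma poly_op_mult: "poly_op (P * Q) E x = poly_op P E (poly_op Q E x)"
proof (induction P)
  case 0
  then show ?case by (simp add: poly_op_0)
next
  case (pCons a P)
  then show ?case by (simp add: mult_pCons_left poly_op_add poly_op_smult poly_op_pCons)
qed

end

text \<open>The linear functional on polynomials that sends the \<open>i\<close>-th power to
  \<open>m i\<close>. With \<open>m i\<close> a component of the exponential applied to
  \<open>(E ^^ i) y\<close>, complex polynomials in \<open>E\<close> can be tested without
  complexifying the space.\<close>

definition umbral :: "(nat \<Rightarrow> complex) \<Rightarrow> complex poly \<Rightarrow> complex" where
  "umbral m P = (\<Sum>i\<le>degree P. coeff P i * m i)"

lemma umbral_bound: "degree P \<le> N \<Longrightarrow> umbral m P = (\<Sum>i\<le>N. coeff P i * m i)"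
  unfolding umbral_def by (intro sum.mono_neutral_left) (auto intro: coeff_eq_0)

lemma umbral_linear_factor: "umbral m ([:-z, 1:] * P) = umbral (\<lambda>i. m (Suc i)) P - z * umbral m P"
proof -
  define N where "N = degree P"
  have co: "coeff ([:-z, 1:] * P) i = coeff (pCons 0 P) i - z * coeff P i" for i by simp
  have "degree ([:-z, 1:] * P) \<le> Suc N" unfolding N_def using degree_mult_le[of "[:-z,1:]" P] by simp
  then have "umbral m ([:-z, 1:] * P) = (\<Sum>i\<le>Suc N. coeff ([:-z, 1:] * P) i * m i)" by (rule umbral_bound)
  also have "\<dots> = (\<Sum>i\<le>Suc N. coeff (pCons 0 P) i * m i) - z * (\<Sum>i\<le>Suc N. coeff P i * m i)"
    unfolding co by (simp only: left_diff_distrib sum_subtractf sum_distrib_left mult.assoc)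
  also have "(\<Sum>i\<le>Suc N. coeff P i * m i) = umbral m P"
    by (rule umbral_bound[symmetric]) (simp add: N_def)
  also have "(\<Sum>i\<le>Suc N. coeff (pCons 0 P) i * m i) = umbral (\<lambda>i. m (Suc i)) P"
    by (subst sum.atMost_Suc_shift) (simp add: umbral_def N_def)
  finally show ?thesis .
qed

text \<open>Variation of constants: \<open>exp (z * t) * f t\<close> has a derivative of size at
  most \<open>C * exp (b * t)\<close> with \<open>b = Re z - a > 0\<close>. Integrating and dividing
  by the exponential leaves the rate \<open>a\<close>.\<close>

lemma decay_of_perturbed_decay:
  fixes f :: "real \<Rightarrow> complex" and a :: real
  assumes d: "\<And>t. (f has_vector_derivative (- z * f t - g t)) (at t)"
    and g: "\<And>t. 0 \<le> t \<Longrightarrow> norm (g t) \<le> C * exp (- a * t)" and z: "a < Re z"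
  shows "\<exists>C'. \<forall>t\<ge>0. norm (f t) \<le> C' * exp (- a * t)"
proof -
  define b where "b = Re z - a"
  have b: "0 < b" using z by (simp add: b_def)
  have C: "0 \<le> C" using order_trans[OF norm_ge_zero g[of 0]] by simp
  define F where "F t = exp (z * of_real t) * f t" for t
  define G where "G t = C / b * exp (b * t)" for t
  have ez: "((\<lambda>t. exp (z * of_real t)) has_vector_derivative (z * exp (z * of_real t))) (at t)" for t
    by (rule has_vector_derivative_real_field) (auto intro!: derivative_eq_intros)
  have dF: "(F has_vector_derivative (- exp (z * of_real t) * g t)) (at t)" for t
    using has_vector_derivative_mult[OF ez d] unfolding F_def by (simp add: algebra_simps)
  have dG: "(G has_vector_derivative (C * exp (b * t))) (at t)" for t
  proof -
    have "(G has_real_derivative (C / b * (exp (b * t) * b))) (at t)"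
      unfolding G_def by (auto intro!: derivative_eq_intros)
    then show ?thesis using b by (simp add: has_real_derivative_iff_has_vector_derivative mult.commute)
  qed
  have main: "norm (f t) \<le> (norm (f 0) + C / b) * exp (- a * t)" if t: "0 \<le> t" for t
  proof -
    have "norm (F t - F 0) \<le> G t - G 0"
    proof (cases "t = 0")
      case False
      then have "0 < t" using t by simp
      then show ?thesis
      proof (rule differentiable_bound_general)
        show "continuous_on {0..t} F" "continuous_on {0..t} G"
          by (meson dF dG continuous_at_imp_continuous_on has_vector_derivative_continuous)+
        fix x assume x: "0 < x" "x < t"
        show "(F has_vector_derivative (- exp (z * of_real x) * g x)) (at x)" by (rule dF)
        show "(G has_vector_derivative (C * exp (b * x))) (at x)" by (rule dG)
        have "norm (- exp (z * of_real x) * g x) = exp (Re z * x) * norm (g x)" by (simp add: norm_mult)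
        also have "\<dots> \<le> exp (Re z * x) * (C * exp (- a * x))" using g[of x] x by (intro mult_left_mono) simp_all
        also have "\<dots> = C * exp (b * x)" by (simp add: b_def exp_add[symmetric] algebra_simps)
        finally show "norm (- exp (z * of_real x) * g x) \<le> C * exp (b * x)" .
      qed
    qed simp
    moreover have "norm (F t) \<le> norm (F 0) + norm (F t - F 0)" by (rule norm_triangle_sub)
    moreover have "F 0 = f 0" by (simp add: F_def)
    moreover have "0 \<le> G 0" using C b by (simp add: G_def)
    ultimately have "norm (F t) \<le> norm (f 0) + C / b * exp (b * t)" by (simp add: G_def)
    moreover have "norm (F t) = exp (Re z * t) * norm (f t)" by (simp add: F_def norm_mult)
    ultimately have "exp (Re z * t) * norm (f t) \<le> norm (f 0) + C / b * exp (b * t)" by simp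
    then have le: "exp (- Re z * t) * (exp (Re z * t) * norm (f t)) \<le> exp (- Re z * t) * (norm (f 0) + C / b * exp (b * t))"
      by (rule mult_left_mono) simp
    have "norm (f t) = exp (- Re z * t) * (exp (Re z * t) * norm (f t))"
      by (simp add: mult.assoc[symmetric] exp_add[symmetric])
    also have "\<dots> \<le> exp (- Re z * t) * norm (f 0) + exp (- Re z * t) * (C / b * exp (b * t))"
      using le by (simp only: distrib_left)
    also have "exp (- Re z * t) * (C / b * exp (b * t)) = C / b * exp (- a * t)"
      by (simp add: mult.left_commute exp_add[symmetric] b_def algebra_simps)
    also have "exp (- Re z * t) * norm (f 0) \<le> exp (- a * t) * norm (f 0)"
      using z t by (intro mult_right_mono) (simp_all add: mult_right_mono)
    finally show ?thesis by (simp add: algebra_simps)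
  qed
  then show ?thesis by blast
qed

lemma map_poly_of_real_prod:
  "map_poly complex_of_real (\<Prod>j\<in>S. q j) = (\<Prod>j\<in>S. map_poly complex_of_real (q j))"
proof (induction S rule: infinite_finite_induct)
  case (insert j S)
  have "map_poly complex_of_real (p * r) = map_poly complex_of_real p * map_poly complex_of_real r" for p r
    by (rule poly_eqI) (simp add: coeff_map_poly coeff_mult)
  then show ?case using insert by simp
qed simp_all

section \<open>Removal of the complex roots and growth of the powers\<close>

context
  fixes E :: "'a::euclidean_space \<Rightarrow> 'a"
  assumes E: "linear E"
begin

interpretation E: linear E by (rule E)

lemma umbral_real_poly:
  "umbral (\<lambda>i. of_real (opexp E t ((E ^^ i) y) \<bullet> b)) (map_poly of_real Q) = of_real (opexp E t (poly_op Q E y) \<bullet> b)"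
proof -
  have "umbral (\<lambda>i. of_real (opexp E t ((E ^^ i) y) \<bullet> b)) (map_poly of_real Q) = of_real (\<Sum>i\<le>degree Q. coeff Q i * (opexp E t ((E ^^ i) y) \<bullet> b))"
    by (subst umbral_bound[OF map_poly_degree_leq]) (simp_all add: coeff_map_poly)
  also have "(\<Sum>i\<le>degree Q. coeff Q i * (opexp E t ((E ^^ i) y) \<bullet> b)) = (opexp E t (poly_op Q E y) \<bullet> b)"
    by (simp add: poly_op_def linear_sum[OF linear_opexp[OF E]] linear_scale[OF linear_opexp[OF E]] inner_sum_left)
  finally show ?thesis .
qed

lemma umbral_opexp_derivative:
  "((\<lambda>t. umbral (\<lambda>i. of_real (opexp E (- t) ((E ^^ i) y) \<bullet> b)) P) has_vector_derivative
     - umbral (\<lambda>i. of_real (opexp E (- t) ((E ^^ Suc i) y) \<bullet> b)) P) (at t)"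
proof -
  have d: "((\<lambda>t. of_real (opexp E (- t) ((E ^^ i) y) \<bullet> b) :: complex) has_vector_derivative
      of_real (- (opexp E (- t) ((E ^^ Suc i) y) \<bullet> b))) (at t)" for i
  proof -
    have "((\<lambda>t. - t) has_real_derivative -1) (at t)" by (auto intro!: derivative_eq_intros)
    from DERIV_chain2[OF opexp_has_derivative[OF E] this]
    have "((\<lambda>t. opexp E (- t) ((E ^^ i) y) \<bullet> b) has_real_derivative - (opexp E (- t) ((E ^^ Suc i) y) \<bullet> b)) (at t)"
      by simp
    then show ?thesis by (intro has_vector_derivative_of_real) (simp add: has_real_derivative_iff_has_vector_derivative)
  qed
  have "((\<lambda>t. \<Sum>i\<le>degree P. coeff P i * of_real (opexp E (- t) ((E ^^ i) y) \<bullet> b)) has_vector_derivative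
      (\<Sum>i\<le>degree P. coeff P i * of_real (- (opexp E (- t) ((E ^^ Suc i) y) \<bullet> b)))) (at t)"
    by (intro has_vector_derivative_sum has_vector_derivative_mult_right d)
  then show ?thesis by (simp add: umbral_def sum_negf)
qed

text \<open>
  The functions \<open>u P\<close> obtained by applying \<open>umbral\<close> to \<open>P\<close> satisfy \<open>u P' = - z * u P - u ([:- z, 1:] * P)\<close>, so
  decay of \<open>u ([:- z, 1:] * P)\<close> at rate \<open>a < Re z\<close> gives decay of \<open>u P\<close> at the same rate. In this way the
  roots are removed one at a time.
\<close>

lemma opexp_component_decay:
  assumes P: "\<And>z. z \<in># A \<Longrightarrow> a < Re z"
    and dec: "\<exists>C. \<forall>t\<ge>0. norm (umbral (\<lambda>i. of_real (opexp E (- t) ((E ^^ i) y) \<bullet> b)) (\<Prod>z\<in>#A. [:-z, 1:])) \<le> C * exp (- a * t)"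
  shows "\<exists>C. \<forall>t\<ge>0. \<bar>opexp E (- t) y \<bullet> b\<bar> \<le> C * exp (- a * t)"
  using assms
proof (induction A)
  case empty
  then show ?case by (simp add: umbral_def)
next
  case (add z A)
  define Q where "Q = (\<Prod>z\<in>#A. [:-z, 1:])"
  define m where "m t i = complex_of_real (opexp E (- t) ((E ^^ i) y) \<bullet> b)" for t i
  obtain C where C: "\<And>t. 0 \<le> t \<Longrightarrow> norm (umbral (m t) ([:-z, 1:] * Q)) \<le> C * exp (- a * t)"
    using add.prems(2) unfolding Q_def m_def image_mset_add_mset prod_mset.add_mset by blast
  have "\<exists>C. \<forall>t\<ge>0. norm (umbral (m t) Q) \<le> C * exp (- a * t)"
  proof (rule decay_of_perturbed_decay)
    show "((\<lambda>t. umbral (m t) Q) has_vector_derivative (- z * umbral (m t) Q - umbral (m t) ([:-z, 1:] * Q))) (at t)" for t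
      using umbral_opexp_derivative[of y b Q t] unfolding umbral_linear_factor m_def by (simp add: algebra_simps)
    show "norm (umbral (m t) ([:-z, 1:] * Q)) \<le> C * exp (- a * t)" if "0 \<le> t" for t by (rule C[OF that])
    show "a < Re z" by (rule add.prems(1)) simp
  qed
  then show ?case using add.IH add.prems(1) unfolding Q_def m_def by auto
qed

text \<open>Let \<open>Q\<close> be the product of the factors other than \<open>q 1\<close>. As
  \<open>q 1 * Q\<close> annihilates \<open>E\<close>, the vector \<open>poly_op Q E y\<close> lies
  in the principal space, where the inverse exponential decays exactly at rate \<open>a 1\<close>.
  The roots of \<open>Q\<close> have larger real part, so removing them transfers this rate to
  \<open>y\<close>.\<close>

lemma op_powr_growth:
  assumes c: "1 < c" and sf: "spectral_factorization E p q a"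
    and E1: "\<And>x. x \<in> spectral_space E q 1 \<Longrightarrow> E x = a 1 *\<^sub>R x"
  shows "\<exists>C>0. \<forall>n x. norm x \<le> C * c powr (- real n * a 1) * norm ((op_powr c E ^^ n) x)"
proof -
  define Q where "Q = (\<Prod>j\<in>{2..p}. q j)"
  define QC where "QC = map_poly complex_of_real Q"
  have mp: "minimal_poly E (\<Prod>j\<in>{1..p}. q j)" and roots: "\<And>j z. j \<in> {1..p} \<Longrightarrow> poly (map_poly complex_of_real (q j)) z = 0 \<Longrightarrow> Re z = a j"
    and deg: "\<And>j. j \<in> {1..p} \<Longrightarrow> 0 < degree (q j)" and mono: "strict_mono_on {1..p} a"
    using sf by (auto simp: spectral_factorization_def)
  \<comment> \<open>For \<open>p = 0\<close> the empty product 1 would annihilate \<open>E\<close>,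
    which is impossible in a nonzero space.\<close>
  have p1: "1 \<le> p"
  proof (rule ccontr)
    assume "\<not> 1 \<le> p"
    then have "poly_op 1 E x = 0" for x using mp by (simp add: minimal_poly_def)
    then have "x = 0" for x :: 'a by (simp add: poly_op_def)
    then show False using nonempty_Basis nonzero_Basis by blast
  qed
  have prod: "(\<Prod>j\<in>{1..p}. q j) = q 1 * Q"
    unfolding Q_def using p1 by (simp add: prod.atLeast_Suc_atMost numeral_2_eq_2)
  have "q j \<noteq> 0" if "j \<in> {2..p}" for j using deg[of j] that by auto
  then have Q0: "Q \<noteq> 0" unfolding Q_def by simp
  have QC0: "QC \<noteq> 0" unfolding QC_def using Q0 by (simp add: map_poly_eq_0_iff)
  obtain A where A: "QC = smult (lead_coeff QC) (\<Prod>x\<in>#A. [:-x, 1:])" using alg_closed_imp_factorization[OF QC0] by blast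
  have Aroot: "a 1 < Re z" if z: "z \<in># A" for z
  proof -
    have "poly QC z = 0"
      by (subst A) (use z in \<open>auto simp: poly_prod_mset prod_mset_zero_iff\<close>)
    moreover have "poly QC z = (\<Prod>j\<in>{2..p}. poly (map_poly complex_of_real (q j)) z)"
    proof -
      have "QC = (\<Prod>j\<in>{2..p}. map_poly complex_of_real (q j))"
        unfolding QC_def Q_def by (rule map_poly_of_real_prod)
      then show ?thesis by (simp add: poly_prod)
    qed
    ultimately obtain j where j: "j \<in> {2..p}" "poly (map_poly complex_of_real (q j)) z = 0" by auto
    then have "Re z = a j" by (intro roots) auto
    moreover have "a 1 < a j" using j(1) by (intro strict_mono_onD[OF mono]) auto
    ultimately show ?thesis by simp
  qed
  have dec: "\<exists>C. \<forall>t\<ge>0. \<bar>opexp E (- t) y \<bullet> b\<bar> \<le> C * exp (- a 1 * t)" for y b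
  proof (rule opexp_component_decay[OF Aroot])
    define v where "v = poly_op Q E y"
    have "poly_op (q 1) E v = poly_op (\<Prod>j\<in>{1..p}. q j) E y" unfolding v_def prod by (rule poly_op_mult[OF E, symmetric])
    also have "\<dots> = 0" using mp by (simp add: minimal_poly_def)
    finally have "E v = a 1 *\<^sub>R v" by (intro E1) (simp add: spectral_space_def)
    then have ev: "opexp E t v = exp (a 1 * t) *\<^sub>R v" for t by (rule opexp_eigen[OF E])
    define l where "l = lead_coeff QC"
    have l: "l \<noteq> 0" unfolding l_def using QC0 by simp
    have "norm (umbral (\<lambda>i. of_real (opexp E (- t) ((E ^^ i) y) \<bullet> b)) (\<Prod>z\<in>#A. [:-z, 1:])) \<le> \<bar>v \<bullet> b\<bar> / norm l * exp (- a 1 * t)" for t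
    proof -
      define m where "m i = complex_of_real (opexp E (- t) ((E ^^ i) y) \<bullet> b)" for i
      have "l * umbral m (\<Prod>z\<in>#A. [:-z, 1:]) = umbral m QC"
      proof -
        have "QC = smult l (\<Prod>z\<in>#A. [:-z, 1:])" using A unfolding l_def .
        then show ?thesis using l by (simp add: umbral_def sum_distrib_left mult.assoc)
      qed
      also have "\<dots> = of_real (exp (- a 1 * t) * (v \<bullet> b))"
        unfolding m_def QC_def umbral_real_poly v_def[symmetric] ev by simp
      finally have "norm l * norm (umbral m (\<Prod>z\<in>#A. [:-z, 1:])) = exp (- a 1 * t) * \<bar>v \<bullet> b\<bar>"
        by (metis norm_mult norm_of_real abs_mult abs_exp_cancel)
      then show ?thesis using l unfolding m_def[symmetric] by (simp add: field_simps)
    qed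
    then show "\<exists>C. \<forall>t\<ge>0. norm (umbral (\<lambda>i. of_real (opexp E (- t) ((E ^^ i) y) \<bullet> b)) (\<Prod>z\<in>#A. [:-z, 1:])) \<le> C * exp (- a 1 * t)"
      by blast
  qed
  then obtain Cf where Cf: "\<And>y b t. 0 \<le> t \<Longrightarrow> \<bar>opexp E (- t) y \<bullet> b\<bar> \<le> Cf y b * exp (- a 1 * t)" by metis
  \<comment> \<open>By linearity the decay of the matrix entries, with one constant for each pair of
    basis vectors, gives a bound uniform in the vector.\<close>
  define C where "C = 1 + (\<Sum>b\<in>Basis. \<Sum>e\<in>Basis. \<bar>Cf e b\<bar>)"
  have C: "0 < C" unfolding C_def by (intro add_pos_nonneg sum_nonneg) simp_all
  have bound: "norm (opexp E (- t) y) \<le> C * exp (- a 1 * t) * norm y" if t: "0 \<le> t" for t y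
  proof -
    have "norm (opexp E (- t) y) \<le> (\<Sum>b\<in>Basis. \<bar>opexp E (- t) y \<bullet> b\<bar>)" by (rule norm_le_l1)
    also have "\<dots> \<le> (\<Sum>b\<in>Basis. \<Sum>e\<in>Basis. \<bar>Cf e b\<bar> * (exp (- a 1 * t) * norm y))"
    proof (rule sum_mono)
      fix b :: 'a
      have "opexp E (- t) y = opexp E (- t) (\<Sum>e\<in>Basis. (y \<bullet> e) *\<^sub>R e)" by (simp only: euclidean_representation)
      also have "\<dots> = (\<Sum>e\<in>Basis. (y \<bullet> e) *\<^sub>R opexp E (- t) e)"
        by (simp only: linear_sum[OF linear_opexp[OF E]] linear_scale[OF linear_opexp[OF E]])
      finally have "\<bar>opexp E (- t) y \<bullet> b\<bar> = \<bar>\<Sum>e\<in>Basis. (y \<bullet> e) * (opexp E (- t) e \<bullet> b)\<bar>" by (simp add: inner_sum_left)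
      also have "\<dots> \<le> (\<Sum>e\<in>Basis. \<bar>(y \<bullet> e) * (opexp E (- t) e \<bullet> b)\<bar>)" by (rule sum_abs)
      also have "\<dots> \<le> (\<Sum>e\<in>Basis. \<bar>Cf e b\<bar> * (exp (- a 1 * t) * norm y))"
      proof (rule sum_mono)
        fix e :: 'a assume e: "e \<in> Basis"
        have "\<bar>y \<bullet> e\<bar> * \<bar>opexp E (- t) e \<bullet> b\<bar> \<le> norm y * (\<bar>Cf e b\<bar> * exp (- a 1 * t))"
        proof (rule mult_mono)
          show "\<bar>y \<bullet> e\<bar> \<le> norm y" by (rule Basis_le_norm[OF e])
          have "Cf e b * exp (- a 1 * t) \<le> \<bar>Cf e b\<bar> * exp (- a 1 * t)" by (intro mult_right_mono) simp_all
          then show "\<bar>opexp E (- t) e \<bullet> b\<bar> \<le> \<bar>Cf e b\<bar> * exp (- a 1 * t)" using Cf[OF t, of e b] by linarith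
        qed simp_all
        then show "\<bar>(y \<bullet> e) * (opexp E (- t) e \<bullet> b)\<bar> \<le> \<bar>Cf e b\<bar> * (exp (- a 1 * t) * norm y)"
          by (simp only: abs_mult mult_ac)
      qed
      finally show "\<bar>opexp E (- t) y \<bullet> b\<bar> \<le> (\<Sum>e\<in>Basis. \<bar>Cf e b\<bar> * (exp (- a 1 * t) * norm y))" .
    qed
    also have "\<dots> = (\<Sum>b\<in>Basis. \<Sum>e\<in>Basis. \<bar>Cf e b\<bar>) * (exp (- a 1 * t) * norm y)" by (simp only: sum_distrib_right)
    also have "\<dots> \<le> C * (exp (- a 1 * t) * norm y)" unfolding C_def by (intro mult_right_mono) simp_all
    finally show ?thesis by (simp add: mult.assoc)
  qed
  have "norm x \<le> C * c powr (- real n * a 1) * norm ((op_powr c E ^^ n) x)" for n x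
  proof -
    have "norm (opexp E (- (real n * ln c)) (opexp E (real n * ln c) x)) \<le> C * exp (- a 1 * (real n * ln c)) * norm (opexp E (real n * ln c) x)"
      using c by (intro bound) simp
    moreover have "exp (- a 1 * (real n * ln c)) = c powr (- real n * a 1)" using c by (simp add: powr_def mult_ac)
    ultimately show ?thesis using op_powr_funpow[OF E, of c n x] c by (simp add: opexp_minus[OF E])
  qed
  then show ?thesis using C by blast
qed

end

section \<open>The exact Hausdorff measure function\<close>

lemma loglog_gauge:
  fixes \<alpha> \<theta> \<delta>0 :: real
  assumes \<alpha>: "0 < \<alpha>" and \<theta>: "0 < \<theta>" and \<delta>0: "0 < \<delta>0"
    and \<phi>: "\<And>r. 0 < r \<Longrightarrow> r < \<delta>0 \<Longrightarrow> \<phi> r = r powr \<alpha> * ln (ln (1 / r)) powr \<theta>"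
  obtains \<delta> where "0 < \<delta>" "\<delta> \<le> \<delta>0" "\<And>r. 0 < r \<Longrightarrow> r < \<delta> \<Longrightarrow> 0 < ln (1 / r)" "\<And>r. 0 < r \<Longrightarrow> r < \<delta> \<Longrightarrow> 1 \<le> ln (ln (1 / r))" "mono_on {0<..<\<delta>} \<phi>"
    "hausdorff_gauge \<phi>" "(\<phi> \<longlongrightarrow> 0) (at_right 0)"
proof -
  define f where "f r = r powr \<alpha> * ln (ln (1 / r)) powr \<theta>" for r
  \<comment> \<open>For \<open>ln (1 / r) \<ge> u0\<close>, the bound \<open>exp 1\<close> makes the
    iterated logarithm at least 1, and \<open>\<theta> / \<alpha>\<close> then makes the last factor
    of \<open>f'\<close> nonnegative.\<close>
  define u0 where "u0 = max (exp 1) (\<theta> / \<alpha>)"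
  define \<delta> where "\<delta> = min \<delta>0 (exp (- u0))"
  have u0: "exp 1 \<le> u0" "\<theta> / \<alpha> \<le> u0" by (auto simp: u0_def)
  have \<delta>: "0 < \<delta>" "\<delta> \<le> \<delta>0" "\<delta> \<le> exp (- u0)" using \<delta>0 by (auto simp: \<delta>_def)
  have lnr: "u0 \<le> ln (1 / r)" if "0 < r" "r < \<delta>" for r
  proof -
    have "ln r \<le> ln (exp (- u0))" using that \<delta>(3) by (subst ln_le_cancel_iff) simp_all
    then show ?thesis using that by (simp add: ln_div)
  qed
  have lnpos: "0 < ln (1 / r)" if "0 < r" "r < \<delta>" for r
    using lnr[OF that] u0(1) exp_gt_zero[of "1::real"] by linarith
  have lnln: "1 \<le> ln (ln (1 / r))" if "0 < r" "r < \<delta>" for r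
  proof -
    have "ln (exp 1) \<le> ln (ln (1 / r))"
      using lnr[OF that] u0(1) lnpos[OF that] by (subst ln_le_cancel_iff) simp_all
    then show ?thesis by simp
  qed
  have feq: "\<phi> r = f r" if "0 < r" "r < \<delta>" for r using \<phi>[of r] that \<delta>(2) by (simp add: f_def)
  define f' where "f' r = r powr \<alpha> * ln (ln (1 / r)) powr \<theta> / r * (\<alpha> - \<theta> / (ln (1 / r) * ln (ln (1 / r))))" for r
  have df: "(f has_real_derivative f' r) (at r)" if r: "0 < r" "r < \<delta>" for r
  proof -
    have l1: "ln (1 / r) > 0" by (rule lnpos[OF r])
    have l2: "ln (ln (1 / r)) > 0" using lnln[OF r] by linarith
    have d1: "((\<lambda>r. ln (1 / r)) has_real_derivative (- 1 / r)) (at r)"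
      using r(1) by (auto intro!: derivative_eq_intros simp: field_simps power2_eq_square)
    have d2: "((\<lambda>r. ln (ln (1 / r))) has_real_derivative (- 1 / r / ln (1 / r))) (at r)"
      using DERIV_chain2[OF DERIV_ln_divide[OF l1] d1] by (simp add: mult.commute)
    have d3: "((\<lambda>r. ln (ln (1 / r)) powr \<theta>) has_real_derivative (\<theta> * ln (ln (1 / r)) powr (\<theta> - 1) * (- 1 / r / ln (1 / r)))) (at r)"
      by (rule DERIV_chain2[OF has_real_derivative_powr[OF l2] d2])
    have d4: "((\<lambda>r. r powr \<alpha>) has_real_derivative (\<alpha> * r powr (\<alpha> - 1))) (at r)"
      by (rule has_real_derivative_powr[OF r(1)])
    have eq: "\<alpha> * r powr (\<alpha> - 1) * ln (ln (1 / r)) powr \<theta> + \<theta> * ln (ln (1 / r)) powr (\<theta> - 1) * (- 1 / r / ln (1 / r)) * r powr \<alpha> = f' r"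
    proof -
      have "r powr (\<alpha> - 1) = r powr \<alpha> / r" using r(1) by (simp add: powr_diff)
      moreover have "ln (ln (1 / r)) powr (\<theta> - 1) = ln (ln (1 / r)) powr \<theta> / ln (ln (1 / r))" using l2 by (simp add: powr_diff)
      ultimately show ?thesis unfolding f'_def by (simp add: right_diff_distrib mult_ac)
    qed
    show ?thesis using DERIV_mult[OF d4 d3] unfolding f_def[abs_def] eq .
  qed
  have f'0: "0 \<le> f' r" if r: "0 < r" "r < \<delta>" for r
  proof -
    have "\<theta> / \<alpha> * 1 \<le> ln (1 / r) * ln (ln (1 / r))"
      using lnr[OF r] lnln[OF r] u0(2) lnpos[OF r] \<alpha> \<theta> by (intro mult_mono) simp_all
    then have "\<theta> \<le> \<alpha> * (ln (1 / r) * ln (ln (1 / r)))" using \<alpha> by (simp add: pos_divide_le_eq mult.commute)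
    moreover have "0 < ln (1 / r) * ln (ln (1 / r))" using lnpos[OF r] lnln[OF r] by (intro mult_pos_pos) linarith+
    ultimately have "\<theta> / (ln (1 / r) * ln (ln (1 / r))) \<le> \<alpha>" by (simp only: pos_divide_le_eq)
    then show ?thesis using r(1) unfolding f'_def by (intro mult_nonneg_nonneg divide_nonneg_pos) simp_all
  qed
  have mono: "mono_on {0<..<\<delta>} \<phi>"
  proof (rule mono_onI)
    fix r s assume rs: "r \<in> {0<..<\<delta>}" "s \<in> {0<..<\<delta>}" "r \<le> s"
    have "f r \<le> f s"
    proof (rule DERIV_nonneg_imp_nondecreasing[OF rs(3)])
      fix x assume "r \<le> x" "x \<le> s"
      then have x: "0 < x" "x < \<delta>" using rs by auto
      show "\<exists>y. (f has_real_derivative y) (at x) \<and> 0 \<le> y" using df[OF x] f'0[OF x] by blast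
    qed
    then show "\<phi> r \<le> \<phi> s" using feq rs by simp
  qed
  have rc: "(\<phi> \<longlongrightarrow> \<phi> s) (at_right s)" if s: "s \<in> {0<..<\<delta>}" for s
  proof -
    have "isCont f s" using df[of s] s by (intro DERIV_isCont) auto
    then have "(f \<longlongrightarrow> f s) (at_right s)" by (simp add: isCont_def filterlim_at_split)
    moreover have "\<forall>\<^sub>F x in at_right s. \<phi> x = f x"
      unfolding eventually_at_right_field using s feq by (intro exI[of _ \<delta>]) auto
    ultimately show ?thesis using feq[of s] s by (subst filterlim_cong[OF refl refl]) simp_all
  qed
  \<comment> \<open>Doubling the radius decreases the iterated logarithm, so only the power
    contributes.\<close>
  have dbl: "\<phi> (2 * s) / \<phi> s \<le> 2 powr \<alpha>" if s: "0 < s" "s < \<delta> / 2" for s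
  proof -
    have r: "0 < 2 * s" "2 * s < \<delta>" "s < \<delta>" using s by simp_all
    have pos: "0 < ln (ln (1 / s)) powr \<theta>" using lnln[OF s(1) r(3)] by simp
    have le: "ln (ln (1 / (2 * s))) powr \<theta> \<le> ln (ln (1 / s)) powr \<theta>"
    proof (rule powr_mono2)
      show "0 \<le> ln (ln (1 / (2 * s)))" using lnln[OF r(1,2)] by linarith
      have "1 / (2 * s) \<le> 1 / s" using s(1) by (simp add: field_simps)
      then have "ln (1 / (2 * s)) \<le> ln (1 / s)" using s(1) by (subst ln_le_cancel_iff) simp_all
      then show "ln (ln (1 / (2 * s))) \<le> ln (ln (1 / s))" using lnpos[OF r(1,2)] lnpos[OF s(1) r(3)] by (subst ln_le_cancel_iff) simp_all
    qed (use \<theta> in simp)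
    have "f (2 * s) = 2 powr \<alpha> * (s powr \<alpha> * ln (ln (1 / (2 * s))) powr \<theta>)"
      using s(1) by (simp add: f_def powr_mult)
    also have "\<dots> \<le> 2 powr \<alpha> * f s" unfolding f_def by (intro mult_left_mono le) simp_all
    finally have "f (2 * s) \<le> 2 powr \<alpha> * f s" .
    moreover have "0 < f s" unfolding f_def using pos s(1) by (intro mult_pos_pos) simp_all
    ultimately show ?thesis using feq[OF r(1,2)] feq[OF s(1) r(3)] by (simp add: pos_divide_le_eq)
  qed
  have "(f \<longlongrightarrow> 0) (at_right 0)" unfolding f_def using \<alpha> \<theta> by real_asymp
  moreover have "\<forall>\<^sub>F x in at_right 0. \<phi> x = f x"
    unfolding eventually_at_right_field using feq \<delta>(1) by (intro exI[of _ \<delta>]) auto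
  ultimately have lim: "(\<phi> \<longlongrightarrow> 0) (at_right 0)" by (subst filterlim_cong[OF refl refl]) simp_all
  have K: "\<exists>K>0. \<forall>s. 0 < s \<and> s < \<delta> / 2 \<longrightarrow> \<phi> (2 * s) / \<phi> s \<le> K"
    by (intro exI[of _ "2 powr \<alpha>"]) (use dbl in simp)
  have "hausdorff_gauge \<phi>"
    unfolding hausdorff_gauge_def using \<delta>(1) mono rc K lim by blast
  then show ?thesis using that[OF \<delta>(1,2) lnpos lnln mono _ lim] by blast
qed

text \<open>For right-continuous paths confinement to a closed set is decided at countably many
  times, so its probability is a function of the law on the product space, and that law is
  determined by the finite-dimensional ones.\<close>

lemma same_fdd_closed_eq:
  fixes Y Z :: "real \<Rightarrow> 'w \<Rightarrow> 'a::euclidean_space"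
  assumes M: "prob_space M" and same: "same_fdd M Y Z" and F: "closed F" and h: "0 \<le> h"
    and Y: "\<And>t. 0 \<le> t \<Longrightarrow> Y t \<in> borel_measurable M" "\<And>\<omega> t. \<omega> \<in> space M \<Longrightarrow> 0 \<le> t \<Longrightarrow> ((\<lambda>s. Y s \<omega>) \<longlongrightarrow> Y t \<omega>) (at_right t)"
    and Z: "\<And>t. 0 \<le> t \<Longrightarrow> Z t \<in> borel_measurable M" "\<And>\<omega> t. \<omega> \<in> space M \<Longrightarrow> 0 \<le> t \<Longrightarrow> ((\<lambda>s. Z s \<omega>) \<longlongrightarrow> Z t \<omega>) (at_right t)"
  shows "measure M {\<omega>\<in>space M. \<forall>s\<in>{0..h}. Y s \<omega> \<in> F} = measure M {\<omega>\<in>space M. \<forall>s\<in>{0..h}. Z s \<omega> \<in> F}"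
proof -
  let ?P = "PiM {0..} (\<lambda>_. borel) :: (real \<Rightarrow> 'a) measure"
  have eq: "distr M ?P (\<lambda>\<omega>. \<lambda>t\<in>{0..}. Y t \<omega>) = distr M ?P (\<lambda>\<omega>. \<lambda>t\<in>{0..}. Z t \<omega>)"
  proof (rule distr_PiM_eqI[OF M M])
    fix J :: "real set" assume "finite J" "J \<subseteq> {0..}"
    then show "distr M (PiM J (\<lambda>_. borel)) (\<lambda>\<omega>. \<lambda>i\<in>J. Y i \<omega>) = distr M (PiM J (\<lambda>_. borel)) (\<lambda>\<omega>. \<lambda>i\<in>J. Z i \<omega>)"
      using same unfolding same_fdd_def by blast
  qed (use Y(1) Z(1) in auto)
  define G where "G = {w\<in>space ?P. \<forall>s\<in>dense_times h. w s \<in> F}"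
  have G: "G \<in> sets ?P"
    unfolding G_def
  proof (rule sets.sets_Collect_countable_All'[OF _ countable_dense_times])
    fix s assume "s \<in> dense_times h"
    then have "(\<lambda>w. w s) \<in> measurable ?P borel"
      using dense_times_subset[OF h] by (intro measurable_component_singleton) auto
    moreover have "F \<in> sets borel" using F by simp
    ultimately show "{w\<in>space ?P. w s \<in> F} \<in> sets ?P" by measurable
  qed
  have *: "measure M {\<omega>\<in>space M. \<forall>s\<in>{0..h}. W s \<omega> \<in> F} = measure (distr M ?P (\<lambda>\<omega>. \<lambda>t\<in>{0..}. W t \<omega>)) G"
    if m: "\<And>t. 0 \<le> t \<Longrightarrow> W t \<in> borel_measurable M" and rc: "\<And>\<omega> t. \<omega> \<in> space M \<Longrightarrow> 0 \<le> t \<Longrightarrow> ((\<lambda>s. W s \<omega>) \<longlongrightarrow> W t \<omega>) (at_right t)"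
    for W :: "real \<Rightarrow> 'w \<Rightarrow> 'a"
  proof -
    have mm: "(\<lambda>\<omega>. \<lambda>t\<in>{0..}. W t \<omega>) \<in> measurable M ?P" by (intro measurable_restrict m) simp
    have "{\<omega>\<in>space M. \<forall>s\<in>{0..h}. W s \<omega> \<in> F} = (\<lambda>\<omega>. \<lambda>t\<in>{0..}. W t \<omega>) -` G \<inter> space M"
    proof (intro set_eqI iffI)
      fix \<omega> assume "\<omega> \<in> {\<omega>\<in>space M. \<forall>s\<in>{0..h}. W s \<omega> \<in> F}"
      then show "\<omega> \<in> (\<lambda>\<omega>. \<lambda>t\<in>{0..}. W t \<omega>) -` G \<inter> space M"
        using measurable_space[OF mm, of \<omega>] dense_times_subset[OF h] by (auto simp: G_def)
    next
      fix \<omega> assume w: "\<omega> \<in> (\<lambda>\<omega>. \<lambda>t\<in>{0..}. W t \<omega>) -` G \<inter> space M"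
      have "0 \<le> s" if "s \<in> dense_times h" for s using dense_times_subset[OF h] that by auto
      then have "\<forall>s\<in>dense_times h. W s \<omega> \<in> F" using w by (simp add: G_def)
      then have "\<forall>s\<in>{0..h}. W s \<omega> \<in> F" using ball_right_continuous_dense_times[OF rc F h, of \<omega>] w by simp
      then show "\<omega> \<in> {\<omega>\<in>space M. \<forall>s\<in>{0..h}. W s \<omega> \<in> F}" using w by simp
    qed
    then show ?thesis using measure_distr[OF mm G] by simp
  qed
  have "measure M {\<omega>\<in>space M. \<forall>s\<in>{0..h}. Y s \<omega> \<in> F} = measure (distr M ?P (\<lambda>\<omega>. \<lambda>t\<in>{0..}. Y t \<omega>)) G" by (rule *) (fact Y)+
  also have "\<dots> = measure (distr M ?P (\<lambda>\<omega>. \<lambda>t\<in>{0..}. Z t \<omega>)) G" by (simp only: eq)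
  also have "\<dots> = measure M {\<omega>\<in>space M. \<forall>s\<in>{0..h}. Z s \<omega> \<in> F}" by (rule *[symmetric]) (fact Z)+
  finally show ?thesis .
qed

context levy_path
begin

text \<open>Each use of semistability trades a factor \<open>c\<close> of time for one application
  of \<open>A\<close> to the path. After \<open>n\<close> of them confinement of the path has become
  confinement of its image under \<open>A ^^ n\<close>, and the growth of the powers turns this into
  confinement to a smaller ball.\<close>

lemma stay_scaling_of_growth:
  fixes A :: "'a \<Rightarrow> 'a"
  assumes A: "linear A" and c: "1 < c" and same: "same_fdd M (\<lambda>t. X (c * t)) (\<lambda>t \<omega>. A (X t \<omega>))"
    and gr: "\<And>n x. norm x \<le> C * c powr (- real n / \<alpha>) * norm ((A ^^ n) x)" and C: "0 < C"
  shows "stay_scaling c \<alpha> C"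
  unfolding stay_scaling_def
proof (intro allI impI)
  fix n :: nat and h a :: real assume h: "0 \<le> h" and a: "0 \<le> a"
  have cont: "continuous_on UNIV ((A ^^ k) :: 'a \<Rightarrow> 'a)" for k
    by (intro linear_continuous_on linear_conv_bounded_linear[THEN iffD1] linear_funpow A)
  have A1: "continuous_on UNIV A" using cont[of 1] by simp
  have rcs: "((\<lambda>s. X (c * s) \<omega>) \<longlongrightarrow> X (c * t) \<omega>) (at_right t)" if "\<omega> \<in> space M" "0 \<le> t" for \<omega> t
  proof (rule filterlim_compose[OF X_rc[OF that(1)]])
    show "0 \<le> c * t" using c that(2) by simp
    have "((\<lambda>s. c * s) \<longlongrightarrow> c * t) (at_right t)" by (intro tendsto_intros)
    moreover have "\<forall>\<^sub>F s in at_right t. c * s \<in> {c * t<..}"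
      unfolding eventually_at_right_field using c by (intro exI[of _ "t + 1"]) auto
    ultimately show "filterlim (\<lambda>s. c * s) (at_right (c * t)) (at_right t)"
      unfolding filterlim_at by (auto elim: eventually_mono)
  qed
  have step: "prob {\<omega>\<in>space M. \<forall>s\<in>{0..c * h}. norm ((A ^^ k) (X s \<omega>)) \<le> a}
      = prob {\<omega>\<in>space M. \<forall>s\<in>{0..h}. norm ((A ^^ Suc k) (X s \<omega>)) \<le> a}" if h: "0 \<le> h" for h k
  proof -
    \<comment> \<open>The intermediate confinement sets are preimages of balls, not balls;
      closedness is all that the comparison of the two processes requires.\<close>
    define F where "F = {x. norm ((A ^^ k) x) \<le> a}"
    have F: "closed F" unfolding F_def
      by (intro closed_Collect_le continuous_on_norm cont continuous_on_const)
    have "prob {\<omega>\<in>space M. \<forall>s\<in>{0..h}. X (c * s) \<omega> \<in> F} = prob {\<omega>\<in>space M. \<forall>s\<in>{0..h}. A (X s \<omega>) \<in> F}"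
    proof (rule same_fdd_closed_eq[OF prob_space_axioms same F h])
      show "X (c * t) \<in> borel_measurable M" if "0 \<le> t" for t using X_meas[of "c * t"] c that by simp
      show "(\<lambda>\<omega>. A (X t \<omega>)) \<in> borel_measurable M" if "0 \<le> t" for t
        by (rule measurable_compose[OF X_meas[OF that] borel_measurable_continuous_onI[OF A1]])
      show "((\<lambda>s. A (X s \<omega>)) \<longlongrightarrow> A (X t \<omega>)) (at_right t)" if "\<omega> \<in> space M" "0 \<le> t" for \<omega> t
        using A1 X_rc[OF that] by (auto simp: continuous_on_eq_continuous_at intro: isCont_tendsto_compose)
    qed (rule rcs)
    moreover have "(\<forall>s\<in>{0..c * h}. norm ((A ^^ k) (X s \<omega>)) \<le> a) \<longleftrightarrow> (\<forall>s\<in>{0..h}. X (c * s) \<omega> \<in> F)" for \<omega>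
    proof
      assume r: "\<forall>s\<in>{0..h}. X (c * s) \<omega> \<in> F"
      show "\<forall>s\<in>{0..c * h}. norm ((A ^^ k) (X s \<omega>)) \<le> a"
      proof
        fix s assume "s \<in> {0..c * h}"
        then have "s / c \<in> {0..h}" using c by (simp add: pos_divide_le_eq mult.commute)
        then have "X (c * (s / c)) \<omega> \<in> F" using r by blast
        then show "norm ((A ^^ k) (X s \<omega>)) \<le> a" using c by (simp add: F_def)
      qed
    qed (use c in \<open>auto simp: F_def\<close>)
    ultimately show ?thesis by (simp add: F_def funpow_swap1)
  qed
  have iter: "prob (stay (c ^ k * h) a) = prob {\<omega>\<in>space M. \<forall>s\<in>{0..h}. norm ((A ^^ k) (X s \<omega>)) \<le> a}" if "0 \<le> h" for k h
    using that
  proof (induction k arbitrary: h)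
    case 0
    then show ?case by (simp add: stay_def)
  next
    case (Suc k)
    have "prob (stay (c ^ Suc k * h) a) = prob (stay (c ^ k * (c * h)) a)" by (simp add: mult_ac)
    also have "\<dots> = prob {\<omega>\<in>space M. \<forall>s\<in>{0..c * h}. norm ((A ^^ k) (X s \<omega>)) \<le> a}" using Suc c by simp
    also have "\<dots> = prob {\<omega>\<in>space M. \<forall>s\<in>{0..h}. norm ((A ^^ Suc k) (X s \<omega>)) \<le> a}" by (rule step[OF Suc.prems])
    finally show ?case .
  qed
  define h' where "h' = h / c ^ n"
  have h': "0 \<le> h'" "h = c ^ n * h'" using h c by (simp_all add: h'_def)
  have "prob (stay h a) = prob {\<omega>\<in>space M. \<forall>s\<in>{0..h'}. norm ((A ^^ n) (X s \<omega>)) \<le> a}"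
    unfolding h'(2) by (rule iter[OF h'(1)])
  also have "\<dots> \<le> prob (stay h' (C * c powr (- real n / \<alpha>) * a))"
  proof (rule finite_measure_mono)
    show "{\<omega>\<in>space M. \<forall>s\<in>{0..h'}. norm ((A ^^ n) (X s \<omega>)) \<le> a} \<subseteq> stay h' (C * c powr (- real n / \<alpha>) * a)"
      unfolding stay_def
    proof (intro Collect_mono impI conjI ballI; elim conjE)
      fix \<omega> s assume s: "s \<in> {0..h'}" "\<forall>s\<in>{0..h'}. norm ((A ^^ n) (X s \<omega>)) \<le> a"
      have "norm (X s \<omega>) \<le> C * c powr (- real n / \<alpha>) * norm ((A ^^ n) (X s \<omega>))" by (rule gr)
      also have "\<dots> \<le> C * c powr (- real n / \<alpha>) * a" using s C by (intro mult_left_mono) simp_all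
      finally show "norm (X s \<omega>) \<le> C * c powr (- real n / \<alpha>) * a" .
    qed
    show "stay h' (C * c powr (- real n / \<alpha>) * a) \<in> events" by (rule stay_events[OF h'(1)])
  qed
  finally show "prob (stay h a) \<le> prob (stay (h / c ^ n) (C * c powr (- real n / \<alpha>) * a))" by (simp only: h'_def)
qed

theorem exact_hausdorff_AE:
  fixes c \<alpha> \<theta> C K L K' C' l0 \<delta>0 :: real
  assumes ip: "inner_product ip" and c: "1 < c" and \<alpha>: "0 < \<alpha>" and \<theta>: "0 < \<theta>" "\<theta> \<le> 1"
    and sc: "stay_scaling c \<alpha> C" and C: "0 < C"
    and sb: "small_ball_bound c \<alpha> (1 / \<theta>) K L" and K: "0 < K" and L: "0 < L"
    and K': "0 < K'" and tail: "\<And>l r. l0 \<le> l \<Longrightarrow> 0 < r \<Longrightarrow> r \<le> 1 \<Longrightarrow>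
      prob {\<omega>\<in>space M. l * r powr \<alpha> < occupation ip 0 r \<omega>} \<le> C' * exp (- K' * l powr (1 / \<theta>))"
    and \<delta>0: "0 < \<delta>0" and \<phi>: "\<And>r. 0 < r \<Longrightarrow> r < \<delta>0 \<Longrightarrow> \<phi> r = r powr \<alpha> * ln (ln (1 / r)) powr \<theta>"
  shows "AE \<omega> in M. exact_hausdorff_function ip \<phi> ((\<lambda>t. X t \<omega>) ` {0..1})"
proof -
  obtain \<delta> where \<delta>: "0 < \<delta>" "\<delta> \<le> \<delta>0" and lnpos: "\<And>r. 0 < r \<Longrightarrow> r < \<delta> \<Longrightarrow> 0 < ln (1 / r)"
    and lnln: "\<And>r. 0 < r \<Longrightarrow> r < \<delta> \<Longrightarrow> 1 \<le> ln (ln (1 / r))" and mono: "mono_on {0<..<\<delta>} \<phi>"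
    and gauge: "hausdorff_gauge \<phi>" and lim: "(\<phi> \<longlongrightarrow> 0) (at_right 0)"
    using loglog_gauge[OF \<alpha> \<theta>(1) \<delta>0 \<phi>] by blast
  obtain c1 c2' where "0 < c1" "0 < c2'" and c2': "\<And>x. c1 * norm x \<le> ip_norm ip x \<and> ip_norm ip x \<le> c2' * norm x"
    using ip_norm_equiv(2)[OF ip] by blast
  define c2 where "c2 = max 1 c2'"
  have c2: "1 \<le> c2" by (simp add: c2_def)
  have c2n: "ip_norm ip x \<le> c2 * norm x" for x
  proof -
    have "ip_norm ip x \<le> c2' * norm x" using c2' by blast
    also have "\<dots> \<le> c2 * norm x" by (intro mult_right_mono) (simp_all add: c2_def)
    finally show ?thesis .
  qed
  have \<phi>nn: "0 \<le> \<phi> r" if "0 < r" "r < \<delta>" for r using \<phi>[of r] that \<delta> by simp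
  obtain L2 where L2: "0 < L2" "\<And>n t. 0 < t \<Longrightarrow> t \<le> 1 \<Longrightarrow> 1 - prob (stay (t / c ^ n) (L2 * c powr (- real n / \<alpha>))) \<le> 2 * t"
    using small_time_bound[OF sc c C] by auto
  \<comment> \<open>The cover construction uses one radius for both the small ball bound and the
    small time bound, and both persist when it is enlarged.\<close>
  define Lm where "Lm = max L L2"
  have Lm: "0 < Lm" "L \<le> Lm" "L2 \<le> Lm" using L by (auto simp: Lm_def)
  have sb': "small_ball_bound c \<alpha> (1 / \<theta>) K Lm"
    unfolding small_ball_bound_def
  proof (intro allI impI)
    fix l :: real and n :: nat assume l: "1 \<le> l"
    have "exp (- K * l powr (1 / \<theta>)) \<le> prob (stay (l / c ^ n) (L * c powr (- real n / \<alpha>)))"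
      using sb l unfolding small_ball_bound_def by blast
    also have "\<dots> \<le> prob (stay (l / c ^ n) (Lm * c powr (- real n / \<alpha>)))"
      using l c Lm by (intro prob_stay_mono mult_right_mono) simp_all
    finally show "exp (- K * l powr (1 / \<theta>)) \<le> prob (stay (l / c ^ n) (Lm * c powr (- real n / \<alpha>)))" .
  qed
  have st': "1 - prob (stay (t / c ^ n) (Lm * c powr (- real n / \<alpha>))) \<le> 2 * t" if t: "0 < t" "t \<le> 1" for n t
  proof -
    have "prob (stay (t / c ^ n) (L2 * c powr (- real n / \<alpha>))) \<le> prob (stay (t / c ^ n) (Lm * c powr (- real n / \<alpha>)))"
      using t c Lm by (intro prob_stay_mono mult_right_mono) simp_all
    then show ?thesis using L2(2)[OF t, of n] by linarith
  qed
  define r0 where "r0 = \<delta> / (2 * c2)"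
  have r0: "0 < r0" using \<delta> c2 by (simp add: r0_def)
  \<comment> \<open>The power part of the change from radius to diameter. Since \<open>c2\<close> is
    at least 1, the diameter exceeds the radius and the iterated logarithm only decreases.\<close>
  define B where "B = (2 * c2) powr \<alpha>"
  have \<psi>: "\<phi> (2 * c2 * r) \<le> B * r powr \<alpha> * ln (ln (1 / r)) powr \<theta>" if r: "0 < r" "r < r0" for r
  proof -
    define R where "R = 2 * c2 * r"
    have R: "0 < R" "R < \<delta>" "r \<le> R"
      using r c2 by (simp_all add: R_def r0_def pos_less_divide_eq mult.commute)
    have l1: "ln (ln (1 / R)) \<le> ln (ln (1 / r))"
    proof -
      have "0 < ln (1 / R)" by (rule lnpos[OF R(1,2)])
      moreover have "1 / R \<le> 1 / r" using R r by (intro divide_left_mono) simp_all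
      then have "ln (1 / R) \<le> ln (1 / r)" using R r by (subst ln_le_cancel_iff) simp_all
      ultimately show ?thesis by (subst ln_le_cancel_iff) simp_all
    qed
    have "\<phi> R = R powr \<alpha> * ln (ln (1 / R)) powr \<theta>" using R \<delta> by (intro \<phi>) simp_all
    also have "\<dots> \<le> R powr \<alpha> * ln (ln (1 / r)) powr \<theta>"
      using l1 lnln[OF R(1,2)] \<theta> by (intro mult_left_mono powr_mono2) simp_all
    also have "R powr \<alpha> = B * r powr \<alpha>" using r c2 by (simp add: R_def B_def powr_mult)
    finally show ?thesis by (simp only: R_def)
  qed
  have "\<exists>V. AE \<omega> in M. \<forall>r>0. ball_cover (\<lambda>r. \<phi> (2 * c2 * r)) r ((\<lambda>t. X t \<omega>) ` {0..1}) V"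
    by (rule ball_cover_AE[OF c \<alpha> \<theta> K Lm(1) sb' st' r0 _ \<psi>]) (simp_all add: B_def)
  then obtain V where V: "AE \<omega> in M. \<forall>r>0. ball_cover (\<lambda>r. \<phi> (2 * c2 * r)) r ((\<lambda>t. X t \<omega>) ` {0..1}) V" ..
  have fin: "AE \<omega> in M. hausdorff_measure ip \<phi> ((\<lambda>t. X t \<omega>) ` {0..1}) < \<infinity>"
    using V
  proof eventually_elim
    case (elim \<omega>)
    have "hausdorff_measure ip \<phi> ((\<lambda>t. X t \<omega>) ` {0..1}) \<le> ennreal V"
      by (rule hausdorff_measure_le[OF c2n _ \<delta>(1) mono \<phi>nn]) (use elim c2 in auto)
    then show ?case by (rule le_less_trans) simp
  qed
  have pos: "AE \<omega> in M. 0 < hausdorff_measure ip \<phi> ((\<lambda>t. X t \<omega>) ` {0..1})"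
    by (rule hausdorff_pos_AE[OF ip \<alpha> \<theta>(1) K' \<delta>0 \<phi> lim tail])
  show ?thesis using fin pos by eventually_elim (simp add: exact_hausdorff_function_def gauge)
qed

end

text \<open>Subtracting the initial value changes no increment, so the process properties persist
  while the start at 0 becomes pointwise.\<close>

lemma levy_path_diff_start:
  assumes "levy_process M X"
  shows "levy_path M (\<lambda>t \<omega>. X t \<omega> - X 0 \<omega>)"
proof -
  have M: "prob_space M" and m: "\<And>t. 0 \<le> t \<Longrightarrow> X t \<in> borel_measurable M"
    and rc: "\<And>\<omega> t. \<omega> \<in> space M \<Longrightarrow> 0 \<le> t \<Longrightarrow> ((\<lambda>s. X s \<omega>) \<longlongrightarrow> X t \<omega>) (at_right t)"
    and ll: "\<And>\<omega> t. \<omega> \<in> space M \<Longrightarrow> 0 < t \<Longrightarrow> \<exists>l. ((\<lambda>s. X s \<omega>) \<longlongrightarrow> l) (at_left t)"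
    and stat: "\<And>s t. 0 \<le> s \<Longrightarrow> 0 \<le> t \<Longrightarrow> distr M borel (\<lambda>\<omega>. X (s + t) \<omega> - X s \<omega>) = distr M borel (\<lambda>\<omega>. X t \<omega> - X 0 \<omega>)"
    and ind: "\<And>(n::nat) t. 0 \<le> t 0 \<Longrightarrow> mono_on {..n} t \<Longrightarrow>
        prob_space.indep_vars M (\<lambda>_. borel) (\<lambda>i \<omega>. X (t (Suc i)) \<omega> - X (t i) \<omega>) {..<n}"
    using assms unfolding levy_process_def by blast+
  show ?thesis
  proof (intro levy_path.intro levy_path_axioms.intro M)
    show "\<exists>l. ((\<lambda>s. X s \<omega> - X 0 \<omega>) \<longlongrightarrow> l) (at_left t)" if w: "\<omega> \<in> space M" "0 < t" for \<omega> t
    proof -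
      obtain l where "((\<lambda>s. X s \<omega>) \<longlongrightarrow> l) (at_left t)" using ll[OF w] by blast
      then have "((\<lambda>s. X s \<omega> - X 0 \<omega>) \<longlongrightarrow> l - X 0 \<omega>) (at_left t)" by (intro tendsto_diff tendsto_const)
      then show ?thesis by blast
    qed
    show "prob_space.indep_vars M (\<lambda>_. borel) (\<lambda>i \<omega>. X (tt (Suc i)) \<omega> - X 0 \<omega> - (X (tt i) \<omega> - X 0 \<omega>)) {..<n}"
      if "0 \<le> tt 0" "mono_on {..n} tt" for tt and n :: nat
      using ind[OF that] by simp
    show "distr M borel (\<lambda>\<omega>. X (s + t) \<omega> - X 0 \<omega> - (X s \<omega> - X 0 \<omega>)) = distr M borel (\<lambda>\<omega>. X t \<omega> - X 0 \<omega>)"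
      if "0 \<le> s" "0 \<le> t" for s t using stat[OF that] by simp
    show "(\<lambda>\<omega>. X t \<omega> - X 0 \<omega>) \<in> borel_measurable M" if "0 \<le> t" for t
      using m[OF that] m[of 0] by simp
    show "((\<lambda>s. X s \<omega> - X 0 \<omega>) \<longlongrightarrow> X t \<omega> - X 0 \<omega>) (at_right t)" if "\<omega> \<in> space M" "0 \<le> t" for \<omega> t
      by (intro tendsto_diff tendsto_const rc that)
  qed simp
qed

lemma opexp_adjoint_eigen:
  fixes E :: "'a::euclidean_space \<Rightarrow> 'a"
  assumes E: "linear E" and \<xi>: "\<And>x. \<xi> \<bullet> E x = a * (\<xi> \<bullet> x)"
  shows "\<xi> \<bullet> opexp E t x = exp (a * t) * (\<xi> \<bullet> x)"
proof -
  have p: "(E ^^ n) x \<bullet> \<xi> = a ^ n * (x \<bullet> \<xi>)" for n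
    by (induction n) (simp_all add: inner_commute[of _ \<xi>] \<xi>)
  have "(\<lambda>n. ((a * t) ^ n /\<^sub>R fact n) * (x \<bullet> \<xi>)) sums (exp (a * t) * (x \<bullet> \<xi>))"
    by (intro sums_mult2 exp_converges)
  moreover have "(((E ^^ n) x \<bullet> \<xi>) / fact n) * t ^ n = ((a * t) ^ n /\<^sub>R fact n) * (x \<bullet> \<xi>)" for n
    by (simp add: p power_mult_distrib divide_inverse mult_ac)
  ultimately have "opexp E t x \<bullet> \<xi> = exp (a * t) * (x \<bullet> \<xi>)"
    using sums_unique2 opexp_inner_sums[OF E, of x \<xi> t] by simp
  then show ?thesis by (simp add: inner_commute)
qed

text \<open>
  On this space the characteristic function scales like that of a stable law. It has the dimension of the
  eigenspace, and \<open>\<alpha>\<close> below that dimension is what bounds the expected occupation time of a ball of radius \<open>r\<close> by a multiple of \<open>r powr \<alpha>\<close>.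
\<close>

lemma dim_adjoint_eigenspace:
  fixes E :: "'a::euclidean_space \<Rightarrow> 'a"
  assumes E: "linear E"
  shows "subspace {\<xi>. \<forall>x. \<xi> \<bullet> E x = a * (\<xi> \<bullet> x)}"
    and "dim {x. E x = a *\<^sub>R x} \<le> dim {\<xi>. \<forall>x. \<xi> \<bullet> E x = a * (\<xi> \<bullet> x)}"
proof -
  define f where "f x = E x - a *\<^sub>R x" for x
  have f: "linear f" unfolding f_def by (intro linear_compose_sub E linear_compose_scale_right linear_ident)
  \<comment> \<open>The adjoint eigenspace is the orthogonal complement of the range of
    \<open>f\<close>, which gives its dimension.\<close>
  have U: "{\<xi>. \<forall>x. \<xi> \<bullet> E x = a * (\<xi> \<bullet> x)} = {y \<in> UNIV. \<forall>x\<in>range f. orthogonal x y}"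
    by (simp add: f_def orthogonal_def inner_commute inner_diff_right inner_diff_left)
  show "subspace {\<xi>. \<forall>x. \<xi> \<bullet> E x = a * (\<xi> \<bullet> x)}"
    by (simp add: subspace_def inner_add_left distrib_left)
  have "dim {\<xi>. \<forall>x. \<xi> \<bullet> E x = a * (\<xi> \<bullet> x)} + dim (range f) = DIM('a)"
    unfolding U using dim_subspace_orthogonal_to_vectors[of "range f" UNIV] linear_subspace_image[OF f subspace_UNIV] by simp
  \<comment> \<open>Half of the rank-nullity theorem: \<open>f\<close> takes all its values already
    on the orthogonal complement of its kernel.\<close>
  moreover have "dim {x. f x = 0} + dim (range f) \<le> DIM('a)"
  proof -
    define K where "K = {x. f x = 0}"
    define W where "W = {y \<in> UNIV. \<forall>x\<in>K. orthogonal x y}"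
    have K: "subspace K" unfolding K_def by (rule linear_subspace_kernel[OF f])
    have "range f \<subseteq> f ` W"
    proof clarify
      fix x
      obtain y z where yz: "y \<in> span K" "\<And>w. w \<in> span K \<Longrightarrow> orthogonal z w" "x = y + z"
        using orthogonal_subspace_decomp_exists[of K x] by blast
      have "y \<in> K" using yz(1) K by (simp add: span_eq_iff[THEN iffD2])
      then have "f x = f z" unfolding yz(3) linear_add[OF f] by (simp add: K_def)
      moreover have "z \<in> W" unfolding W_def using yz(2) by (auto simp: orthogonal_commute span_base)
      ultimately show "f x \<in> f ` W" by blast
    qed
    then have "dim (range f) \<le> dim (f ` W)" by (rule dim_subset)
    also have "\<dots> \<le> dim W" by (rule dim_image_le[OF f])
    finally show ?thesis
      using dim_subspace_orthogonal_to_vectors[OF K subspace_UNIV] unfolding W_def K_def by simp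
  qed
  moreover have "{x. f x = 0} = {x. E x = a *\<^sub>R x}" by (auto simp: f_def)
  ultimately show "dim {x. E x = a *\<^sub>R x} \<le> dim {\<xi>. \<forall>x. \<xi> \<bullet> E x = a * (\<xi> \<bullet> x)}" by simp
qed

text \<open>By continuity the density is at least half its value at 0 on the ball of radius
  \<open>e\<close>. With \<open>R = e / 4\<close>, every ball of radius \<open>R\<close> whose
  centre has norm at most \<open>R\<close> lies in it, which makes the bound uniform in the starting
  point.\<close>

lemma return_probability:
  fixes Y :: "'w \<Rightarrow> 'a::euclidean_space"
  assumes M: "prob_space M" and f: "continuous_density M Y f" and f0: "0 < f 0"
  shows "\<exists>R>0. \<exists>p>0. p < 1 \<and> (\<forall>x. norm x \<le> R \<longrightarrow> 2 * p \<le> measure M {\<omega>\<in>space M. norm (x + Y \<omega>) \<le> R})"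
proof -
  interpret prob_space M by (rule M)
  have cont: "continuous_on UNIV f" and d: "distributed M lborel Y (\<lambda>x. ennreal (f x))" and fn: "\<And>x. 0 \<le> f x"
    using f by (auto simp: continuous_density_def)
  have Ym: "Y \<in> borel_measurable M" using distributed_measurable[OF d] by simp
  have "isCont f 0" using cont by (simp add: continuous_on_eq_continuous_at)
  then obtain e where e: "0 < e" "\<And>x. norm x < e \<Longrightarrow> \<bar>f x - f 0\<bar> < f 0 / 2"
    using f0 unfolding continuous_at_eps_delta by (metis dist_0_norm dist_commute dist_real_def half_gt_zero)
  define R where "R = e / 4"
  have R: "0 < R" using e by (simp add: R_def)
  define v where "v = unit_ball_vol (real DIM('a)) * R ^ DIM('a)"
  have v: "0 < v" using R by (simp add: v_def)
  have key: "f 0 / 2 * v \<le> prob {\<omega>\<in>space M. norm (x + Y \<omega>) \<le> R}" if x: "norm x \<le> R" for x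
  proof -
    have "emeasure M {\<omega>\<in>space M. norm (x + Y \<omega>) \<le> R} = emeasure M (Y -` cball (- x) R \<inter> space M)"
    proof -
      have "norm (x + y) = dist (- x) y" for y by (simp add: dist_norm norm_minus_commute add.commute)
      then show ?thesis by (intro arg_cong[where f="emeasure M"]) auto
    qed
    also have "\<dots> = (\<integral>\<^sup>+y. ennreal (f y) * indicator (cball (- x) R) y \<partial>lborel)"
      by (rule distributed_emeasure[OF d]) simp
    also have "\<dots> \<ge> (\<integral>\<^sup>+y. ennreal (f 0 / 2) * indicator (cball (- x) R) y \<partial>lborel)"
    proof (rule nn_integral_mono)
      fix y :: 'a
      show "ennreal (f 0 / 2) * indicator (cball (- x) R) y \<le> ennreal (f y) * indicator (cball (- x) R) y"
      proof (cases "y \<in> cball (- x) R")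
        case True
        then have "norm (y + x) \<le> R" by (simp add: dist_norm norm_minus_commute)
        moreover have "norm y \<le> norm (y + x) + norm x" using norm_triangle_ineq4[of "y + x" x] by simp
        ultimately have "norm y < e" using x R by (simp add: R_def)
        then have "f 0 / 2 \<le> f y" using e(2)[of y] by linarith
        then show ?thesis using True by (simp add: ennreal_leI)
      qed simp
    qed
    also have "(\<integral>\<^sup>+y. ennreal (f 0 / 2) * indicator (cball (- x) R) y \<partial>lborel) = ennreal (f 0 / 2) * emeasure lborel (cball (- x) R)"
      by (rule nn_integral_cmult_indicator) simp
    also have "emeasure lborel (cball (- x) R) = ennreal v"
      unfolding v_def using R by (intro emeasure_cball) simp
    finally have "ennreal (f 0 / 2 * v) \<le> ennreal (prob {\<omega>\<in>space M. norm (x + Y \<omega>) \<le> R})"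
      using f0 v by (subst ennreal_mult) (simp_all add: emeasure_eq_measure)
    then show ?thesis by (subst (asm) ennreal_le_iff) simp_all
  qed
  define p where "p = min (1 / 2) (f 0 / 4 * v)"
  have p: "0 < p" "p < 1" using f0 v by (auto simp: p_def)
  have "2 * p \<le> f 0 / 2 * v" unfolding p_def by (simp add: min_def)
  then have "2 * p \<le> prob {\<omega>\<in>space M. norm (x + Y \<omega>) \<le> R}" if "norm x \<le> R" for x
    using key[OF that] by linarith
  then show ?thesis using R p by blast
qed

lemma same_fdd_cong_AE:
  fixes Y Z Y' Z' :: "real \<Rightarrow> 'w \<Rightarrow> 'a::euclidean_space"
  assumes same: "same_fdd M Y Z"
    and m: "\<And>t. 0 \<le> t \<Longrightarrow> Y t \<in> borel_measurable M" "\<And>t. 0 \<le> t \<Longrightarrow> Z t \<in> borel_measurable M"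
      "\<And>t. 0 \<le> t \<Longrightarrow> Y' t \<in> borel_measurable M" "\<And>t. 0 \<le> t \<Longrightarrow> Z' t \<in> borel_measurable M"
    and eq: "AE \<omega> in M. \<forall>t. Y' t \<omega> = Y t \<omega> \<and> Z' t \<omega> = Z t \<omega>"
  shows "same_fdd M Y' Z'"
  unfolding same_fdd_def
proof (intro allI impI, elim conjE)
  fix I :: "real set" assume I: "finite I" "I \<subseteq> {0..}"
  have c: "distr M (PiM I (\<lambda>_. borel)) (\<lambda>\<omega>. \<lambda>t\<in>I. W' t \<omega>) = distr M (PiM I (\<lambda>_. borel)) (\<lambda>\<omega>. \<lambda>t\<in>I. W t \<omega>)"
    if "\<And>t. 0 \<le> t \<Longrightarrow> W t \<in> borel_measurable M" "\<And>t. 0 \<le> t \<Longrightarrow> W' t \<in> borel_measurable M"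
      "AE \<omega> in M. \<forall>t. W' t \<omega> = W t \<omega>" for W W' :: "real \<Rightarrow> 'w \<Rightarrow> 'a"
  proof (rule distr_cong_AE)
    show "AE \<omega> in M. (\<lambda>t\<in>I. W' t \<omega>) = (\<lambda>t\<in>I. W t \<omega>)" using that(3) by eventually_elim simp
  qed (use that(1,2) I(2) in \<open>auto intro!: measurable_restrict\<close>)
  have "distr M (PiM I (\<lambda>_. borel)) (\<lambda>\<omega>. \<lambda>t\<in>I. Y' t \<omega>) = distr M (PiM I (\<lambda>_. borel)) (\<lambda>\<omega>. \<lambda>t\<in>I. Y t \<omega>)"
    using eq by (intro c m) (auto elim: eventually_mono)
  also have "\<dots> = distr M (PiM I (\<lambda>_. borel)) (\<lambda>\<omega>. \<lambda>t\<in>I. Z t \<omega>)" using same I unfolding same_fdd_def by blast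
  also have "\<dots> = distr M (PiM I (\<lambda>_. borel)) (\<lambda>\<omega>. \<lambda>t\<in>I. Z' t \<omega>)"
    using eq by (intro c[symmetric] m) (auto elim: eventually_mono)
  finally show "distr M (PiM I (\<lambda>_. borel)) (\<lambda>\<omega>. \<lambda>t\<in>I. Y' t \<omega>) = distr M (PiM I (\<lambda>_. borel)) (\<lambda>\<omega>. \<lambda>t\<in>I. Z' t \<omega>)" .
qed

context levy_path
begin

text \<open>Serves to compare the sojourn times before and after subtracting the initial value: with
  \<open>Z\<close> the initial value or 0, both are covered, and their almost sure equality can be
  turned into equality of probabilities.\<close>

lemma sojourn_time_shift_meas:
  assumes ip: "inner_product ip" and Z: "Z \<in> borel_measurable M"
  shows "(\<lambda>\<omega>. sojourn_time ip (\<lambda>t \<omega>. X t \<omega> + Z \<omega>) r 1 \<omega>) \<in> borel_measurable M"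
proof -
  have "(\<lambda>z. ip_norm ip (X (max 0 (snd z)) (fst z) + Z (fst z))) \<in> borel_measurable (M \<Otimes>\<^sub>M lborel)"
  proof (rule measurable_compose[OF _ ip_norm_meas[OF ip]])
    have "(\<lambda>z. (snd z, fst z)) \<in> measurable (M \<Otimes>\<^sub>M lborel) (borel \<Otimes>\<^sub>M M)" by simp
    from measurable_compose[OF this X_joint]
    have "(\<lambda>z. X (max 0 (snd z)) (fst z)) \<in> borel_measurable (M \<Otimes>\<^sub>M lborel)" by simp
    then show "(\<lambda>z. X (max 0 (snd z)) (fst z) + Z (fst z)) \<in> borel_measurable (M \<Otimes>\<^sub>M lborel)"
      by (intro borel_measurable_add measurable_compose[OF measurable_fst Z])
  qed
  then have [measurable]: "{z\<in>space (M \<Otimes>\<^sub>M lborel). ip_norm ip (X (max 0 (snd z)) (fst z) + Z (fst z)) \<le> r} \<in> sets (M \<Otimes>\<^sub>M lborel)"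
    by measurable
  define S where "S = {z\<in>space (M \<Otimes>\<^sub>M lborel). ip_norm ip (X (max 0 (snd z)) (fst z) + Z (fst z)) \<le> r}"
  have S [measurable]: "S \<in> sets (M \<Otimes>\<^sub>M lborel)" unfolding S_def by measurable
  have "sojourn_time ip (\<lambda>t \<omega>. X t \<omega> + Z \<omega>) r 1 \<omega> = (LINT t|lborel. indicat_real {0..1} t * indicat_real S (\<omega>, t))"
    if "\<omega> \<in> space M" for \<omega>
    unfolding sojourn_time_def set_lebesgue_integral_def
    by (intro Bochner_Integration.integral_cong refl)
       (use that in \<open>auto simp: S_def space_pair_measure ip_cball_def max_def split: split_indicator\<close>)
  moreover have "(\<lambda>\<omega>. LINT t|lborel. indicat_real {0..1} t * indicat_real S (\<omega>, t)) \<in> borel_measurable M"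
  proof (rule sigma_finite_measure.borel_measurable_lebesgue_integral[OF sigma_finite_lborel])
    have "(\<lambda>z. indicat_real {0..1} (snd z) * indicat_real S z) \<in> borel_measurable (M \<Otimes>\<^sub>M lborel)" by measurable
    then show "(\<lambda>(\<omega>, t). indicat_real {0..1} t * indicat_real S (\<omega>, t)) \<in> borel_measurable (M \<Otimes>\<^sub>M lborel)"
      by (simp add: case_prod_beta)
  qed
  ultimately show ?thesis by (simp cong: measurable_cong)
qed

text \<open>Moved to the other side of the inner product, the operator scaling of the process
  becomes a scalar scaling of those frequencies on which the adjoint of \<open>A\<close> is
  multiplication by \<open>b\<close>.\<close>

lemma char_fun_scaling_of_same_fdd:
  assumes c: "0 < c" and A: "linear A" and same: "same_fdd M (\<lambda>t. X (c * t)) (\<lambda>t \<omega>. A (X t \<omega>))"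
    and \<xi>: "\<And>x. \<xi> \<bullet> A x = b * (\<xi> \<bullet> x)" and t: "0 \<le> t"
  shows "char_fun (c * t) \<xi> = char_fun t (b *\<^sub>R \<xi>)"
proof -
  have cism: "(\<lambda>x. cis (\<xi> \<bullet> x)) \<in> borel_measurable borel"
    by (intro borel_measurable_continuous_onI continuous_on_cis continuous_intros)
  let ?P = "PiM {t} (\<lambda>_. borel) :: (real \<Rightarrow> 'a) measure"
  have hm: "(\<lambda>w. cis (\<xi> \<bullet> w t)) \<in> borel_measurable ?P"
    by (rule measurable_compose[OF _ cism]) (rule measurable_component_singleton, simp)
  have Am: "A \<in> borel_measurable borel"
    by (intro borel_measurable_continuous_onI linear_continuous_on linear_conv_bounded_linear[THEN iffD1] A)
  have m: "(\<lambda>\<omega>. \<lambda>s\<in>{t}. X (c * s) \<omega>) \<in> measurable M ?P" "(\<lambda>\<omega>. \<lambda>s\<in>{t}. A (X s \<omega>)) \<in> measurable M ?P"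
    using c t by (auto intro!: measurable_restrict X_meas measurable_compose[OF X_meas Am])
  have "char_fun (c * t) \<xi> = (LINT w|distr M ?P (\<lambda>\<omega>. \<lambda>s\<in>{t}. X (c * s) \<omega>). cis (\<xi> \<bullet> w t))"
    unfolding char_fun_def by (subst integral_distr[OF m(1) hm]) simp
  also have "distr M ?P (\<lambda>\<omega>. \<lambda>s\<in>{t}. X (c * s) \<omega>) = distr M ?P (\<lambda>\<omega>. \<lambda>s\<in>{t}. A (X s \<omega>))"
    using same t unfolding same_fdd_def by simp
  also have "(LINT w|distr M ?P (\<lambda>\<omega>. \<lambda>s\<in>{t}. A (X s \<omega>)). cis (\<xi> \<bullet> w t)) = char_fun t (b *\<^sub>R \<xi>)"
    unfolding char_fun_def by (subst integral_distr[OF m(2) hm]) (simp add: \<xi>)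
  finally show ?thesis .
qed

end

theorem theorem3p4:
  fixes M :: "'w measure"
    and X :: "real \<Rightarrow> 'w \<Rightarrow> real ^ 'd"
    and E :: "real ^ 'd \<Rightarrow> real ^ 'd"
    and c :: real
    and p :: nat
    and q :: "nat \<Rightarrow> real poly"
    and a \<alpha> :: "nat \<Rightarrow> real"
    and ip :: "real ^ 'd \<Rightarrow> real ^ 'd \<Rightarrow> real"
  assumes "c > 1"
    and "linear E"
    and "levy_process M X"
    and "operator_semistable M c E X"
    and "no_gaussian_component M X"
    and "spectral_factorization E p q a"
    and "\<And>j. \<alpha> j = 1 / a j"
    and "inner_product ip"
    and "\<And>i j x y. i \<in> {1..p} \<Longrightarrow> j \<in> {1..p} \<Longrightarrow> i \<noteq> j \<Longrightarrow>
           x \<in> spectral_space E q i \<Longrightarrow> y \<in> spectral_space E q j \<Longrightarrow> ip x y = 0"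
    and "\<And>x. x \<in> spectral_space E q 1 \<Longrightarrow> E x = inverse (\<alpha> 1) *\<^sub>R x"
  shows "(type_A M X \<and> 0 < \<alpha> 1 \<and> \<alpha> 1 < min 2 (real (dim (spectral_space E q 1))) \<longrightarrow>
            (AE \<omega> in M. exact_hausdorff_function ip
               (\<lambda>r. r powr \<alpha> 1 * ln (ln (1 / r))) ((\<lambda>t. X t \<omega>) ` {0..1})))
       \<and> (type_B M X \<and> 0 < \<alpha> 1 \<and> \<alpha> 1 < 1 \<and>
          (\<exists>K\<^sub>8>0. \<exists>l\<^sub>0>0. \<forall>l\<ge>l\<^sub>0. \<forall>r>0.
             measure M {\<omega> \<in> space M. sojourn_time ip X r 1 \<omega> > l * r powr \<alpha> 1}
               \<le> exp (- K\<^sub>8 * l powr (1 / (1 - \<alpha> 1)))) \<longrightarrow>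
            (AE \<omega> in M. exact_hausdorff_function ip
               (\<lambda>r. r powr \<alpha> 1 * (ln (ln (1 / r))) powr (1 - \<alpha> 1)) ((\<lambda>t. X t \<omega>) ` {0..1})))"
proof -
  note c = \<open>c > 1\<close> and E = \<open>linear E\<close> and ip = \<open>inner_product ip\<close>
  define \<beta> where "\<beta> = \<alpha> 1"
  define A where "A = op_powr c E"
  \<comment> \<open>Outside one null set the two processes agree at all times, so scaling, density
    and range carry over.\<close>
  define Y where "Y t \<omega> = X t \<omega> - X 0 \<omega>" for t \<omega>
  interpret Y: levy_path M Y
    using levy_path_diff_start[OF assms(3)] unfolding Y_def[abs_def] .
  have X_meas: "\<And>t. 0 \<le> t \<Longrightarrow> X t \<in> borel_measurable M" and X0: "AE \<omega> in M. X 0 \<omega> = 0"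
    using assms(3) by (auto simp: levy_process_def)
  have YX: "AE \<omega> in M. \<forall>t. Y t \<omega> = X t \<omega>" using X0 by eventually_elim (simp add: Y_def)
  have linA: "linear A" unfolding A_def op_powr_eq_opexp by (rule linear_opexp[OF E])
  have Am: "A \<in> borel_measurable borel"
    by (intro borel_measurable_continuous_onI linear_continuous_on linear_conv_bounded_linear[THEN iffD1] linA)
  have Ysame: "same_fdd M (\<lambda>t. Y (c * t)) (\<lambda>t \<omega>. A (Y t \<omega>))"
  proof (rule same_fdd_cong_AE)
    show "same_fdd M (\<lambda>t. X (c * t)) (\<lambda>t \<omega>. A (X t \<omega>))" using assms(4) by (simp add: operator_semistable_def A_def)
    show "AE \<omega> in M. \<forall>t. Y (c * t) \<omega> = X (c * t) \<omega> \<and> A (Y t \<omega>) = A (X t \<omega>)"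
      using YX by eventually_elim simp
  qed (use c in \<open>auto intro!: X_meas Y.X_meas measurable_compose[OF X_meas Am] measurable_compose[OF Y.X_meas Am]\<close>)
  have im: "AE \<omega> in M. (\<lambda>t. Y t \<omega>) ` {0..1} = (\<lambda>t. X t \<omega>) ` {0..1}" using YX by eventually_elim simp
  have a1: "inverse \<beta> = a 1" using assms(7)[of 1] by (simp add: \<beta>_def)
  have E1: "\<And>x. x \<in> spectral_space E q 1 \<Longrightarrow> E x = a 1 *\<^sub>R x" using assms(10) a1 by (simp add: \<beta>_def)
  obtain C where C: "0 < C" "\<And>n x. norm x \<le> C * c powr (- real n * a 1) * norm ((A ^^ n) x)"
    using op_powr_growth[OF E c assms(6) E1] unfolding A_def by blast
  have sc: "Y.stay_scaling c \<beta> C"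
  proof (rule Y.stay_scaling_of_growth[OF linA c Ysame _ C(1)])
    show "norm x \<le> C * c powr (- real n / \<beta>) * norm ((A ^^ n) x)" for n x
      using C(2)[of x n] a1 by (simp add: divide_inverse)
  qed
  have "AE \<omega> in M. exact_hausdorff_function ip (\<lambda>r. r powr \<beta> * ln (ln (1 / r))) ((\<lambda>t. X t \<omega>) ` {0..1})"
    if A: "type_A M X" and \<beta>: "0 < \<beta>" "\<beta> < real (dim (spectral_space E q 1))"
  proof -
    obtain f where f: "continuous_density M (X 1) f" "0 < f 0" using A by (auto simp: type_A_def)
    have d: "distributed M lborel (Y 1) (\<lambda>x. ennreal (f x))"
    proof -
      have "distr M lborel (Y 1) = distr M lborel (X 1)"
        using YX Y.X_meas[of 1] X_meas[of 1] by (intro distr_cong_AE) (auto elim: eventually_mono)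
      then show ?thesis using f(1) Y.X_meas[of 1] unfolding continuous_density_def distributed_def by auto
    qed
    then have Yf: "continuous_density M (Y 1) f" using f(1) by (simp add: continuous_density_def)
    obtain R p where "0 < R" "0 < p" "p < 1" "\<And>x. norm x \<le> R \<Longrightarrow> 2 * p \<le> measure M {\<omega>\<in>space M. norm (x + Y 1 \<omega>) \<le> R}"
      using return_probability[OF Y.prob_space_axioms Yf f(2)] by blast
    then obtain K L where KL: "0 < K" "0 < L" "Y.small_ball_bound c \<beta> 1 K L"
      using Y.small_ball_recurrent[OF sc c C(1)] by blast
    \<comment> \<open>The Gaussian average of characters is taken over this space, and its dimension
      must exceed \<open>\<beta>\<close> for the negative moment to be finite.\<close>
    define U where "U = {\<xi>. \<forall>x. \<xi> \<bullet> E x = a 1 * (\<xi> \<bullet> x)}"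
    have U: "subspace U" unfolding U_def by (rule dim_adjoint_eigenspace(1)[OF E])
    have "dim (spectral_space E q 1) \<le> dim {x. E x = a 1 *\<^sub>R x}" using E1 by (intro dim_subset) auto
    also have "\<dots> \<le> dim U" unfolding U_def by (rule dim_adjoint_eigenspace(2)[OF E])
    finally have \<beta>U: "\<beta> < real (dim U)" using \<beta>(2) by linarith
    obtain B where B: "B \<subseteq> U" "pairwise orthogonal B" "\<And>x. x \<in> B \<Longrightarrow> norm x = 1" "independent B" "card B = dim U" "span B = U"
      using orthonormal_basis_subspace[OF U] by metis
    have oB: "orthonormal B" using B(2,3) independent_imp_finite[OF B(4)] by (simp add: orthonormal_def)
    have "\<exists>\<kappa>>0. \<exists>C\<ge>0. \<forall>t>0. \<forall>\<xi>\<in>U. norm (Y.char_fun t \<xi>) \<le> C * exp (- \<kappa> * t * norm \<xi> powr \<beta>)"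
    proof (rule Y.char_fun_bound[OF c \<beta>(1) U])
      fix t \<xi> assume t: "0 \<le> (t::real)" and \<xi>: "\<xi> \<in> U"
      show "Y.char_fun (c * t) \<xi> = Y.char_fun t (c powr (1 / \<beta>) *\<^sub>R \<xi>)"
      proof (rule Y.char_fun_scaling_of_same_fdd[OF _ linA Ysame _ t])
        fix x
        have "\<xi> \<bullet> A x = exp (a 1 * ln c) * (\<xi> \<bullet> x)"
          unfolding A_def op_powr_eq_opexp using \<xi> by (intro opexp_adjoint_eigen[OF E]) (simp add: U_def)
        also have "exp (a 1 * ln c) = c powr (1 / \<beta>)" using c a1 by (simp add: powr_def divide_inverse)
        finally show "\<xi> \<bullet> A x = c powr (1 / \<beta>) * (\<xi> \<bullet> x)" .
      qed (use c in simp)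
    next
      fix \<xi> :: "real ^ 'd" assume "\<xi> \<noteq> 0"
      then show "norm (Y.char_fun 1 \<xi>) < 1" unfolding Y.char_fun_def by (rule Y.norm_char_less_1[OF d])
    qed
    then obtain \<kappa> Cc where cc: "0 < \<kappa>" "0 \<le> Cc" "\<And>t \<xi>. 0 < t \<Longrightarrow> \<xi> \<in> span B \<Longrightarrow> norm (LINT \<omega>|M. cis (\<xi> \<bullet> Y t \<omega>)) \<le> Cc * exp (- \<kappa> * t * norm \<xi> powr \<beta>)"
      unfolding Y.char_fun_def B(6) by blast
    have \<beta>B: "\<beta> < real (card B)" using \<beta>U B(5) by simp
    obtain K' where K': "0 < K'" "\<And>l r. 0 \<le> l \<Longrightarrow> 0 < r \<Longrightarrow> Y.prob {\<omega>\<in>space M. l * r powr \<beta> < Y.occupation ip 0 r \<omega>} \<le> 2 * exp (- K' * l)"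
      using Y.occupation_tail_exponential[OF oB \<beta>(1) \<beta>B cc ip] by blast
    have "AE \<omega> in M. exact_hausdorff_function ip (\<lambda>r. r powr \<beta> * ln (ln (1 / r))) ((\<lambda>t. Y t \<omega>) ` {0..1})"
    proof (rule Y.exact_hausdorff_AE[OF ip c \<beta>(1) _ _ sc C(1) _ KL(1,2) K'(1)])
      show "Y.small_ball_bound c \<beta> (1 / 1) K L" using KL(3) by simp
      show "Y.prob {\<omega>\<in>space M. l * r powr \<beta> < Y.occupation ip 0 r \<omega>} \<le> 2 * exp (- K' * l powr (1 / 1))"
        if "0 \<le> l" "0 < r" "r \<le> 1" for l r using K'(2)[OF that(1,2)] that(1) by simp
      show "0 < exp (- exp (1::real))" by simp
      \<comment> \<open>The exponent 1 can be inserted where the iterated logarithm is nonnegative;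
        below \<open>exp (- exp 1)\<close> it exceeds 1.\<close>
      show "r powr \<beta> * ln (ln (1 / r)) = r powr \<beta> * ln (ln (1 / r)) powr 1" if r: "0 < r" "r < exp (- exp 1)" for r :: real
      proof -
        have "ln r < ln (exp (- exp 1))" using r by (subst ln_less_cancel_iff) simp_all
        then have "exp 1 < ln (1 / r)" using r by (simp add: ln_div)
        then have "ln (exp 1) < ln (ln (1 / r))" by (subst ln_less_cancel_iff) (auto intro: less_trans[OF exp_gt_zero])
        then show ?thesis by simp
      qed
    qed simp_all
    then show ?thesis using im by eventually_elim simp
  qed
  moreover have "AE \<omega> in M. exact_hausdorff_function ip (\<lambda>r. r powr \<beta> * (ln (ln (1 / r))) powr (1 - \<beta>)) ((\<lambda>t. X t \<omega>) ` {0..1})"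
    if \<beta>: "0 < \<beta>" "\<beta> < 1" and K8: "0 < K8"
      and tail: "\<And>l r. l0 \<le> l \<Longrightarrow> 0 < r \<Longrightarrow> measure M {\<omega> \<in> space M. sojourn_time ip X r 1 \<omega> > l * r powr \<beta>} \<le> exp (- K8 * l powr (1 / (1 - \<beta>)))"
    for K8 l0
  proof -
    obtain K L where KL: "0 < K" "0 < L" "Y.small_ball_bound c \<beta> (1 / (1 - \<beta>)) K L"
      using Y.small_ball_transient[OF sc c C(1) \<beta>] by blast
    have "AE \<omega> in M. exact_hausdorff_function ip (\<lambda>r. r powr \<beta> * (ln (ln (1 / r))) powr (1 - \<beta>)) ((\<lambda>t. Y t \<omega>) ` {0..1})"
    proof (rule Y.exact_hausdorff_AE[OF ip c \<beta>(1) _ _ sc C(1) KL(3,1,2) K8 _ zero_less_one])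
      fix l r :: real assume l: "l0 \<le> l" and r: "0 < r" "r \<le> 1"
      \<comment> \<open>The assumed tail concerns the sojourn time of \<open>X\<close>; writing
        \<open>X\<close> as a shift of \<open>Y\<close> makes that time measurable, so that the tail
        passes to \<open>Y\<close>.\<close>
      have XY: "X = (\<lambda>t \<omega>. Y t \<omega> + X 0 \<omega>)" by (intro ext) (simp add: Y_def)
      have Xm: "(\<lambda>\<omega>. sojourn_time ip X r 1 \<omega>) \<in> borel_measurable M"
        using Y.sojourn_time_shift_meas[OF ip X_meas[of 0], of r] unfolding XY[symmetric] by simp
      have Ym: "(\<lambda>\<omega>. sojourn_time ip Y r 1 \<omega>) \<in> borel_measurable M"
        using Y.sojourn_time_shift_meas[OF ip, of "\<lambda>_. 0" r] by simp
      have "Y.prob {\<omega>\<in>space M. l * r powr \<beta> < Y.occupation ip 0 r \<omega>} = measure M {\<omega>\<in>space M. l * r powr \<beta> < sojourn_time ip Y r 1 \<omega>}"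
        by (rule arg_cong[where f="measure M"]) (auto simp: Y.occupation_0_sojourn[OF ip])
      also have "\<dots> = measure M {\<omega>\<in>space M. l * r powr \<beta> < sojourn_time ip X r 1 \<omega>}"
      proof (rule measure_eq_AE)
        show "AE \<omega> in M. (\<omega> \<in> {\<omega>\<in>space M. l * r powr \<beta> < sojourn_time ip Y r 1 \<omega>}) = (\<omega> \<in> {\<omega>\<in>space M. l * r powr \<beta> < sojourn_time ip X r 1 \<omega>})"
          using YX by eventually_elim (simp add: sojourn_time_def)
      qed (use Xm Ym in measurable)
      also have "\<dots> \<le> 1 * exp (- K8 * l powr (1 / (1 - \<beta>)))" using tail[OF l r(1)] by simp
      finally show "Y.prob {\<omega>\<in>space M. l * r powr \<beta> < Y.occupation ip 0 r \<omega>} \<le> 1 * exp (- K8 * l powr (1 / (1 - \<beta>)))" .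
    qed (use \<beta> in simp_all)
    then show ?thesis using im by eventually_elim simp
  qed
  ultimately show ?thesis unfolding \<beta>_def by auto
qed

end
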